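(* Let $k>l>0$ be integers and let $\lambda=(k,l|0)$ (a typical super-weight of $GL_{2|1}$). Then the orbit $Gr^\lambda\subset Gr_{GL_{2|1}}$ is parametrized by the superscheme $\mathcal{P}_{k,l}$ over the even projective line $\mathbb{P}^{1|0}\cong\mathbb{P}^1\times\{pt\}=U_0\cup U_1$, i.e. $Gr^\lambda\cong\mathcal{P}_{k,l}$, where $\mathcal{P}_{k,l}$ consists of two super affine spaces $\mathbb{A}^{k-l|k+l}$ (one over each of $U_0$, $U_1$) glued over $U_0\cap U_1$ as follows. The chart over $U_0$ has coordinates $$(\widetilde z_0,\xi_0,\eta_0)\in \mathbb{C}[t]/t^{k-l}\times\Pi\bigl(\mathbb{C}[t]/t^{k}\times\mathbb{C}[t]/t^{l}\bigr)\cong\mathbb{A}^{k-l|k+l},$$ lying over the point $z_0=\widetilde z_0(0)$ of $U_0$; the chart over $U_1$ has coordinates $$(\widetilde z_1,\xi_1,\eta_1)\in \mathbb{C}[t]/t^{k-l}\times\Pi\bigl(\mathbb{C}[t]/t^{l}\times\mathbb{C}[t]/t^{k}\bigr)\cong\mathbb{A}^{k-l|k+l},$$ lying over the point $z_1=\widetilde z_1(0)$ of $U_1$; and over $U_0\cap U_1$ (where $z_0$, $z_1$ are invertible and $z_0=1/z_1$) the gluing relations are $$\widetilde z_0\,\widetilde z_1=1 \ \text{ in } \mathbb{C}[t]/t^{k-l},\qquad \begin{pmatrix}\xi_0\\ \eta_0\end{pmatrix}=\begin{pmatrix} i_k & \widetilde z_0\,(i_k\circ\pi_l-\mathrm{id})\\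 0&\pi_l\end{pmatrix}\begin{pmatrix}\xi_1\\ \eta_1\end{pmatrix}.$$
   Context: A superalgebra $R=R_0\oplus R_1$ here is an associative, unital, supercommutative ($ab=(-1)^{|a||b|}ba$ for homogeneous $a,b$) $\mathbb{Z}_2$-graded algebra over $\mathbb{C}$. $G=GL_{2|1}$ is the functor sending $R$ to the group of supermatrices $\left(\begin{array}{c|c} a & \alpha\\ \hline \alpha' & a'\end{array}\right)$ with $a\in GL_2(R_0)$, $a'\in R_0^*$, $\alpha\in Mat_{2\times1}(R_1)$, $\alpha'\in Mat_{1\times2}(R_1)$. Put $R\llbracket t\rrbracket=R_0\llbracket t\rrbracket\oplus R_1\llbracket t\rrbracket$ and $R((t))=R_0((t))\oplus R_1((t))$ with $t$ even; $G\llbracket t\rrbracket$, $G((t))$ denote $R\mapsto G(R\llbracket t\rrbracket)$, $R\mapsto G(R((t)))$. The affine Grassmannian is $Gr_G=G((t))/G\llbracket t\rrbracket$ (quotient by right multiplication), with left action of $G\llbracket t\rrbracket$. For $\lambda=(k,l|0)$, $t^\lambda=\operatorname{diag}(t^k,t^l,1)$, and $Gr^\lambda$ is the $G\llbracket t\rrbracket$-orbit of $[t^\lambda]$, identified with $G\llbracket t\rrbracket/\bigl(G\llbracket t\rrbracket\cap t^\lambda G\llbracket t\rrbracket t^{-\lambda}\bigr)$; quotients are in the sense of supergeometry (sheafified coset functors). $\Pi$ is the parity shift. Truncated polynomial spaces are regarded as affine superspaces: the $R$-points of $\mathbb{C}[t]/t^{r}$ are $R_0[t]/t^r$ and the $R$-points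 of $\Pi(\mathbb{C}[t]/t^r)$ are $R_1[t]/t^r$. The map $\pi_l:\Pi(\mathbb{C}[t]/t^k)\to\Pi(\mathbb{C}[t]/t^l)$ is reduction modulo $t^l$, and $i_k:\Pi(\mathbb{C}[t]/t^l)\to\Pi(\mathbb{C}[t]/t^k)$ is the inclusion sending a class to its representative polynomial of degree $<l$. The expression $\widetilde z_0\,(i_k\circ\pi_l-\mathrm{id})$ is well defined in $\Pi(\mathbb{C}[t]/t^k)$ since the image of $i_k\circ\pi_l-\mathrm{id}$ is divisible by $t^l$ and $\widetilde z_0$ is defined modulo $t^{k-l}$. *)

theory Defs
  imports Complex_Main "HOL-Library.Numeral_Type" "HOL-Algebra.Left_Coset" "HOL-Algebra.Module"
begin

section \<open>Superalgebras\<close>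

definition complex_ring :: "complex ring" where
  "complex_ring = \<lparr>carrier = UNIV, monoid.mult = (*), one = 1, zero = 0, add = (+)\<rparr>"

record 'a superalg = "(complex, 'a) module" +
  even_part :: "'a set"
  odd_part :: "'a set"

locale superalgebra = ring R + Module.module complex_ring R for R :: "'a superalg" (structure) +
  assumes smult_mult_left:
      "\<lbrakk>x \<in> carrier R; y \<in> carrier R\<rbrakk> \<Longrightarrow> c \<odot> (x \<otimes> y) = (c \<odot> x) \<otimes> y"
    and smult_mult_right:
      "\<lbrakk>x \<in> carrier R; y \<in> carrier R\<rbrakk> \<Longrightarrow> c \<odot> (x \<otimes> y) = x \<otimes> (c \<odot> y)"
    and even_submodule: "submodule (even_part R) complex_ring R"
    and odd_submodule: "submodule (odd_part R) complex_ring R"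
    and decomposition: "x \<in> carrier R \<Longrightarrow> \<exists>a\<in>even_part R. \<exists>b\<in>odd_part R. x = a \<oplus> b"
    and even_inter_odd: "even_part R \<inter> odd_part R = {\<zero>}"
    and one_even: "\<one> \<in> even_part R"
    and even_even: "\<lbrakk>a \<in> even_part R; b \<in> even_part R\<rbrakk> \<Longrightarrow> a \<otimes> b \<in> even_part R"
    and even_odd: "\<lbrakk>a \<in> even_part R; b \<in> odd_part R\<rbrakk> \<Longrightarrow> a \<otimes> b \<in> odd_part R"
    and odd_even: "\<lbrakk>a \<in> odd_part R; b \<in> even_part R\<rbrakk> \<Longrightarrow> a \<otimes> b \<in> odd_part R"
    and odd_odd: "\<lbrakk>a \<in> odd_part R; b \<in> odd_part R\<rbrakk> \<Longrightarrow> a \<otimes> b \<in> even_part R"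
    and even_commute: "\<lbrakk>a \<in> even_part R; x \<in> carrier R\<rbrakk> \<Longrightarrow> a \<otimes> x = x \<otimes> a"
    and odd_anticommute: "\<lbrakk>a \<in> odd_part R; b \<in> odd_part R\<rbrakk> \<Longrightarrow> a \<otimes> b = \<ominus> (b \<otimes> a)"

text \<open>
  Homomorphisms are extensional functions, so that two homomorphisms which agree on the carrier
  are equal; they are composed with \<^const>\<open>compose\<close>.
\<close>

definition superhom :: "'a superalg \<Rightarrow> 'b superalg \<Rightarrow> ('a \<Rightarrow> 'b) set" where
  "superhom R S = {\<phi> \<in> ring_hom R S \<inter> extensional (carrier R).
     (\<forall>c. \<forall>x\<in>carrier R. \<phi> (c \<odot>\<^bsub>R\<^esub> x) = c \<odot>\<^bsub>S\<^esub> \<phi> x) \<and>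
     \<phi> ` even_part R \<subseteq> even_part S \<and> \<phi> ` odd_part R \<subseteq> odd_part S}"


section \<open>Superspaces as functors of points\<close>

text \<open>
  The test superalgebras are all superalgebras whose carrier is a set of elements of an arbitrary
  but fixed type \<^typ>\<open>'u\<close>, which plays the role of a universe. Whenever \<^typ>\<open>'u\<close> admits a nonzero
  superalgebra it is infinite, and then an isomorphic copy of every localisation of a test
  superalgebra is again a test superalgebra.
\<close>

record ('u, 'x) superfunctor =
  points :: "'u superalg \<Rightarrow> 'x set"
  pmap :: "'u superalg \<Rightarrow> 'u superalg \<Rightarrow> ('u \<Rightarrow> 'u) \<Rightarrow> 'x \<Rightarrow> 'x"

definition superfunctor_morphism ::
    "('u, 'x) superfunctor \<Rightarrow> ('u, 'y) superfunctor \<Rightarrow> ('u superalg \<Rightarrow> 'x \<Rightarrow> 'y) \<Rightarrow> bool" where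
  "superfunctor_morphism F F' \<Phi> \<longleftrightarrow>
     (\<forall>R. superalgebra R \<longrightarrow> \<Phi> R \<in> points F R \<rightarrow> points F' R) \<and>
     (\<forall>R S \<phi> x. superalgebra R \<and> superalgebra S \<and> \<phi> \<in> superhom R S \<and> x \<in> points F R \<longrightarrow>
        \<Phi> S (pmap F R S \<phi> x) = pmap F' R S \<phi> (\<Phi> R x))"

definition superfunctor_isomorphic ::
    "('u, 'x) superfunctor \<Rightarrow> ('u, 'y) superfunctor \<Rightarrow> bool" where
  "superfunctor_isomorphic F F' \<longleftrightarrow>
     (\<exists>\<Phi>. superfunctor_morphism F F' \<Phi> \<and>
        (\<forall>R. superalgebra R \<longrightarrow> bij_betw (\<Phi> R) (points F R) (points F' R)))"


section \<open>Zariski sheafification\<close>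

definition is_localization :: "'u superalg \<Rightarrow> 'u \<Rightarrow> 'u superalg \<Rightarrow> ('u \<Rightarrow> 'u) \<Rightarrow> bool" where
  "is_localization R f S \<phi> \<longleftrightarrow>
     superalgebra S \<and> f \<in> even_part R \<and> \<phi> \<in> superhom R S \<and> \<phi> f \<in> Units S \<and>
     (\<forall>s\<in>carrier S. \<exists>r\<in>carrier R. \<exists>n::nat. s \<otimes>\<^bsub>S\<^esub> (\<phi> f [^]\<^bsub>S\<^esub> n) = \<phi> r) \<and>
     (\<forall>r\<in>carrier R. \<phi> r = \<zero>\<^bsub>S\<^esub> \<longrightarrow> (\<exists>n::nat. (f [^]\<^bsub>R\<^esub> n) \<otimes>\<^bsub>R\<^esub> r = \<zero>\<^bsub>R\<^esub>))"

text \<open>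
  The empty family covers the zero superalgebra.
\<close>

definition zariski_cover :: "'u superalg \<Rightarrow> ('u superalg \<times> ('u \<Rightarrow> 'u)) set \<Rightarrow> bool" where
  "zariski_cover R \<C> \<longleftrightarrow> finite \<C> \<and>
     (\<exists>f a. (\<forall>c\<in>\<C>. is_localization R (f c) (fst c) (snd c)) \<and>
            (\<forall>c\<in>\<C>. a c \<in> even_part R) \<and>
            (\<Oplus>\<^bsub>R\<^esub>c\<in>\<C>. a c \<otimes>\<^bsub>R\<^esub> f c) = \<one>\<^bsub>R\<^esub>)"

definition locally_equal :: "('u, 'x) superfunctor \<Rightarrow> 'u superalg \<Rightarrow> 'x \<Rightarrow> 'x \<Rightarrow> bool" where
  "locally_equal F R x y \<longleftrightarrow>
     (\<exists>\<C>. zariski_cover R \<C> \<and> (\<forall>(S, \<phi>)\<in>\<C>. pmap F R S \<phi> x = pmap F R S \<phi> y))"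

text \<open>
  A section \<open>\<sigma>\<close> over \<open>R\<close> of the sheaf associated with the presheaf \<open>F\<close> is represented by the set of
  all triples \<open>(S, \<phi>, x)\<close>, with \<open>\<phi> : R \<rightarrow> S\<close> and \<open>x \<in> F(S)\<close>, such that the pull-back of \<open>\<sigma>\<close> along
  \<open>\<phi>\<close> is the image of \<open>x\<close>. The sets arising in this way are those which are stable under base
  change, determine \<open>x\<close> up to local equality, are local in \<open>x\<close>, and contain triples over the
  members of some cover of \<open>R\<close>. No choice of covers or quotient by refinement is needed, and
  \<open>F\<close> need not be separated.
\<close>

type_synonym ('u, 'x) germs = "('u superalg \<times> ('u \<Rightarrow> 'u) \<times> 'x) set"

definition sheaf_section :: "('u, 'x) superfunctor \<Rightarrow> 'u superalg \<Rightarrow> ('u, 'x) germs \<Rightarrow> bool" where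
  "sheaf_section F R s \<longleftrightarrow>
     (\<forall>S \<phi> x. (S, \<phi>, x) \<in> s \<longrightarrow> superalgebra S \<and> \<phi> \<in> superhom R S \<and> x \<in> points F S) \<and>
     (\<forall>S \<phi> x T \<psi>. (S, \<phi>, x) \<in> s \<and> superalgebra T \<and> \<psi> \<in> superhom S T \<longrightarrow>
        (T, compose (carrier R) \<psi> \<phi>, pmap F S T \<psi> x) \<in> s) \<and>
     (\<forall>S \<phi> x y. (S, \<phi>, x) \<in> s \<and> (S, \<phi>, y) \<in> s \<longrightarrow> locally_equal F S x y) \<and>
     (\<forall>S \<phi> x \<C>. superalgebra S \<and> \<phi> \<in> superhom R S \<and> x \<in> points F S \<and> zariski_cover S \<C> \<and>
        (\<forall>(T, \<psi>)\<in>\<C>. (T, compose (carrier R) \<psi> \<phi>, pmap F S T \<psi> x) \<in> s) \<longrightarrow> (S, \<phi>, x) \<in> s) \<and>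
     (\<exists>\<C>. zariski_cover R \<C> \<and> (\<forall>(S, \<phi>)\<in>\<C>. \<exists>x. (S, \<phi>, x) \<in> s))"

definition sheafify :: "('u, 'x) superfunctor \<Rightarrow> ('u, ('u, 'x) germs) superfunctor" where
  "sheafify F =
     \<lparr>points = \<lambda>R. {s. sheaf_section F R s},
      pmap = \<lambda>R R' \<rho> s.
        {(S, \<phi>, x). \<phi> \<in> superhom R' S \<and> (S, compose (carrier R) \<phi> \<rho>, x) \<in> s}\<rparr>"

definition sheafify_map :: "('u, 'y) superfunctor \<Rightarrow> ('u superalg \<Rightarrow> 'x \<Rightarrow> 'y) \<Rightarrow>
    'u superalg \<Rightarrow> ('u, 'x) germs \<Rightarrow> ('u, 'y) germs" where
  "sheafify_map F' \<alpha> R s =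
     {(S, \<phi>, y). superalgebra S \<and> \<phi> \<in> superhom R S \<and> y \<in> points F' S \<and>
        (\<exists>\<C>. zariski_cover S \<C> \<and>
           (\<forall>(T, \<psi>)\<in>\<C>. \<exists>x. (T, compose (carrier R) \<psi> \<phi>, x) \<in> s \<and> pmap F' S T \<psi> y = \<alpha> T x))}"


section \<open>The affine Grassmannian\<close>

definition laurent :: "'a superalg \<Rightarrow> (int \<Rightarrow> 'a) superalg" where
  "laurent R =
     (let L = (\<lambda>V. {f. (\<forall>n. f n \<in> V) \<and> (\<exists>N. \<forall>n<N. f n = \<zero>\<^bsub>R\<^esub>)}) in
     \<lparr>carrier = L (carrier R),
      monoid.mult = \<lambda>f g n.
        \<Oplus>\<^bsub>R\<^esub>i\<in>{i. f i \<noteq> \<zero>\<^bsub>R\<^esub> \<and> g (n - i) \<noteq> \<zero>\<^bsub>R\<^esub>}. f i \<otimes>\<^bsub>R\<^esub> g (n - i),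
      one = \<lambda>n. if n = 0 then \<one>\<^bsub>R\<^esub> else \<zero>\<^bsub>R\<^esub>,
      zero = \<lambda>n. \<zero>\<^bsub>R\<^esub>,
      add = \<lambda>f g n. f n \<oplus>\<^bsub>R\<^esub> g n,
      smult = \<lambda>c f n. c \<odot>\<^bsub>R\<^esub> f n,
      even_part = L (even_part R),
      odd_part = L (odd_part R)\<rparr>)"

definition power_series :: "'a superalg \<Rightarrow> (int \<Rightarrow> 'a) superalg" where
  "power_series R =
     (let P = {f. \<forall>n<0. f n = \<zero>\<^bsub>R\<^esub>} in
      (laurent R)\<lparr>carrier := carrier (laurent R) \<inter> P,
                  even_part := even_part (laurent R) \<inter> P,
                  odd_part := odd_part (laurent R) \<inter> P\<rparr>)"

definition mat_mult :: "'s superalg \<Rightarrow> ('i::finite \<Rightarrow> 'i \<Rightarrow> 's) \<Rightarrow> ('i \<Rightarrow> 'i \<Rightarrow> 's) \<Rightarrow> 'i \<Rightarrow> 'i \<Rightarrow> 's"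
  where "mat_mult S A B = (\<lambda>i j. \<Oplus>\<^bsub>S\<^esub>m\<in>UNIV. A i m \<otimes>\<^bsub>S\<^esub> B m j)"

definition mat_diag :: "'s superalg \<Rightarrow> ('i \<Rightarrow> 's) \<Rightarrow> 'i \<Rightarrow> 'i \<Rightarrow> 's" where
  "mat_diag S d = (\<lambda>i j. if i = j then d i else \<zero>\<^bsub>S\<^esub>)"

definition GL_even :: "'s superalg \<Rightarrow> ('i::finite \<Rightarrow> 'i \<Rightarrow> 's) set" where
  "GL_even S = {a. (\<forall>i j. a i j \<in> even_part S) \<and>
     (\<exists>b. (\<forall>i j. b i j \<in> even_part S) \<and>
        mat_mult S a b = mat_diag S (\<lambda>_. \<one>\<^bsub>S\<^esub>) \<and> mat_mult S b a = mat_diag S (\<lambda>_. \<one>\<^bsub>S\<^esub>))}"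

text \<open>
  The group of \<open>S\<close>-points of \<open>GL\<^bsub>m|n\<^esub>\<close>, where \<open>m\<close> and \<open>n\<close> are the cardinalities of the two index
  types.
\<close>

definition GL_super :: "'s superalg \<Rightarrow> ('m::finite + 'n::finite \<Rightarrow> 'm + 'n \<Rightarrow> 's) monoid" where
  "GL_super S =
     \<lparr>carrier = {g. (\<lambda>i j. g (Inl i) (Inl j)) \<in> GL_even S \<and>
                    (\<lambda>i j. g (Inr i) (Inr j)) \<in> GL_even S \<and>
                    (\<forall>i j. g (Inl i) (Inr j) \<in> odd_part S) \<and>
                    (\<forall>i j. g (Inr i) (Inl j) \<in> odd_part S)},
      monoid.mult = mat_mult S,
      one = mat_diag S (\<lambda>_. \<one>\<^bsub>S\<^esub>)\<rparr>"

definition t_power :: "'a superalg \<Rightarrow> ('i \<Rightarrow> int) \<Rightarrow> 'i \<Rightarrow> 'i \<Rightarrow> int \<Rightarrow> 'a" where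
  "t_power R \<mu> = mat_diag (laurent R) (\<lambda>i n. if n = \<mu> i then \<one>\<^bsub>R\<^esub> else \<zero>\<^bsub>R\<^esub>)"

definition mat_map :: "('a \<Rightarrow> 'b) \<Rightarrow> ('i \<Rightarrow> 'i \<Rightarrow> int \<Rightarrow> 'a) \<Rightarrow> 'i \<Rightarrow> 'i \<Rightarrow> int \<Rightarrow> 'b" where
  "mat_map \<phi> g = (\<lambda>i j n. \<phi> (g i j n))"

type_synonym ('u, 'm, 'n) loop_coset = "('m + 'n \<Rightarrow> 'm + 'n \<Rightarrow> int \<Rightarrow> 'u) set"

definition Gr_presheaf :: "('u, ('u, 'm::finite, 'n::finite) loop_coset) superfunctor" where
  "Gr_presheaf =
     \<lparr>points = \<lambda>R. lcosets\<^bsub>GL_super (laurent R)\<^esub> (carrier (GL_super (power_series R))),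
      pmap = \<lambda>R S \<phi> C.
        (mat_map \<phi> ` C) <#>\<^bsub>GL_super (laurent S)\<^esub> carrier (GL_super (power_series S))\<rparr>"

definition Gr :: "('u, ('u, ('u, 'm::finite, 'n::finite) loop_coset) germs) superfunctor" where
  "Gr = sheafify Gr_presheaf"

text \<open>
  The orbit of \<open>[t\<^sup>\<mu>]\<close> in the sense of sheaves: those points of \<^const>\<open>Gr\<close> which locally are of the
  form \<open>g [t\<^sup>\<mu>] = [g t\<^sup>\<mu>]\<close> with \<open>g\<close> a point of the group of matrices over power series. It is the image
  of the orbit map, hence the sheaf quotient of that group by the stabiliser of \<open>[t\<^sup>\<mu>]\<close>.
\<close>

definition Gr_orbit :: "('m::finite + 'n::finite \<Rightarrow> int) \<Rightarrow>
    ('u, ('u, ('u, 'm, 'n) loop_coset) germs) superfunctor" where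
  "Gr_orbit \<mu> = Gr\<lparr>points := \<lambda>R. {s \<in> points Gr R.
     \<exists>\<C>. zariski_cover R \<C> \<and>
       (\<forall>(S, \<phi>)\<in>\<C>. \<exists>g \<in> carrier (GL_super (power_series S)).
          (S, \<phi>, (g \<otimes>\<^bsub>GL_super (laurent S)\<^esub> t_power S \<mu>)
                   <#\<^bsub>GL_super (laurent S)\<^esub> carrier (GL_super (power_series S))) \<in> s)}\<rparr>"

definition weight :: "int \<Rightarrow> int \<Rightarrow> 2 + 1 \<Rightarrow> int" where
  "weight k l = case_sum (\<lambda>i. if i = 1 then k else l) (\<lambda>_. 0)"


section \<open>Gluing two superspaces\<close>

text \<open>
  \<open>E R\<close> is the graph, on \<open>R\<close>-points, of the gluing isomorphism between an open subfunctor of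
  \<open>F\<^sub>0\<close> and an open subfunctor of \<open>F\<^sub>1\<close>. The glued superspace is the sheaf associated with the
  presheaf of \<open>R\<close>-points of the disjoint union modulo the identifications.
\<close>

definition glue_rel :: "('u, 'x) superfunctor \<Rightarrow> ('u, 'y) superfunctor \<Rightarrow>
    ('u superalg \<Rightarrow> ('x \<times> 'y) set) \<Rightarrow> 'u superalg \<Rightarrow> (('x + 'y) \<times> ('x + 'y)) set" where
  "glue_rel F\<^sub>0 F\<^sub>1 E R =
     (let A = points F\<^sub>0 R <+> points F\<^sub>1 R; e = {(Inl x, Inr y) | x y. (x, y) \<in> E R}
      in (e \<union> e\<inverse>)\<^sup>* \<inter> A \<times> A)"

definition glue_presheaf :: "('u, 'x) superfunctor \<Rightarrow> ('u, 'y) superfunctor \<Rightarrow>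
    ('u superalg \<Rightarrow> ('x \<times> 'y) set) \<Rightarrow> ('u, ('x + 'y) set) superfunctor" where
  "glue_presheaf F\<^sub>0 F\<^sub>1 E =
     \<lparr>points = \<lambda>R. (points F\<^sub>0 R <+> points F\<^sub>1 R) // glue_rel F\<^sub>0 F\<^sub>1 E R,
      pmap = \<lambda>R S \<phi> C.
        glue_rel F\<^sub>0 F\<^sub>1 E S `` (map_sum (pmap F\<^sub>0 R S \<phi>) (pmap F\<^sub>1 R S \<phi>) ` C)\<rparr>"

definition glue :: "('u, 'x) superfunctor \<Rightarrow> ('u, 'y) superfunctor \<Rightarrow>
    ('u superalg \<Rightarrow> ('x \<times> 'y) set) \<Rightarrow> ('u, ('u, ('x + 'y) set) germs) superfunctor" where
  "glue F\<^sub>0 F\<^sub>1 E = sheafify (glue_presheaf F\<^sub>0 F\<^sub>1 E)"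

definition affine_line :: "('u, 'u) superfunctor" where
  "affine_line = \<lparr>points = even_part, pmap = \<lambda>R S \<phi>. \<phi>\<rparr>"

definition P1_overlap :: "'u superalg \<Rightarrow> ('u \<times> 'u) set" where
  "P1_overlap R =
     {(z\<^sub>0, z\<^sub>1). z\<^sub>0 \<in> even_part R \<and> z\<^sub>1 \<in> even_part R \<and> z\<^sub>0 \<otimes>\<^bsub>R\<^esub> z\<^sub>1 = \<one>\<^bsub>R\<^esub>}"

definition P1 :: "('u, ('u, ('u + 'u) set) germs) superfunctor" where
  "P1 = glue affine_line affine_line P1_overlap"


section \<open>The superscheme over the projective line\<close>

text \<open>
  A class in \<open>V[t]/t\<^sup>r\<close> is given by the coefficient sequence of its representative of degree \<open>< r\<close>,
  extended by zero.
\<close>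

definition trunc :: "'u superalg \<Rightarrow> 'u set \<Rightarrow> nat \<Rightarrow> (nat \<Rightarrow> 'u) set" where
  "trunc R V r = {p. (\<forall>n<r. p n \<in> V) \<and> (\<forall>n\<ge>r. p n = \<zero>\<^bsub>R\<^esub>)}"

definition trunc_one :: "'u superalg \<Rightarrow> nat \<Rightarrow> nat \<Rightarrow> 'u" where
  "trunc_one R r = (\<lambda>n. if n = 0 \<and> n < r then \<one>\<^bsub>R\<^esub> else \<zero>\<^bsub>R\<^esub>)"

definition trunc_add :: "'u superalg \<Rightarrow> (nat \<Rightarrow> 'u) \<Rightarrow> (nat \<Rightarrow> 'u) \<Rightarrow> nat \<Rightarrow> 'u" where
  "trunc_add R p q = (\<lambda>n. p n \<oplus>\<^bsub>R\<^esub> q n)"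

definition trunc_diff :: "'u superalg \<Rightarrow> (nat \<Rightarrow> 'u) \<Rightarrow> (nat \<Rightarrow> 'u) \<Rightarrow> nat \<Rightarrow> 'u" where
  "trunc_diff R p q = (\<lambda>n. p n \<ominus>\<^bsub>R\<^esub> q n)"

definition trunc_mult :: "'u superalg \<Rightarrow> nat \<Rightarrow> (nat \<Rightarrow> 'u) \<Rightarrow> (nat \<Rightarrow> 'u) \<Rightarrow> nat \<Rightarrow> 'u" where
  "trunc_mult R r p q =
     (\<lambda>n. if n < r then \<Oplus>\<^bsub>R\<^esub>i\<in>{..n}. p i \<otimes>\<^bsub>R\<^esub> q (n - i) else \<zero>\<^bsub>R\<^esub>)"

definition trunc_reduce :: "'u superalg \<Rightarrow> nat \<Rightarrow> (nat \<Rightarrow> 'u) \<Rightarrow> nat \<Rightarrow> 'u" where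
  "trunc_reduce R l p = (\<lambda>n. if n < l then p n else \<zero>\<^bsub>R\<^esub>)"

text \<open>
  The inclusion \<open>\<Pi>(\<complex>[t]/t\<^sup>l) \<rightarrow> \<Pi>(\<complex>[t]/t\<^sup>k)\<close> by representatives of degree \<open>< l\<close>
  does not change the coefficient sequence.
\<close>

definition trunc_incl :: "(nat \<Rightarrow> 'u) \<Rightarrow> nat \<Rightarrow> 'u" where
  "trunc_incl p = p"

type_synonym 'u chart_point = "(nat \<Rightarrow> 'u) \<times> (nat \<Rightarrow> 'u) \<times> (nat \<Rightarrow> 'u)"

text \<open>
  \<open>\<complex>[t]/t\<^sup>a \<times> \<Pi>(\<complex>[t]/t\<^sup>b \<times> \<complex>[t]/t\<^sup>c)\<close>, an affine superspace of dimension \<open>a|b+c\<close>.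
\<close>

definition chart :: "nat \<Rightarrow> nat \<Rightarrow> nat \<Rightarrow> ('u, 'u chart_point) superfunctor" where
  "chart a b c =
     \<lparr>points = \<lambda>R. trunc R (even_part R) a \<times> trunc R (odd_part R) b \<times> trunc R (odd_part R) c,
      pmap = \<lambda>R S \<phi> (z, \<xi>, \<eta>). (\<phi> \<circ> z, \<phi> \<circ> \<xi>, \<phi> \<circ> \<eta>)\<rparr>"

definition base_point :: "'u chart_point \<Rightarrow> 'u" where
  "base_point = (\<lambda>(z, \<xi>, \<eta>). z 0)"

definition chart0 :: "nat \<Rightarrow> nat \<Rightarrow> ('u, 'u chart_point) superfunctor" where
  "chart0 k l = chart (k - l) k l"

definition chart1 :: "nat \<Rightarrow> nat \<Rightarrow> ('u, 'u chart_point) superfunctor" where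
  "chart1 k l = chart (k - l) l k"

text \<open>
  In \<open>z\<^sub>0 (i\<^sub>k \<circ> \<pi>\<^sub>l - id) \<eta>\<^sub>1\<close>, the class \<open>z\<^sub>0\<close> modulo \<open>t\<^bsup>k-l\<^esup>\<close> is lifted to its representative of
  degree \<open>< k - l\<close>; the product modulo \<open>t\<^sup>k\<close> does not depend on the lift.
\<close>

definition P_overlap ::
    "nat \<Rightarrow> nat \<Rightarrow> 'u superalg \<Rightarrow> ('u chart_point \<times> 'u chart_point) set" where
  "P_overlap k l R =
     {(x\<^sub>0, x\<^sub>1). x\<^sub>0 \<in> points (chart0 k l) R \<and> x\<^sub>1 \<in> points (chart1 k l) R \<and>
        (base_point x\<^sub>0, base_point x\<^sub>1) \<in> P1_overlap R \<and>
        (case (x\<^sub>0, x\<^sub>1) of ((z\<^sub>0, \<xi>\<^sub>0, \<eta>\<^sub>0), (z\<^sub>1, \<xi>\<^sub>1, \<eta>\<^sub>1)) \<Rightarrow>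
           trunc_mult R (k - l) z\<^sub>0 z\<^sub>1 = trunc_one R (k - l) \<and>
           \<xi>\<^sub>0 = trunc_add R (trunc_incl \<xi>\<^sub>1)
                  (trunc_mult R k z\<^sub>0 (trunc_diff R (trunc_incl (trunc_reduce R l \<eta>\<^sub>1)) \<eta>\<^sub>1)) \<and>
           \<eta>\<^sub>0 = trunc_reduce R l \<eta>\<^sub>1)}"

definition P_scheme ::
    "nat \<Rightarrow> nat \<Rightarrow> ('u, ('u, ('u chart_point + 'u chart_point) set) germs) superfunctor" where
  "P_scheme k l = glue (chart0 k l) (chart1 k l) (P_overlap k l)"

definition P_proj :: "'u superalg \<Rightarrow> ('u, ('u chart_point + 'u chart_point) set) germs \<Rightarrow>
    ('u, ('u + 'u) set) germs" where
  "P_proj = sheafify_map (glue_presheaf affine_line affine_line P1_overlap)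
     (\<lambda>R C. glue_rel affine_line affine_line P1_overlap R ``
              (map_sum base_point base_point ` C))"

end

theory Submission
  imports Defs
begin

text \<open>
  A coset \<open>g t\<^sup>\<lambda> G[[t]]\<close> only depends on \<open>g\<close> modulo column operations by the stabiliser of
  \<open>[t\<^sup>\<lambda>]\<close>. The constant terms of the even entries of the second column of \<open>g\<close> generate the unit
  ideal, so Zariski locally one of them is invertible, and column operations bring \<open>g\<close> to a unique
  normal form with columns \<open>(1, 0, 0)\<close>, \<open>(z\<^sub>0, 1, 0)\<close>, \<open>(\<xi>\<^sub>0, \<eta>\<^sub>0, 1)\<close> or \<open>(0, 1, 0)\<close>, \<open>(1, z\<^sub>1, 0)\<close>,
  \<open>(\<xi>\<^sub>1, \<eta>\<^sub>1, 1)\<close>. Comparing the two normal forms gives exactly the gluing relations. Hence the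
  presheaf of chart points modulo gluing embeds into the presheaf of cosets with image that is
  locally the orbit, and the sheafified map is an isomorphism onto the orbit.
\<close>

section \<open>Supercommutative rings\<close>

text \<open>The truncation orders come from conjugation: passing from w to
  \<open>t^(-\<lambda>) w t^\<lambda>\<close> multiplies the entry (i,j) by t to the power
  \<lambda>(j) - \<lambda>(i). For \<lambda> = (k,l|0) only the three entries above the diagonal
  must become divisible, by t^(k-l), t^k and t^l. All comparisons apply this test to w = M^(-1) M'
  with an explicit chart matrix M: M' from the same chart gives injectivity, M' from the other chart
  the gluing relations, an arbitrary M' the existence of normal forms. Odd entries do not commute,
  but a product of two of them is a harmless perturbation of a unit, so invertibility is decided by
  the even blocks. The sheaf side has its own obstacle: a member of a cover is a pair (S, \<phi>)
  that does not remember the element inverted, and all test superalgebras live in one type.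
  Localisations must therefore be built inside that type, and base change and transitivity of covers
  must be independent of the chosen elements. After that the argument is formal: an injective map of
  presheaves sheafifies to a bijection onto the sections that lie locally in its image.\<close>

locale superring = ring S for S :: "'a superalg" (structure) +
  assumes even_carrier: "a \<in> even_part S \<Longrightarrow> a \<in> carrier S"
    and odd_carrier: "a \<in> odd_part S \<Longrightarrow> a \<in> carrier S"
    and even_zero: "\<zero> \<in> even_part S"
    and odd_zero: "\<zero> \<in> odd_part S"
    and even_add: "\<lbrakk>a \<in> even_part S; b \<in> even_part S\<rbrakk> \<Longrightarrow> a \<oplus> b \<in> even_part S"
    and odd_add: "\<lbrakk>a \<in> odd_part S; b \<in> odd_part S\<rbrakk> \<Longrightarrow> a \<oplus> b \<in> odd_part S"
    and even_minus: "a \<in> even_part S \<Longrightarrow> \<ominus> a \<in> even_part S"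
    and odd_minus: "a \<in> odd_part S \<Longrightarrow> \<ominus> a \<in> odd_part S"
    and decomp: "x \<in> carrier S \<Longrightarrow> \<exists>a\<in>even_part S. \<exists>b\<in>odd_part S. x = a \<oplus> b"
    and even_inter_odd: "\<lbrakk>a \<in> even_part S; a \<in> odd_part S\<rbrakk> \<Longrightarrow> a = \<zero>"
    and even_one: "\<one> \<in> even_part S"
    and even_even: "\<lbrakk>a \<in> even_part S; b \<in> even_part S\<rbrakk> \<Longrightarrow> a \<otimes> b \<in> even_part S"
    and even_odd: "\<lbrakk>a \<in> even_part S; b \<in> odd_part S\<rbrakk> \<Longrightarrow> a \<otimes> b \<in> odd_part S"
    and odd_even: "\<lbrakk>a \<in> odd_part S; b \<in> even_part S\<rbrakk> \<Longrightarrow> a \<otimes> b \<in> odd_part S"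
    and odd_odd: "\<lbrakk>a \<in> odd_part S; b \<in> odd_part S\<rbrakk> \<Longrightarrow> a \<otimes> b \<in> even_part S"
    and even_commute: "\<lbrakk>a \<in> even_part S; x \<in> carrier S\<rbrakk> \<Longrightarrow> a \<otimes> x = x \<otimes> a"
    and odd_anticommute: "\<lbrakk>a \<in> odd_part S; b \<in> odd_part S\<rbrakk> \<Longrightarrow> a \<otimes> b = \<ominus> (b \<otimes> a)"
    and double_zeroD: "\<lbrakk>x \<in> carrier S; x \<oplus> x = \<zero>\<rbrakk> \<Longrightarrow> x = \<zero>"
begin

lemmas parity_closed [simp] =
  even_carrier odd_carrier even_zero odd_zero even_add odd_add even_minus odd_minus even_one
  even_even even_odd odd_even odd_odd

lemma even_diff [simp]: "\<lbrakk>a \<in> even_part S; b \<in> even_part S\<rbrakk> \<Longrightarrow> a \<ominus> b \<in> even_part S"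
  and odd_diff [simp]: "\<lbrakk>a \<in> odd_part S; b \<in> odd_part S\<rbrakk> \<Longrightarrow> a \<ominus> b \<in> odd_part S"
  by (simp_all add: minus_eq)

lemma even_comm: "\<lbrakk>a \<in> even_part S; b \<in> even_part S\<rbrakk> \<Longrightarrow> a \<otimes> b = b \<otimes> a"
  by (simp add: even_commute)

lemma even_lcomm:
  "\<lbrakk>a \<in> even_part S; b \<in> carrier S; c \<in> carrier S\<rbrakk> \<Longrightarrow> b \<otimes> (a \<otimes> c) = a \<otimes> (b \<otimes> c)"
  using even_commute[of a b] by (simp add: m_assoc[symmetric])

lemma even_pow [simp]: "a \<in> even_part S \<Longrightarrow> a [^] (n::nat) \<in> even_part S"
  by (induction n) simp_all

text \<open>Anticommutation only says that a a equals its own negative. \<open>double_zeroD\<close>,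
  the one trace of the complex scalars kept in \<open>superring\<close>, removes the factor
  2.\<close>

lemma odd_square: "a \<in> odd_part S \<Longrightarrow> a \<otimes> a = \<zero>"
  using odd_anticommute[of a a] double_zeroD[of "a \<otimes> a"]
  by (metis m_closed odd_carrier r_neg)

lemma even_part_unique:
  assumes "a \<in> even_part S" "b \<in> odd_part S" "a \<oplus> b \<in> even_part S"
  shows "b = \<zero>"
proof -
  have "\<ominus> a \<oplus> (a \<oplus> b) = b"
    using assms by (simp add: r_neg1)
  then have "b \<in> even_part S"
    using assms by (metis even_add even_minus)
  then show ?thesis
    using assms even_inter_odd by blast
qed

text \<open>Since u a + u b = 1 is even, the odd part b of v satisfies u b = 0, and multiplying by v
  gives b = 0. Hence an even element that is a unit of the whole ring is already a unit of the even
  part.\<close>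

lemma even_inverse:
  assumes "u \<in> even_part S" "v \<in> carrier S" "u \<otimes> v = \<one>"
  shows "v \<in> even_part S"
proof -
  obtain a b where ab: "a \<in> even_part S" "b \<in> odd_part S" "v = a \<oplus> b"
    using decomp assms(2) by blast
  have eq: "u \<otimes> a \<oplus> u \<otimes> b = \<one>"
    using assms ab by (simp add: r_distr)
  have "u \<otimes> b = \<zero>"
    by (rule even_part_unique[of "u \<otimes> a"]) (use assms ab eq in simp_all)
  have "v \<otimes> u = \<one>"
    using assms even_commute[of u v] by simp
  then have "b = (v \<otimes> u) \<otimes> b"
    using ab by simp
  also have "\<dots> = v \<otimes> (u \<otimes> b)"
    using assms(1,2) ab(2) by (intro m_assoc) simp_all
  also have "\<dots> = \<zero>"
    using assms \<open>u \<otimes> b = \<zero>\<close> by simp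
  finally show ?thesis
    using ab by simp
qed

section \<open>Units of the even part and their perturbations\<close>

definition even_unit :: "'a \<Rightarrow> bool" where
  "even_unit u \<longleftrightarrow> u \<in> even_part S \<and> (\<exists>v\<in>even_part S. u \<otimes> v = \<one>)"

lemma even_unit_even [simp]: "even_unit u \<Longrightarrow> u \<in> even_part S"
  by (simp add: even_unit_def)

lemma even_unit_iff_Units: "even_unit u \<longleftrightarrow> u \<in> even_part S \<and> u \<in> Units S"
proof
  assume "even_unit u"
  then obtain v where "u \<in> even_part S" "v\<in>even_part S" "u \<otimes> v = \<one>"
    unfolding even_unit_def by blast
  then show "u \<in> even_part S \<and> u \<in> Units S"
    using even_comm[of u v] unfolding Units_def by force
next
  assume "u \<in> even_part S \<and> u \<in> Units S"
  then show "even_unit u"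
    unfolding even_unit_def using even_inverse Units_closed Units_r_inv
    by (meson Units_inv_closed)
qed

lemma even_unit_inverseE:
  assumes "even_unit u"
  obtains v where "v \<in> even_part S" "u \<otimes> v = \<one>" "v \<otimes> u = \<one>"
  using assms even_comm unfolding even_unit_def by metis

lemma even_unit_mult: "\<lbrakk>even_unit u; even_unit v\<rbrakk> \<Longrightarrow> even_unit (u \<otimes> v)"
  by (simp add: even_unit_iff_Units)

lemma even_unit_one [simp]: "even_unit \<one>"
  unfolding even_unit_def by (intro conjI bexI[of _ \<one>]) simp_all

lemma even_unit_minus: "even_unit u \<Longrightarrow> even_unit (\<ominus> u)"
proof -
  assume u: "even_unit u"
  have "even_unit (\<ominus> \<one>)"
    unfolding even_unit_def by (intro conjI bexI[of _ "\<ominus> \<one>"]) (simp_all add: l_minus)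
  then have "even_unit (\<ominus> \<one> \<otimes> u)"
    using u by (rule even_unit_mult)
  then show ?thesis
    using u by (simp add: l_minus)
qed

text \<open>With v inverse to u, the geometric series for the inverse of u + n stops after two
  terms, v - v v n, because n n = 0.\<close>

lemma even_unit_add_square_zero:
  assumes u: "even_unit u" and n: "n \<in> even_part S" "n \<otimes> n = \<zero>"
  shows "even_unit (u \<oplus> n)"
proof -
  obtain v where v: "v \<in> even_part S" "u \<otimes> v = \<one>" "v \<otimes> u = \<one>"
    using u by (rule even_unit_inverseE)
  have "v \<otimes> (v \<otimes> n) = n \<otimes> (v \<otimes> v)"
    using v n even_comm[of n "v \<otimes> v"] by (simp add: m_assoc)
  then have "n \<otimes> (v \<otimes> (v \<otimes> n)) = n \<otimes> n \<otimes> (v \<otimes> v)"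
    using v n(1) m_assoc[of n n "v \<otimes> v"] by simp
  then have nvvn: "n \<otimes> (v \<otimes> (v \<otimes> n)) = \<zero>"
    using v n by simp
  have "u \<otimes> (v \<otimes> (v \<otimes> n)) = v \<otimes> n"
    using u v n by (simp add: m_assoc[symmetric])
  then have "(u \<oplus> n) \<otimes> (v \<ominus> v \<otimes> (v \<otimes> n)) = \<one> \<ominus> v \<otimes> n \<oplus> n \<otimes> v"
    using u v n nvvn by (simp add: minus_eq l_distr r_distr r_minus a_ac)
  also have "\<dots> = \<one>"
    using u v n even_comm[of n v] by (simp add: minus_eq a_assoc l_neg)
  finally show ?thesis
    unfolding even_unit_def using u v n
    by (intro conjI bexI[of _ "v \<ominus> v \<otimes> (v \<otimes> n)"]) simp_all
qed

text \<open>
  The elements of the Jacobson radical of the even part which are needed: it contains all products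
  of two odd elements.
\<close>

definition perturb :: "'a set" where
  "perturb = {n \<in> even_part S. \<forall>e\<in>even_part S. \<forall>u. even_unit u \<longrightarrow> even_unit (u \<oplus> e \<otimes> n)}"

lemma perturb_even [simp]: "n \<in> perturb \<Longrightarrow> n \<in> even_part S"
  by (simp add: perturb_def)

lemma perturb_unit: "\<lbrakk>even_unit u; n \<in> perturb\<rbrakk> \<Longrightarrow> even_unit (u \<oplus> n)"
  unfolding perturb_def by (force dest: bspec[of _ _ \<one>])

lemma perturb_mult_left: "\<lbrakk>e \<in> even_part S; n \<in> perturb\<rbrakk> \<Longrightarrow> e \<otimes> n \<in> perturb"
  unfolding perturb_def by (auto simp: m_assoc[symmetric])

lemma perturb_mult_right: "\<lbrakk>e \<in> even_part S; n \<in> perturb\<rbrakk> \<Longrightarrow> n \<otimes> e \<in> perturb"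
  using perturb_mult_left[of e n] by (simp add: even_comm)

lemma perturb_add: "\<lbrakk>m \<in> perturb; n \<in> perturb\<rbrakk> \<Longrightarrow> m \<oplus> n \<in> perturb"
  unfolding perturb_def by (auto simp: r_distr a_assoc[symmetric])

lemma perturb_minus: "n \<in> perturb \<Longrightarrow> \<ominus> n \<in> perturb"
  using perturb_mult_left[of "\<ominus> \<one>" n] by (simp add: l_minus)

text \<open>Moving c past b in (c b)(c b) brings together two odd squares, which vanish. The factor
  e in the definition of \<open>perturb\<close> is absorbed by taking c = e a, which is odd
  again.\<close>

lemma odd_odd_perturb:
  assumes "a \<in> odd_part S" "b \<in> odd_part S"
  shows "a \<otimes> b \<in> perturb"
proof -
  have sq: "c \<otimes> b \<otimes> (c \<otimes> b) = \<zero>" if "c \<in> odd_part S" for c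
  proof -
    have "c \<otimes> b \<otimes> (c \<otimes> b) = c \<otimes> (b \<otimes> c) \<otimes> b"
      using that assms by (simp add: m_assoc)
    also have "b \<otimes> c = \<ominus> (c \<otimes> b)"
      using that assms by (intro odd_anticommute)
    also have "c \<otimes> (\<ominus> (c \<otimes> b)) \<otimes> b = \<ominus> (c \<otimes> c \<otimes> (b \<otimes> b))"
      using that assms by (simp add: m_assoc r_minus l_minus)
    also have "\<dots> = \<zero>"
      using that assms by (simp add: odd_square)
    finally show ?thesis .
  qed
  show ?thesis
    unfolding perturb_def
  proof (intro CollectI conjI ballI allI impI)
    fix e u assume "e \<in> even_part S" "even_unit u"
    then show "even_unit (u \<oplus> e \<otimes> (a \<otimes> b))"
      using even_unit_add_square_zero[of u "e \<otimes> a \<otimes> b"] assms sq[of "e \<otimes> a"]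
      by (simp add: m_assoc)
  qed (use assms in simp)
qed

end

lemma superalgebra_superring:
  assumes "superalgebra R"
  shows "superring R"
proof -
  interpret superalgebra R by fact
  interpret Module.module complex_ring R by (rule superalgebra.axioms(2)[OF assms])
  note E = submoduleE[OF even_submodule] and O = submoduleE[OF odd_submodule]
  have zero: "\<zero>\<^bsub>R\<^esub> \<in> even_part R" "\<zero>\<^bsub>R\<^esub> \<in> odd_part R"
    using even_inter_odd by blast+
  show ?thesis
  proof
    fix x assume x: "x \<in> carrier R" "x \<oplus>\<^bsub>R\<^esub> x = \<zero>\<^bsub>R\<^esub>"
    have "x = (1/2 + 1/2) \<odot>\<^bsub>R\<^esub> x"
      using smult_one[OF x(1)] by (simp add: complex_ring_def)
    also have "\<dots> = (1/2) \<odot>\<^bsub>R\<^esub> x \<oplus>\<^bsub>R\<^esub> (1/2) \<odot>\<^bsub>R\<^esub> x"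
      using smult_l_distr[of "1/2" "1/2" x] x by (simp add: complex_ring_def)
    also have "\<dots> = (1/2) \<odot>\<^bsub>R\<^esub> (x \<oplus>\<^bsub>R\<^esub> x)"
      using smult_r_distr[of "1/2" x x] x(1) by (simp add: complex_ring_def)
    also have "\<dots> = \<zero>\<^bsub>R\<^esub>"
      unfolding x(2) by (rule smult_r_null) (simp add: complex_ring_def)
    finally show "x = \<zero>\<^bsub>R\<^esub>" .
  next
    fix a assume "a \<in> even_part R" "a \<in> odd_part R"
    then show "a = \<zero>\<^bsub>R\<^esub>"
      using even_inter_odd by blast
  qed (rule zero E(3,5) O(3,5) decomposition one_even even_even even_odd odd_even odd_odd
      even_commute odd_anticommute subsetD[OF E(1)] subsetD[OF O(1)]; assumption)+
qed

section \<open>The group of points of $GL_{2|1}$\<close>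

lemma UNIV_type_2: "(UNIV :: 2 set) = {1, 0}"
  by (rule sym, rule card_subset_eq) simp_all

lemma type_2_cases: "(i :: 2) = 1 \<or> i = 0"
  using UNIV_type_2 by blast

lemma all_type_2: "(\<forall>i::2. P i) \<longleftrightarrow> P 1 \<and> P 0"
  using type_2_cases by metis

lemma type_1_eq: "(i :: 1) = 1"
  by (cases i) simp

lemma all_type_1: "(\<forall>i::1. P i) \<longleftrightarrow> P 1"
  using type_1_eq by metis

lemma UNIV_type_1: "(UNIV :: 1 set) = {1}"
  using type_1_eq by blast

lemma UNIV_type_21: "(UNIV :: (2 + 1) set) = {Inl 1, Inl 0, Inr 1}"
  by (auto simp: UNIV_sum UNIV_type_2 UNIV_type_1)

lemma all_type_21: "(\<forall>i::2 + 1. P i) \<longleftrightarrow> P (Inl 1) \<and> P (Inl 0) \<and> P (Inr 1)"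
  by (metis type_2_cases type_1_eq sum.exhaust)

text \<open>The entries are listed row by row with \<open>Inl 1\<close> as first,
  \<open>Inl 0\<close> as second and \<open>Inr 1\<close> as third index. This order agrees with
  \<open>weight\<close>, which puts k at 1 and l at the other element of the type
  \<open>2\<close>.\<close>

definition mat3 :: "'s \<Rightarrow> 's \<Rightarrow> 's \<Rightarrow> 's \<Rightarrow> 's \<Rightarrow> 's \<Rightarrow> 's \<Rightarrow> 's \<Rightarrow> 's \<Rightarrow> 2 + 1 \<Rightarrow> 2 + 1 \<Rightarrow> 's" where
  "mat3 a b c d e f g h i =
     (let row = (\<lambda>x y z. case_sum (\<lambda>j. if j = 1 then x else y) (\<lambda>_. z))
      in case_sum (\<lambda>r. if r = 1 then row a b c else row d e f) (\<lambda>_. row g h i))"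

lemma mat3_entries [simp]:
  "mat3 a b c d e f g h i (Inl 1) (Inl 1) = a"
  "mat3 a b c d e f g h i (Inl 1) (Inl 0) = b"
  "mat3 a b c d e f g h i (Inl 1) (Inr y) = c"
  "mat3 a b c d e f g h i (Inl 0) (Inl 1) = d"
  "mat3 a b c d e f g h i (Inl 0) (Inl 0) = e"
  "mat3 a b c d e f g h i (Inl 0) (Inr y) = f"
  "mat3 a b c d e f g h i (Inr x) (Inl 1) = g"
  "mat3 a b c d e f g h i (Inr x) (Inl 0) = h"
  "mat3 a b c d e f g h i (Inr x) (Inr y) = i"
  by (simp_all add: mat3_def)

lemma mat_eq_iff:
  "(A :: 2 + 1 \<Rightarrow> 2 + 1 \<Rightarrow> 's) = B \<longleftrightarrow> (\<forall>i j. A i j = B i j)"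
  by (auto simp: fun_eq_iff)

lemma mat3_eq_iff [simp]:
  "mat3 a b c d e f g h i = mat3 a' b' c' d' e' f' g' h' i' \<longleftrightarrow>
   a = a' \<and> b = b' \<and> c = c' \<and> d = d' \<and> e = e' \<and> f = f' \<and> g = g' \<and> h = h' \<and> i = i'"
  by (auto simp: mat_eq_iff all_type_21)

lemma mat3_cases:
  obtains a b c d e f g h i where "A = mat3 a b c d e f g h i"
proof
  show "A = mat3 (A (Inl 1) (Inl 1)) (A (Inl 1) (Inl 0)) (A (Inl 1) (Inr 1))
     (A (Inl 0) (Inl 1)) (A (Inl 0) (Inl 0)) (A (Inl 0) (Inr 1))
     (A (Inr 1) (Inl 1)) (A (Inr 1) (Inl 0)) (A (Inr 1) (Inr 1))"
    by (simp add: mat_eq_iff all_type_21)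
qed

lemma mat_diag_mat3:
  "mat_diag S d = mat3 (d (Inl 1)) \<zero>\<^bsub>S\<^esub> \<zero>\<^bsub>S\<^esub> \<zero>\<^bsub>S\<^esub> (d (Inl 0)) \<zero>\<^bsub>S\<^esub> \<zero>\<^bsub>S\<^esub> \<zero>\<^bsub>S\<^esub> (d (Inr 1))"
  by (simp add: mat_eq_iff all_type_21 mat_diag_def)

lemma (in superring) mat_mult_mat3:
  assumes "{a, b, c, d, e, f, g, h, i, a', b', c', d', e', f', g', h', i'} \<subseteq> carrier S"
  shows "mat_mult S (mat3 a b c d e f g h i) (mat3 a' b' c' d' e' f' g' h' i') =
    mat3
     (a \<otimes> a' \<oplus> (b \<otimes> d' \<oplus> c \<otimes> g')) (a \<otimes> b' \<oplus> (b \<otimes> e' \<oplus> c \<otimes> h')) (a \<otimes> c' \<oplus> (b \<otimes> f' \<oplus> c \<otimes> i'))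
     (d \<otimes> a' \<oplus> (e \<otimes> d' \<oplus> f \<otimes> g')) (d \<otimes> b' \<oplus> (e \<otimes> e' \<oplus> f \<otimes> h')) (d \<otimes> c' \<oplus> (e \<otimes> f' \<oplus> f \<otimes> i'))
     (g \<otimes> a' \<oplus> (h \<otimes> d' \<oplus> i \<otimes> g')) (g \<otimes> b' \<oplus> (h \<otimes> e' \<oplus> i \<otimes> h')) (g \<otimes> c' \<oplus> (h \<otimes> f' \<oplus> i \<otimes> i'))"
  using assms by (simp add: mat_eq_iff all_type_21 mat_mult_def UNIV_type_21)

text \<open>The determinant identities are proved for commutative rings, where
  \<open>algebra\<close> decides them, and are then applied to \<open>even_ring\<close>; the ring
  \<open>S\<close> itself is not commutative.\<close>

lemma (in cring) det_mult:
  assumes "a \<in> carrier R" "b \<in> carrier R" "c \<in> carrier R" "d \<in> carrier R"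
    "a' \<in> carrier R" "b' \<in> carrier R" "c' \<in> carrier R" "d' \<in> carrier R"
  shows "(a \<otimes> a' \<oplus> b \<otimes> c') \<otimes> (c \<otimes> b' \<oplus> d \<otimes> d') \<ominus> (a \<otimes> b' \<oplus> b \<otimes> d') \<otimes> (c \<otimes> a' \<oplus> d \<otimes> c') =
    (a \<otimes> d \<ominus> b \<otimes> c) \<otimes> (a' \<otimes> d' \<ominus> b' \<otimes> c')"
  using assms by algebra

lemma (in cring) adjugate:
  assumes "a \<in> carrier R" "b \<in> carrier R" "c \<in> carrier R" "d \<in> carrier R" "v \<in> carrier R"
  shows "a \<otimes> (v \<otimes> d) \<oplus> b \<otimes> (\<ominus> (v \<otimes> c)) = (a \<otimes> d \<ominus> b \<otimes> c) \<otimes> v"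
    and "a \<otimes> (\<ominus> (v \<otimes> b)) \<oplus> b \<otimes> (v \<otimes> a) = \<zero>"
    and "c \<otimes> (v \<otimes> d) \<oplus> d \<otimes> (\<ominus> (v \<otimes> c)) = \<zero>"
    and "c \<otimes> (\<ominus> (v \<otimes> b)) \<oplus> d \<otimes> (v \<otimes> a) = (a \<otimes> d \<ominus> b \<otimes> c) \<otimes> v"
    and "v \<otimes> d \<otimes> a \<oplus> (\<ominus> (v \<otimes> b)) \<otimes> c = (a \<otimes> d \<ominus> b \<otimes> c) \<otimes> v"
    and "v \<otimes> d \<otimes> b \<oplus> (\<ominus> (v \<otimes> b)) \<otimes> d = \<zero>"
    and "(\<ominus> (v \<otimes> c)) \<otimes> a \<oplus> v \<otimes> a \<otimes> c = \<zero>"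
    and "(\<ominus> (v \<otimes> c)) \<otimes> b \<oplus> v \<otimes> a \<otimes> d = (a \<otimes> d \<ominus> b \<otimes> c) \<otimes> v"
  using assms by algebra+

lemma (in cring) det_adjugate:
  assumes "a \<in> carrier R" "b \<in> carrier R" "c \<in> carrier R" "d \<in> carrier R" "v \<in> carrier R"
  shows "v \<otimes> d \<otimes> (v \<otimes> a) \<ominus> \<ominus> (v \<otimes> b) \<otimes> \<ominus> (v \<otimes> c) = v \<otimes> v \<otimes> (a \<otimes> d \<ominus> b \<otimes> c)"
  using assms by algebra

text \<open>Collects every term that contains one of m, n, p, q, so that for a perturbed matrix the
  determinant is the old one plus a correction built from the perturbations.\<close>

lemma (in ring) det_add:
  assumes "a \<in> carrier R" "b \<in> carrier R" "c \<in> carrier R" "d \<in> carrier R"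
    "m \<in> carrier R" "n \<in> carrier R" "p \<in> carrier R" "q \<in> carrier R"
  shows "(a \<oplus> m) \<otimes> (d \<oplus> q) \<ominus> (b \<oplus> n) \<otimes> (c \<oplus> p) =
    (a \<otimes> d \<ominus> b \<otimes> c) \<oplus> ((a \<otimes> q \<oplus> (m \<otimes> d \<oplus> m \<otimes> q)) \<oplus> \<ominus> (b \<otimes> p \<oplus> (n \<otimes> c \<oplus> n \<otimes> p)))"
  using assms by algebra

section \<open>Determinants over the even part and the group structure\<close>

context superring
begin

definition even_ring :: "'a superalg" where
  "even_ring = S\<lparr>carrier := even_part S\<rparr>"

lemma even_ring_simps [simp]:
  "carrier even_ring = even_part S" "mult even_ring = mult S" "add even_ring = add S"
  "one even_ring = \<one>" "zero even_ring = \<zero>"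
  by (simp_all add: even_ring_def)

lemma even_cring: "cring even_ring"
proof (intro cringI abelian_groupI comm_monoidI)
  fix x assume "x \<in> carrier even_ring"
  then show "\<exists>y\<in>carrier even_ring. y \<oplus>\<^bsub>even_ring\<^esub> x = \<zero>\<^bsub>even_ring\<^esub>"
    by (intro bexI[of _ "\<ominus> x"]) (simp_all add: l_neg)
next
  fix x y z assume "x \<in> carrier even_ring" "y \<in> carrier even_ring" "z \<in> carrier even_ring"
  then show "(x \<oplus>\<^bsub>even_ring\<^esub> y) \<otimes>\<^bsub>even_ring\<^esub> z =
      x \<otimes>\<^bsub>even_ring\<^esub> z \<oplus>\<^bsub>even_ring\<^esub> y \<otimes>\<^bsub>even_ring\<^esub> z"
    by (simp add: l_distr)
qed (simp_all add: a_assoc m_assoc, simp_all add: a_comm even_comm)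

text \<open>A negative is chosen within the carrier, so the one of \<open>even_ring\<close>, whose
  carrier is smaller, has to be compared with the one of \<open>S\<close>.\<close>

lemma even_ring_uminus:
  assumes "y \<in> even_part S"
  shows "\<ominus>\<^bsub>even_ring\<^esub> y = \<ominus> y"
proof -
  interpret E: cring even_ring by (rule even_cring)
  show ?thesis
    using assms E.l_neg[of y] E.a_inv_closed[of y] by (intro minus_equality[symmetric]) simp_all
qed

lemma even_ring_minus: "y \<in> even_part S \<Longrightarrow> x \<ominus>\<^bsub>even_ring\<^esub> y = x \<ominus> y"
  by (simp add: a_minus_def even_ring_uminus)

lemmas even_det_mult =
  cring.det_mult[OF even_cring, unfolded even_ring_simps]
lemmas even_adjugate =
  cring.adjugate[OF even_cring, unfolded even_ring_simps]

text \<open>\<open>perturb\<close> is closed under sums, negatives and multiplication by even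
  elements, so the correction term of \<open>det_add\<close> lies in it and does not affect
  invertibility.\<close>

lemma det_perturb:
  assumes "{a, b, c, d} \<subseteq> even_part S" and "{m, n, p, q} \<subseteq> perturb"
    and "even_unit (a \<otimes> d \<ominus> b \<otimes> c)"
  shows "even_unit ((a \<oplus> m) \<otimes> (d \<oplus> q) \<ominus> (b \<oplus> n) \<otimes> (c \<oplus> p))"
proof -
  have E: "m \<in> even_part S" "n \<in> even_part S" "p \<in> even_part S" "q \<in> even_part S"
    using assms by simp_all
  have "(a \<oplus> m) \<otimes> (d \<oplus> q) \<ominus> (b \<oplus> n) \<otimes> (c \<oplus> p) =
    (a \<otimes> d \<ominus> b \<otimes> c) \<oplus> ((a \<otimes> q \<oplus> (m \<otimes> d \<oplus> m \<otimes> q)) \<oplus> \<ominus> (b \<otimes> p \<oplus> (n \<otimes> c \<oplus> n \<otimes> p)))"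
    by (rule det_add) (use assms E in simp_all)
  moreover have "(a \<otimes> q \<oplus> (m \<otimes> d \<oplus> m \<otimes> q)) \<oplus> \<ominus> (b \<otimes> p \<oplus> (n \<otimes> c \<oplus> n \<otimes> p)) \<in> perturb"
    using assms E
    by (intro perturb_add perturb_minus) (simp_all add: perturb_mult_left perturb_mult_right)
  ultimately show ?thesis
    using assms(3) by (metis perturb_unit)
qed

text \<open>One direction is the multiplicativity of the determinant, the other the adjugate divided
  by the determinant.\<close>

lemma GL_even_2:
  fixes A :: "2 \<Rightarrow> 2 \<Rightarrow> 'a"
  shows "A \<in> GL_even S \<longleftrightarrow> (\<forall>i j. A i j \<in> even_part S) \<and>
    even_unit (A 1 1 \<otimes> A 0 0 \<ominus> A 1 0 \<otimes> A 0 1)" (is "_ \<longleftrightarrow> ?R")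
proof -
  have mult: "mat_mult S A B i j = A i 1 \<otimes> B 1 j \<oplus> A i 0 \<otimes> B 0 j"
    if "\<forall>i j. A i j \<in> even_part S" "\<forall>i j. B i j \<in> even_part S"
    for A B :: "2 \<Rightarrow> 2 \<Rightarrow> 'a" and i j
    using that by (simp add: mat_mult_def UNIV_type_2)
  show ?thesis
  proof
    assume "A \<in> GL_even S"
    then obtain B where A: "\<forall>i j. A i j \<in> even_part S" and B: "\<forall>i j. B i j \<in> even_part S"
      and AB: "mat_mult S A B = mat_diag S (\<lambda>_. \<one>)"
      unfolding GL_even_def by blast
    have e: "A i 1 \<otimes> B 1 j \<oplus> A i 0 \<otimes> B 0 j = (if i = j then \<one> else \<zero>)" for i j
      using mult[OF A B, of i j] AB by (simp add: mat_diag_def)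
    have "(A 1 1 \<otimes> A 0 0 \<ominus> A 1 0 \<otimes> A 0 1) \<otimes> (B 1 1 \<otimes> B 0 0 \<ominus> B 1 0 \<otimes> B 0 1) = \<one>"
      using even_det_mult[of "A 1 1" "A 1 0" "A 0 1" "A 0 0" "B 1 1" "B 1 0" "B 0 1" "B 0 0"] A B e
      by (simp add: minus_eq even_ring_minus)
    then show ?R
      using A B unfolding even_unit_def by (metis even_diff even_even)
  next
    assume R: ?R
    then obtain v where v: "v \<in> even_part S" "(A 1 1 \<otimes> A 0 0 \<ominus> A 1 0 \<otimes> A 0 1) \<otimes> v = \<one>"
      unfolding even_unit_def by blast
    \<comment> \<open>The adjugate times v; the nested index tests exchange the two diagonal
      entries.\<close>
    define B where "B = (\<lambda>i j :: 2. if i = j then v \<otimes> A (if i = 1 then 0 else 1) (if i = 1 then 0 else 1)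
       else \<ominus> (v \<otimes> A i j))"
    have A: "\<forall>i j. A i j \<in> even_part S" and B: "\<forall>i j. B i j \<in> even_part S"
      using R v by (auto simp: B_def)
    have "\<forall>i j. mat_mult S A B i j = (if i = j then \<one> else \<zero>) \<and>
        mat_mult S B A i j = (if i = j then \<one> else \<zero>)"
      unfolding mult[OF A B] mult[OF B A] all_type_2
      using A v(2) even_adjugate[of "A 1 1" "A 1 0" "A 0 1" "A 0 0" v, OF _ _ _ _ v(1)]
      by (simp add: B_def v(1) even_ring_minus even_ring_uminus)
    then have "mat_mult S A B = mat_diag S (\<lambda>_. \<one>)" "mat_mult S B A = mat_diag S (\<lambda>_. \<one>)"
      by (simp_all add: mat_diag_def fun_eq_iff)
    then show "A \<in> GL_even S"
      unfolding GL_even_def using A B by blast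
  qed
qed

lemma GL_even_1:
  fixes A :: "1 \<Rightarrow> 1 \<Rightarrow> 'a"
  shows "A \<in> GL_even S \<longleftrightarrow> even_unit (A 1 1)"
proof
  assume "A \<in> GL_even S"
  then obtain B where "\<forall>i j. A i j \<in> even_part S" "\<forall>i j. B i j \<in> even_part S"
    "mat_mult S A B = mat_diag S (\<lambda>_. \<one>)"
    unfolding GL_even_def by blast
  then show "even_unit (A 1 1)"
    unfolding even_unit_def
    by (auto simp: mat_mult_def mat_diag_def UNIV_type_1 fun_eq_iff all_type_1 intro!: bexI[of _ "B 1 1"])
next
  assume "even_unit (A 1 1)"
  then obtain v where "v \<in> even_part S" "A 1 1 \<otimes> v = \<one>" "v \<otimes> A 1 1 = \<one>"
    by (rule even_unit_inverseE)
  with \<open>even_unit (A 1 1)\<close> show "A \<in> GL_even S"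
    unfolding GL_even_def
    by (auto simp: mat_mult_def mat_diag_def UNIV_type_1 fun_eq_iff all_type_1 intro!: exI[of _ "\<lambda>_ _. v"])
qed


lemma GL_super_mat3:
  "mat3 a b c d e f g h i \<in> carrier (GL_super S) \<longleftrightarrow>
    a \<in> even_part S \<and> b \<in> even_part S \<and> c \<in> odd_part S \<and>
    d \<in> even_part S \<and> e \<in> even_part S \<and> f \<in> odd_part S \<and>
    g \<in> odd_part S \<and> h \<in> odd_part S \<and>
    even_unit (a \<otimes> e \<ominus> b \<otimes> d) \<and> even_unit i"
  by (auto simp: GL_super_def GL_even_2 GL_even_1 all_type_2 all_type_1)

lemma GL_super_carrier:
  assumes "A \<in> carrier (GL_super S :: (2 + 1 \<Rightarrow> 2 + 1 \<Rightarrow> 'a) monoid)"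
  shows "A i j \<in> carrier S"
proof -
  obtain a b c d e f g h k where A: "A = mat3 a b c d e f g h k"
    by (rule mat3_cases)
  have "\<forall>i j. A i j \<in> carrier S"
    using assms unfolding A GL_super_mat3 all_type_21 by auto
  then show ?thesis by blast
qed

lemma mat_mult_entry:
  fixes A B :: "2 + 1 \<Rightarrow> 2 + 1 \<Rightarrow> 'a"
  assumes "\<And>i j. A i j \<in> carrier S" and "\<And>i j. B i j \<in> carrier S"
  shows "mat_mult S A B i j =
    A i (Inl 1) \<otimes> B (Inl 1) j \<oplus> (A i (Inl 0) \<otimes> B (Inl 0) j \<oplus> A i (Inr 1) \<otimes> B (Inr 1) j)"
  using assms by (simp add: mat_mult_def UNIV_type_21)

lemma mat_mult_assoc:
  fixes A B C :: "2 + 1 \<Rightarrow> 2 + 1 \<Rightarrow> 'a"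
  assumes A: "\<And>i j. A i j \<in> carrier S" and B: "\<And>i j. B i j \<in> carrier S"
    and C: "\<And>i j. C i j \<in> carrier S"
  shows "mat_mult S (mat_mult S A B) C = mat_mult S A (mat_mult S B C)"
proof -
  have AB: "\<And>i j. mat_mult S A B i j \<in> carrier S" and BC: "\<And>i j. mat_mult S B C i j \<in> carrier S"
    using A B C by (simp_all add: mat_mult_entry)
  have "(x \<oplus> (y \<oplus> z)) \<oplus> ((x' \<oplus> (y' \<oplus> z')) \<oplus> (x'' \<oplus> (y'' \<oplus> z''))) =
      (x \<oplus> (x' \<oplus> x'')) \<oplus> ((y \<oplus> (y' \<oplus> y'')) \<oplus> (z \<oplus> (z' \<oplus> z'')))"
    if "{x, y, z, x', y', z', x'', y'', z''} \<subseteq> carrier S" for x y z x' y' z' x'' y'' z''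
    using that by (simp add: a_ac)
  then show ?thesis
    unfolding mat_eq_iff mat_mult_entry[OF AB C] mat_mult_entry[OF A BC]
      mat_mult_entry[OF A B] mat_mult_entry[OF B C]
    using A B C by (simp add: l_distr r_distr m_assoc)
qed

text \<open>Each even block of the product is the product of the even blocks plus products of two
  odd entries. The latter lie in \<open>perturb\<close>, so the determinant and the last entry
  remain units.\<close>

lemma GL_super_mult_closed:
  assumes "A \<in> carrier (GL_super S :: (2 + 1 \<Rightarrow> 2 + 1 \<Rightarrow> 'a) monoid)" "B \<in> carrier (GL_super S)"
  shows "mat_mult S A B \<in> carrier (GL_super S)"
proof -
  obtain a b c d e f g h i where A: "A = mat3 a b c d e f g h i"
    by (rule mat3_cases)
  obtain a' b' c' d' e' f' g' h' i' where B: "B = mat3 a' b' c' d' e' f' g' h' i'"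
    by (rule mat3_cases)
  note mem = assms[unfolded A B GL_super_mat3]
  have "even_unit ((a \<otimes> a' \<oplus> b \<otimes> d') \<otimes> (d \<otimes> b' \<oplus> e \<otimes> e') \<ominus> (a \<otimes> b' \<oplus> b \<otimes> e') \<otimes> (d \<otimes> a' \<oplus> e \<otimes> d'))"
    using even_det_mult[of a b d e a' b' d' e'] even_unit_mult mem by (simp add: even_ring_minus)
  then have "even_unit (((a \<otimes> a' \<oplus> b \<otimes> d') \<oplus> c \<otimes> g') \<otimes> ((d \<otimes> b' \<oplus> e \<otimes> e') \<oplus> f \<otimes> h')
      \<ominus> ((a \<otimes> b' \<oplus> b \<otimes> e') \<oplus> c \<otimes> h') \<otimes> ((d \<otimes> a' \<oplus> e \<otimes> d') \<oplus> f \<otimes> g'))"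
    using mem odd_odd_perturb
    by (intro det_perturb[of "a \<otimes> a' \<oplus> b \<otimes> d'" "a \<otimes> b' \<oplus> b \<otimes> e'" "d \<otimes> a' \<oplus> e \<otimes> d'"
      "d \<otimes> b' \<oplus> e \<otimes> e'" "c \<otimes> g'" "c \<otimes> h'" "f \<otimes> g'" "f \<otimes> h'"]) simp_all
  then have det: "even_unit ((a \<otimes> a' \<oplus> (b \<otimes> d' \<oplus> c \<otimes> g')) \<otimes> (d \<otimes> b' \<oplus> (e \<otimes> e' \<oplus> f \<otimes> h'))
      \<ominus> (a \<otimes> b' \<oplus> (b \<otimes> e' \<oplus> c \<otimes> h')) \<otimes> (d \<otimes> a' \<oplus> (e \<otimes> d' \<oplus> f \<otimes> g')))"
    using mem by (simp add: a_assoc)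
  have "even_unit (i \<otimes> i' \<oplus> (g \<otimes> c' \<oplus> h \<otimes> f'))"
    by (intro perturb_unit even_unit_mult perturb_add odd_odd_perturb) (use mem in auto)
  moreover have "i \<otimes> i' \<oplus> (g \<otimes> c' \<oplus> h \<otimes> f') = g \<otimes> c' \<oplus> (h \<otimes> f' \<oplus> i \<otimes> i')"
    using mem by (simp add: a_ac)
  ultimately show ?thesis
    using mem det unfolding A B by (subst mat_mult_mat3) (simp_all add: GL_super_mat3)
qed

lemma GL_super_monoid: "Group.monoid (GL_super S :: (2 + 1 \<Rightarrow> 2 + 1 \<Rightarrow> 'a) monoid)"
  (is "Group.monoid ?G")
proof
  show "\<one>\<^bsub>?G\<^esub> \<in> carrier ?G"
    by (simp add: GL_super_def[of S, THEN arg_cong[where f = one]] mat_diag_mat3 GL_super_mat3 minus_eq)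
next
  fix A assume A: "A \<in> carrier ?G"
  obtain a b c d e f g h i where eq: "A = mat3 a b c d e f g h i"
    by (rule mat3_cases)
  note mem = A[unfolded eq GL_super_mat3]
  show "\<one>\<^bsub>?G\<^esub> \<otimes>\<^bsub>?G\<^esub> A = A" "A \<otimes>\<^bsub>?G\<^esub> \<one>\<^bsub>?G\<^esub> = A"
    using mem unfolding eq by (simp_all add: GL_super_def mat_diag_mat3 mat_mult_mat3)
next
  fix A B assume "A \<in> carrier ?G" "B \<in> carrier ?G"
  then show "A \<otimes>\<^bsub>?G\<^esub> B \<in> carrier ?G"
    using GL_super_mult_closed[of A B] by (simp add: GL_super_def)
next
  fix A B C assume "A \<in> carrier ?G" "B \<in> carrier ?G" "C \<in> carrier ?G"
  then show "A \<otimes>\<^bsub>?G\<^esub> B \<otimes>\<^bsub>?G\<^esub> C = A \<otimes>\<^bsub>?G\<^esub> (B \<otimes>\<^bsub>?G\<^esub> C)"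
    using mat_mult_assoc[of A B C] GL_super_carrier by (simp add: GL_super_def)
qed

lemma GL_super_mult [simp]: "mult (GL_super S) = mat_mult S"
  and GL_super_one [simp]: "one (GL_super S) = mat_diag S (\<lambda>_. \<one>)"
  by (simp_all add: GL_super_def)

text \<open>
  Inverses come from the factorisation of a supermatrix into an upper unitriangular, a block
  diagonal and a lower unitriangular one; the Schur complement is a perturbation of the even block.
\<close>

lemma GL_super_group: "group (GL_super S :: (2 + 1 \<Rightarrow> 2 + 1 \<Rightarrow> 'a) monoid)"
  (is "group ?G")
proof -
  interpret G: Group.monoid ?G by (rule GL_super_monoid)
  have unitI: "A \<in> Units ?G"
    if "A \<in> carrier ?G" "B \<in> carrier ?G" "mat_mult S A B = mat_diag S (\<lambda>_. \<one>)"
      "mat_mult S B A = mat_diag S (\<lambda>_. \<one>)" for A B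
    using that unfolding Units_def by auto
  have one: "even_unit (\<one> \<otimes> \<one> \<ominus> \<zero> \<otimes> \<zero>)"
    by (simp add: minus_eq)
  have "A \<in> Units ?G" if A: "A \<in> carrier ?G" for A
  proof -
    obtain a b c d e f g h i where eq: "A = mat3 a b c d e f g h i"
      by (rule mat3_cases)
    note mem = A[unfolded eq GL_super_mat3]
    obtain v where v: "v \<in> even_part S" "i \<otimes> v = \<one>" "v \<otimes> i = \<one>"
      using mem even_unit_inverseE by blast
    define U where "U = (\<lambda>x y. mat3 \<one> \<zero> x \<zero> \<one> y \<zero> \<zero> \<one>)"
    define L where "L = (\<lambda>x y. mat3 \<one> \<zero> \<zero> \<zero> \<one> \<zero> x y \<one>)"
    have U: "U x y \<in> Units ?G" if "x \<in> odd_part S" "y \<in> odd_part S" for x y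
      by (rule unitI[of _ "U (\<ominus> x) (\<ominus> y)"])
        (use that one in \<open>simp_all add: U_def GL_super_mat3 mat_mult_mat3 mat_diag_mat3 l_neg r_neg\<close>)
    have L: "L x y \<in> Units ?G" if "x \<in> odd_part S" "y \<in> odd_part S" for x y
      by (rule unitI[of _ "L (\<ominus> x) (\<ominus> y)"])
        (use that one in \<open>simp_all add: L_def GL_super_mat3 mat_mult_mat3 mat_diag_mat3 l_neg r_neg\<close>)
    define D where "D = (\<lambda>x y z w u. mat3 x y \<zero> z w \<zero> \<zero> \<zero> u)"
    have D: "D x y z w i \<in> Units ?G"
      if dxyz: "{x, y, z, w} \<subseteq> even_part S" "even_unit (x \<otimes> w \<ominus> y \<otimes> z)" for x y z w
    proof -
      obtain r where r: "r \<in> even_part S" "(x \<otimes> w \<ominus> y \<otimes> z) \<otimes> r = \<one>"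
        using dxyz unfolding even_unit_def by blast
      note adj = even_adjugate[of x y z w r, OF _ _ _ _ r(1)]
      have inv: "mat_mult S (D x y z w i) (D (r \<otimes> w) (\<ominus> (r \<otimes> y)) (\<ominus> (r \<otimes> z)) (r \<otimes> x) v) = mat_diag S (\<lambda>_. \<one>)"
        "mat_mult S (D (r \<otimes> w) (\<ominus> (r \<otimes> y)) (\<ominus> (r \<otimes> z)) (r \<otimes> x) v) (D x y z w i) = mat_diag S (\<lambda>_. \<one>)"
        using adj r dxyz(1) v mem
        by (simp_all add: D_def mat_mult_mat3 mat_diag_mat3 even_ring_minus even_ring_uminus)
      have "r \<otimes> w \<otimes> (r \<otimes> x) \<ominus> \<ominus> (r \<otimes> y) \<otimes> \<ominus> (r \<otimes> z) = r \<otimes> r \<otimes> (x \<otimes> w \<ominus> y \<otimes> z)"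
        using dxyz(1) r(1) cring.det_adjugate[OF even_cring, of x y z w r]
        by (simp add: even_ring_minus even_ring_uminus)
      moreover have "even_unit r"
        using r dxyz(1) even_comm[of r "x \<otimes> w \<ominus> y \<otimes> z"] unfolding even_unit_def
        by (intro conjI bexI[of _ "x \<otimes> w \<ominus> y \<otimes> z"]) simp_all
      ultimately have "even_unit (r \<otimes> w \<otimes> (r \<otimes> x) \<ominus> \<ominus> (r \<otimes> y) \<otimes> \<ominus> (r \<otimes> z))"
        using dxyz(2) by (simp add: even_unit_mult)
      moreover have "even_unit v"
        using v mem unfolding even_unit_def by (intro conjI bexI[of _ i]) simp_all
      ultimately show ?thesis
        using dxyz r(1) mem by (intro unitI[OF _ _ inv]) (simp_all add: D_def GL_super_mat3)
    qed
    \<comment> \<open>\<open>s\<close> computes the entries x - y v z of the Schur complement of i,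
      where v is the inverse of i.\<close>
    define s where "s = (\<lambda>x y z. x \<oplus> \<ominus> (y \<otimes> (v \<otimes> z)))"
    have "even_unit (s a c g \<otimes> s e f h \<ominus> s b c h \<otimes> s d f g)"
      unfolding s_def using mem v(1)
      by (intro det_perturb) (auto intro!: perturb_minus odd_odd_perturb)
    then have "D (s a c g) (s b c h) (s d f g) (s e f h) i \<in> Units ?G"
      by (intro D) (use mem v in \<open>auto simp: s_def\<close>)
    moreover have "U (c \<otimes> v) (f \<otimes> v) \<in> Units ?G" "L (v \<otimes> g) (v \<otimes> h) \<in> Units ?G"
      using U L mem v by simp_all
    moreover have "mat_mult S (U (c \<otimes> v) (f \<otimes> v))
        (mat_mult S (D (s a c g) (s b c h) (s d f g) (s e f h) i) (L (v \<otimes> g) (v \<otimes> h))) = A"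
    proof -
      have "x \<oplus> \<ominus> y \<oplus> y = x" if "x \<in> carrier S" "y \<in> carrier S" for x y
        using that by (simp add: a_assoc l_neg)
      moreover have "i \<otimes> (v \<otimes> y) = y" "v \<otimes> (i \<otimes> y) = y" if "y \<in> carrier S" for y
        using that v mem by (simp_all add: m_assoc[symmetric])
      ultimately show ?thesis
        using mem v unfolding eq U_def D_def L_def s_def
        by (simp add: mat_mult_mat3 m_assoc)
    qed
    ultimately show ?thesis
      using G.Units_m_closed by (metis GL_super_mult)
  qed
  then show ?thesis
    by unfold_locales auto
qed

end

section \<open>Laurent series over a superring\<close>

context superring
begin

lemma finsum_even: "(\<And>i. i \<in> A \<Longrightarrow> f i \<in> even_part S) \<Longrightarrow> finsum S f A \<in> even_part S"
  by (induction A rule: infinite_finite_induct) (simp_all add: Pi_def)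

lemma finsum_odd: "(\<And>i. i \<in> A \<Longrightarrow> f i \<in> odd_part S) \<Longrightarrow> finsum S f A \<in> odd_part S"
  by (induction A rule: infinite_finite_induct) (simp_all add: Pi_def)

lemma finsum_minus:
  "(\<And>i. i \<in> A \<Longrightarrow> f i \<in> carrier S) \<Longrightarrow> (\<Oplus>i\<in>A. \<ominus> f i) = \<ominus> (\<Oplus>i\<in>A. f i)"
  by (induction A rule: infinite_finite_induct) (simp_all add: Pi_def minus_add)

lemma finsum_swap:
  assumes "finite A" "finite B" "\<And>i j. \<lbrakk>i \<in> A; j \<in> B\<rbrakk> \<Longrightarrow> f i j \<in> carrier S"
  shows "(\<Oplus>i\<in>A. \<Oplus>j\<in>B. f i j) = (\<Oplus>j\<in>B. \<Oplus>i\<in>A. f i j)"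
  using assms(1,3)
proof (induction A)
  case (insert a A)
  then have "(\<Oplus>i\<in>insert a A. \<Oplus>j\<in>B. f i j) = (\<Oplus>j\<in>B. f a j) \<oplus> (\<Oplus>j\<in>B. \<Oplus>i\<in>A. f i j)"
    by (simp add: Pi_def)
  also have "\<dots> = (\<Oplus>j\<in>B. f a j \<oplus> (\<Oplus>i\<in>A. f i j))"
    using insert.prems by (intro finsum_addf[symmetric]) auto
  also have "\<dots> = (\<Oplus>j\<in>B. \<Oplus>i\<in>insert a A. f i j)"
    using insert.prems insert.hyps by (intro finsum_cong') (auto simp: Pi_def)
  finally show ?case .
qed (simp add: Pi_def)

abbreviation (input) L where "L \<equiv> laurent S"

lemma carrier_laurent:
  "f \<in> carrier L \<longleftrightarrow> (\<forall>n. f n \<in> carrier S) \<and> (\<exists>N. \<forall>n<N. f n = \<zero>)"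
  and even_laurent:
  "f \<in> even_part L \<longleftrightarrow> (\<forall>n. f n \<in> even_part S) \<and> (\<exists>N. \<forall>n<N. f n = \<zero>)"
  and odd_laurent:
  "f \<in> odd_part L \<longleftrightarrow> (\<forall>n. f n \<in> odd_part S) \<and> (\<exists>N. \<forall>n<N. f n = \<zero>)"
  and add_laurent: "f \<oplus>\<^bsub>L\<^esub> g = (\<lambda>n. f n \<oplus> g n)"
  and zero_laurent: "\<zero>\<^bsub>L\<^esub> = (\<lambda>n. \<zero>)"
  and one_laurent: "\<one>\<^bsub>L\<^esub> = (\<lambda>n. if n = 0 then \<one> else \<zero>)"
  by (simp_all add: laurent_def)

text \<open>The product is defined as a sum over the exact set of contributing indices, which
  changes with the factors and with n. Any finite A containing that set serves as well, so products
  can be compared over a common index set.\<close>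

lemma mult_laurent:
  assumes "finite A" and "\<And>i. f i \<in> carrier S" and "\<And>i. g i \<in> carrier S"
    and "\<And>i. \<lbrakk>i \<notin> A; f i \<noteq> \<zero>\<rbrakk> \<Longrightarrow> g (n - i) = \<zero>"
  shows "(f \<otimes>\<^bsub>L\<^esub> g) n = (\<Oplus>i\<in>A. f i \<otimes> g (n - i))"
proof -
  have "(\<Oplus>i\<in>{i. f i \<noteq> \<zero> \<and> g (n - i) \<noteq> \<zero>}. f i \<otimes> g (n - i)) = (\<Oplus>i\<in>A. f i \<otimes> g (n - i))"
    using assms by (intro add.finprod_mono_neutral_cong_left) (auto simp: Pi_def)
  then show ?thesis
    by (simp add: laurent_def)
qed

lemma mult_laurent_bounds:
  assumes "f \<in> carrier L" "g \<in> carrier L" "\<forall>n<M. f n = \<zero>" "\<forall>n<N. g n = \<zero>"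
  shows "(f \<otimes>\<^bsub>L\<^esub> g) n = (\<Oplus>i\<in>{M..n - N}. f i \<otimes> g (n - i))"
proof (rule mult_laurent)
  fix i assume "i \<notin> {M..n - N}" "f i \<noteq> \<zero>"
  then have "n - i < N"
    using assms(3) by force
  then show "g (n - i) = \<zero>"
    using assms(4) by blast
qed (use assms in \<open>auto simp: carrier_laurent\<close>)

lemma mult_laurent_zero:
  assumes "f \<in> carrier L" "g \<in> carrier L" "\<forall>n<M. f n = \<zero>" "\<forall>n<N. g n = \<zero>"
    and "n < M + N"
  shows "(f \<otimes>\<^bsub>L\<^esub> g) n = \<zero>"
  using mult_laurent_bounds[OF assms(1-4), of n] assms(5) by simp

lemma laurent_lower_bound:
  assumes "f \<in> carrier L"
  obtains N where "N \<le> M" "\<forall>n<N. f n = \<zero>"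
proof -
  obtain N where "\<forall>n<N. f n = \<zero>"
    using assms by (auto simp: carrier_laurent)
  then show ?thesis
    by (intro that[of "min N M"]) auto
qed

lemma mult_laurent_support:
  assumes "f \<in> carrier L" "g \<in> carrier L"
  shows "\<exists>N. \<forall>n<N. (f \<otimes>\<^bsub>L\<^esub> g) n = \<zero>"
  using laurent_lower_bound[OF assms(1), of 0] laurent_lower_bound[OF assms(2), of 0]
    mult_laurent_zero[OF assms] by metis

lemma mult_laurent_closed:
  assumes "f \<in> carrier L" "g \<in> carrier L"
  shows "f \<otimes>\<^bsub>L\<^esub> g \<in> carrier L"
proof -
  have "(f \<otimes>\<^bsub>L\<^esub> g) n \<in> carrier S" for n
    using assms by (auto simp: laurent_def intro!: finsum_closed)
  then show ?thesis
    using mult_laurent_support[OF assms] by (simp add: carrier_laurent)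
qed

lemma mult_laurent_assoc:
  assumes "f \<in> carrier L" "g \<in> carrier L" "h \<in> carrier L"
  shows "f \<otimes>\<^bsub>L\<^esub> g \<otimes>\<^bsub>L\<^esub> h = f \<otimes>\<^bsub>L\<^esub> (g \<otimes>\<^bsub>L\<^esub> h)"
proof
  fix n
  have c: "f i \<in> carrier S" "g i \<in> carrier S" "h i \<in> carrier S"
    "(f \<otimes>\<^bsub>L\<^esub> g) i \<in> carrier S" "(g \<otimes>\<^bsub>L\<^esub> h) i \<in> carrier S" for i
    using assms mult_laurent_closed[of f g] mult_laurent_closed[of g h] by (simp_all add: carrier_laurent)
  obtain N1 where N1: "N1 \<le> 0" "\<forall>n<N1. f n = \<zero>"
    using laurent_lower_bound[OF assms(1)] by blast
  obtain N2 where N2: "N2 \<le> N1" "\<forall>n<N2. g n = \<zero>"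
    using laurent_lower_bound[OF assms(2)] by blast
  obtain N where N: "N \<le> N2" "\<forall>n<N. h n = \<zero>"
    using laurent_lower_bound[OF assms(3)] by blast
  have z: "\<forall>i<N. f i = \<zero>" "\<forall>i<N. g i = \<zero>" "\<forall>i<N. h i = \<zero>"
    using N N2 N1 by auto
  then have z2: "\<forall>i<2 * N. (f \<otimes>\<^bsub>L\<^esub> g) i = \<zero>" "\<forall>i<2 * N. (g \<otimes>\<^bsub>L\<^esub> h) i = \<zero>"
    using mult_laurent_zero[OF assms(1,2), of N N] mult_laurent_zero[OF assms(2,3), of N N] by auto
  \<comment> \<open>N bounds all three supports from below, hence 2 N bounds those of the two
    partial products. These are the ranges left for the index of f g and for the index of f, and
    both are independent of the other index, so the double sum can be interchanged.\<close>
  let ?A = "{2 * N..n - N}" and ?B = "{N..n - 2 * N}"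
  have "(f \<otimes>\<^bsub>L\<^esub> g \<otimes>\<^bsub>L\<^esub> h) n = (\<Oplus>i\<in>?A. (f \<otimes>\<^bsub>L\<^esub> g) i \<otimes> h (n - i))"
    using mult_laurent_bounds[OF mult_laurent_closed[OF assms(1,2)] assms(3) z2(1) z(3)] by simp
  also have "\<dots> = (\<Oplus>i\<in>?A. (\<Oplus>j\<in>?B. f j \<otimes> g (i - j)) \<otimes> h (n - i))"
  proof (intro finsum_cong' refl)
    fix i assume i: "i \<in> ?A"
    have "(f \<otimes>\<^bsub>L\<^esub> g) i = (\<Oplus>j\<in>?B. f j \<otimes> g (i - j))"
    proof (rule mult_laurent)
      fix j assume "j \<notin> ?B" "f j \<noteq> \<zero>"
      then show "g (i - j) = \<zero>"
        using z(1)[rule_format, of j] i by (intro z(2)[rule_format]) force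
    qed (use c in auto)
    then show "(f \<otimes>\<^bsub>L\<^esub> g) i \<otimes> h (n - i) = (\<Oplus>j\<in>?B. f j \<otimes> g (i - j)) \<otimes> h (n - i)"
      by simp
  qed (use c in auto)
  also have "\<dots> = (\<Oplus>i\<in>?A. \<Oplus>j\<in>?B. f j \<otimes> (g (i - j) \<otimes> h (n - i)))"
    using c by (intro finsum_cong' refl) (auto simp: finsum_ldistr m_assoc Pi_def)
  also have "\<dots> = (\<Oplus>j\<in>?B. \<Oplus>i\<in>?A. f j \<otimes> (g (i - j) \<otimes> h (n - i)))"
    using c by (intro finsum_swap) auto
  also have "\<dots> = (\<Oplus>j\<in>?B. f j \<otimes> (g \<otimes>\<^bsub>L\<^esub> h) (n - j))"
  proof (intro finsum_cong' refl)
    fix j assume j: "j \<in> ?B"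
    have "(g \<otimes>\<^bsub>L\<^esub> h) (n - j) = (\<Oplus>m\<in>(\<lambda>i. i - j) ` ?A. g m \<otimes> h (n - j - m))"
    proof (rule mult_laurent)
      fix m assume m: "m \<notin> (\<lambda>i. i - j) ` ?A" "g m \<noteq> \<zero>"
      then have "m + j \<notin> ?A"
        by force
      then show "h (n - j - m) = \<zero>"
        using z(2)[rule_format, of m] m(2) j by (intro z(3)[rule_format]) force
    qed (use c in auto)
    also have "\<dots> = (\<Oplus>i\<in>?A. g (i - j) \<otimes> h (n - i))"
      using c by (subst finsum_reindex) (auto simp: inj_on_def algebra_simps)
    finally show "(\<Oplus>i\<in>?A. f j \<otimes> (g (i - j) \<otimes> h (n - i))) = f j \<otimes> (g \<otimes>\<^bsub>L\<^esub> h) (n - j)"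
      using c by (simp add: finsum_rdistr Pi_def)
  qed (use c in auto)
  also have "\<dots> = (f \<otimes>\<^bsub>L\<^esub> (g \<otimes>\<^bsub>L\<^esub> h)) n"
    using mult_laurent_bounds[OF assms(1) mult_laurent_closed[OF assms(2,3)] z(1) z2(2)] by simp
  finally show "(f \<otimes>\<^bsub>L\<^esub> g \<otimes>\<^bsub>L\<^esub> h) n = (f \<otimes>\<^bsub>L\<^esub> (g \<otimes>\<^bsub>L\<^esub> h)) n" .
qed

text \<open>The substitution of n - i for i makes the sum run over the index set that defines the
  product in the other order, so the commutation rules can be checked term by term.\<close>

lemma mult_laurent_flip:
  assumes "f \<in> carrier L" "g \<in> carrier L"
  shows "(f \<otimes>\<^bsub>L\<^esub> g) n = (\<Oplus>i\<in>{i. g i \<noteq> \<zero> \<and> f (n - i) \<noteq> \<zero>}. f (n - i) \<otimes> g i)"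
proof -
  have eq: "{i. f i \<noteq> \<zero> \<and> g (n - i) \<noteq> \<zero>} = (\<lambda>i. n - i) ` {i. g i \<noteq> \<zero> \<and> f (n - i) \<noteq> \<zero>}"
    by (auto intro!: rev_image_eqI[where x = "n - i" for i])
  show ?thesis
    using assms unfolding laurent_def Let_def monoid.simps eq
    by (subst finsum_reindex) (auto simp: inj_on_def carrier_laurent)
qed

lemma laurent_lower_bound2:
  assumes "f \<in> carrier L" "g \<in> carrier L"
  obtains N where "\<forall>n<N. f n = \<zero>" "\<forall>n<N. g n = \<zero>"
  using laurent_lower_bound[OF assms(1), of 0] laurent_lower_bound[OF assms(2)]
  by (metis order_less_le_trans)

lemma parity_laurent_carrier: "f \<in> even_part L \<Longrightarrow> f \<in> carrier L" "f \<in> odd_part L \<Longrightarrow> f \<in> carrier L"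
  by (auto simp: even_laurent odd_laurent carrier_laurent)

lemma laurent_add_support:
  assumes "\<exists>N. \<forall>n<N. f n = \<zero>" "\<exists>N. \<forall>n<(N::int). g n = \<zero>"
  shows "\<exists>N. \<forall>n<N. f n \<oplus> g n = \<zero>"
proof -
  obtain M N where "\<forall>n<M. f n = \<zero>" "\<forall>n<N. g n = \<zero>"
    using assms by blast
  then show ?thesis
    by (intro exI[of _ "min M N"]) simp
qed

lemma laurent_minus_support: "\<exists>N. \<forall>n<(N::int). f n = \<zero> \<Longrightarrow> \<exists>N. \<forall>n<N. \<ominus> f n = \<zero>"
  by (metis minus_zero)

lemma laurent_ring: "ring L"
proof (intro ringI abelian_groupI Group.monoidI)
  fix f assume f: "f \<in> carrier L"
  show "\<exists>g\<in>carrier L. g \<oplus>\<^bsub>L\<^esub> f = \<zero>\<^bsub>L\<^esub>"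
    using f by (intro bexI[of _ "\<lambda>n. \<ominus> f n"])
      (auto simp: carrier_laurent add_laurent zero_laurent l_neg intro: laurent_minus_support)
  have c: "\<And>i. f i \<in> carrier S"
    using f by (simp add: carrier_laurent)
  show "\<one>\<^bsub>L\<^esub> \<otimes>\<^bsub>L\<^esub> f = f"
  proof
    fix n
    have "(\<one>\<^bsub>L\<^esub> \<otimes>\<^bsub>L\<^esub> f) n = (\<Oplus>i\<in>{0}. \<one>\<^bsub>L\<^esub> i \<otimes> f (n - i))"
      using c by (intro mult_laurent) (auto simp: one_laurent)
    then show "(\<one>\<^bsub>L\<^esub> \<otimes>\<^bsub>L\<^esub> f) n = f n"
      using c by (simp add: one_laurent)
  qed
  show "f \<otimes>\<^bsub>L\<^esub> \<one>\<^bsub>L\<^esub> = f"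
  proof
    fix n
    have "(f \<otimes>\<^bsub>L\<^esub> \<one>\<^bsub>L\<^esub>) n = (\<Oplus>i\<in>{n}. f i \<otimes> \<one>\<^bsub>L\<^esub> (n - i))"
      using c by (intro mult_laurent) (auto simp: one_laurent)
    then show "(f \<otimes>\<^bsub>L\<^esub> \<one>\<^bsub>L\<^esub>) n = f n"
      using c by (simp add: one_laurent)
  qed
next
  fix f g h assume fgh: "f \<in> carrier L" "g \<in> carrier L" "h \<in> carrier L"
  then have c: "\<And>i. f i \<in> carrier S" "\<And>i. g i \<in> carrier S" "\<And>i. h i \<in> carrier S"
    by (simp_all add: carrier_laurent)
  obtain N where N: "\<forall>n<N. f n = \<zero>" "\<forall>n<N. g n = \<zero>"
    using laurent_lower_bound2[OF fgh(1,2)] by blast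
  obtain M where M: "\<forall>n<M. h n = \<zero>"
    using laurent_lower_bound[OF fgh(3)] by blast
  have fg: "f \<oplus>\<^bsub>L\<^esub> g \<in> carrier L" "\<forall>n<N. (f \<oplus>\<^bsub>L\<^esub> g) n = \<zero>"
    using fgh N c by (auto simp: carrier_laurent add_laurent intro: laurent_add_support)
  show "(f \<oplus>\<^bsub>L\<^esub> g) \<otimes>\<^bsub>L\<^esub> h = f \<otimes>\<^bsub>L\<^esub> h \<oplus>\<^bsub>L\<^esub> g \<otimes>\<^bsub>L\<^esub> h"
  proof
    fix n
    show "((f \<oplus>\<^bsub>L\<^esub> g) \<otimes>\<^bsub>L\<^esub> h) n = (f \<otimes>\<^bsub>L\<^esub> h \<oplus>\<^bsub>L\<^esub> g \<otimes>\<^bsub>L\<^esub> h) n"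
      using mult_laurent_bounds[OF fg(1) fgh(3) fg(2) M, of n]
        mult_laurent_bounds[OF fgh(1,3) N(1) M, of n] mult_laurent_bounds[OF fgh(2,3) N(2) M, of n] c
      by (simp add: add_laurent l_distr finsum_addf Pi_def)
  qed
  show "h \<otimes>\<^bsub>L\<^esub> (f \<oplus>\<^bsub>L\<^esub> g) = h \<otimes>\<^bsub>L\<^esub> f \<oplus>\<^bsub>L\<^esub> h \<otimes>\<^bsub>L\<^esub> g"
  proof
    fix n
    show "(h \<otimes>\<^bsub>L\<^esub> (f \<oplus>\<^bsub>L\<^esub> g)) n = (h \<otimes>\<^bsub>L\<^esub> f \<oplus>\<^bsub>L\<^esub> h \<otimes>\<^bsub>L\<^esub> g) n"
      using mult_laurent_bounds[OF fgh(3) fg(1) M fg(2), of n]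
        mult_laurent_bounds[OF fgh(3,1) M N(1), of n] mult_laurent_bounds[OF fgh(3,2) M N(2), of n] c
      by (simp add: add_laurent r_distr finsum_addf Pi_def)
  qed
  show "f \<oplus>\<^bsub>L\<^esub> g \<oplus>\<^bsub>L\<^esub> h = f \<oplus>\<^bsub>L\<^esub> (g \<oplus>\<^bsub>L\<^esub> h)"
    using c by (simp add: add_laurent a_assoc)
next
  fix f g assume fg: "f \<in> carrier L" "g \<in> carrier L"
  then show "f \<oplus>\<^bsub>L\<^esub> g \<in> carrier L"
    by (auto simp: carrier_laurent add_laurent intro: laurent_add_support)
  show "f \<oplus>\<^bsub>L\<^esub> g = g \<oplus>\<^bsub>L\<^esub> f"
    using fg by (simp add: carrier_laurent add_laurent a_comm)
qed (auto intro: mult_laurent_closed mult_laurent_assoc,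
    auto simp: carrier_laurent zero_laurent one_laurent add_laurent)

lemma laurent_minus:
  assumes "f \<in> carrier L"
  shows "\<ominus>\<^bsub>L\<^esub> f = (\<lambda>n. \<ominus> f n)"
proof -
  interpret L: ring L by (rule laurent_ring)
  show ?thesis
    using assms by (intro L.minus_equality)
      (auto simp: carrier_laurent add_laurent zero_laurent l_neg intro: laurent_minus_support)
qed

lemma laurent_superring: "superring L"
proof -
  interpret L: ring L by (rule laurent_ring)
  have mult: "(f \<otimes>\<^bsub>L\<^esub> g) n = (\<Oplus>i\<in>{i. f i \<noteq> \<zero> \<and> g (n - i) \<noteq> \<zero>}. f i \<otimes> g (n - i))" for f g n
    by (simp add: laurent_def)
  note sub = parity_laurent_carrier
  show ?thesis
  proof
    fix f assume f: "f \<in> carrier L"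
    \<comment> \<open>The splitting is chosen coefficient by coefficient; requiring zero parts where
      f vanishes keeps both supports bounded below.\<close>
    have "\<exists>a b. \<forall>n. a n \<in> even_part S \<and> b n \<in> odd_part S \<and> f n = a n \<oplus> b n \<and>
        (f n = \<zero> \<longrightarrow> a n = \<zero> \<and> b n = \<zero>)"
    proof -
      have "\<exists>p. fst p \<in> even_part S \<and> snd p \<in> odd_part S \<and> f n = fst p \<oplus> snd p \<and>
        (f n = \<zero> \<longrightarrow> fst p = \<zero> \<and> snd p = \<zero>)" for n
      proof (cases "f n = \<zero>")
        case True
        then show ?thesis by (intro exI[of _ "(\<zero>, \<zero>)"]) simp
      next
        case False
        then show ?thesis
          using decomp[of "f n"] f by (auto simp: carrier_laurent)
      qed
      then obtain p where "\<And>n. fst (p n) \<in> even_part S \<and> snd (p n) \<in> odd_part S \<and>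
          f n = fst (p n) \<oplus> snd (p n) \<and> (f n = \<zero> \<longrightarrow> fst (p n) = \<zero> \<and> snd (p n) = \<zero>)"
        by metis
      then show ?thesis
        by (intro exI[of _ "\<lambda>n. fst (p n)"] exI[of _ "\<lambda>n. snd (p n)"]) blast
    qed
    then obtain a b where ab: "\<And>n. a n \<in> even_part S" "\<And>n. b n \<in> odd_part S"
      "\<And>n. f n = a n \<oplus> b n" "\<And>n. f n = \<zero> \<Longrightarrow> a n = \<zero> \<and> b n = \<zero>"
      by blast
    have "a \<in> even_part L" "b \<in> odd_part L"
      using ab(1,2,4) f unfolding even_laurent odd_laurent carrier_laurent by metis+
    moreover have "f = a \<oplus>\<^bsub>L\<^esub> b"
      using ab(3) by (auto simp: add_laurent)
    ultimately show "\<exists>a\<in>even_part L. \<exists>b\<in>odd_part L. f = a \<oplus>\<^bsub>L\<^esub> b"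
      by (intro bexI[of _ a] bexI[of _ b])
  next
    fix f assume f: "f \<in> carrier L" "f \<oplus>\<^bsub>L\<^esub> f = \<zero>\<^bsub>L\<^esub>"
    have "f n = \<zero>" for n
      by (rule double_zeroD)
        (use f(1) fun_cong[OF f(2), of n] in \<open>simp_all add: carrier_laurent add_laurent zero_laurent\<close>)
    then show "f = \<zero>\<^bsub>L\<^esub>"
      by (auto simp: zero_laurent)
  next
    fix f assume "f \<in> even_part L" "f \<in> odd_part L"
    then show "f = \<zero>\<^bsub>L\<^esub>"
      by (auto simp: even_laurent odd_laurent zero_laurent intro: even_inter_odd)
  next
    fix f g assume fg: "f \<in> even_part L" "g \<in> even_part L"
    then show "f \<otimes>\<^bsub>L\<^esub> g \<in> even_part L"
      using mult_laurent_support[OF sub(1) sub(1), OF fg] unfolding even_laurent mult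
      by (auto intro!: finsum_even)
  next
    fix f g assume fg: "f \<in> odd_part L" "g \<in> odd_part L"
    then show "f \<otimes>\<^bsub>L\<^esub> g \<in> even_part L"
      using mult_laurent_support[OF sub(2) sub(2), OF fg] unfolding even_laurent odd_laurent mult
      by (auto intro!: finsum_even)
    show "f \<otimes>\<^bsub>L\<^esub> g = \<ominus>\<^bsub>L\<^esub> (g \<otimes>\<^bsub>L\<^esub> f)"
    proof
      fix n
      have c: "f i \<in> odd_part S" "g i \<in> odd_part S" for i
        using fg by (simp_all add: odd_laurent)
      have "(f \<otimes>\<^bsub>L\<^esub> g) n = (\<Oplus>i\<in>{i. g i \<noteq> \<zero> \<and> f (n - i) \<noteq> \<zero>}. \<ominus> (g i \<otimes> f (n - i)))"
        unfolding mult_laurent_flip[OF sub(2) sub(2), OF fg]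
        using c by (intro finsum_cong') (auto intro: odd_anticommute)
      also have "\<dots> = \<ominus> ((g \<otimes>\<^bsub>L\<^esub> f) n)"
        unfolding mult using c by (intro finsum_minus) auto
      finally show "(f \<otimes>\<^bsub>L\<^esub> g) n = (\<ominus>\<^bsub>L\<^esub> (g \<otimes>\<^bsub>L\<^esub> f)) n"
        using fg sub by (simp add: laurent_minus)
    qed
  next
    fix f g assume fg: "f \<in> even_part L" "g \<in> odd_part L"
    then show "f \<otimes>\<^bsub>L\<^esub> g \<in> odd_part L"
      using mult_laurent_support[OF sub(1) sub(2), OF fg] unfolding even_laurent odd_laurent mult
      by (auto intro!: finsum_odd)
  next
    fix f g assume fg: "f \<in> odd_part L" "g \<in> even_part L"
    then show "f \<otimes>\<^bsub>L\<^esub> g \<in> odd_part L"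
      using mult_laurent_support[OF sub(2) sub(1), OF fg] unfolding even_laurent odd_laurent mult
      by (auto intro!: finsum_odd)
  next
    fix f g assume fg: "f \<in> even_part L" "g \<in> carrier L"
    show "f \<otimes>\<^bsub>L\<^esub> g = g \<otimes>\<^bsub>L\<^esub> f"
    proof
      fix n
      have c: "f i \<in> even_part S" "g i \<in> carrier S" for i
        using fg by (simp_all add: even_laurent carrier_laurent)
      show "(f \<otimes>\<^bsub>L\<^esub> g) n = (g \<otimes>\<^bsub>L\<^esub> f) n"
        unfolding mult_laurent_flip[OF sub(1) fg(2), OF fg(1)] unfolding mult
        using c by (intro finsum_cong') (auto intro: even_commute)
    qed
  next
    fix f g assume "f \<in> even_part L" "g \<in> even_part L"
    then show "f \<oplus>\<^bsub>L\<^esub> g \<in> even_part L"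
      by (auto simp: even_laurent add_laurent intro: laurent_add_support)
  next
    fix f g assume "f \<in> odd_part L" "g \<in> odd_part L"
    then show "f \<oplus>\<^bsub>L\<^esub> g \<in> odd_part L"
      by (auto simp: odd_laurent add_laurent intro: laurent_add_support)
  next
    fix f assume f: "f \<in> even_part L"
    then show "\<ominus>\<^bsub>L\<^esub> f \<in> even_part L"
      using laurent_minus[OF sub(1)[OF f]] by (auto simp: even_laurent intro: laurent_minus_support)
  next
    fix f assume f: "f \<in> odd_part L"
    then show "\<ominus>\<^bsub>L\<^esub> f \<in> odd_part L"
      using laurent_minus[OF sub(2)[OF f]] by (auto simp: odd_laurent intro: laurent_minus_support)
  qed (use sub in \<open>auto simp: even_laurent odd_laurent zero_laurent one_laurent\<close>)
qed

end

text \<open>The last hypothesis says that P is a graded subset: it contains the homogeneous parts of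
  its elements. The second conclusion is needed because negatives depend on the carrier. The
  intended case is the passage from Laurent series to power series.\<close>

lemma (in superring) restrict_superring:
  assumes "\<zero> \<in> P" "\<one> \<in> P"
    and "\<And>x y. \<lbrakk>x \<in> carrier S \<inter> P; y \<in> carrier S \<inter> P\<rbrakk> \<Longrightarrow> x \<oplus> y \<in> P"
    and "\<And>x. x \<in> carrier S \<inter> P \<Longrightarrow> \<ominus> x \<in> P"
    and "\<And>x y. \<lbrakk>x \<in> carrier S \<inter> P; y \<in> carrier S \<inter> P\<rbrakk> \<Longrightarrow> x \<otimes> y \<in> P"
    and "\<And>a b. \<lbrakk>a \<in> even_part S; b \<in> odd_part S; a \<oplus> b \<in> P\<rbrakk> \<Longrightarrow> a \<in> P \<and> b \<in> P"
  shows "superring (S\<lparr>carrier := carrier S \<inter> P, even_part := even_part S \<inter> P,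
    odd_part := odd_part S \<inter> P\<rparr>)" (is "superring ?P")
    and "x \<in> carrier S \<inter> P \<Longrightarrow> a_inv (S\<lparr>carrier := carrier S \<inter> P, even_part := even_part S \<inter> P,
    odd_part := odd_part S \<inter> P\<rparr>) x = \<ominus> x"
proof -
  have P: "ring ?P"
  proof (intro ringI abelian_groupI Group.monoidI)
    fix x assume "x \<in> carrier ?P"
    then show "\<exists>y\<in>carrier ?P. y \<oplus>\<^bsub>?P\<^esub> x = \<zero>\<^bsub>?P\<^esub>"
      using assms(4) by (intro bexI[of _ "\<ominus> x"]) (simp_all add: l_neg)
  next
    fix x y assume "x \<in> carrier ?P" "y \<in> carrier ?P"
    then show "x \<oplus>\<^bsub>?P\<^esub> y = y \<oplus>\<^bsub>?P\<^esub> x"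
      by (simp add: a_comm)
  qed (use assms(1-3,5) in \<open>auto simp: a_assoc m_assoc l_distr r_distr\<close>)
  interpret P: ring ?P by (rule P)
  show inv: "\<ominus>\<^bsub>?P\<^esub> x = \<ominus> x" if "x \<in> carrier S \<inter> P" for x
    using that assms(4) by (intro P.minus_equality) (simp_all add: l_neg)
  show "superring ?P"
  proof
    fix x assume x: "x \<in> carrier ?P"
    then obtain a b where ab: "a \<in> even_part S" "b \<in> odd_part S" "x = a \<oplus> b"
      using decomp[of x] by auto
    then have "a \<in> P \<and> b \<in> P"
      using assms(6) x by auto
    then show "\<exists>a\<in>even_part ?P. \<exists>b\<in>odd_part ?P. x = a \<oplus>\<^bsub>?P\<^esub> b"
      using ab by (intro bexI[of _ a] bexI[of _ b]) auto
  next
    fix a x assume "a \<in> even_part ?P" "x \<in> carrier ?P"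
    then show "a \<otimes>\<^bsub>?P\<^esub> x = x \<otimes>\<^bsub>?P\<^esub> a"
      using even_commute[of a x] by simp
  next
    fix a b assume "a \<in> odd_part ?P" "b \<in> odd_part ?P"
    then show "a \<otimes>\<^bsub>?P\<^esub> b = \<ominus>\<^bsub>?P\<^esub> (b \<otimes>\<^bsub>?P\<^esub> a)"
      using inv[of "b \<otimes> a"] assms(5)[of b a] odd_anticommute[of a b] by simp
  next
    fix a assume "a \<in> even_part ?P" "a \<in> odd_part ?P"
    then show "a = \<zero>\<^bsub>?P\<^esub>"
      using even_inter_odd[of a] by simp
  next
    fix x assume "x \<in> carrier ?P" "x \<oplus>\<^bsub>?P\<^esub> x = \<zero>\<^bsub>?P\<^esub>"
    then show "x = \<zero>\<^bsub>?P\<^esub>"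
      using double_zeroD[of x] by simp
  qed (use assms(1-5) inv in auto)
qed

section \<open>Power series\<close>

context superring
begin

abbreviation (input) P where "P \<equiv> power_series S"

lemma power_series_simps [simp]:
  "mult P = mult L" "add P = add L" "one P = one L" "zero P = zero L"
  by (simp_all add: power_series_def Let_def)

lemma carrier_power_series: "f \<in> carrier P \<longleftrightarrow> (\<forall>n. f n \<in> carrier S) \<and> (\<forall>n<0. f n = \<zero>)"
  and even_power_series: "f \<in> even_part P \<longleftrightarrow> (\<forall>n. f n \<in> even_part S) \<and> (\<forall>n<0. f n = \<zero>)"
  and odd_power_series: "f \<in> odd_part P \<longleftrightarrow> (\<forall>n. f n \<in> odd_part S) \<and> (\<forall>n<0. f n = \<zero>)"
  by (auto simp: power_series_def Let_def carrier_laurent even_laurent odd_laurent)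

lemma power_series_laurent:
  "f \<in> carrier P \<Longrightarrow> f \<in> carrier L" "f \<in> even_part P \<Longrightarrow> f \<in> even_part L"
  "f \<in> odd_part P \<Longrightarrow> f \<in> odd_part L"
  by (simp_all add: power_series_def Let_def)

lemma power_series_superring: "superring P"
  and power_series_minus: "f \<in> carrier P \<Longrightarrow> \<ominus>\<^bsub>P\<^esub> f = (\<lambda>n. \<ominus> f n)"
proof -
  interpret L: superring L by (rule laurent_superring)
  let ?P = "{f :: int \<Rightarrow> 'a. \<forall>n<0. f n = \<zero>}"
  have eq: "P = L\<lparr>carrier := carrier L \<inter> ?P, even_part := even_part L \<inter> ?P,
    odd_part := odd_part L \<inter> ?P\<rparr>"
    by (simp add: power_series_def Let_def)
  \<comment> \<open>A negative coefficient of the sum vanishes, so there b n is minus a n, which is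
    both odd and even.\<close>
  have parts: "a \<in> ?P \<and> b \<in> ?P" if "a \<in> even_part L" "b \<in> odd_part L" "a \<oplus>\<^bsub>L\<^esub> b \<in> ?P" for a b
  proof -
    have c: "\<And>n. a n \<in> even_part S" "\<And>n. b n \<in> odd_part S"
      using that by (simp_all add: even_laurent odd_laurent)
    have "a n = \<zero> \<and> b n = \<zero>" if "n < 0" for n
    proof -
      have "a n \<oplus> b n = \<zero>"
        using \<open>a \<oplus>\<^bsub>L\<^esub> b \<in> ?P\<close> that by (simp add: add_laurent)
      then have "b n = \<zero>"
        using even_part_unique[OF c(1) c(2)] by (metis even_zero)
      then show ?thesis
        using \<open>a n \<oplus> b n = \<zero>\<close> c(1)[of n] by simp
    qed
    then show ?thesis by simp
  qed
  have mult: "f \<otimes>\<^bsub>L\<^esub> g \<in> ?P" if "f \<in> carrier L \<inter> ?P" "g \<in> carrier L \<inter> ?P" for f g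
    using mult_laurent_zero[of f g 0 0] that by simp
  have zero: "\<zero>\<^bsub>L\<^esub> \<in> ?P" and one: "\<one>\<^bsub>L\<^esub> \<in> ?P"
    by (simp_all add: zero_laurent one_laurent)
  have add: "f \<oplus>\<^bsub>L\<^esub> g \<in> ?P" if "f \<in> carrier L \<inter> ?P" "g \<in> carrier L \<inter> ?P" for f g
    using that by (simp add: add_laurent)
  have minus: "\<ominus>\<^bsub>L\<^esub> f \<in> ?P" if "f \<in> carrier L \<inter> ?P" for f
    using that by (simp add: laurent_minus)
  show "superring P"
    unfolding eq by (rule L.restrict_superring(1)[OF zero one add minus mult parts])
  assume f: "f \<in> carrier P"
  then have f': "f \<in> carrier L \<inter> ?P"
    by (simp add: power_series_def Let_def)
  have "\<ominus>\<^bsub>P\<^esub> f = \<ominus>\<^bsub>L\<^esub> f"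
    unfolding eq by (rule L.restrict_superring(2)[OF zero one add minus mult parts f'])
  then show "\<ominus>\<^bsub>P\<^esub> f = (\<lambda>n. \<ominus> f n)"
    using laurent_minus f' by simp
qed

lemma power_series_mult:
  assumes "f \<in> carrier P" "g \<in> carrier P"
  shows "(f \<otimes>\<^bsub>L\<^esub> g) n = (\<Oplus>i\<in>{0..n}. f i \<otimes> g (n - i))"
  using mult_laurent_bounds[of f g 0 0 n] assms
  by (simp add: carrier_power_series power_series_laurent)

lemma power_series_mult_const:
  assumes "f \<in> carrier P" "g \<in> carrier P"
  shows "(f \<otimes>\<^bsub>L\<^esub> g) 0 = f 0 \<otimes> g 0"
  using power_series_mult[OF assms, of 0] assms by (simp add: carrier_power_series)

text \<open>The guard \<open>i < n\<close> only serves the termination proof.\<close>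

fun inverse_coeff :: "'a \<Rightarrow> (nat \<Rightarrow> 'a) \<Rightarrow> nat \<Rightarrow> 'a" where
  "inverse_coeff u f n = u \<otimes>
     (if n = 0 then \<one> else \<ominus> (\<Oplus>i\<in>{..<n}. if i < n then f (n - i) \<otimes> inverse_coeff u f i else \<zero>))"

declare inverse_coeff.simps [simp del]

text \<open>The equation for the m-th coefficient of f g is solved recursively for the m-th
  coefficient of g; only the constant term of f has to be inverted. This is why the domain of a
  chart is an open condition on constant terms.\<close>

lemma power_series_even_unit:
  assumes "f \<in> even_part P" "even_unit (f 0)"
  shows "superring.even_unit P f"
proof -
  interpret P: superring P by (rule power_series_superring)
  obtain u where u: "u \<in> even_part S" "f 0 \<otimes> u = \<one>"
    using assms(2) unfolding even_unit_def by blast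
  have fe: "f i \<in> even_part S" for i
    using assms(1) by (simp add: even_power_series)
  define F where "F = (\<lambda>n::nat. f (int n))"
  define w where "w = inverse_coeff u F"
  have w: "w n = u \<otimes> (if n = 0 then \<one> else \<ominus> (\<Oplus>i\<in>{..<n}. if i < n then F (n - i) \<otimes> w i else \<zero>))" for n
    unfolding w_def by (rule inverse_coeff.simps)
  have we: "w n \<in> even_part S" for n
  proof (induction n rule: less_induct)
    case (less n)
    then show ?case
      using u(1) fe by (subst w) (auto simp: F_def intro!: even_even even_minus finsum_even)
  qed
  define g where "g = (\<lambda>n::int. if n < 0 then \<zero> else w (nat n))"
  have g: "g \<in> even_part P"
    using we by (simp add: g_def even_power_series)
  have "(f \<otimes>\<^bsub>L\<^esub> g) n = \<one>\<^bsub>L\<^esub> n" for n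
  proof -
    consider "n < 0" | "n = 0" | m where "n = int m" "m > 0"
      by (metis linorder_neqE_linordered_idom pos_int_cases)
    then show ?thesis
    proof cases
      case 1
      then show ?thesis
        using power_series_mult[OF P.even_carrier P.even_carrier, OF assms(1) g] by (simp add: one_laurent)
    next
      case 2
      then show ?thesis
        using power_series_mult_const[OF P.even_carrier P.even_carrier, OF assms(1) g] u fe
          w[of 0] by (simp add: one_laurent g_def)
    next
      case (3 m)
      \<comment> \<open>In the order g f the summation index runs over the coefficients of g, as in
        the recursion, where the top coefficient w m can be split off.\<close>
      have "(f \<otimes>\<^bsub>L\<^esub> g) n = (g \<otimes>\<^bsub>L\<^esub> f) n"
        using P.even_comm[OF assms(1) g] by simp
      also have "\<dots> = (\<Oplus>i\<in>int ` {..m}. g i \<otimes> f (n - i))"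
        using power_series_mult[OF P.even_carrier P.even_carrier, OF g assms(1), of n] 3
        by (simp add: image_int_atLeastAtMost atMost_atLeast0)
      also have "\<dots> = (\<Oplus>i\<in>{..m}. w i \<otimes> f (int m - int i))"
        using 3 we fe by (subst finsum_reindex) (auto simp: g_def)
      also have "\<dots> = w m \<otimes> f 0 \<oplus> (\<Oplus>i\<in>{..<m}. w i \<otimes> f (int m - int i))"
        using we fe by (simp add: ivl_disj_un(2)[of m, symmetric] lessThan_Suc_atMost[symmetric] lessThan_Suc Pi_def)
      also have "(\<Oplus>i\<in>{..<m}. w i \<otimes> f (int m - int i)) =
          (\<Oplus>i\<in>{..<m}. if i < m then F (m - i) \<otimes> w i else \<zero>)" (is "_ = ?s")
        using we fe by (intro finsum_cong') (auto simp: F_def of_nat_diff intro: even_comm)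
      also have "w m \<otimes> f 0 = \<ominus> ?s"
      proof -
        have s: "?s \<in> even_part S"
          using we fe by (intro finsum_even) (auto simp: F_def)
        have "w m \<otimes> f 0 = f 0 \<otimes> w m"
          using fe we by (intro even_comm)
        also have "\<dots> = f 0 \<otimes> (u \<otimes> \<ominus> ?s)"
          using 3 w[of m] by simp
        also have "f 0 \<otimes> (u \<otimes> \<ominus> ?s) = f 0 \<otimes> u \<otimes> \<ominus> ?s"
          using fe u(1) s by (intro m_assoc[symmetric]) simp_all
        also have "\<dots> = \<ominus> ?s"
          using u(2) s by simp
        finally show ?thesis .
      qed
      also have "\<ominus> ?s \<oplus> ?s = \<zero>"
        using we fe by (intro l_neg finsum_closed) (auto simp: F_def)
      finally show ?thesis
        using 3 by (simp add: one_laurent)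
    qed
  qed
  then show ?thesis
    unfolding P.even_unit_def using assms(1) g by (intro conjI bexI[of _ g]) auto
qed

lemma power_series_even_unit_const:
  assumes "superring.even_unit P f"
  shows "even_unit (f 0)"
proof -
  interpret P: superring P by (rule power_series_superring)
  obtain g where "f \<in> even_part P" "g \<in> even_part P" "f \<otimes>\<^bsub>L\<^esub> g = \<one>\<^bsub>L\<^esub>"
    using assms unfolding P.even_unit_def by auto
  then show ?thesis
    using power_series_mult_const[of f g] unfolding even_unit_def
    by (intro conjI bexI[of _ "g 0"]) (auto simp: even_power_series one_laurent carrier_power_series)
qed

end

section \<open>Cosets of diagonal loops\<close>

lemma (in group) lcoset_mult_eq_iff:
  assumes "subgroup H G" "x \<in> carrier G" "y \<in> carrier G"
  shows "x <# H = (x \<otimes> y) <# H \<longleftrightarrow> y \<in> H"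
proof
  assume "x <# H = (x \<otimes> y) <# H"
  then have "x \<otimes> y \<in> x <# H"
    using assms lcos_self[of "x \<otimes> y" H] by simp
  then obtain h where "h \<in> H" "x \<otimes> y = x \<otimes> h"
    by (auto simp: l_coset_def)
  then show "y \<in> H"
    using assms subgroup.mem_carrier[OF assms(1)] by simp
next
  assume "y \<in> H"
  then have "x \<otimes> y \<in> x <# H"
    by (auto simp: l_coset_def)
  then show "x <# H = (x \<otimes> y) <# H"
    using assms by (intro l_repr_independence)
qed

context superring
begin

text \<open>The Laurent monomial \<open>t^m\<close>.\<close>

definition monomial :: "int \<Rightarrow> int \<Rightarrow> 'a" where
  "monomial m = (\<lambda>n. if n = m then \<one> else \<zero>)"

lemma monomial_even: "monomial m \<in> even_part L"
  by (auto simp: monomial_def even_laurent intro: exI[of _ m])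

lemma monomial_mult:
  assumes "f \<in> carrier L"
  shows "monomial m \<otimes>\<^bsub>L\<^esub> f = (\<lambda>n. f (n - m))"
proof
  fix n
  have c: "\<And>i. f i \<in> carrier S"
    using assms by (simp add: carrier_laurent)
  then have "(monomial m \<otimes>\<^bsub>L\<^esub> f) n = (\<Oplus>i\<in>{m}. monomial m i \<otimes> f (n - i))"
    by (intro mult_laurent) (auto simp: monomial_def)
  then show "(monomial m \<otimes>\<^bsub>L\<^esub> f) n = f (n - m)"
    using c by (simp add: monomial_def)
qed

lemma monomial_mult_right: "f \<in> carrier L \<Longrightarrow> f \<otimes>\<^bsub>L\<^esub> monomial m = monomial m \<otimes>\<^bsub>L\<^esub> f"
  using superring.even_commute[OF laurent_superring monomial_even] by metis

lemma monomial_monomial: "monomial m \<otimes>\<^bsub>L\<^esub> monomial n = monomial (m + n)"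
  by (subst monomial_mult) (auto simp: monomial_def superring.even_carrier[OF laurent_superring monomial_even, unfolded monomial_def])

lemma monomial_0: "monomial 0 = \<one>\<^bsub>L\<^esub>"
  by (simp add: monomial_def one_laurent)

lemma power_series_mat_mult:
  fixes A B :: "2 + 1 \<Rightarrow> 2 + 1 \<Rightarrow> int \<Rightarrow> 'a"
  assumes "\<And>i j. A i j \<in> carrier P" "\<And>i j. B i j \<in> carrier P"
  shows "mat_mult P A B = mat_mult L A B"
  unfolding mat_eq_iff
  using superring.mat_mult_entry[OF power_series_superring assms]
    superring.mat_mult_entry[OF laurent_superring power_series_laurent(1) power_series_laurent(1), OF assms]
  by simp

lemma power_series_a_minus:
  assumes "f \<in> carrier P" "g \<in> carrier P"
  shows "f \<ominus>\<^bsub>P\<^esub> g = f \<ominus>\<^bsub>L\<^esub> g"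
  using assms by (simp add: a_minus_def power_series_minus laurent_minus power_series_laurent)

lemma power_series_even_unit_laurent:
  assumes "superring.even_unit P f"
  shows "superring.even_unit L f"
  using assms unfolding superring.even_unit_def[OF power_series_superring]
    superring.even_unit_def[OF laurent_superring] by (auto intro: power_series_laurent)

text \<open>Both sides are groups already, with the same product. What remains is that differences,
  units and inverses, which refer to the carrier, agree with those of Laurent series; an inverse
  found over power series is an inverse over Laurent series.\<close>

lemma GL_power_series_subgroup:
  "subgroup (carrier (GL_super P)) (GL_super L :: (2 + 1 \<Rightarrow> 2 + 1 \<Rightarrow> int \<Rightarrow> 'a) monoid)"
    (is "subgroup ?H ?K")
proof -
  interpret K: group ?K by (rule superring.GL_super_group[OF laurent_superring])
  interpret H: group "GL_super P :: (2 + 1 \<Rightarrow> 2 + 1 \<Rightarrow> int \<Rightarrow> 'a) monoid"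
    by (rule superring.GL_super_group[OF power_series_superring])
  interpret L: superring L by (rule laurent_superring)
  interpret P: superring P by (rule power_series_superring)
  have sub: "A \<in> carrier ?K" if A: "A \<in> ?H" for A
  proof -
    obtain a b c d e f g h i where eq: "A = mat3 a b c d e f g h i"
      by (rule mat3_cases)
    note mem = A[unfolded eq P.GL_super_mat3]
    have "a \<otimes>\<^bsub>P\<^esub> e \<ominus>\<^bsub>P\<^esub> b \<otimes>\<^bsub>P\<^esub> d = a \<otimes>\<^bsub>P\<^esub> e \<ominus>\<^bsub>L\<^esub> b \<otimes>\<^bsub>P\<^esub> d"
      by (intro power_series_a_minus P.m_closed P.even_carrier) (use mem in simp_all)
    then show ?thesis
      using mem power_series_even_unit_laurent unfolding eq L.GL_super_mat3
      by (simp add: power_series_laurent)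
  qed
  have mult: "mat_mult L A B = mat_mult P A B" if "A \<in> ?H" "B \<in> ?H" for A B
    using that P.GL_super_carrier by (intro power_series_mat_mult[symmetric]) auto
  have inv: "inv\<^bsub>?K\<^esub> A = inv\<^bsub>GL_super P\<^esub> A" if A: "A \<in> ?H" for A
    using H.l_inv[OF A] H.inv_closed[OF A] A mult[OF H.inv_closed[OF A] A] sub
    by (intro K.inv_equality) (auto simp: mat_diag_mat3)
  show ?thesis
  proof (rule K.subgroupI)
    show "?H \<noteq> {}"
      using H.one_closed by blast
    fix A assume A: "A \<in> ?H"
    then show "inv\<^bsub>?K\<^esub> A \<in> ?H"
      using inv by simp
    fix B assume "B \<in> ?H"
    then show "A \<otimes>\<^bsub>?K\<^esub> B \<in> ?H"
      using A H.m_closed[of A B] mult by simp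
  qed (use sub in blast)
qed

lemma t_power_mat3:
  "t_power S (weight k l) =
    mat3 (monomial k) \<zero>\<^bsub>L\<^esub> \<zero>\<^bsub>L\<^esub> \<zero>\<^bsub>L\<^esub> (monomial l) \<zero>\<^bsub>L\<^esub> \<zero>\<^bsub>L\<^esub> \<zero>\<^bsub>L\<^esub> (monomial 0)"
  by (simp add: t_power_def mat_diag_mat3 weight_def monomial_def[abs_def])

lemma t_power_GL: "t_power S (weight k l) \<in> carrier (GL_super L)"
proof -
  interpret L: superring L by (rule laurent_superring)
  have "L.even_unit (monomial m)" for m
    unfolding L.even_unit_def
    by (intro conjI bexI[of _ "monomial (- m)"]) (simp_all add: monomial_monomial monomial_0 monomial_even)
  then show ?thesis
    unfolding t_power_mat3 L.GL_super_mat3 by (simp add: monomial_even L.minus_eq L.even_unit_mult)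
qed

text \<open>Writing T for the power of t, A w T = (A T)(T^(-1) w T), so the cosets agree iff T^(-1)
  w T has power series entries. Conjugation shifts the entries b, c, f down by k - l, k and l, and
  the entries d, g, h below the diagonal up; only the former impose a condition.\<close>

lemma lcoset_stabilizer:
  fixes A :: "2 + 1 \<Rightarrow> 2 + 1 \<Rightarrow> int \<Rightarrow> 'a"
  assumes "0 \<le> l" "l \<le> k"
    and A: "A \<in> carrier (GL_super P)" and w: "mat3 a b c d e f g h i \<in> carrier (GL_super P)"
  shows "mat_mult L A (t_power S (weight k l)) <#\<^bsub>GL_super L\<^esub> carrier (GL_super P) =
      mat_mult L (mat_mult L A (mat3 a b c d e f g h i)) (t_power S (weight k l))
        <#\<^bsub>GL_super L\<^esub> carrier (GL_super P) \<longleftrightarrow>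
    (\<forall>n<k - l. b n = \<zero>) \<and> (\<forall>n<k. c n = \<zero>) \<and> (\<forall>n<l. f n = \<zero>)"
proof -
  let ?K = "GL_super L :: (2 + 1 \<Rightarrow> 2 + 1 \<Rightarrow> int \<Rightarrow> 'a) monoid"
  let ?T = "t_power S (weight k l)" and ?w = "mat3 a b c d e f g h i"
  interpret L: superring L by (rule laurent_superring)
  interpret P: superring P by (rule power_series_superring)
  interpret K: group ?K by (rule L.GL_super_group)
  note H = GL_power_series_subgroup
  have HK: "x \<in> carrier ?K" if "x \<in> carrier (GL_super P)" for x
    using subgroup.mem_carrier[OF H that] .
  \<comment> \<open>This is \<open>t^(-\<lambda>) w t^\<lambda>\<close>, written out entry by
    entry.\<close>
  define w' where "w' = mat3 a (monomial (l - k) \<otimes>\<^bsub>L\<^esub> b) (monomial (- k) \<otimes>\<^bsub>L\<^esub> c)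
    (monomial (k - l) \<otimes>\<^bsub>L\<^esub> d) e (monomial (- l) \<otimes>\<^bsub>L\<^esub> f) (monomial k \<otimes>\<^bsub>L\<^esub> g) (monomial l \<otimes>\<^bsub>L\<^esub> h) i"
  note wP = w[unfolded P.GL_super_mat3]
  note wL = HK[OF w, unfolded L.GL_super_mat3]
  have wc: "a \<in> carrier L" "b \<in> carrier L" "c \<in> carrier L" "d \<in> carrier L" "e \<in> carrier L"
    "f \<in> carrier L" "g \<in> carrier L" "h \<in> carrier L" "i \<in> carrier L" "\<And>m. monomial m \<in> carrier L"
    using wL monomial_even by auto
  have mm: "monomial m \<otimes>\<^bsub>L\<^esub> (monomial n \<otimes>\<^bsub>L\<^esub> x) = monomial (m + n) \<otimes>\<^bsub>L\<^esub> x" if "x \<in> carrier L" for m n x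
    using wc that by (simp add: L.m_assoc[symmetric] monomial_monomial)
  have w'_eq: "mat_mult L ?T w' = mat_mult L ?w ?T"
    unfolding w'_def t_power_mat3 using wc
    by (simp add: L.mat_mult_mat3 mm monomial_mult_right)
  \<comment> \<open>The shifts of the two off-diagonal even entries cancel, so conjugation does not
    change the even determinant.\<close>
  have det: "monomial (l - k) \<otimes>\<^bsub>L\<^esub> b \<otimes>\<^bsub>L\<^esub> (monomial (k - l) \<otimes>\<^bsub>L\<^esub> d) = b \<otimes>\<^bsub>L\<^esub> d"
  proof -
    have "b \<otimes>\<^bsub>L\<^esub> (monomial (k - l) \<otimes>\<^bsub>L\<^esub> d) = monomial (k - l) \<otimes>\<^bsub>L\<^esub> (b \<otimes>\<^bsub>L\<^esub> d)"
      using wc monomial_even by (intro L.even_lcomm)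
    then show ?thesis
      using wc by (simp add: L.m_assoc mm) (simp add: monomial_0)
  qed
  have w'K: "w' \<in> carrier ?K"
    unfolding w'_def L.GL_super_mat3 det using wL by (simp add: monomial_even)
  have "mat_mult L (mat_mult L A ?w) ?T = mat_mult L (mat_mult L A ?T) w'"
    using K.m_assoc[OF HK[OF A] HK[OF w] t_power_GL[of k l]]
      K.m_assoc[OF HK[OF A] t_power_GL[of k l] w'K] w'_eq by simp
  then have "?thesis \<longleftrightarrow> (w' \<in> carrier (GL_super P) \<longleftrightarrow>
      (\<forall>n<k - l. b n = \<zero>) \<and> (\<forall>n<k. c n = \<zero>) \<and> (\<forall>n<l. f n = \<zero>))"
    using K.lcoset_mult_eq_iff[OF H K.m_closed[OF HK[OF A] t_power_GL[of k l]] w'K] by simp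
  moreover have "w' \<in> carrier (GL_super P) \<longleftrightarrow>
      (\<forall>n<k - l. b n = \<zero>) \<and> (\<forall>n<k. c n = \<zero>) \<and> (\<forall>n<l. f n = \<zero>)"
  proof -
    have shift: "(\<forall>n<0. x (n + m) = \<zero>) \<longleftrightarrow> (\<forall>n<m. x n = \<zero>)" for x and m :: int
      by (metis add_less_cancel_right add_0 diff_add_cancel)
    have "(\<forall>n<0. d (n - (k - l)) = \<zero>)" "(\<forall>n<0. g (n - k) = \<zero>)" "(\<forall>n<0. h (n - l) = \<zero>)"
      using wP assms(1,2) by (simp_all add: even_power_series odd_power_series)
    then show ?thesis
      unfolding w'_def P.GL_super_mat3 power_series_simps det
      using wP wc shift[of b "k - l"] shift[of c k] shift[of f l]
      by (simp add: monomial_mult even_power_series odd_power_series algebra_simps)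
  qed
  ultimately show ?thesis by blast
qed

end

section \<open>Functoriality\<close>

lemma ring_hom_finsum:
  assumes "ring R" "ring S" "h \<in> ring_hom R S" "\<And>i. i \<in> A \<Longrightarrow> f i \<in> carrier R"
  shows "h (finsum R f A) = finsum S (\<lambda>i. h (f i)) A"
proof -
  interpret R: ring R by fact
  interpret S: ring S by fact
  show ?thesis
    using assms(4)
  proof (induction A rule: infinite_finite_induct)
    case (insert x A)
    then show ?case
      using ring_hom_add[OF assms(3)] ring_hom_closed[OF assms(3)] by (simp add: Pi_def)
  qed (simp_all add: ring_hom_zero[OF assms(3,1,2)])
qed

text \<open>Unlike \<open>superhom\<close> this asks neither for extensionality nor for linearity
  over the scalars, so that it also covers the coefficientwise action \<open>(o) \<phi>\<close> on
  series.\<close>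

definition super_hom :: "'a superalg \<Rightarrow> 'b superalg \<Rightarrow> ('a \<Rightarrow> 'b) set" where
  "super_hom R S = {\<phi> \<in> ring_hom R S. \<phi> ` even_part R \<subseteq> even_part S \<and> \<phi> ` odd_part R \<subseteq> odd_part S}"

lemma superhom_super_hom: "\<phi> \<in> superhom R S \<Longrightarrow> \<phi> \<in> super_hom R S"
  by (simp add: superhom_def super_hom_def)

locale superring_hom = R: superring R + S: superring S
  for R :: "'a superalg" and S :: "'b superalg" +
  fixes \<phi> assumes hom: "\<phi> \<in> super_hom R S"
begin

lemma hom_simps [simp]:
  "\<lbrakk>x \<in> carrier R; y \<in> carrier R\<rbrakk> \<Longrightarrow> \<phi> (x \<otimes>\<^bsub>R\<^esub> y) = \<phi> x \<otimes>\<^bsub>S\<^esub> \<phi> y"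
  "\<lbrakk>x \<in> carrier R; y \<in> carrier R\<rbrakk> \<Longrightarrow> \<phi> (x \<oplus>\<^bsub>R\<^esub> y) = \<phi> x \<oplus>\<^bsub>S\<^esub> \<phi> y"
  "x \<in> carrier R \<Longrightarrow> \<phi> x \<in> carrier S"
  "x \<in> even_part R \<Longrightarrow> \<phi> x \<in> even_part S"
  "x \<in> odd_part R \<Longrightarrow> \<phi> x \<in> odd_part S"
  "\<phi> \<one>\<^bsub>R\<^esub> = \<one>\<^bsub>S\<^esub>" "\<phi> \<zero>\<^bsub>R\<^esub> = \<zero>\<^bsub>S\<^esub>"
  using hom ring_hom_zero[of \<phi> R S, OF _ R.ring_axioms S.ring_axioms]
  by (auto simp: super_hom_def ring_hom_mult ring_hom_add ring_hom_closed ring_hom_one)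

lemma hom_minus [simp]: "x \<in> carrier R \<Longrightarrow> \<phi> (\<ominus>\<^bsub>R\<^esub> x) = \<ominus>\<^bsub>S\<^esub> \<phi> x"
  by (rule S.minus_equality[symmetric]) (simp_all flip: hom_simps(2) add: R.l_neg)

lemma hom_diff [simp]:
  "\<lbrakk>x \<in> carrier R; y \<in> carrier R\<rbrakk> \<Longrightarrow> \<phi> (x \<ominus>\<^bsub>R\<^esub> y) = \<phi> x \<ominus>\<^bsub>S\<^esub> \<phi> y"
  by (simp add: a_minus_def)

lemma hom_pow [simp]: "x \<in> carrier R \<Longrightarrow> \<phi> (x [^]\<^bsub>R\<^esub> (n::nat)) = \<phi> x [^]\<^bsub>S\<^esub> n"
  by (induction n) simp_all

lemma hom_finsum: "(\<And>i. i \<in> A \<Longrightarrow> f i \<in> carrier R) \<Longrightarrow> \<phi> (finsum R f A) = finsum S (\<lambda>i. \<phi> (f i)) A"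
  using hom by (intro ring_hom_finsum) (auto simp: super_hom_def intro: R.ring_axioms S.ring_axioms)

lemma hom_even_unit: "R.even_unit u \<Longrightarrow> S.even_unit (\<phi> u)"
  unfolding R.even_unit_def S.even_unit_def
  by (metis R.even_carrier hom_simps(1,4,6))

lemma hom_GL_super:
  fixes A :: "2 + 1 \<Rightarrow> 2 + 1 \<Rightarrow> 'a"
  assumes "A \<in> carrier (GL_super R)"
  shows "(\<lambda>i j. \<phi> (A i j)) \<in> carrier (GL_super S)"
proof -
  obtain a b c d e f g h i where eq: "A = mat3 a b c d e f g h i"
    by (rule mat3_cases)
  have map: "(\<lambda>x y. \<phi> (A x y)) = mat3 (\<phi> a) (\<phi> b) (\<phi> c) (\<phi> d) (\<phi> e) (\<phi> f) (\<phi> g) (\<phi> h) (\<phi> i)"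
    by (simp add: eq mat_eq_iff all_type_21)
  show ?thesis
    using assms hom_even_unit[of "a \<otimes>\<^bsub>R\<^esub> e \<ominus>\<^bsub>R\<^esub> b \<otimes>\<^bsub>R\<^esub> d"] hom_even_unit[of i]
    unfolding map unfolding eq R.GL_super_mat3 S.GL_super_mat3 by simp
qed

lemma hom_mat_mult:
  fixes A B :: "2 + 1 \<Rightarrow> 2 + 1 \<Rightarrow> 'a"
  assumes "\<And>i j. A i j \<in> carrier R" "\<And>i j. B i j \<in> carrier R"
  shows "(\<lambda>i j. \<phi> (mat_mult R A B i j)) = mat_mult S (\<lambda>i j. \<phi> (A i j)) (\<lambda>i j. \<phi> (B i j))"
  unfolding mat_eq_iff using assms by (simp add: R.mat_mult_entry S.mat_mult_entry)

text \<open>\<phi> may kill coefficients, so the sums defining the two products run over different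
  supports. A common lower bound N for both factors gives one finite interval that serves on both
  sides.\<close>

lemma laurent_hom: "superring_hom (laurent R) (laurent S) ((\<circ>) \<phi>)"
proof (intro superring_hom.intro superring_hom_axioms.intro R.laurent_superring S.laurent_superring)
  have supp: "\<exists>N. \<forall>n<N. \<phi> (f n) = \<zero>\<^bsub>S\<^esub>" if "\<exists>N. \<forall>n<(N::int). f n = \<zero>\<^bsub>R\<^esub>" for f
    using that by (metis hom_simps(7))
  have mult: "\<phi> \<circ> (f \<otimes>\<^bsub>laurent R\<^esub> g) = (\<phi> \<circ> f) \<otimes>\<^bsub>laurent S\<^esub> (\<phi> \<circ> g)"
    if fg: "f \<in> carrier (laurent R)" "g \<in> carrier (laurent R)" for f g
  proof
    fix n
    obtain N where N: "\<forall>n<N. f n = \<zero>\<^bsub>R\<^esub>" "\<forall>n<N. g n = \<zero>\<^bsub>R\<^esub>"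
      using R.laurent_lower_bound2[OF fg] by blast
    have c: "\<And>i. f i \<in> carrier R" "\<And>i. g i \<in> carrier R"
      using fg by (simp_all add: R.carrier_laurent)
    have "((\<phi> \<circ> f) \<otimes>\<^bsub>laurent S\<^esub> (\<phi> \<circ> g)) n = (\<Oplus>\<^bsub>S\<^esub>i\<in>{N..n - N}. \<phi> (f i) \<otimes>\<^bsub>S\<^esub> \<phi> (g (n - i)))"
      using N c S.mult_laurent_bounds[of "\<phi> \<circ> f" "\<phi> \<circ> g" N N n] supp
      by (simp add: S.carrier_laurent) (metis hom_simps(7))
    then show "(\<phi> \<circ> (f \<otimes>\<^bsub>laurent R\<^esub> g)) n = ((\<phi> \<circ> f) \<otimes>\<^bsub>laurent S\<^esub> (\<phi> \<circ> g)) n"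
      using R.mult_laurent_bounds[OF fg N, of n] c by (simp add: hom_finsum)
  qed
  show "(\<circ>) \<phi> \<in> super_hom (laurent R) (laurent S)"
    unfolding super_hom_def
    by (auto simp: ring_hom_def mult R.carrier_laurent S.carrier_laurent R.even_laurent S.even_laurent
        R.odd_laurent S.odd_laurent R.add_laurent S.add_laurent R.one_laurent S.one_laurent
        fun_eq_iff intro!: supp)
qed

lemma power_series_hom: "superring_hom (power_series R) (power_series S) ((\<circ>) \<phi>)"
proof (intro superring_hom.intro superring_hom_axioms.intro R.power_series_superring S.power_series_superring)
  interpret L: superring_hom "laurent R" "laurent S" "(\<circ>) \<phi>" by (rule laurent_hom)
  show "(\<circ>) \<phi> \<in> super_hom (power_series R) (power_series S)"
    unfolding super_hom_def
    by (auto simp: ring_hom_def R.power_series_laurent R.carrier_power_series S.carrier_power_series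
        R.even_power_series S.even_power_series R.odd_power_series S.odd_power_series
        simp del: o_apply intro: L.hom_simps; simp)
qed

lemma mat_map_GL_laurent:
  fixes A :: "2 + 1 \<Rightarrow> 2 + 1 \<Rightarrow> int \<Rightarrow> 'a"
  shows "A \<in> carrier (GL_super (laurent R)) \<Longrightarrow> mat_map \<phi> A \<in> carrier (GL_super (laurent S))"
  using superring_hom.hom_GL_super[OF laurent_hom, of A] by (simp add: mat_map_def comp_def)

lemma mat_map_GL_power_series:
  fixes A :: "2 + 1 \<Rightarrow> 2 + 1 \<Rightarrow> int \<Rightarrow> 'a"
  shows "A \<in> carrier (GL_super (power_series R)) \<Longrightarrow> mat_map \<phi> A \<in> carrier (GL_super (power_series S))"
  using superring_hom.hom_GL_super[OF power_series_hom, of A] by (simp add: mat_map_def comp_def)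

lemma mat_map_mult:
  fixes A B :: "2 + 1 \<Rightarrow> 2 + 1 \<Rightarrow> int \<Rightarrow> 'a"
  assumes "\<And>i j. A i j \<in> carrier (laurent R)" "\<And>i j. B i j \<in> carrier (laurent R)"
  shows "mat_map \<phi> (mat_mult (laurent R) A B) = mat_mult (laurent S) (mat_map \<phi> A) (mat_map \<phi> B)"
  using superring_hom.hom_mat_mult[OF laurent_hom, of A B] assms
  by (simp add: mat_map_def comp_def)

lemma mat_map_mat3:
  "mat_map \<phi> (mat3 a b c d e f g h i) =
    mat3 (\<phi> \<circ> a) (\<phi> \<circ> b) (\<phi> \<circ> c) (\<phi> \<circ> d) (\<phi> \<circ> e) (\<phi> \<circ> f) (\<phi> \<circ> g) (\<phi> \<circ> h) (\<phi> \<circ> i)"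
  by (simp add: mat_eq_iff all_type_21 mat_map_def comp_def)

lemma mat_map_t_power: "mat_map \<phi> (t_power R \<mu>) = t_power S \<mu>"
  by (auto simp: mat_map_def t_power_def mat_diag_def fun_eq_iff R.zero_laurent S.zero_laurent)

end

section \<open>Localisation of superalgebras\<close>

text \<open>Provides codes, within a given infinite set, for the pairs of a numerator and an
  exponent.\<close>

lemma card_times_nat_inj:
  assumes "infinite A"
  obtains j where "inj_on j (A \<times> (UNIV :: nat set))" "j ` (A \<times> UNIV) \<subseteq> A"
proof -
  have "(card_of (UNIV :: nat set), card_of A) \<in> ordLeq"
    using assms infinite_iff_card_of_nat by blast
  then have "(card_of (A \<times> (UNIV :: nat set)), card_of A) \<in> ordLeq"
    using card_of_Times_infinite[OF assms, of "UNIV :: nat set"] ordIso_iff_ordLeq by blast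
  then show ?thesis
    using that by (auto simp: card_of_ordLeq[symmetric])
qed

locale test_algebra = superring R for R :: "'u superalg" (structure) +
  assumes superalgebra: "superalgebra R"
begin

lemma complex_module: "Module.module complex_ring R"
  by (rule superalgebra.axioms(2)[OF superalgebra])

lemma smult_simps [simp]:
  "x \<in> carrier R \<Longrightarrow> c \<odot> x \<in> carrier R"
  "\<lbrakk>x \<in> carrier R; y \<in> carrier R\<rbrakk> \<Longrightarrow> c \<odot> (x \<oplus> y) = c \<odot> x \<oplus> c \<odot> y"
  "x \<in> carrier R \<Longrightarrow> (c + d) \<odot> x = c \<odot> x \<oplus> d \<odot> x"
  "x \<in> carrier R \<Longrightarrow> (c * d) \<odot> x = c \<odot> (d \<odot> x)"
  "x \<in> carrier R \<Longrightarrow> 1 \<odot> x = x"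
  "x \<in> even_part R \<Longrightarrow> c \<odot> x \<in> even_part R"
  "x \<in> odd_part R \<Longrightarrow> c \<odot> x \<in> odd_part R"
  "c \<odot> \<zero> = \<zero>"
proof -
  interpret M: Module.module complex_ring R by (rule complex_module)
  show "x \<in> carrier R \<Longrightarrow> c \<odot> x \<in> carrier R"
    "\<lbrakk>x \<in> carrier R; y \<in> carrier R\<rbrakk> \<Longrightarrow> c \<odot> (x \<oplus> y) = c \<odot> x \<oplus> c \<odot> y"
    "x \<in> carrier R \<Longrightarrow> (c + d) \<odot> x = c \<odot> x \<oplus> d \<odot> x"
    "x \<in> carrier R \<Longrightarrow> (c * d) \<odot> x = c \<odot> (d \<odot> x)"
    "x \<in> carrier R \<Longrightarrow> 1 \<odot> x = x" "c \<odot> \<zero> = \<zero>"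
    using M.smult_closed[of c] M.smult_r_distr[of c] M.smult_l_distr[of c d] M.smult_assoc1[of c d]
      M.smult_one M.smult_r_null[of c]
    by (auto simp: complex_ring_def)
  show "x \<in> even_part R \<Longrightarrow> c \<odot> x \<in> even_part R" "x \<in> odd_part R \<Longrightarrow> c \<odot> x \<in> odd_part R"
    using M.submoduleE(4)[OF superalgebra.even_submodule[OF superalgebra], of c x]
      M.submoduleE(4)[OF superalgebra.odd_submodule[OF superalgebra], of c x]
    by (auto simp: complex_ring_def)
qed

lemmas smult_mult_left = superalgebra.smult_mult_left[OF superalgebra]
  and smult_mult_right = superalgebra.smult_mult_right[OF superalgebra]

text \<open>If 1 is nonzero, the complex multiples of 1 are pairwise different.\<close>

lemma infinite_carrier:
  assumes "\<one> \<noteq> \<zero>"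
  shows "infinite (carrier R)"
proof
  assume fin: "finite (carrier R)"
  have "inj (\<lambda>c. c \<odot> \<one>)"
  proof
    fix c d assume eq: "c \<odot> \<one> = d \<odot> \<one>"
    have "(c - d) \<odot> \<one> \<oplus> d \<odot> \<one> = d \<odot> \<one>"
      using smult_simps(3)[of \<one> "c - d" d] eq by simp
    then have 0: "(c - d) \<odot> \<one> = \<zero>"
      using add.right_cancel[of "d \<odot> \<one>" "(c - d) \<odot> \<one>" \<zero>] by simp
    show "c = d"
    proof (rule ccontr)
      assume "c \<noteq> d"
      then have "\<one> = (1 / (c - d)) \<odot> ((c - d) \<odot> \<one>)"
        by (simp flip: smult_simps(4))
      also have "\<dots> = \<zero>"
        unfolding 0 by simp
      finally show False
        using assms by simp
    qed
  qed
  then have "infinite (range (\<lambda>c. c \<odot> \<one>))"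
    using infinite_UNIV_char_0 finite_imageD by blast
  moreover have "range (\<lambda>c. c \<odot> \<one>) \<subseteq> carrier R"
    by auto
  ultimately show False
    using fin finite_subset by blast
qed

end

section \<open>Fractions with powers of a fixed even element as denominators, coded in the given
  type\<close>

locale fractions = test_algebra R for R :: "'u superalg" (structure) +
  fixes f :: 'u
  assumes f_even: "f \<in> even_part R"
begin

text \<open>Treating multiplication by \<open>f^n\<close> as an operator lets simplification move
  all powers of f outwards and add their exponents, which is the only arithmetic that equality of
  fractions needs.\<close>

definition F :: "nat \<Rightarrow> 'u \<Rightarrow> 'u" where
  "F n x = f [^] n \<otimes> x"

lemma F_simps [simp]:
  "x \<in> carrier R \<Longrightarrow> F n x \<in> carrier R"
  "x \<in> even_part R \<Longrightarrow> F n x \<in> even_part R"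
  "x \<in> odd_part R \<Longrightarrow> F n x \<in> odd_part R"
  "x \<in> carrier R \<Longrightarrow> F m (F n x) = F (m + n) x"
  "\<lbrakk>x \<in> carrier R; y \<in> carrier R\<rbrakk> \<Longrightarrow> F n (x \<oplus> y) = F n x \<oplus> F n y"
  "\<lbrakk>x \<in> carrier R; y \<in> carrier R\<rbrakk> \<Longrightarrow> F n x \<otimes> y = F n (x \<otimes> y)"
  "\<lbrakk>x \<in> carrier R; y \<in> carrier R\<rbrakk> \<Longrightarrow> x \<otimes> F n y = F n (x \<otimes> y)"
  "x \<in> carrier R \<Longrightarrow> F n (\<ominus> x) = \<ominus> F n x"
  "x \<in> carrier R \<Longrightarrow> c \<odot> F n x = F n (c \<odot> x)"
  "F n \<zero> = \<zero>"
  "x \<in> carrier R \<Longrightarrow> F 0 x = x"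
proof -
  have e: "f [^] n \<in> even_part R" for n :: nat
    using f_even by simp
  note c = even_carrier[OF e]
  show "x \<in> carrier R \<Longrightarrow> F m (F n x) = F (m + n) x"
    unfolding F_def using c f_even by (simp add: m_assoc[symmetric] nat_pow_mult)
  show "\<lbrakk>x \<in> carrier R; y \<in> carrier R\<rbrakk> \<Longrightarrow> x \<otimes> F n y = F n (x \<otimes> y)"
    unfolding F_def by (intro even_lcomm e)
qed (use f_even in \<open>simp_all add: F_def m_assoc r_distr r_minus smult_mult_right\<close>)

text \<open>A pair (r, m) stands for the fraction r / f^m. The additional exponent p is there
  because f may be a zero divisor.\<close>

definition eqv :: "'u \<times> nat \<Rightarrow> 'u \<times> nat \<Rightarrow> bool" where
  "eqv x y \<longleftrightarrow> (\<exists>p. F (p + snd y) (fst x) = F (p + snd x) (fst y))"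

lemma eqv_refl: "eqv x x"
  by (auto simp: eqv_def)

lemma eqv_sym: "eqv x y \<Longrightarrow> eqv y x"
  unfolding eqv_def by (erule exE) (rule exI, erule sym)

lemma eqv_trans:
  assumes "eqv x y" "eqv y z" "fst x \<in> carrier R" "fst y \<in> carrier R" "fst z \<in> carrier R"
  shows "eqv x z"
proof -
  obtain p q where pq: "F (p + snd y) (fst x) = F (p + snd x) (fst y)"
    "F (q + snd z) (fst y) = F (q + snd y) (fst z)"
    using assms unfolding eqv_def by blast
  have "F (q + snd z) (F (p + snd y) (fst x)) = F (p + snd x) (F (q + snd z) (fst y))"
    unfolding pq(1) using assms(3-) by (simp add: add_ac)
  then have "F (q + snd z) (F (p + snd y) (fst x)) = F (p + snd x) (F (q + snd y) (fst z))"
    unfolding pq(2) .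
  then show ?thesis
    unfolding eqv_def using assms(3-) by (intro exI[of _ "p + q + snd y"]) (simp add: add_ac)
qed

text \<open>A nonzero superalgebra is infinite, so there is room for the classes of fractions in its own type.\<close>

lemma fraction_codes:
  "\<exists>e :: 'u \<times> nat \<Rightarrow> 'u. \<forall>r\<in>carrier R. \<forall>s\<in>carrier R. \<forall>m n. e (r, m) = e (s, n) \<longleftrightarrow> eqv (r, m) (s, n)"
proof (cases "\<one> = \<zero>")
  case True
  then have "carrier R = {\<zero>}"
    using carrier_one_zero by blast
  then show ?thesis
    by (intro exI[of _ "\<lambda>_. \<zero>"]) (auto simp: eqv_def)
next
  case False
  obtain j :: "'u \<times> nat \<Rightarrow> 'u" where j: "inj_on j (carrier R \<times> (UNIV :: nat set))"
    using card_times_nat_inj[OF infinite_carrier[OF False]] by blast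
  \<comment> \<open>Equivalent pairs satisfy the same predicate, so the choice operator picks the
    same representative for both; its code then depends on the class alone.\<close>
  define rep where "rep = (\<lambda>x. SOME y. y \<in> carrier R \<times> UNIV \<and> eqv x y)"
  have rep: "rep x \<in> carrier R \<times> UNIV \<and> eqv x (rep x)" if "fst x \<in> carrier R" for x
  proof -
    have "x \<in> carrier R \<times> UNIV \<and> eqv x x"
      using that eqv_refl by (cases x) simp
    then show ?thesis
      unfolding rep_def by (rule someI)
  qed
  have "rep x = rep y \<longleftrightarrow> eqv x y" if xy: "fst x \<in> carrier R" "fst y \<in> carrier R" for x y
  proof
    assume eq: "rep x = rep y"
    have c: "fst (rep y) \<in> carrier R"
      using rep[OF xy(2)] by (auto simp: mem_Times_iff)
    show "eqv x y"
      using rep[OF xy(1)] rep[OF xy(2)] eqv_trans[of x "rep y" y] eqv_sym xy c unfolding eq by blast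
  next
    assume eq: "eqv x y"
    have "y' \<in> carrier R \<times> UNIV \<and> eqv x y' \<longleftrightarrow> y' \<in> carrier R \<times> UNIV \<and> eqv y y'" for y'
      using xy eqv_trans[OF eqv_sym[OF eq], of y'] eqv_trans[OF eq, of y'] by (auto simp: mem_Times_iff)
    then show "rep x = rep y"
      unfolding rep_def by simp
  qed
  then have "\<forall>r\<in>carrier R. \<forall>s\<in>carrier R. \<forall>m n.
      j (rep (r, m)) = j (rep (s, n)) \<longleftrightarrow> eqv (r, m) (s, n)"
    using j rep by (simp add: inj_on_eq_iff)
  then show ?thesis
    by (intro exI[of _ "\<lambda>x. j (rep x)"])
qed

text \<open>The code of r / f^m. All later reasoning about it goes through the equality criterion
  \<open>frac_eq_iff\<close>.\<close>

definition frac :: "'u \<Rightarrow> nat \<Rightarrow> 'u" where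
  "frac r m = (SOME e. \<forall>r\<in>carrier R. \<forall>s\<in>carrier R. \<forall>m n. e (r, m) = e (s, n) \<longleftrightarrow> eqv (r, m) (s, n)) (r, m)"

lemma frac_eq_iff:
  assumes "r \<in> carrier R" "s \<in> carrier R"
  shows "frac r m = frac s n \<longleftrightarrow> (\<exists>p. F (p + n) r = F (p + m) s)"
  using someI_ex[OF fraction_codes] assms unfolding frac_def[abs_def] by (simp add: eqv_def)

lemma frac_eqI:
  assumes "F n r = F m s" "r \<in> carrier R" "s \<in> carrier R"
  shows "frac r m = frac s n"
  using assms by (subst frac_eq_iff) (auto intro: exI[of _ 0])

definition num_den :: "'u \<Rightarrow> 'u \<times> nat" where
  "num_den u = (SOME x. fst x \<in> carrier R \<and> u = frac (fst x) (snd x))"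

text \<open>The operations must be functions of codes, hence the detour through a chosen numerator
  and exponent \<open>num_den\<close>; \<open>loc_mult\<close>, \<open>loc_add\<close> and
  \<open>loc_smult\<close> show that the choice does not matter.\<close>

definition loc :: "'u superalg" where
  "loc = \<lparr>carrier = {frac r m | r m. r \<in> carrier R},
    monoid.mult = \<lambda>u v. case (num_den u, num_den v) of ((r, m), (s, n)) \<Rightarrow> frac (r \<otimes> s) (m + n),
    one = frac \<one> 0, zero = frac \<zero> 0,
    add = \<lambda>u v. case (num_den u, num_den v) of ((r, m), (s, n)) \<Rightarrow> frac (F n r \<oplus> F m s) (m + n),
    smult = \<lambda>c u. case num_den u of (r, m) \<Rightarrow> frac (c \<odot> r) m,
    even_part = {frac r m | r m. r \<in> even_part R},
    odd_part = {frac r m | r m. r \<in> odd_part R}\<rparr>"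

lemma num_denE:
  assumes "r \<in> carrier R"
  obtains r' m' p where "num_den (frac r m) = (r', m')" "r' \<in> carrier R" "F (p + m') r = F (p + m) r'"
proof -
  have "fst (r, m) \<in> carrier R \<and> frac r m = frac (fst (r, m)) (snd (r, m))"
    using assms by simp
  then have "fst (num_den (frac r m)) \<in> carrier R \<and>
      frac r m = frac (fst (num_den (frac r m))) (snd (num_den (frac r m)))"
    unfolding num_den_def by (rule someI)
  then show ?thesis
    using that[of "fst (num_den (frac r m))" "snd (num_den (frac r m))"] assms
    by (auto simp: frac_eq_iff)
qed

lemma loc_mult:
  assumes "r \<in> carrier R" "s \<in> carrier R"
  shows "frac r m \<otimes>\<^bsub>loc\<^esub> frac s n = frac (r \<otimes> s) (m + n)"
proof -
  obtain r' m' p where r: "num_den (frac r m) = (r', m')" "r' \<in> carrier R" "F (p + m') r = F (p + m) r'"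
    using num_denE[OF assms(1)] by blast
  obtain s' n' q where s: "num_den (frac s n) = (s', n')" "s' \<in> carrier R" "F (q + n') s = F (q + n) s'"
    using num_denE[OF assms(2)] by blast
  have "F (p + m') r \<otimes> F (q + n') s = F (p + m) r' \<otimes> F (q + n) s'"
    by (simp add: r s)
  then have "F ((p + q) + (m' + n')) (r \<otimes> s) = F ((p + q) + (m + n)) (r' \<otimes> s')"
    using assms r(2) s(2) by (simp add: add_ac)
  then show ?thesis
    using assms r s by (simp add: loc_def frac_eq_iff) metis
qed

lemma loc_add:
  assumes "r \<in> carrier R" "s \<in> carrier R"
  shows "frac r m \<oplus>\<^bsub>loc\<^esub> frac s n = frac (F n r \<oplus> F m s) (m + n)"
proof -
  obtain r' m' p where r: "num_den (frac r m) = (r', m')" "r' \<in> carrier R" "F (p + m') r = F (p + m) r'"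
    using num_denE[OF assms(1)] by blast
  obtain s' n' q where s: "num_den (frac s n) = (s', n')" "s' \<in> carrier R" "F (q + n') s = F (q + n) s'"
    using num_denE[OF assms(2)] by blast
  \<comment> \<open>Each of the two relations is multiplied by the exponents of the other one, so
    that both summands acquire the same additional power of f.\<close>
  have "F (q + n' + n) (F (p + m') r) \<oplus> F (p + m' + m) (F (q + n') s) =
      F (q + n' + n) (F (p + m) r') \<oplus> F (p + m' + m) (F (q + n) s')"
    by (simp only: r s)
  then have "F ((p + q) + (m' + n')) (F n r \<oplus> F m s) = F ((p + q) + (m + n)) (F n' r' \<oplus> F m' s')"
    using assms r(2) s(2) by (simp add: add_ac)
  then show ?thesis
    using assms r s by (simp add: loc_def frac_eq_iff) metis
qed

lemma loc_smult:
  assumes "r \<in> carrier R"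
  shows "c \<odot>\<^bsub>loc\<^esub> frac r m = frac (c \<odot> r) m"
proof -
  obtain r' m' p where r: "num_den (frac r m) = (r', m')" "r' \<in> carrier R" "F (p + m') r = F (p + m) r'"
    using num_denE[OF assms(1)] by blast
  have "c \<odot> F (p + m') r = c \<odot> F (p + m) r'"
    by (simp only: r)
  then have "F (p + m') (c \<odot> r) = F (p + m) (c \<odot> r')"
    using assms r(2) by simp
  then show ?thesis
    using assms r by (simp add: loc_def frac_eq_iff) metis
qed

lemma loc_simps:
  "\<one>\<^bsub>loc\<^esub> = frac \<one> 0" "\<zero>\<^bsub>loc\<^esub> = frac \<zero> 0"
  "u \<in> carrier loc \<longleftrightarrow> (\<exists>r\<in>carrier R. \<exists>m. u = frac r m)"
  "u \<in> even_part loc \<longleftrightarrow> (\<exists>r\<in>even_part R. \<exists>m. u = frac r m)"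
  "u \<in> odd_part loc \<longleftrightarrow> (\<exists>r\<in>odd_part R. \<exists>m. u = frac r m)"
  by (auto simp: loc_def)

lemma frac_mem [simp]:
  "r \<in> carrier R \<Longrightarrow> frac r m \<in> carrier loc"
  "r \<in> even_part R \<Longrightarrow> frac r m \<in> even_part loc"
  "r \<in> odd_part R \<Longrightarrow> frac r m \<in> odd_part loc"
  by (auto simp: loc_simps)

lemma loc_cases:
  "u \<in> carrier loc \<Longrightarrow> (\<And>r m. r \<in> carrier R \<Longrightarrow> u = frac r m \<Longrightarrow> thesis) \<Longrightarrow> thesis"
  "u \<in> even_part loc \<Longrightarrow> (\<And>r m. r \<in> even_part R \<Longrightarrow> u = frac r m \<Longrightarrow> thesis) \<Longrightarrow> thesis"
  "u \<in> odd_part loc \<Longrightarrow> (\<And>r m. r \<in> odd_part R \<Longrightarrow> u = frac r m \<Longrightarrow> thesis) \<Longrightarrow> thesis"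
  by (auto simp: loc_simps)

lemma frac_zero: "frac \<zero> m = frac \<zero> n"
  by (rule frac_eqI) simp_all

lemma loc_ring: "ring loc"
proof (intro ringI abelian_groupI Group.monoidI)
  fix u assume "u \<in> carrier loc"
  then obtain r m where u: "r \<in> carrier R" "u = frac r m"
    by (auto simp: loc_simps)
  show "\<exists>v\<in>carrier loc. v \<oplus>\<^bsub>loc\<^esub> u = \<zero>\<^bsub>loc\<^esub>"
    using u by (intro bexI[of _ "frac (\<ominus> r) m"])
      (auto simp: loc_simps loc_add l_neg intro: frac_zero)
  show "\<one>\<^bsub>loc\<^esub> \<otimes>\<^bsub>loc\<^esub> u = u" "u \<otimes>\<^bsub>loc\<^esub> \<one>\<^bsub>loc\<^esub> = u" "\<zero>\<^bsub>loc\<^esub> \<oplus>\<^bsub>loc\<^esub> u = u"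
    using u by (simp_all add: loc_simps loc_mult loc_add)
next
  fix u v assume "u \<in> carrier loc" "v \<in> carrier loc"
  then obtain r m s n where uv: "r \<in> carrier R" "u = frac r m" "s \<in> carrier R" "v = frac s n"
    by (auto simp: loc_simps)
  show "u \<oplus>\<^bsub>loc\<^esub> v = v \<oplus>\<^bsub>loc\<^esub> u"
    using uv by (simp add: loc_add a_comm add.commute)
  show "u \<oplus>\<^bsub>loc\<^esub> v \<in> carrier loc"
    using uv unfolding loc_simps(3) by (auto simp: loc_add intro!: bexI[of _ "F n r \<oplus> F m s"])
  show "u \<otimes>\<^bsub>loc\<^esub> v \<in> carrier loc"
    using uv unfolding loc_simps(3) by (auto simp: loc_mult intro!: bexI[of _ "r \<otimes> s"])
next
  fix u v w assume "u \<in> carrier loc" "v \<in> carrier loc" "w \<in> carrier loc"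
  then obtain r m s n t k where uv: "r \<in> carrier R" "u = frac r m" "s \<in> carrier R" "v = frac s n"
    "t \<in> carrier R" "w = frac t k"
    by (auto simp: loc_simps)
  show "u \<oplus>\<^bsub>loc\<^esub> v \<oplus>\<^bsub>loc\<^esub> w = u \<oplus>\<^bsub>loc\<^esub> (v \<oplus>\<^bsub>loc\<^esub> w)"
    "u \<otimes>\<^bsub>loc\<^esub> v \<otimes>\<^bsub>loc\<^esub> w = u \<otimes>\<^bsub>loc\<^esub> (v \<otimes>\<^bsub>loc\<^esub> w)"
    using uv by (simp_all add: loc_add loc_mult a_assoc m_assoc add_ac)
  show "(u \<oplus>\<^bsub>loc\<^esub> v) \<otimes>\<^bsub>loc\<^esub> w = u \<otimes>\<^bsub>loc\<^esub> w \<oplus>\<^bsub>loc\<^esub> v \<otimes>\<^bsub>loc\<^esub> w"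
    "w \<otimes>\<^bsub>loc\<^esub> (u \<oplus>\<^bsub>loc\<^esub> v) = w \<otimes>\<^bsub>loc\<^esub> u \<oplus>\<^bsub>loc\<^esub> w \<otimes>\<^bsub>loc\<^esub> v"
    using uv by (simp_all add: loc_add loc_mult l_distr r_distr) (rule frac_eqI; simp add: add_ac)+
qed (auto simp: loc_simps)

lemma loc_minus:
  assumes "r \<in> carrier R"
  shows "\<ominus>\<^bsub>loc\<^esub> frac r m = frac (\<ominus> r) m"
proof -
  interpret loc: ring loc by (rule loc_ring)
  show ?thesis
    using assms by (intro loc.minus_equality) (auto simp: loc_simps loc_add l_neg intro: frac_zero)
qed

lemma loc_superalgebra: "superalgebra loc"
proof -
  interpret loc: ring loc by (rule loc_ring)
  have module: "Module.module complex_ring loc"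
  proof (intro moduleI loc.abelian_group_axioms)
    show "cring complex_ring"
      using complex_module by (simp add: module_def)
  qed (auto simp: loc_smult loc_add complex_ring_def elim!: loc_cases intro!: frac_eqI)
  interpret loc: Module.module complex_ring loc by (rule module)
  show ?thesis
  proof (intro superalgebra.intro superalgebra_axioms.intro loc_ring module)
    show "submodule (even_part loc) complex_ring loc" 
      by (rule loc.submoduleI)
        (auto simp: loc_simps(1,2) loc_minus loc_smult loc_add elim!: loc_cases)
    show "submodule (odd_part loc) complex_ring loc"
      by (rule loc.submoduleI)
        (auto simp: loc_simps(1,2) loc_minus loc_smult loc_add elim!: loc_cases)
    show "\<exists>a\<in>even_part loc. \<exists>b\<in>odd_part loc. x = a \<oplus>\<^bsub>loc\<^esub> b" if x_in: "x \<in> carrier loc" for x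
    proof -
      obtain r m where x: "r \<in> carrier R" "x = frac r m"
        using x_in by (auto simp: loc_simps)
      obtain a b where ab: "a \<in> even_part R" "b \<in> odd_part R" "r = a \<oplus> b"
        using decomp[OF x(1)] by blast
      have "x = frac a m \<oplus>\<^bsub>loc\<^esub> frac b m"
        unfolding x(2) ab(3) using ab(1,2) by (subst loc_add) (auto intro: frac_eqI)
      then show ?thesis
        using ab by (intro bexI[of _ "frac a m"] bexI[of _ "frac b m"]) simp_all
    qed
    show "even_part loc \<inter> odd_part loc = {\<zero>\<^bsub>loc\<^esub>}"
    proof (intro equalityI subsetI)
      fix x assume "x \<in> even_part loc \<inter> odd_part loc"
      then obtain a m b n where ab: "a \<in> even_part R" "b \<in> odd_part R" "x = frac a m" "x = frac b n"
        by (metis IntE loc_simps(4,5))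
      then obtain p where p: "F (p + n) a = F (p + m) b"
        using frac_eq_iff[of a b m n] by auto
      \<comment> \<open>After clearing denominators, one and the same element is both even and
        odd.\<close>
      have "F (p + n) a = \<zero>"
        using F_simps(2)[OF ab(1), of "p + n"] F_simps(3)[OF ab(2), of "p + m"]
        unfolding p by (rule even_inter_odd)
      then have "x = \<zero>\<^bsub>loc\<^esub>"
        using ab(1) unfolding ab(3) loc_simps by (subst frac_eq_iff) (auto intro: exI[of _ "p + n"])
      then show "x \<in> {\<zero>\<^bsub>loc\<^esub>}" by simp
    qed (auto simp: loc_simps)
    show "a \<otimes>\<^bsub>loc\<^esub> x = x \<otimes>\<^bsub>loc\<^esub> a" if x_in: "a \<in> even_part loc" "x \<in> carrier loc" for a x
    proof -
      obtain r m s n where "r \<in> even_part R" "s \<in> carrier R" "a = frac r m" "x = frac s n"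
        using x_in by (auto simp: loc_simps)
      then show ?thesis
        using even_commute[of r s] by (simp add: loc_mult add.commute)
    qed
    show "a \<otimes>\<^bsub>loc\<^esub> x = \<ominus>\<^bsub>loc\<^esub> (x \<otimes>\<^bsub>loc\<^esub> a)" if x_in: "a \<in> odd_part loc" "x \<in> odd_part loc" for a x
    proof -
      obtain r m s n where "r \<in> odd_part R" "s \<in> odd_part R" "a = frac r m" "x = frac s n"
        using x_in by (auto simp: loc_simps)
      then show ?thesis
        using odd_anticommute[of r s] by (simp add: loc_mult loc_minus add.commute)
    qed
  qed (use even_even even_odd odd_even odd_odd in \<open>auto simp: loc_simps(1,2) loc_mult loc_smult smult_mult_left[symmetric]
      smult_mult_right[symmetric] elim!: loc_cases\<close>)
qed

lemma loc_is_localization: "is_localization R f loc (\<lambda>r\<in>carrier R. frac r 0)"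
proof -
  let ?\<phi> = "\<lambda>r\<in>carrier R. frac r 0"
  interpret loc: ring loc by (rule loc_ring)
  have hom: "?\<phi> \<in> superhom R loc"
    unfolding superhom_def ring_hom_def
    by (auto simp: loc_simps(1) loc_mult loc_add loc_smult)
  have f: "f \<in> carrier R"
    using f_even by simp
  have pow: "frac f 0 [^]\<^bsub>loc\<^esub> n = frac (f [^] n) 0" for n :: nat
    using f by (induction n) (simp_all add: loc_simps loc_mult)
  have "frac f 0 \<otimes>\<^bsub>loc\<^esub> frac \<one> 1 = \<one>\<^bsub>loc\<^esub>" "frac \<one> 1 \<otimes>\<^bsub>loc\<^esub> frac f 0 = \<one>\<^bsub>loc\<^esub>"
    using f unfolding loc_simps(1) by (auto simp: loc_mult F_def intro!: frac_eqI)
  then have "frac f 0 \<in> Units loc"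
    unfolding Units_def using f by (auto intro!: bexI[of _ "frac \<one> 1"])
  moreover have "\<exists>r\<in>carrier R. \<exists>n::nat. s \<otimes>\<^bsub>loc\<^esub> (frac f 0 [^]\<^bsub>loc\<^esub> n) = ?\<phi> r" if s: "s \<in> carrier loc" for s
  proof -
    obtain r m where r: "r \<in> carrier R" "s = frac r m"
      using s by (auto simp: loc_simps)
    have "r \<otimes> f [^] m = F m r"
      unfolding F_def using r f_even even_commute[of "f [^] m" r] by simp
    then have "s \<otimes>\<^bsub>loc\<^esub> (frac f 0 [^]\<^bsub>loc\<^esub> m) = ?\<phi> r"
      using r f by (simp add: pow loc_mult) (rule frac_eqI; simp)
    then show ?thesis
      using r by blast
  qed
  moreover have "\<exists>n::nat. (f [^] n) \<otimes> r = \<zero>" if "r \<in> carrier R" "frac r 0 = \<zero>\<^bsub>loc\<^esub>" for r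
    using that by (auto simp: loc_simps frac_eq_iff F_def[symmetric])
  ultimately show ?thesis
    unfolding is_localization_def using loc_superalgebra hom f f_even by auto
qed

end

lemma superalgebra_test_algebra: "superalgebra R \<Longrightarrow> test_algebra R"
  by (simp add: test_algebra_def test_algebra_axioms_def superalgebra_superring)

text \<open>This is what makes a fixed type \<open>'u\<close> large enough as a universe: every
  basic open of a test superalgebra is again represented by a test superalgebra over the same
  type.\<close>

lemma localization_exists:
  assumes "superalgebra R" "f \<in> even_part R"
  shows "\<exists>S \<phi>. is_localization R f S \<phi>"
  using fractions.loc_is_localization[of R f] assms
  by (auto simp: fractions_def fractions_axioms_def superalgebra_test_algebra)

section \<open>Composition of homomorphisms and the universal property of localisation\<close>

lemma (in superring) diff_eq_zero_iff:
  assumes "x \<in> carrier S" "y \<in> carrier S"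
  shows "x \<ominus> y = \<zero> \<longleftrightarrow> x = y"
proof
  assume "x \<ominus> y = \<zero>"
  moreover have "x \<ominus> y \<oplus> y = x"
    using assms by (simp add: minus_eq a_assoc l_neg)
  ultimately show "x = y"
    using assms by simp
qed (use assms in \<open>simp add: minus_eq r_neg\<close>)

lemma superhom_superring_hom:
  assumes "superalgebra R" "superalgebra S" "\<phi> \<in> superhom R S"
  shows "superring_hom R S \<phi>"
  using assms by (simp add: superring_hom_def superring_hom_axioms_def superalgebra_superring superhom_super_hom)

lemma superhom_id:
  assumes "superalgebra R"
  shows "(\<lambda>x\<in>carrier R. x) \<in> superhom R R"
proof -
  interpret test_algebra R using assms by (rule superalgebra_test_algebra)
  show ?thesis
    by (auto simp: superhom_def ring_hom_def)
qed

lemma superhom_compose: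
  assumes "superalgebra R" "superalgebra S" "superalgebra T" "\<phi> \<in> superhom R S" "\<psi> \<in> superhom S T"
  shows "compose (carrier R) \<psi> \<phi> \<in> superhom R T"
proof -
  interpret R: test_algebra R using assms(1) by (rule superalgebra_test_algebra)
  interpret a: superring_hom R S \<phi> by (rule superhom_superring_hom) fact+
  interpret b: superring_hom S T \<psi> by (rule superhom_superring_hom) fact+
  show ?thesis
    using assms(4,5) unfolding superhom_def ring_hom_def
    by (auto simp: compose_def)
qed

lemma superhom_compose_assoc:
  assumes "\<phi> \<in> superhom R S"
  shows "compose (carrier R) \<chi> (compose (carrier R) \<psi> \<phi>) = compose (carrier R) (compose (carrier S) \<chi> \<psi>) \<phi>"
  using assms by (auto simp: superhom_def ring_hom_def compose_def fun_eq_iff)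

lemma superhom_compose_id:
  assumes "\<phi> \<in> superhom R S"
  shows "compose (carrier R) \<phi> (\<lambda>x\<in>carrier R. x) = \<phi>" "compose (carrier R) (\<lambda>x\<in>carrier S. x) \<phi> = \<phi>"
  using assms by (auto simp: superhom_def ring_hom_def compose_def fun_eq_iff extensional_def)

locale localization_map = superring_hom R S \<phi> for R :: "'u superalg" and f and S :: "'u superalg" and \<phi> +
  assumes R_alg: "superalgebra R" and loc: "is_localization R f S \<phi>"
begin

lemma S_alg: "superalgebra S" and hom_S: "\<phi> \<in> superhom R S" and f_even [simp]: "f \<in> even_part R"
  and f_unit: "\<phi> f \<in> Units S"
  using loc by (simp_all add: is_localization_def)

lemma f_closed [simp]: "f \<in> carrier R"
  by simp

lemma fractionE:
  assumes "s \<in> carrier S"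
  obtains r and n :: nat where "r \<in> carrier R" "s \<otimes>\<^bsub>S\<^esub> (\<phi> f [^]\<^bsub>S\<^esub> n) = \<phi> r"
  using loc assms unfolding is_localization_def by blast

lemma kernelE:
  assumes "r \<in> carrier R" "r' \<in> carrier R" "\<phi> r = \<phi> r'"
  obtains n :: nat where "(f [^]\<^bsub>R\<^esub> n) \<otimes>\<^bsub>R\<^esub> r = (f [^]\<^bsub>R\<^esub> n) \<otimes>\<^bsub>R\<^esub> r'"
proof -
  have "\<phi> (r \<ominus>\<^bsub>R\<^esub> r') = \<zero>\<^bsub>S\<^esub>"
    using assms by (simp add: S.diff_eq_zero_iff)
  then obtain n :: nat where "(f [^]\<^bsub>R\<^esub> n) \<otimes>\<^bsub>R\<^esub> (r \<ominus>\<^bsub>R\<^esub> r') = \<zero>\<^bsub>R\<^esub>"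
    using loc assms unfolding is_localization_def by blast
  then have "(f [^]\<^bsub>R\<^esub> n) \<otimes>\<^bsub>R\<^esub> r \<ominus>\<^bsub>R\<^esub> (f [^]\<^bsub>R\<^esub> n) \<otimes>\<^bsub>R\<^esub> r' = \<zero>\<^bsub>R\<^esub>"
    using assms by (simp add: a_minus_def R.r_distr R.r_minus)
  then show ?thesis
    using that assms by (simp add: R.diff_eq_zero_iff)
qed

text \<open>The odd part of any numerator of an even element maps to an element that is even and
  odd, hence to zero, and may be dropped.\<close>

lemma even_fractionE:
  assumes "s \<in> even_part S"
  obtains r and n :: nat where "r \<in> even_part R" "s \<otimes>\<^bsub>S\<^esub> (\<phi> f [^]\<^bsub>S\<^esub> n) = \<phi> r"
proof -
  obtain r and n :: nat where r: "r \<in> carrier R" "s \<otimes>\<^bsub>S\<^esub> (\<phi> f [^]\<^bsub>S\<^esub> n) = \<phi> r"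
    using fractionE assms by (metis S.even_carrier)
  obtain a b where ab: "a \<in> even_part R" "b \<in> odd_part R" "r = a \<oplus>\<^bsub>R\<^esub> b"
    using R.decomp[OF r(1)] by blast
  have "\<phi> a \<oplus>\<^bsub>S\<^esub> \<phi> b \<in> even_part S"
    using r(2) assms ab by (metis R.even_carrier R.odd_carrier S.even_even S.even_pow f_even hom_simps(2,4))
  then have "\<phi> b = \<zero>\<^bsub>S\<^esub>"
    using ab by (intro S.even_part_unique[of "\<phi> a"]) simp_all
  then show ?thesis
    using that[of a n] r(2) ab by simp
qed

lemma odd_fractionE:
  assumes "s \<in> odd_part S"
  obtains r and n :: nat where "r \<in> odd_part R" "s \<otimes>\<^bsub>S\<^esub> (\<phi> f [^]\<^bsub>S\<^esub> n) = \<phi> r"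
proof -
  obtain r and n :: nat where r: "r \<in> carrier R" "s \<otimes>\<^bsub>S\<^esub> (\<phi> f [^]\<^bsub>S\<^esub> n) = \<phi> r"
    using fractionE assms by (metis S.odd_carrier)
  obtain a b where ab: "a \<in> even_part R" "b \<in> odd_part R" "r = a \<oplus>\<^bsub>R\<^esub> b"
    using R.decomp[OF r(1)] by blast
  define x where "x = s \<otimes>\<^bsub>S\<^esub> (\<phi> f [^]\<^bsub>S\<^esub> n)"
  have x: "x \<in> odd_part S" "x = \<phi> a \<oplus>\<^bsub>S\<^esub> \<phi> b"
    using assms unfolding x_def by simp (use r(2) ab in simp)
  have "\<phi> a = x \<ominus>\<^bsub>S\<^esub> \<phi> b"
    using ab unfolding x(2) by (simp add: a_minus_def S.a_assoc S.r_neg)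
  then have "\<phi> a \<in> odd_part S"
    using ab x(1) by simp
  then have "\<phi> a = \<zero>\<^bsub>S\<^esub>"
    using ab(1) by (intro S.even_inter_odd) simp_all
  then show ?thesis
    using that[of b n] r(2) ab by simp
qed

text \<open>\<open>is_localization\<close> describes \<phi> only by its elements, so the universal
  property has to be derived. The value at s with numerator r and exponent n is forced to be
  \<chi>(r) divided by \<chi>(f)^n; the kernel condition makes it independent of r and n.\<close>

lemma localization_extend:
  assumes U: "superalgebra U" and \<chi>: "\<chi> \<in> superhom R U" and unit: "\<chi> f \<in> Units U"
  shows "\<exists>\<theta>\<in>superhom S U. compose (carrier R) \<theta> \<phi> = \<chi>"
proof -
  interpret R: test_algebra R using R_alg by (rule superalgebra_test_algebra)
  interpret S: test_algebra S using S_alg by (rule superalgebra_test_algebra)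
  interpret U: test_algebra U using U by (rule superalgebra_test_algebra)
  interpret X: superring_hom R U \<chi> by (rule superhom_superring_hom[OF R_alg U \<chi>])
  let ?f = "\<lambda>n::nat. f [^]\<^bsub>R\<^esub> n" and ?p = "\<lambda>n::nat. \<phi> f [^]\<^bsub>S\<^esub> n" and ?q = "\<lambda>n::nat. \<chi> f [^]\<^bsub>U\<^esub> n"
  have pq: "?p n = \<phi> (?f n)" "?q n = \<chi> (?f n)" for n
    by simp_all
  have pe: "?p n \<in> even_part S" "?q n \<in> even_part U" for n
    by simp_all
  have qu: "?q n \<in> Units U" for n
    using unit by (induction n) simp_all
  have cancel: "y = y'" if "y \<otimes>\<^bsub>U\<^esub> ?q n = y' \<otimes>\<^bsub>U\<^esub> ?q n" "y \<in> carrier U" "y' \<in> carrier U" for y y' n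
  proof -
    have "?q n \<otimes>\<^bsub>U\<^esub> y = ?q n \<otimes>\<^bsub>U\<^esub> y'"
      using that U.even_commute[OF pe(2)] by metis
    then show ?thesis
      using qu that by simp
  qed
  have frac_mult: "(x \<otimes>\<^bsub>S\<^esub> ?p m) \<otimes>\<^bsub>S\<^esub> (y \<otimes>\<^bsub>S\<^esub> ?p n) = (x \<otimes>\<^bsub>S\<^esub> y) \<otimes>\<^bsub>S\<^esub> ?p (m + n)"
    if "x \<in> carrier S" "y \<in> carrier S" for x y m n
  proof -
    have "(x \<otimes>\<^bsub>S\<^esub> ?p m) \<otimes>\<^bsub>S\<^esub> (y \<otimes>\<^bsub>S\<^esub> ?p n) = x \<otimes>\<^bsub>S\<^esub> (?p m \<otimes>\<^bsub>S\<^esub> y) \<otimes>\<^bsub>S\<^esub> ?p n"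
      using that by (simp add: S.m_assoc)
    also have "?p m \<otimes>\<^bsub>S\<^esub> y = y \<otimes>\<^bsub>S\<^esub> ?p m"
      using that pe(1) by (intro S.even_commute)
    finally show ?thesis
      using that by (simp add: S.m_assoc S.nat_pow_mult)
  qed
  have frac_mult': "(x \<otimes>\<^bsub>U\<^esub> ?q m) \<otimes>\<^bsub>U\<^esub> (y \<otimes>\<^bsub>U\<^esub> ?q n) = (x \<otimes>\<^bsub>U\<^esub> y) \<otimes>\<^bsub>U\<^esub> ?q (m + n)"
    if "x \<in> carrier U" "y \<in> carrier U" for x y m n
  proof -
    have "(x \<otimes>\<^bsub>U\<^esub> ?q m) \<otimes>\<^bsub>U\<^esub> (y \<otimes>\<^bsub>U\<^esub> ?q n) = x \<otimes>\<^bsub>U\<^esub> (?q m \<otimes>\<^bsub>U\<^esub> y) \<otimes>\<^bsub>U\<^esub> ?q n"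
      using that by (simp add: U.m_assoc)
    also have "?q m \<otimes>\<^bsub>U\<^esub> y = y \<otimes>\<^bsub>U\<^esub> ?q m"
      using that pe(2) by (intro U.even_commute)
    finally show ?thesis
      using that by (simp add: U.m_assoc U.nat_pow_mult)
  qed
  have frac_add: "(x \<oplus>\<^bsub>S\<^esub> y) \<otimes>\<^bsub>S\<^esub> ?p (m + n) = (x \<otimes>\<^bsub>S\<^esub> ?p m) \<otimes>\<^bsub>S\<^esub> ?p n \<oplus>\<^bsub>S\<^esub> (y \<otimes>\<^bsub>S\<^esub> ?p n) \<otimes>\<^bsub>S\<^esub> ?p m"
    if "x \<in> carrier S" "y \<in> carrier S" for x y m n
    using that by (simp add: S.m_assoc S.nat_pow_mult S.l_distr add.commute)
  have frac_add': "(x \<oplus>\<^bsub>U\<^esub> y) \<otimes>\<^bsub>U\<^esub> ?q (m + n) = (x \<otimes>\<^bsub>U\<^esub> ?q m) \<otimes>\<^bsub>U\<^esub> ?q n \<oplus>\<^bsub>U\<^esub> (y \<otimes>\<^bsub>U\<^esub> ?q n) \<otimes>\<^bsub>U\<^esub> ?q m"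
    if "x \<in> carrier U" "y \<in> carrier U" for x y m n
    using that by (simp add: U.m_assoc U.nat_pow_mult U.l_distr add.commute)
  \<comment> \<open>The graph of the map to be constructed, phrased without division.\<close>
  define G where "G = (\<lambda>s y. y \<in> carrier U \<and> (\<exists>r\<in>carrier R. \<exists>n. s \<otimes>\<^bsub>S\<^esub> ?p n = \<phi> r \<and> y \<otimes>\<^bsub>U\<^esub> ?q n = \<chi> r))"
  have exist: "\<exists>y. G s y \<and> (s \<in> even_part S \<longrightarrow> y \<in> even_part U) \<and> (s \<in> odd_part S \<longrightarrow> y \<in> odd_part U)"
    if s: "s \<in> carrier S" for s
  proof -
    have *: "\<exists>y. G s y \<and> (r \<in> even_part R \<longrightarrow> y \<in> even_part U) \<and> (r \<in> odd_part R \<longrightarrow> y \<in> odd_part U)"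
      if "r \<in> carrier R" "s \<otimes>\<^bsub>S\<^esub> ?p n = \<phi> r" for r n
    proof -
      have "U.even_unit (?q n)"
        using qu pe by (simp add: U.even_unit_iff_Units)
      then obtain v where v: "v \<in> even_part U" "v \<otimes>\<^bsub>U\<^esub> ?q n = \<one>\<^bsub>U\<^esub>"
        by (rule U.even_unit_inverseE)
      have "G s (\<chi> r \<otimes>\<^bsub>U\<^esub> v)"
        unfolding G_def using that v
        by (intro conjI bexI[of _ r] exI[of _ n]) (simp_all add: U.m_assoc)
      then show ?thesis
        using v by (intro exI[of _ "\<chi> r \<otimes>\<^bsub>U\<^esub> v"]) auto
    qed
    \<comment> \<open>The numerator is chosen with the parity of s, so that the value gets the same
      parity. Zero has both parities, and the numerator zero serves for both.\<close>
    consider "s \<in> even_part S" "s \<notin> odd_part S" | "s \<in> odd_part S" "s \<notin> even_part S" |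
      "s = \<zero>\<^bsub>S\<^esub>" | "s \<notin> even_part S" "s \<notin> odd_part S"
      using S.even_inter_odd by blast
    then show ?thesis
    proof cases
      case 1
      then show ?thesis using even_fractionE[of s] * by (metis R.even_carrier)
    next
      case 2
      then show ?thesis using odd_fractionE[of s] * by (metis R.odd_carrier)
    next
      case 3
      then have "s \<otimes>\<^bsub>S\<^esub> ?p 0 = \<phi> \<zero>\<^bsub>R\<^esub>"
        by simp
      then show ?thesis using *[of "\<zero>\<^bsub>R\<^esub>" 0] by auto
    next
      case 4
      then show ?thesis using fractionE[OF s] * by metis
    qed
  qed
  have unique: "y = y'" if G: "G s y" "G s y'" and s: "s \<in> carrier S" for s y y'
  proof -
    obtain r n where r: "r \<in> carrier R" "s \<otimes>\<^bsub>S\<^esub> ?p n = \<phi> r" "y \<otimes>\<^bsub>U\<^esub> ?q n = \<chi> r" "y \<in> carrier U"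
      using G(1) unfolding G_def by blast
    obtain r' n' where r': "r' \<in> carrier R" "s \<otimes>\<^bsub>S\<^esub> ?p n' = \<phi> r'" "y' \<otimes>\<^bsub>U\<^esub> ?q n' = \<chi> r'" "y' \<in> carrier U"
      using G(2) unfolding G_def by blast
    have "\<phi> (r \<otimes>\<^bsub>R\<^esub> ?f n') = s \<otimes>\<^bsub>S\<^esub> ?p n \<otimes>\<^bsub>S\<^esub> ?p n'"
      using r by simp
    also have "\<dots> = s \<otimes>\<^bsub>S\<^esub> ?p n' \<otimes>\<^bsub>S\<^esub> ?p n"
      using s by (simp add: S.m_assoc S.nat_pow_mult add.commute)
    also have "\<dots> = \<phi> (r' \<otimes>\<^bsub>R\<^esub> ?f n)"
      using r' by simp
    finally obtain q where q: "?f q \<otimes>\<^bsub>R\<^esub> (r \<otimes>\<^bsub>R\<^esub> ?f n') = ?f q \<otimes>\<^bsub>R\<^esub> (r' \<otimes>\<^bsub>R\<^esub> ?f n)"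
      using kernelE r(1) r'(1) by (metis R.m_closed R.nat_pow_closed f_closed)
    have "?q q \<otimes>\<^bsub>U\<^esub> (\<chi> r \<otimes>\<^bsub>U\<^esub> ?q n') = \<chi> (?f q \<otimes>\<^bsub>R\<^esub> (r \<otimes>\<^bsub>R\<^esub> ?f n'))"
      using r(1) by simp
    also have "\<dots> = ?q q \<otimes>\<^bsub>U\<^esub> (\<chi> r' \<otimes>\<^bsub>U\<^esub> ?q n)"
      unfolding q using r'(1) by simp
    finally have "\<chi> r \<otimes>\<^bsub>U\<^esub> ?q n' = \<chi> r' \<otimes>\<^bsub>U\<^esub> ?q n"
      using qu[of q] r(1) r'(1) by simp
    then have "y \<otimes>\<^bsub>U\<^esub> ?q n \<otimes>\<^bsub>U\<^esub> ?q n' = y' \<otimes>\<^bsub>U\<^esub> ?q n' \<otimes>\<^bsub>U\<^esub> ?q n"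
      unfolding r(3) r'(3) .
    then have "y \<otimes>\<^bsub>U\<^esub> ?q (n + n') = y' \<otimes>\<^bsub>U\<^esub> ?q (n + n')"
      using r(4) r'(4) by (simp add: U.m_assoc U.nat_pow_mult add.commute)
    then show ?thesis
      using r(4) r'(4) by (rule cancel)
  qed
  define \<theta> where "\<theta> = (\<lambda>s\<in>carrier S. SOME y. G s y)"
  have \<theta>G: "G s (\<theta> s)" if "s \<in> carrier S" for s
    unfolding \<theta>_def using exist[OF that] that by (auto intro: someI)
  have \<theta>_eq: "\<theta> s = y" if "G s y" "s \<in> carrier S" for s y
    using unique[OF \<theta>G that(1)] that(2) by blast
  have \<theta>U: "\<theta> s \<in> carrier U" if "s \<in> carrier S" for s
    using \<theta>G[OF that] by (simp add: G_def)
  have "\<theta> \<in> superhom S U"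
    unfolding superhom_def
  proof (intro CollectI IntI conjI ballI allI subsetI ring_hom_memI)
    fix x y assume xy: "x \<in> carrier S" "y \<in> carrier S"
    obtain r m where r: "r \<in> carrier R" "x \<otimes>\<^bsub>S\<^esub> ?p m = \<phi> r" "\<theta> x \<otimes>\<^bsub>U\<^esub> ?q m = \<chi> r"
      using \<theta>G[OF xy(1)] unfolding G_def by blast
    obtain s n where s: "s \<in> carrier R" "y \<otimes>\<^bsub>S\<^esub> ?p n = \<phi> s" "\<theta> y \<otimes>\<^bsub>U\<^esub> ?q n = \<chi> s"
      using \<theta>G[OF xy(2)] unfolding G_def by blast
    show "\<theta> (x \<otimes>\<^bsub>S\<^esub> y) = \<theta> x \<otimes>\<^bsub>U\<^esub> \<theta> y"
    proof (rule \<theta>_eq)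
      show "G (x \<otimes>\<^bsub>S\<^esub> y) (\<theta> x \<otimes>\<^bsub>U\<^esub> \<theta> y)"
        unfolding G_def using r s xy \<theta>U frac_mult[OF xy, of m n] frac_mult'[OF \<theta>U \<theta>U, OF xy, of m n]
        by (intro conjI bexI[of _ "r \<otimes>\<^bsub>R\<^esub> s"] exI[of _ "m + n"]) simp_all
    qed (use xy in simp)
    show "\<theta> (x \<oplus>\<^bsub>S\<^esub> y) = \<theta> x \<oplus>\<^bsub>U\<^esub> \<theta> y"
    proof (rule \<theta>_eq)
      show "G (x \<oplus>\<^bsub>S\<^esub> y) (\<theta> x \<oplus>\<^bsub>U\<^esub> \<theta> y)"
        unfolding G_def using r s xy \<theta>U frac_add[OF xy, of m n] frac_add'[OF \<theta>U \<theta>U, OF xy, of m n]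
        by (intro conjI bexI[of _ "r \<otimes>\<^bsub>R\<^esub> ?f n \<oplus>\<^bsub>R\<^esub> s \<otimes>\<^bsub>R\<^esub> ?f m"] exI[of _ "m + n"]) simp_all
    qed (use xy in simp)
  next
    fix c x assume x: "x \<in> carrier S"
    obtain r m where r: "r \<in> carrier R" "x \<otimes>\<^bsub>S\<^esub> ?p m = \<phi> r" "\<theta> x \<otimes>\<^bsub>U\<^esub> ?q m = \<chi> r"
      using \<theta>G[OF x] unfolding G_def by blast
    have lin: "\<phi> (c \<odot>\<^bsub>R\<^esub> r) = c \<odot>\<^bsub>S\<^esub> \<phi> r" "\<chi> (c \<odot>\<^bsub>R\<^esub> r) = c \<odot>\<^bsub>U\<^esub> \<chi> r"
      using hom_S \<chi> r(1) by (auto simp: superhom_def)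
    show "\<theta> (c \<odot>\<^bsub>S\<^esub> x) = c \<odot>\<^bsub>U\<^esub> \<theta> x"
    proof (rule \<theta>_eq)
      show "G (c \<odot>\<^bsub>S\<^esub> x) (c \<odot>\<^bsub>U\<^esub> \<theta> x)"
        unfolding G_def using r x \<theta>U lin S.smult_mult_left[of x "?p m" c] U.smult_mult_left[of "\<theta> x" "?q m" c]
        by (intro conjI bexI[of _ "c \<odot>\<^bsub>R\<^esub> r"] exI[of _ m]) simp_all
    qed (use x in simp)
  next
    show "\<theta> \<one>\<^bsub>S\<^esub> = \<one>\<^bsub>U\<^esub>"
    proof (rule \<theta>_eq)
      show "G \<one>\<^bsub>S\<^esub> \<one>\<^bsub>U\<^esub>"
        unfolding G_def by (intro conjI bexI[of _ "\<one>\<^bsub>R\<^esub>"] exI[of _ 0]) simp_all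
    qed simp
  next
    fix y assume "y \<in> \<theta> ` even_part S"
    then show "y \<in> even_part U"
      using exist \<theta>_eq by (metis S.even_carrier imageE)
  next
    fix y assume "y \<in> \<theta> ` odd_part S"
    then show "y \<in> odd_part U"
      using exist \<theta>_eq by (metis S.odd_carrier imageE)
  qed (use \<theta>U in \<open>auto simp: \<theta>_def\<close>)
  moreover have "compose (carrier R) \<theta> \<phi> = \<chi>"
  proof
    fix r
    have "\<theta> (\<phi> r) = \<chi> r" if "r \<in> carrier R"
    proof (rule \<theta>_eq)
      show "G (\<phi> r) (\<chi> r)"
        unfolding G_def using that by (intro conjI bexI[of _ r] exI[of _ 0]) simp_all
    qed (use that in simp)
    then show "compose (carrier R) \<theta> \<phi> r = \<chi> r"
      using \<chi> by (auto simp: compose_def superhom_def extensional_def)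
  qed
  ultimately show ?thesis by blast
qed

end

lemma localization_mapI:
  assumes "superalgebra R" "is_localization R f S \<phi>"
  shows "localization_map R f S \<phi>"
  using assms superhom_superring_hom[of R S \<phi>]
  by (simp add: localization_map_def localization_map_axioms_def is_localization_def)

section \<open>Zariski covers\<close>

text \<open>An ideal of the even part only, since localisation is allowed only at even
  elements.\<close>

definition radical_ideal :: "'u superalg \<Rightarrow> 'u set \<Rightarrow> bool" where
  "radical_ideal R I \<longleftrightarrow> I \<subseteq> even_part R \<and> \<zero>\<^bsub>R\<^esub> \<in> I \<and> (\<forall>x\<in>I. \<forall>y\<in>I. x \<oplus>\<^bsub>R\<^esub> y \<in> I) \<and>
     (\<forall>e\<in>even_part R. \<forall>x\<in>I. e \<otimes>\<^bsub>R\<^esub> x \<in> I) \<and>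
     (\<forall>x\<in>even_part R. \<forall>n::nat. x [^]\<^bsub>R\<^esub> n \<in> I \<longrightarrow> x \<in> I)"

lemma radical_idealD:
  assumes "radical_ideal R I"
  shows "x \<in> I \<Longrightarrow> x \<in> even_part R" "\<zero>\<^bsub>R\<^esub> \<in> I"
    "\<lbrakk>x \<in> I; y \<in> I\<rbrakk> \<Longrightarrow> x \<oplus>\<^bsub>R\<^esub> y \<in> I"
    "\<lbrakk>e \<in> even_part R; x \<in> I\<rbrakk> \<Longrightarrow> e \<otimes>\<^bsub>R\<^esub> x \<in> I"
    "\<lbrakk>x \<in> even_part R; x [^]\<^bsub>R\<^esub> (n::nat) \<in> I\<rbrakk> \<Longrightarrow> x \<in> I"
  using assms unfolding radical_ideal_def by blast+

text \<open>The inverse of \<phi>(f) is a fraction \<phi>(r) / \<phi>(g)^n, so \<phi>(g)^n =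
  \<phi>(f r), and some power of g is a multiple of f in R. Thus membership in a radical ideal
  depends on (S, \<phi>) alone and not on the element inverted.\<close>

lemma localization_radical_ideal:
  assumes R: "superalgebra R" and f: "is_localization R f S \<phi>" and g: "is_localization R g S \<phi>"
    and I: "radical_ideal R I" and "f \<in> I"
  shows "g \<in> I"
proof -
  interpret f: localization_map R f S \<phi> using R f by (rule localization_mapI)
  interpret g: localization_map R g S \<phi> using R g by (rule localization_mapI)
  have "f.S.even_unit (\<phi> f)"
    using f.f_unit by (simp add: f.S.even_unit_iff_Units)
  then obtain v where v: "v \<in> even_part S" "\<phi> f \<otimes>\<^bsub>S\<^esub> v = \<one>\<^bsub>S\<^esub>"
    by (rule f.S.even_unit_inverseE)
  obtain r and n :: nat where r: "r \<in> even_part R" "v \<otimes>\<^bsub>S\<^esub> (\<phi> g [^]\<^bsub>S\<^esub> n) = \<phi> r"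
    using g.even_fractionE[OF v(1)] by blast
  have "\<phi> (g [^]\<^bsub>R\<^esub> n) = \<phi> f \<otimes>\<^bsub>S\<^esub> v \<otimes>\<^bsub>S\<^esub> (\<phi> g [^]\<^bsub>S\<^esub> n)"
    using v by simp
  also have "\<dots> = \<phi> f \<otimes>\<^bsub>S\<^esub> \<phi> r"
    unfolding r(2)[symmetric] using v by (intro f.S.m_assoc) simp_all
  also have "\<dots> = \<phi> (f \<otimes>\<^bsub>R\<^esub> r)"
    using r by simp
  finally obtain m :: nat where m: "(g [^]\<^bsub>R\<^esub> m) \<otimes>\<^bsub>R\<^esub> (g [^]\<^bsub>R\<^esub> n) = (g [^]\<^bsub>R\<^esub> m) \<otimes>\<^bsub>R\<^esub> (f \<otimes>\<^bsub>R\<^esub> r)"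
    using g.kernelE r(1)
    by (metis f.R.even_carrier f.R.m_closed f.R.nat_pow_closed f.f_even g.f_even)
  have "f \<otimes>\<^bsub>R\<^esub> r = r \<otimes>\<^bsub>R\<^esub> f"
    using r by (intro f.R.even_comm) simp_all
  then have "(g [^]\<^bsub>R\<^esub> m) \<otimes>\<^bsub>R\<^esub> (f \<otimes>\<^bsub>R\<^esub> r) \<in> I"
    using radical_idealD(4)[OF I] r(1) \<open>f \<in> I\<close> by simp
  then have "g [^]\<^bsub>R\<^esub> (m + n) \<in> I"
    using m by (simp add: f.R.nat_pow_mult[symmetric])
  then show ?thesis
    using radical_idealD(5)[OF I] by simp
qed

text \<open>This is the usual binomial argument, done by expanding one factor x + y at a
  time.\<close>

lemma (in superring) ideal_radical_add:
  assumes J: "J \<subseteq> even_part S" "\<And>x y. \<lbrakk>x \<in> J; y \<in> J\<rbrakk> \<Longrightarrow> x \<oplus> y \<in> J"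
    "\<And>e x. \<lbrakk>e \<in> even_part S; x \<in> J\<rbrakk> \<Longrightarrow> e \<otimes> x \<in> J"
    and x: "x \<in> even_part S" "x [^] (n::nat) \<in> J" and y: "y \<in> even_part S" "y [^] (m::nat) \<in> J"
  shows "(x \<oplus> y) [^] (n + m) \<in> J"
proof -
  \<comment> \<open>a and b count the factors that may still be spent on x and on y. When one of
    them reaches zero, x^n or y^m is already present and the ideal property finishes.\<close>
  have *: "x [^] i \<otimes> y [^] j \<otimes> (x \<oplus> y) [^] N \<in> J" if "n \<le> i + a" "m \<le> j + b" "N = a + b" for i j a b N :: nat
    using that
  proof (induction N arbitrary: i j a b)
    case 0
    then obtain k where "i = k + n"
      by (metis add.commute add_is_0 le_Suc_ex add_0_right)
    then have "x [^] i \<otimes> y [^] j = x [^] k \<otimes> y [^] j \<otimes> x [^] n"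
      using x(1) y(1) even_comm[of "x [^] n" "y [^] j"] by (simp add: nat_pow_mult[symmetric] m_assoc)
    then show ?case
      using J(3)[of "x [^] k \<otimes> y [^] j"] x y by simp
  next
    case (Suc N)
    let ?z = "(x \<oplus> y) [^] N"
    consider "a > 0" "b > 0" | "a = 0" | "b = 0"
      by blast
    then show ?case
    proof cases
      case 1
      have "x [^] Suc i \<otimes> y [^] j \<otimes> ?z \<in> J"
        using Suc.prems 1 by (intro Suc.IH[of _ "a - 1" _ b]) auto
      moreover have "x [^] i \<otimes> y [^] Suc j \<otimes> ?z \<in> J"
        using Suc.prems 1 by (intro Suc.IH[of _ a _ "b - 1"]) auto
      moreover have "x [^] i \<otimes> y [^] j \<otimes> (x \<oplus> y) [^] Suc N =
          x [^] Suc i \<otimes> y [^] j \<otimes> ?z \<oplus> x [^] i \<otimes> y [^] Suc j \<otimes> ?z"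
      proof -
        have c: "(x \<oplus> y) [^] Suc N = (x \<oplus> y) \<otimes> ?z"
          using x(1) y(1) even_comm[of "x \<oplus> y" ?z] by simp
        have "x [^] i \<otimes> y [^] j \<otimes> x = x [^] Suc i \<otimes> y [^] j"
          using x(1) y(1) even_comm[of "y [^] j" x] by (simp add: m_assoc)
        moreover have "x [^] i \<otimes> y [^] j \<otimes> y = x [^] i \<otimes> y [^] Suc j"
          using x(1) y(1) by (simp add: m_assoc)
        moreover have "x [^] i \<otimes> y [^] j \<otimes> ((x \<oplus> y) \<otimes> ?z) =
          x [^] i \<otimes> y [^] j \<otimes> x \<otimes> ?z \<oplus> x [^] i \<otimes> y [^] j \<otimes> y \<otimes> ?z"
          using x(1) y(1) by (simp add: l_distr r_distr m_assoc)
        ultimately show ?thesis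
          unfolding c by simp
      qed
      ultimately show ?thesis
        using J(2) by simp
    next
      case 2
      then obtain k where "i = k + n"
        using Suc.prems by (metis add.commute add_0_right le_Suc_ex)
      then have "x [^] i \<otimes> y [^] j \<otimes> (x \<oplus> y) [^] Suc N = (x [^] k \<otimes> (y [^] j \<otimes> (x \<oplus> y) [^] Suc N)) \<otimes> x [^] n"
        using x(1) y(1) even_comm[of "x [^] n" "y [^] j \<otimes> (x \<oplus> y) [^] Suc N"]
        by (simp add: nat_pow_mult[symmetric] m_assoc del: nat_pow_Suc)
      then show ?thesis
        using J(3)[of "x [^] k \<otimes> (y [^] j \<otimes> (x \<oplus> y) [^] Suc N)"] x y by simp
    next
      case 3
      then obtain k where "j = k + m"
        using Suc.prems by (metis add.commute add_0_right le_Suc_ex)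
      then have "x [^] i \<otimes> y [^] j \<otimes> (x \<oplus> y) [^] Suc N = (x [^] i \<otimes> (y [^] k \<otimes> (x \<oplus> y) [^] Suc N)) \<otimes> y [^] m"
        using x(1) y(1) even_comm[of "y [^] m" "(x \<oplus> y) [^] Suc N"]
        by (simp add: nat_pow_mult[symmetric] m_assoc del: nat_pow_Suc)
      then show ?thesis
        using J(3)[of "x [^] i \<otimes> (y [^] k \<otimes> (x \<oplus> y) [^] Suc N)"] x y by simp
    qed
  qed
  show ?thesis
    using *[of n 0 m 0 0] *[of 0 n 0 m "n + m"] x(1) y(1) by simp
qed

text \<open>
  A cover is detected by radical ideals, because a localisation at \<open>f\<close> determines the radical of
  the ideal generated by \<open>f\<close>.
\<close>

lemma zariski_cover_iff:
  assumes R: "superalgebra R"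
  shows "zariski_cover R \<C> \<longleftrightarrow> finite \<C> \<and> (\<forall>c\<in>\<C>. \<exists>f. is_localization R f (fst c) (snd c)) \<and>
    (\<forall>I. radical_ideal R I \<and> (\<forall>c\<in>\<C>. \<forall>f. is_localization R f (fst c) (snd c) \<longrightarrow> f \<in> I) \<longrightarrow> \<one>\<^bsub>R\<^esub> \<in> I)"
    (is "_ \<longleftrightarrow> ?R")
proof
  interpret R: superring R by (rule superalgebra_superring[OF R])
  assume "zariski_cover R \<C>"
  then obtain f a where fin: "finite \<C>" and f: "\<And>c. c \<in> \<C> \<Longrightarrow> is_localization R (f c) (fst c) (snd c)"
    and a: "\<And>c. c \<in> \<C> \<Longrightarrow> a c \<in> even_part R" and sum: "(\<Oplus>\<^bsub>R\<^esub>c\<in>\<C>. a c \<otimes>\<^bsub>R\<^esub> f c) = \<one>\<^bsub>R\<^esub>"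
    unfolding zariski_cover_def by blast
  have "\<one>\<^bsub>R\<^esub> \<in> I" if I: "radical_ideal R I" and fI: "\<forall>c\<in>\<C>. \<forall>f. is_localization R f (fst c) (snd c) \<longrightarrow> f \<in> I" for I
  proof -
    have "(\<Oplus>\<^bsub>R\<^esub>c\<in>D. a c \<otimes>\<^bsub>R\<^esub> f c) \<in> I" if "finite D" "D \<subseteq> \<C>" for D
      using that
    proof (induction D)
      case (insert d D)
      have af: "a c \<otimes>\<^bsub>R\<^esub> f c \<in> I" if "c \<in> insert d D" for c
      proof -
        have "c \<in> \<C>"
          using that insert.prems by blast
        then show ?thesis
          using a f fI radical_idealD(4)[OF I, of "a c" "f c"] by blast
      qed
      then have "a c \<otimes>\<^bsub>R\<^esub> f c \<in> carrier R" if "c \<in> insert d D" for c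
        using that radical_idealD(1)[OF I] by simp
      then have "(\<Oplus>\<^bsub>R\<^esub>c\<in>insert d D. a c \<otimes>\<^bsub>R\<^esub> f c) = a d \<otimes>\<^bsub>R\<^esub> f d \<oplus>\<^bsub>R\<^esub> (\<Oplus>\<^bsub>R\<^esub>c\<in>D. a c \<otimes>\<^bsub>R\<^esub> f c)"
        using insert.hyps by (intro R.finsum_insert) auto
      then show ?case
        using af insert.IH insert.prems radical_idealD(3)[OF I] by simp
    qed (simp add: radical_idealD[OF I])
    then show ?thesis
      using fin sum by force
  qed
  then show ?R
    using fin f by blast
next
  interpret R: superring R by (rule superalgebra_superring[OF R])
  assume ?R
  then have fin: "finite \<C>" and ex: "\<forall>c\<in>\<C>. \<exists>f. is_localization R f (fst c) (snd c)"
    and unit: "\<And>I. \<lbrakk>radical_ideal R I; \<forall>c\<in>\<C>. \<forall>f. is_localization R f (fst c) (snd c) \<longrightarrow> f \<in> I\<rbrakk> \<Longrightarrow> \<one>\<^bsub>R\<^esub> \<in> I"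
    by blast+
  obtain f where f: "\<And>c. c \<in> \<C> \<Longrightarrow> is_localization R (f c) (fst c) (snd c)"
    using ex by metis
  then have fe: "f c \<in> even_part R" if "c \<in> \<C>" for c
    using that by (auto simp: is_localization_def)
  \<comment> \<open>The ideal generated by one chosen element for each member of the family. If 1
    lies in its radical then it lies in J, and that is the equation required of a cover.\<close>
  define J where "J = {(\<Oplus>\<^bsub>R\<^esub>c\<in>\<C>. a c \<otimes>\<^bsub>R\<^esub> f c) | a. \<forall>c\<in>\<C>. a c \<in> even_part R}"
  have JI: "x \<in> J" if "x = (\<Oplus>\<^bsub>R\<^esub>c\<in>\<C>. a c \<otimes>\<^bsub>R\<^esub> f c)" "\<And>c. c \<in> \<C> \<Longrightarrow> a c \<in> even_part R" for x a
    unfolding J_def using that by blast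
  have J1: "J \<subseteq> even_part R"
    using fe by (auto simp: J_def intro!: R.finsum_even)
  have J2: "x \<oplus>\<^bsub>R\<^esub> y \<in> J" if xy: "x \<in> J" "y \<in> J" for x y
  proof -
    obtain a b where ab: "\<forall>c\<in>\<C>. a c \<in> even_part R" "\<forall>c\<in>\<C>. b c \<in> even_part R"
      "x = (\<Oplus>\<^bsub>R\<^esub>c\<in>\<C>. a c \<otimes>\<^bsub>R\<^esub> f c)" "y = (\<Oplus>\<^bsub>R\<^esub>c\<in>\<C>. b c \<otimes>\<^bsub>R\<^esub> f c)"
      using xy unfolding J_def by blast
    have "x \<oplus>\<^bsub>R\<^esub> y = (\<Oplus>\<^bsub>R\<^esub>c\<in>\<C>. a c \<otimes>\<^bsub>R\<^esub> f c \<oplus>\<^bsub>R\<^esub> b c \<otimes>\<^bsub>R\<^esub> f c)"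
      unfolding ab(3,4) using ab(1,2) fe by (intro R.finsum_addf[symmetric]) auto
    also have "\<dots> = (\<Oplus>\<^bsub>R\<^esub>c\<in>\<C>. (a c \<oplus>\<^bsub>R\<^esub> b c) \<otimes>\<^bsub>R\<^esub> f c)"
      using ab(1,2) fe by (intro R.finsum_cong') (auto simp: R.l_distr)
    finally show ?thesis
      by (rule JI) (use ab(1,2) in simp)
  qed
  have J3: "e \<otimes>\<^bsub>R\<^esub> x \<in> J" if ex: "e \<in> even_part R" "x \<in> J" for e x
  proof -
    obtain a where a: "\<forall>c\<in>\<C>. a c \<in> even_part R" "x = (\<Oplus>\<^bsub>R\<^esub>c\<in>\<C>. a c \<otimes>\<^bsub>R\<^esub> f c)"
      using ex unfolding J_def by blast
    have "e \<otimes>\<^bsub>R\<^esub> x = (\<Oplus>\<^bsub>R\<^esub>c\<in>\<C>. e \<otimes>\<^bsub>R\<^esub> (a c \<otimes>\<^bsub>R\<^esub> f c))"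
      unfolding a(2) using ex a(1) fe fin by (intro R.finsum_rdistr) auto
    also have "\<dots> = (\<Oplus>\<^bsub>R\<^esub>c\<in>\<C>. (e \<otimes>\<^bsub>R\<^esub> a c) \<otimes>\<^bsub>R\<^esub> f c)"
      using ex a(1) fe by (intro R.finsum_cong') (auto simp: R.m_assoc)
    finally show ?thesis
      by (rule JI) (use a(1) ex(1) in simp)
  qed
  have fJ: "f d \<in> J" if "d \<in> \<C>" for d
  proof -
    have "(\<Oplus>\<^bsub>R\<^esub>c\<in>\<C>. (if d = c then f c else \<zero>\<^bsub>R\<^esub>)) = f d"
      using that fin fe by (intro R.add.finprod_singleton) auto
    moreover have "(\<Oplus>\<^bsub>R\<^esub>c\<in>\<C>. (if d = c then f c else \<zero>\<^bsub>R\<^esub>)) = (\<Oplus>\<^bsub>R\<^esub>c\<in>\<C>. (if d = c then \<one>\<^bsub>R\<^esub> else \<zero>\<^bsub>R\<^esub>) \<otimes>\<^bsub>R\<^esub> f c)"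
      using fe by (intro R.finsum_cong') auto
    ultimately show ?thesis
      by (intro JI[of _ "\<lambda>c. if d = c then \<one>\<^bsub>R\<^esub> else \<zero>\<^bsub>R\<^esub>"]) simp_all
  qed
  have J0: "\<zero>\<^bsub>R\<^esub> \<in> J"
  proof (rule JI[of _ "\<lambda>_. \<zero>\<^bsub>R\<^esub>"])
    have "(\<Oplus>\<^bsub>R\<^esub>c\<in>\<C>. \<zero>\<^bsub>R\<^esub> \<otimes>\<^bsub>R\<^esub> f c) = (\<Oplus>\<^bsub>R\<^esub>c\<in>\<C>. \<zero>\<^bsub>R\<^esub>)"
      using fe by (intro R.finsum_cong') auto
    then show "\<zero>\<^bsub>R\<^esub> = (\<Oplus>\<^bsub>R\<^esub>c\<in>\<C>. \<zero>\<^bsub>R\<^esub> \<otimes>\<^bsub>R\<^esub> f c)"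
      by simp
  qed simp
  define I where "I = {x \<in> even_part R. \<exists>n::nat. x [^]\<^bsub>R\<^esub> n \<in> J}"
  have II: "x \<in> I" if "x [^]\<^bsub>R\<^esub> n \<in> J" "x \<in> even_part R" for x and n :: nat
    unfolding I_def using that by blast
  have I: "radical_ideal R I"
    unfolding radical_ideal_def
  proof (intro conjI ballI allI impI)
    show "\<zero>\<^bsub>R\<^esub> \<in> I"
      unfolding I_def using J0 by (auto intro!: exI[of _ 1])
    show "x \<oplus>\<^bsub>R\<^esub> y \<in> I" if xy: "x \<in> I" "y \<in> I" for x y
    proof -
      obtain n m :: nat where nm: "x \<in> even_part R" "x [^]\<^bsub>R\<^esub> n \<in> J" "y \<in> even_part R" "y [^]\<^bsub>R\<^esub> m \<in> J"
        using xy unfolding I_def by blast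
      have "(x \<oplus>\<^bsub>R\<^esub> y) [^]\<^bsub>R\<^esub> (n + m) \<in> J"
        by (rule R.ideal_radical_add[OF J1]) (fact J2 J3 nm)+
      then show ?thesis
        using nm(1,3) by (intro II) simp_all
    qed
    show "e \<otimes>\<^bsub>R\<^esub> x \<in> I" if ex: "e \<in> even_part R" "x \<in> I" for e x
    proof -
      obtain n :: nat where "x \<in> even_part R" "x [^]\<^bsub>R\<^esub> n \<in> J"
        using ex unfolding I_def by blast
      moreover have "(e \<otimes>\<^bsub>R\<^esub> x) [^]\<^bsub>R\<^esub> n = (e [^]\<^bsub>R\<^esub> n) \<otimes>\<^bsub>R\<^esub> (x [^]\<^bsub>R\<^esub> n)" if "x \<in> even_part R"
        using ex that by (intro R.pow_mult_distrib) (auto intro: R.even_comm)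
      ultimately have "(e \<otimes>\<^bsub>R\<^esub> x) [^]\<^bsub>R\<^esub> n \<in> J"
        using ex(1) J3 by simp
      then show ?thesis
        using ex(1) \<open>x \<in> even_part R\<close> by (intro II) simp_all
    qed
    show "x \<in> I" if "x \<in> even_part R" "x [^]\<^bsub>R\<^esub> (n::nat) \<in> I" for x n
      using that unfolding I_def by (auto simp: R.nat_pow_pow)
  qed (auto simp: I_def)
  have "f c \<in> I" if "c \<in> \<C>" for c
    using fJ[OF that] fe[OF that] by (intro II[of _ 1]) simp_all
  \<comment> \<open>The radical contains only the chosen elements by construction; every other
    element with the same localisation follows by \<open>localization_radical_ideal\<close>.\<close>
  then have "\<forall>c\<in>\<C>. \<forall>g. is_localization R g (fst c) (snd c) \<longrightarrow> g \<in> I"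
    using localization_radical_ideal[OF R f _ I] by blast
  then have "\<one>\<^bsub>R\<^esub> \<in> I"
    by (rule unit[OF I])
  then have "\<one>\<^bsub>R\<^esub> \<in> J"
    unfolding I_def by simp
  then show "zariski_cover R \<C>"
    unfolding zariski_cover_def J_def using fin f by force
qed

section \<open>Construction of covers: two basic opens, base change, transitivity\<close>

lemma is_localization_unit:
  assumes "superalgebra R" "f \<in> even_part R" "f \<in> Units R"
  shows "is_localization R f R (\<lambda>x\<in>carrier R. x)"
proof -
  interpret R: test_algebra R by (rule superalgebra_test_algebra[OF assms(1)])
  show ?thesis
    using assms superhom_id[OF assms(1)] unfolding is_localization_def
    by (auto intro: bexI[of _ s for s] exI[of _ 0])
qed

lemma zariski_cover_trivial:
  assumes "superalgebra R"
  shows "zariski_cover R {(R, \<lambda>x\<in>carrier R. x)}"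
proof -
  interpret R: test_algebra R by (rule superalgebra_test_algebra[OF assms])
  show ?thesis
    using is_localization_unit[OF assms R.even_one] unfolding zariski_cover_iff[OF assms] by auto
qed

text \<open>The criterion by radical ideals is insensitive to the two localisations being the same
  pair (S, \<phi>), in which case the sum in the definition of a cover would have a single
  term.\<close>

lemma zariski_cover_pair:
  assumes R: "superalgebra R" and ab: "a \<in> even_part R" "b \<in> even_part R" "x \<in> even_part R" "y \<in> even_part R"
    and eq: "x \<otimes>\<^bsub>R\<^esub> a \<oplus>\<^bsub>R\<^esub> y \<otimes>\<^bsub>R\<^esub> b = \<one>\<^bsub>R\<^esub>"
  shows "\<exists>\<C>. zariski_cover R \<C> \<and> (\<forall>(S, \<phi>)\<in>\<C>. \<phi> a \<in> Units S \<or> \<phi> b \<in> Units S)"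
proof -
  obtain S \<phi> where S: "is_localization R a S \<phi>"
    using localization_exists[OF R ab(1)] by blast
  obtain T \<psi> where T: "is_localization R b T \<psi>"
    using localization_exists[OF R ab(2)] by blast
  have "\<one>\<^bsub>R\<^esub> \<in> I" if "radical_ideal R I" "a \<in> I" "b \<in> I" for I
    using radical_idealD(3,4)[OF that(1)] that ab eq by metis
  then have "zariski_cover R {(S, \<phi>), (T, \<psi>)}"
    unfolding zariski_cover_iff[OF R] using S T by auto
  moreover have "\<phi> a \<in> Units S" "\<psi> b \<in> Units T"
    using S T by (simp_all add: is_localization_def)
  ultimately show ?thesis
    by (intro exI[of _ "{(S, \<phi>), (T, \<psi>)}"]) auto
qed

lemma zariski_cover_member:
  assumes "zariski_cover R \<C>" "(S, \<phi>) \<in> \<C>"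
  shows "superalgebra S" "\<phi> \<in> superhom R S"
  using assms unfolding zariski_cover_def is_localization_def by force+

text \<open>S is localised at the images of the elements that define the given cover; the preimage
  of a radical ideal is radical, so this is a cover. The universal property over R supplies
  \<theta>.\<close>

lemma zariski_cover_pullback:
  assumes R: "superalgebra R" and S: "superalgebra S" and \<rho>: "\<rho> \<in> superhom R S"
    and \<C>: "zariski_cover R \<C>"
  shows "\<exists>\<D>. zariski_cover S \<D> \<and> (\<forall>(T', \<psi>)\<in>\<D>. \<exists>(T, \<phi>)\<in>\<C>. \<exists>\<theta>\<in>superhom T T'.
    compose (carrier R) \<psi> \<rho> = compose (carrier R) \<theta> \<phi>)"
proof -
  interpret \<rho>: superring_hom R S \<rho> by (rule superhom_superring_hom) fact+
  have fin: "finite \<C>" and ex: "\<forall>c\<in>\<C>. \<exists>f. is_localization R f (fst c) (snd c)"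
    and unit: "\<And>I. \<lbrakk>radical_ideal R I; \<forall>c\<in>\<C>. \<forall>f. is_localization R f (fst c) (snd c) \<longrightarrow> f \<in> I\<rbrakk> \<Longrightarrow> \<one>\<^bsub>R\<^esub> \<in> I"
    using \<C> unfolding zariski_cover_iff[OF R] by blast+
  obtain f where f: "\<And>c. c \<in> \<C> \<Longrightarrow> is_localization R (f c) (fst c) (snd c)"
    using ex by metis
  have "\<forall>c\<in>\<C>. \<exists>d. is_localization S (\<rho> (f c)) (fst d) (snd d)"
    using f localization_exists[OF S] unfolding is_localization_def by (metis \<rho>.hom_simps(4) fst_conv snd_conv)
  then obtain d where d: "\<And>c. c \<in> \<C> \<Longrightarrow> is_localization S (\<rho> (f c)) (fst (d c)) (snd (d c))"
    by metis
  have "zariski_cover S (d ` \<C>)"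
    unfolding zariski_cover_iff[OF S]
  proof (intro conjI allI impI)
    fix I assume I: "radical_ideal S I \<and> (\<forall>c\<in>d ` \<C>. \<forall>f. is_localization S f (fst c) (snd c) \<longrightarrow> f \<in> I)"
    let ?I = "{x \<in> even_part R. \<rho> x \<in> I}"
    note D = radical_idealD[OF conjunct1[OF I]]
    have rad: "radical_ideal R ?I"
      unfolding radical_ideal_def
    proof (intro conjI ballI allI impI)
      show "x \<in> ?I" if "x \<in> even_part R" "x [^]\<^bsub>R\<^esub> n \<in> ?I" for x and n :: nat
        using that D(5)[of "\<rho> x" n] by simp
    qed (use D(2-4) in auto)
    have "f c \<in> ?I" if "c \<in> \<C>" for c
      using I d[OF that] f[OF that] that by (auto simp: is_localization_def)
    then have "\<forall>c\<in>\<C>. \<forall>g. is_localization R g (fst c) (snd c) \<longrightarrow> g \<in> ?I"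
      using localization_radical_ideal[OF R f _ rad] by blast
    then have "\<one>\<^bsub>R\<^esub> \<in> ?I"
      by (rule unit[OF rad])
    then show "\<one>\<^bsub>S\<^esub> \<in> I" by simp
  qed (use fin d in auto)
  moreover have "\<exists>(T, \<phi>)\<in>\<C>. \<exists>\<theta>\<in>superhom T T'. compose (carrier R) \<psi> \<rho> = compose (carrier R) \<theta> \<phi>"
    if T': "(T', \<psi>) \<in> d ` \<C>" for T' \<psi>
  proof -
    obtain c where c: "c \<in> \<C>" "d c = (T', \<psi>)"
      using T' by (metis imageE)
    interpret c: localization_map R "f c" "fst c" "snd c"
      by (rule localization_mapI[OF R f[OF c(1)]])
    interpret d: localization_map S "\<rho> (f c)" T' \<psi>
      using d[OF c(1)] unfolding c(2) by (intro localization_mapI S) simp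
    obtain \<theta> where "\<theta> \<in> superhom (fst c) T'" "compose (carrier R) \<theta> (snd c) = compose (carrier R) \<psi> \<rho>"
      using c.localization_extend[OF d.S_alg superhom_compose[OF R S d.S_alg \<rho> d.hom_S]] d.f_unit
      by (auto simp: compose_def)
    then show ?thesis
      using c(1) by (intro bexI[of _ c]) (auto split: prod.splits intro!: bexI[of _ \<theta>])
  qed
  ultimately show ?thesis by blast
qed

text \<open>Here g is the fraction r / f^n. Inverting f and then g amounts to inverting f r.\<close>

lemma localization_compose:
  assumes R: "superalgebra R" and S: "is_localization R f S \<phi>" and T: "is_localization S g T \<psi>"
    and r: "r \<in> even_part R" "g \<otimes>\<^bsub>S\<^esub> (\<phi> f [^]\<^bsub>S\<^esub> (n::nat)) = \<phi> r"
  shows "is_localization R (f \<otimes>\<^bsub>R\<^esub> r) T (compose (carrier R) \<psi> \<phi>)"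
proof -
  interpret S: localization_map R f S \<phi> by (rule localization_mapI[OF R S])
  interpret T: localization_map S g T \<psi> by (rule localization_mapI[OF S.S_alg T])
  let ?\<chi> = "compose (carrier R) \<psi> \<phi>" and ?h = "f \<otimes>\<^bsub>R\<^esub> r"
  interpret \<chi>: superring_hom R T ?\<chi>
    by (intro superhom_superring_hom R T.S_alg superhom_compose[OF R S.S_alg T.S_alg S.hom_S T.hom_S])
  have \<chi>: "?\<chi> x = \<psi> (\<phi> x)" if "x \<in> carrier R" for x
    using that by (simp add: compose_def)
  have fu: "\<psi> (\<phi> f) \<in> Units T"
  proof -
    have "S.S.even_unit (\<phi> f)"
      using S.f_unit by (simp add: S.S.even_unit_iff_Units)
    then have "T.S.even_unit (\<psi> (\<phi> f))"
      by (rule T.hom_even_unit)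
    then show ?thesis
      by (simp add: T.S.even_unit_iff_Units)
  qed
  have pow: "x [^]\<^bsub>T\<^esub> (m::nat) \<in> Units T" if "x \<in> Units T" for x m
    using that by (induction m) simp_all
  have "\<psi> (\<phi> r) = \<psi> g \<otimes>\<^bsub>T\<^esub> (\<psi> (\<phi> f) [^]\<^bsub>T\<^esub> n)"
    by (simp flip: r(2))
  then have ru: "\<psi> (\<phi> r) \<in> Units T"
    using T.f_unit pow[OF fu] by simp
  have hu: "?\<chi> ?h \<in> Units T"
    using fu ru r(1) by (simp add: \<chi>)
  have surj: "\<exists>x\<in>carrier R. \<exists>m::nat. s \<otimes>\<^bsub>T\<^esub> (?\<chi> ?h [^]\<^bsub>T\<^esub> m) = ?\<chi> x" if s: "s \<in> carrier T" for s
  proof -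
    obtain y and a :: nat where y: "y \<in> carrier S" "s \<otimes>\<^bsub>T\<^esub> (\<psi> g [^]\<^bsub>T\<^esub> a) = \<psi> y"
      using T.fractionE[OF s] by blast
    obtain x and b :: nat where x: "x \<in> carrier R" "y \<otimes>\<^bsub>S\<^esub> (\<phi> f [^]\<^bsub>S\<^esub> b) = \<phi> x"
      using S.fractionE[OF y(1)] by blast
    define c where "c = \<psi> (\<phi> f)"
    define d where "d = \<psi> g"
    have cd: "c \<in> even_part T" "d \<in> even_part T"
      by (simp_all add: c_def d_def)
    \<comment> \<open>The image of f r is c c^n d, because r maps to d c^n.\<close>
    have hpow: "?\<chi> ?h [^]\<^bsub>T\<^esub> m = (c [^]\<^bsub>T\<^esub> (m + n * m)) \<otimes>\<^bsub>T\<^esub> (d [^]\<^bsub>T\<^esub> m)" for m :: nat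
    proof -
      have "?\<chi> ?h = c \<otimes>\<^bsub>T\<^esub> (c [^]\<^bsub>T\<^esub> n) \<otimes>\<^bsub>T\<^esub> d"
        using r(1) \<open>\<psi> (\<phi> r) = _\<close> cd T.S.even_comm[of d "c [^]\<^bsub>T\<^esub> n"]
        by (simp add: \<chi> T.S.m_assoc flip: c_def d_def)
      also have "\<dots> [^]\<^bsub>T\<^esub> m = ((c \<otimes>\<^bsub>T\<^esub> (c [^]\<^bsub>T\<^esub> n)) [^]\<^bsub>T\<^esub> m) \<otimes>\<^bsub>T\<^esub> (d [^]\<^bsub>T\<^esub> m)"
        using cd by (intro T.S.pow_mult_distrib T.S.even_comm) simp_all
      also have "(c \<otimes>\<^bsub>T\<^esub> (c [^]\<^bsub>T\<^esub> n)) [^]\<^bsub>T\<^esub> m = (c [^]\<^bsub>T\<^esub> m) \<otimes>\<^bsub>T\<^esub> ((c [^]\<^bsub>T\<^esub> n) [^]\<^bsub>T\<^esub> m)"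
        using cd by (intro T.S.pow_mult_distrib T.S.even_comm) simp_all
      also have "\<dots> = c [^]\<^bsub>T\<^esub> (m + n * m)"
        using cd by (simp add: T.S.nat_pow_pow T.S.nat_pow_mult)
      finally show ?thesis .
    qed
    let ?m = "a + b" and ?M = "a + n * (a + b)"
    \<comment> \<open>The surplus of the (a + b)-th power of the image of f r after d^a and c^b have
      been spent on clearing the denominators of s. It comes from R: the exponent of c contains n b,
      and d^b c^(n b) is the image of r^b.\<close>
    define e where "e = (c [^]\<^bsub>T\<^esub> ?M) \<otimes>\<^bsub>T\<^esub> (d [^]\<^bsub>T\<^esub> b)"
    have split: "c [^]\<^bsub>T\<^esub> (?m + n * ?m) = (c [^]\<^bsub>T\<^esub> ?M) \<otimes>\<^bsub>T\<^esub> (c [^]\<^bsub>T\<^esub> b)"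
      "d [^]\<^bsub>T\<^esub> ?m = (d [^]\<^bsub>T\<^esub> b) \<otimes>\<^bsub>T\<^esub> (d [^]\<^bsub>T\<^esub> a)"
      using cd by (simp_all add: T.S.nat_pow_mult add_ac)
    have ee: "e = \<psi> (g [^]\<^bsub>S\<^esub> b \<otimes>\<^bsub>S\<^esub> (\<phi> f [^]\<^bsub>S\<^esub> ?M))"
      using cd T.S.even_comm by (simp add: e_def c_def d_def)
    have "\<exists>z\<in>carrier R. e = \<psi> (\<phi> z)"
    proof -
      have ge: "(g [^]\<^bsub>S\<^esub> b) \<otimes>\<^bsub>S\<^esub> (\<phi> f [^]\<^bsub>S\<^esub> (n * b)) = \<phi> (r [^]\<^bsub>R\<^esub> b)"
      proof -
        have "\<phi> (r [^]\<^bsub>R\<^esub> b) = (g \<otimes>\<^bsub>S\<^esub> (\<phi> f [^]\<^bsub>S\<^esub> n)) [^]\<^bsub>S\<^esub> b"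
          using r by simp
        also have "\<dots> = (g [^]\<^bsub>S\<^esub> b) \<otimes>\<^bsub>S\<^esub> ((\<phi> f [^]\<^bsub>S\<^esub> n) [^]\<^bsub>S\<^esub> b)"
          by (intro S.S.pow_mult_distrib S.S.even_comm) simp_all
        finally show ?thesis
          by (simp add: S.S.nat_pow_pow)
      qed
      have "?M = n * b + (a + n * a)"
        by (simp add: distrib_left)
      then have "e = \<psi> ((g [^]\<^bsub>S\<^esub> b) \<otimes>\<^bsub>S\<^esub> (\<phi> f [^]\<^bsub>S\<^esub> (n * b)) \<otimes>\<^bsub>S\<^esub> (\<phi> f [^]\<^bsub>S\<^esub> (a + n * a)))"
        unfolding ee by (simp add: S.S.m_assoc S.S.nat_pow_mult add_ac del: T.hom_simps)
      then have "e = \<psi> (\<phi> ((r [^]\<^bsub>R\<^esub> b) \<otimes>\<^bsub>R\<^esub> (f [^]\<^bsub>R\<^esub> (a + n * a))))"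
        unfolding ge using r(1) by simp
      then show ?thesis
        using r(1) by (intro bexI[of _ "(r [^]\<^bsub>R\<^esub> b) \<otimes>\<^bsub>R\<^esub> (f [^]\<^bsub>R\<^esub> (a + n * a))"]) simp_all
    qed
    then obtain z where z: "z \<in> carrier R" "e = \<psi> (\<phi> z)"
      by blast
    have ze: "e \<in> even_part T"
      using cd by (simp add: e_def)
    have "s \<otimes>\<^bsub>T\<^esub> (?\<chi> ?h [^]\<^bsub>T\<^esub> ?m) = s \<otimes>\<^bsub>T\<^esub> (d [^]\<^bsub>T\<^esub> a) \<otimes>\<^bsub>T\<^esub> (c [^]\<^bsub>T\<^esub> b) \<otimes>\<^bsub>T\<^esub> e"
    proof -
      have 1: "x1 \<otimes>\<^bsub>T\<^esub> x2 \<otimes>\<^bsub>T\<^esub> (x3 \<otimes>\<^bsub>T\<^esub> x4) = x4 \<otimes>\<^bsub>T\<^esub> x2 \<otimes>\<^bsub>T\<^esub> (x1 \<otimes>\<^bsub>T\<^esub> x3)"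
        if "x1 \<in> even_part T" "x2 \<in> even_part T" "x3 \<in> even_part T" "x4 \<in> even_part T" for x1 x2 x3 x4
      proof -
        interpret E: cring "T.S.even_ring" by (rule T.S.even_cring)
        show ?thesis
          using that E.m_assoc E.m_comm E.m_lcomm by simp
      qed
      show ?thesis
        unfolding hpow split e_def using cd s 1 by (simp add: T.S.m_assoc)
    qed
    also have "\<dots> = \<psi> (y \<otimes>\<^bsub>S\<^esub> (\<phi> f [^]\<^bsub>S\<^esub> b)) \<otimes>\<^bsub>T\<^esub> e"
      using y by (simp add: c_def d_def)
    also have "\<dots> = ?\<chi> (x \<otimes>\<^bsub>R\<^esub> z)"
      unfolding x(2) z(2) using x(1) z(1) by (simp add: \<chi>)
    finally show ?thesis
      using x(1) z(1) by blast
  qed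
  have ker: "\<exists>m::nat. (?h [^]\<^bsub>R\<^esub> m) \<otimes>\<^bsub>R\<^esub> x = \<zero>\<^bsub>R\<^esub>" if x: "x \<in> carrier R" "?\<chi> x = \<zero>\<^bsub>T\<^esub>" for x
  proof -
    have "\<psi> (\<phi> x) = \<psi> \<zero>\<^bsub>S\<^esub>"
      using x by (simp add: \<chi>)
    then obtain m :: nat where m: "(g [^]\<^bsub>S\<^esub> m) \<otimes>\<^bsub>S\<^esub> \<phi> x = (g [^]\<^bsub>S\<^esub> m) \<otimes>\<^bsub>S\<^esub> \<zero>\<^bsub>S\<^esub>"
      using T.kernelE[of "\<phi> x" "\<zero>\<^bsub>S\<^esub>"] x(1) by auto
    have "\<phi> ((r [^]\<^bsub>R\<^esub> m) \<otimes>\<^bsub>R\<^esub> x) = ((g \<otimes>\<^bsub>S\<^esub> (\<phi> f [^]\<^bsub>S\<^esub> n)) [^]\<^bsub>S\<^esub> m) \<otimes>\<^bsub>S\<^esub> \<phi> x"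
      using r x by simp
    also have "(g \<otimes>\<^bsub>S\<^esub> (\<phi> f [^]\<^bsub>S\<^esub> n)) [^]\<^bsub>S\<^esub> m = ((\<phi> f [^]\<^bsub>S\<^esub> n) \<otimes>\<^bsub>S\<^esub> g) [^]\<^bsub>S\<^esub> m"
      using S.S.even_comm[of g "\<phi> f [^]\<^bsub>S\<^esub> n"] by simp
    also have "\<dots> = ((\<phi> f [^]\<^bsub>S\<^esub> n) [^]\<^bsub>S\<^esub> m) \<otimes>\<^bsub>S\<^esub> (g [^]\<^bsub>S\<^esub> m)"
      by (intro S.S.pow_mult_distrib S.S.even_comm) simp_all
    also have "\<dots> \<otimes>\<^bsub>S\<^esub> \<phi> x = \<phi> \<zero>\<^bsub>R\<^esub>"
      using m x by (simp add: S.S.m_assoc)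
    finally obtain q :: nat where q: "(f [^]\<^bsub>R\<^esub> q) \<otimes>\<^bsub>R\<^esub> ((r [^]\<^bsub>R\<^esub> m) \<otimes>\<^bsub>R\<^esub> x) = (f [^]\<^bsub>R\<^esub> q) \<otimes>\<^bsub>R\<^esub> \<zero>\<^bsub>R\<^esub>"
      using S.kernelE[of "(r [^]\<^bsub>R\<^esub> m) \<otimes>\<^bsub>R\<^esub> x" "\<zero>\<^bsub>R\<^esub>"] x(1) r(1) by auto
    have "(?h [^]\<^bsub>R\<^esub> (q + m)) = (f [^]\<^bsub>R\<^esub> (q + m)) \<otimes>\<^bsub>R\<^esub> (r [^]\<^bsub>R\<^esub> (q + m))"
      using r(1) by (intro S.R.pow_mult_distrib S.R.even_comm) simp_all
    also have "\<dots> = ((f [^]\<^bsub>R\<^esub> m) \<otimes>\<^bsub>R\<^esub> (f [^]\<^bsub>R\<^esub> q)) \<otimes>\<^bsub>R\<^esub> ((r [^]\<^bsub>R\<^esub> q) \<otimes>\<^bsub>R\<^esub> (r [^]\<^bsub>R\<^esub> m))"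
      using r(1) by (simp add: S.R.nat_pow_mult add.commute)
    also have "\<dots> = (f [^]\<^bsub>R\<^esub> m) \<otimes>\<^bsub>R\<^esub> ((r [^]\<^bsub>R\<^esub> q) \<otimes>\<^bsub>R\<^esub> ((f [^]\<^bsub>R\<^esub> q) \<otimes>\<^bsub>R\<^esub> (r [^]\<^bsub>R\<^esub> m)))"
      using r(1) S.R.even_lcomm[of "r [^]\<^bsub>R\<^esub> q" "f [^]\<^bsub>R\<^esub> q" "r [^]\<^bsub>R\<^esub> m"] by (simp add: S.R.m_assoc)
    finally have "(?h [^]\<^bsub>R\<^esub> (q + m)) \<otimes>\<^bsub>R\<^esub> x = \<zero>\<^bsub>R\<^esub>"
      using q x(1) r(1) by (simp add: S.R.m_assoc)
    then show ?thesis by blast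
  qed
  show ?thesis
    unfolding is_localization_def
    using T.S_alg superhom_compose[OF R S.S_alg T.S_alg S.hom_S T.hom_S] hu surj ker r(1) by auto
qed

text \<open>Let I be a radical ideal containing every element whose localisation is a composite. For
  a member inverting f, the fractions whose numerator r satisfies f r in I form a radical ideal over
  that member. It contains the elements of the second cover, hence 1, and this forces f into
  I.\<close>

lemma zariski_cover_compose:
  assumes R: "superalgebra R" and \<C>: "zariski_cover R \<C>"
    and \<D>: "\<And>c. c \<in> \<C> \<Longrightarrow> zariski_cover (fst c) (\<D> c)"
  shows "zariski_cover R (\<Union>c\<in>\<C>. (\<lambda>d. (fst d, compose (carrier R) (snd d) (snd c))) ` \<D> c)"
    (is "zariski_cover R ?\<E>")
proof -
  have fin: "finite \<C>" and ex: "\<forall>c\<in>\<C>. \<exists>f. is_localization R f (fst c) (snd c)"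
    and unit: "\<And>I. \<lbrakk>radical_ideal R I; \<forall>c\<in>\<C>. \<forall>f. is_localization R f (fst c) (snd c) \<longrightarrow> f \<in> I\<rbrakk> \<Longrightarrow> \<one>\<^bsub>R\<^esub> \<in> I"
    using \<C> unfolding zariski_cover_iff[OF R] by blast+
  have alg: "superalgebra (fst c)" if "c \<in> \<C>" for c
    using zariski_cover_member[OF \<C>] that by (metis prod.collapse)
  have D: "finite (\<D> c)" "\<forall>d\<in>\<D> c. \<exists>f. is_localization (fst c) f (fst d) (snd d)"
    "\<lbrakk>radical_ideal (fst c) I; \<forall>d\<in>\<D> c. \<forall>f. is_localization (fst c) f (fst d) (snd d) \<longrightarrow> f \<in> I\<rbrakk> \<Longrightarrow> \<one>\<^bsub>fst c\<^esub> \<in> I"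
    if "c \<in> \<C>" for c I
    using \<D>[OF that] unfolding zariski_cover_iff[OF alg[OF that]] by blast+
  show ?thesis
    unfolding zariski_cover_iff[OF R]
  proof (intro conjI ballI allI impI)
    show "finite ?\<E>"
      using fin D(1) by blast
  next
    fix e assume "e \<in> ?\<E>"
    then obtain c d where cd: "c \<in> \<C>" "d \<in> \<D> c" "e = (fst d, compose (carrier R) (snd d) (snd c))"
      by blast
    obtain f g where f: "is_localization R f (fst c) (snd c)" and g: "is_localization (fst c) g (fst d) (snd d)"
      using ex D(2)[OF cd(1)] cd by blast
    interpret localization_map R f "fst c" "snd c" by (rule localization_mapI[OF R f])
    obtain r and n :: nat where "r \<in> even_part R" "g \<otimes>\<^bsub>fst c\<^esub> (snd c f [^]\<^bsub>fst c\<^esub> n) = snd c r"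
      using even_fractionE g unfolding is_localization_def by metis
    then show "\<exists>f. is_localization R f (fst e) (snd e)"
      using localization_compose[OF R f g] cd(3) by auto
  next
    fix I assume I: "radical_ideal R I \<and> (\<forall>e\<in>?\<E>. \<forall>f. is_localization R f (fst e) (snd e) \<longrightarrow> f \<in> I)"
    note Irad = radical_idealD[OF conjunct1[OF I]]
    have "f \<in> I" if c: "c \<in> \<C>" and f: "is_localization R f (fst c) (snd c)" for c f
    proof -
      let ?S = "fst c" and ?\<phi> = "snd c"
      interpret localization_map R f ?S ?\<phi> by (rule localization_mapI[OF R f])
      define q where "q = (\<lambda>n::nat. ?\<phi> f [^]\<^bsub>?S\<^esub> n)"
      have q: "q n \<in> even_part ?S" "q n = ?\<phi> (f [^]\<^bsub>R\<^esub> n)" "q m \<otimes>\<^bsub>?S\<^esub> q n = q (m + n)" for m n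
        by (simp_all add: q_def S.nat_pow_mult)
      have qm: "(x \<otimes>\<^bsub>?S\<^esub> q m) \<otimes>\<^bsub>?S\<^esub> (y \<otimes>\<^bsub>?S\<^esub> q n) = (x \<otimes>\<^bsub>?S\<^esub> y) \<otimes>\<^bsub>?S\<^esub> q (m + n)"
        if "x \<in> even_part ?S" "y \<in> even_part ?S" for x y m n
        using that q(1,3) S.even_lcomm[OF that(2), of "q m" "q n"] by (simp add: S.m_assoc)
      \<comment> \<open>The extension to the localisation of the ideal quotient of I by f.\<close>
      define J where "J = {g \<in> even_part ?S. \<exists>r\<in>even_part R. \<exists>n. g \<otimes>\<^bsub>?S\<^esub> q n = ?\<phi> r \<and> f \<otimes>\<^bsub>R\<^esub> r \<in> I}"
      have JI: "g \<in> J" if "g \<otimes>\<^bsub>?S\<^esub> q n = ?\<phi> r" "f \<otimes>\<^bsub>R\<^esub> r \<in> I" "r \<in> even_part R" "g \<in> even_part ?S" for g r n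
        unfolding J_def using that by blast
      have rad: "radical_ideal ?S J"
        unfolding radical_ideal_def
      proof (intro conjI ballI allI impI)
        show "J \<subseteq> even_part ?S"
          by (auto simp: J_def)
        show "\<zero>\<^bsub>?S\<^esub> \<in> J"
          using Irad(2) q(1) by (intro JI[of _ 0 "\<zero>\<^bsub>R\<^esub>"]) simp_all
      next
        fix g g' assume "g \<in> J" "g' \<in> J"
        then obtain r n r' m where g: "g \<in> even_part ?S" "r \<in> even_part R" "g \<otimes>\<^bsub>?S\<^esub> q n = ?\<phi> r" "f \<otimes>\<^bsub>R\<^esub> r \<in> I"
          and g': "g' \<in> even_part ?S" "r' \<in> even_part R" "g' \<otimes>\<^bsub>?S\<^esub> q m = ?\<phi> r'" "f \<otimes>\<^bsub>R\<^esub> r' \<in> I"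
          unfolding J_def by blast
        let ?r = "(f [^]\<^bsub>R\<^esub> m) \<otimes>\<^bsub>R\<^esub> r \<oplus>\<^bsub>R\<^esub> (f [^]\<^bsub>R\<^esub> n) \<otimes>\<^bsub>R\<^esub> r'"
        show "g \<oplus>\<^bsub>?S\<^esub> g' \<in> J"
        proof (rule JI[of _ "n + m" ?r])
          have "(g \<oplus>\<^bsub>?S\<^esub> g') \<otimes>\<^bsub>?S\<^esub> q (n + m) = g \<otimes>\<^bsub>?S\<^esub> q n \<otimes>\<^bsub>?S\<^esub> q m \<oplus>\<^bsub>?S\<^esub> g' \<otimes>\<^bsub>?S\<^esub> q m \<otimes>\<^bsub>?S\<^esub> q n"
            using g(1) g'(1) q(1,3) by (simp add: S.l_distr S.m_assoc add.commute)
          also have "\<dots> = q m \<otimes>\<^bsub>?S\<^esub> ?\<phi> r \<oplus>\<^bsub>?S\<^esub> q n \<otimes>\<^bsub>?S\<^esub> ?\<phi> r'"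
            unfolding g(3) g'(3) using g(2) g'(2) q(1) S.even_comm[of "?\<phi> r" "q m"] S.even_comm[of "?\<phi> r'" "q n"]
            by simp
          finally show "(g \<oplus>\<^bsub>?S\<^esub> g') \<otimes>\<^bsub>?S\<^esub> q (n + m) = ?\<phi> ?r"
            using g(2) g'(2) by (simp add: q_def)
          have "f \<otimes>\<^bsub>R\<^esub> ?r = (f [^]\<^bsub>R\<^esub> m) \<otimes>\<^bsub>R\<^esub> (f \<otimes>\<^bsub>R\<^esub> r) \<oplus>\<^bsub>R\<^esub> (f [^]\<^bsub>R\<^esub> n) \<otimes>\<^bsub>R\<^esub> (f \<otimes>\<^bsub>R\<^esub> r')"
            using g(2) g'(2) R.even_lcomm[of "f [^]\<^bsub>R\<^esub> m" f r] R.even_lcomm[of "f [^]\<^bsub>R\<^esub> n" f r']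
            by (simp add: R.r_distr)
          then show "f \<otimes>\<^bsub>R\<^esub> ?r \<in> I"
            using Irad(3,4) g(4) g'(4) by simp
        qed (use g(1,2) g'(1,2) in simp_all)
      next
        fix e g assume e: "e \<in> even_part ?S" and "g \<in> J"
        then obtain r n where g: "g \<in> even_part ?S" "r \<in> even_part R" "g \<otimes>\<^bsub>?S\<^esub> q n = ?\<phi> r" "f \<otimes>\<^bsub>R\<^esub> r \<in> I"
          unfolding J_def by blast
        obtain s m where s: "s \<in> even_part R" "e \<otimes>\<^bsub>?S\<^esub> q m = ?\<phi> s"
          using even_fractionE[OF e] unfolding q_def by blast
        show "e \<otimes>\<^bsub>?S\<^esub> g \<in> J"
        proof (rule JI[of _ "m + n" "s \<otimes>\<^bsub>R\<^esub> r"])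
          show "e \<otimes>\<^bsub>?S\<^esub> g \<otimes>\<^bsub>?S\<^esub> q (m + n) = ?\<phi> (s \<otimes>\<^bsub>R\<^esub> r)"
            using qm[OF e g(1), of m n] g(2,3) s by simp
          have "f \<otimes>\<^bsub>R\<^esub> (s \<otimes>\<^bsub>R\<^esub> r) = s \<otimes>\<^bsub>R\<^esub> (f \<otimes>\<^bsub>R\<^esub> r)"
            using g(2) s(1) by (intro R.even_lcomm) simp_all
          then show "f \<otimes>\<^bsub>R\<^esub> (s \<otimes>\<^bsub>R\<^esub> r) \<in> I"
            using Irad(4)[OF s(1) g(4)] by simp
        qed (use e g(1,2) s(1) in simp_all)
      next
        fix g and p :: nat assume g: "g \<in> even_part ?S" "g [^]\<^bsub>?S\<^esub> p \<in> J"
        obtain r n where r: "r \<in> even_part R" "(g [^]\<^bsub>?S\<^esub> p) \<otimes>\<^bsub>?S\<^esub> q n = ?\<phi> r" "f \<otimes>\<^bsub>R\<^esub> r \<in> I"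
          using g(2) unfolding J_def by blast
        obtain s m where s: "s \<in> even_part R" "g \<otimes>\<^bsub>?S\<^esub> q m = ?\<phi> s"
          using even_fractionE[OF g(1)] unfolding q_def by blast
        have "?\<phi> ((s [^]\<^bsub>R\<^esub> p) \<otimes>\<^bsub>R\<^esub> (f [^]\<^bsub>R\<^esub> n)) = ((g \<otimes>\<^bsub>?S\<^esub> q m) [^]\<^bsub>?S\<^esub> p) \<otimes>\<^bsub>?S\<^esub> q n"
          using s by (simp add: q_def)
        also have "(g \<otimes>\<^bsub>?S\<^esub> q m) [^]\<^bsub>?S\<^esub> p = (g [^]\<^bsub>?S\<^esub> p) \<otimes>\<^bsub>?S\<^esub> q (m * p)"
          using g(1) S.pow_mult_distrib[of g "q m" p] S.even_comm[of g "q m"] q(1)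
          by (simp add: q_def S.nat_pow_pow)
        also have "\<dots> \<otimes>\<^bsub>?S\<^esub> q n = (g [^]\<^bsub>?S\<^esub> p) \<otimes>\<^bsub>?S\<^esub> q n \<otimes>\<^bsub>?S\<^esub> q (m * p)"
          using g(1) q(1,3) by (simp add: S.m_assoc add.commute)
        also have "\<dots> = ?\<phi> (r \<otimes>\<^bsub>R\<^esub> (f [^]\<^bsub>R\<^esub> (m * p)))"
          unfolding r(2) using r(1) by (simp add: q_def)
        finally obtain k :: nat where k: "(f [^]\<^bsub>R\<^esub> k) \<otimes>\<^bsub>R\<^esub> ((s [^]\<^bsub>R\<^esub> p) \<otimes>\<^bsub>R\<^esub> (f [^]\<^bsub>R\<^esub> n)) =
            (f [^]\<^bsub>R\<^esub> k) \<otimes>\<^bsub>R\<^esub> (r \<otimes>\<^bsub>R\<^esub> (f [^]\<^bsub>R\<^esub> (m * p)))"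
          using kernelE[of "(s [^]\<^bsub>R\<^esub> p) \<otimes>\<^bsub>R\<^esub> (f [^]\<^bsub>R\<^esub> n)" "r \<otimes>\<^bsub>R\<^esub> (f [^]\<^bsub>R\<^esub> (m * p))"] r(1) s(1) by auto
        interpret E: cring "R.even_ring" by (rule R.even_cring)
        note AC = E.m_assoc[simplified] E.m_comm[simplified] E.m_lcomm[simplified]
        \<comment> \<open>This exponent is just large enough to split off f f^k s^p f^n from the
          power of f s, so that the relation obtained from the kernel applies.\<close>
        let ?N = "p + k + n + 1"
        have "(f \<otimes>\<^bsub>R\<^esub> s) [^]\<^bsub>R\<^esub> ?N = (f [^]\<^bsub>R\<^esub> ?N) \<otimes>\<^bsub>R\<^esub> (s [^]\<^bsub>R\<^esub> ?N)"
          using s(1) by (intro R.pow_mult_distrib R.even_comm) simp_all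
        also have "\<dots> = (f [^]\<^bsub>R\<^esub> p) \<otimes>\<^bsub>R\<^esub> (s [^]\<^bsub>R\<^esub> (k + n + 1)) \<otimes>\<^bsub>R\<^esub>
            (f \<otimes>\<^bsub>R\<^esub> ((f [^]\<^bsub>R\<^esub> k) \<otimes>\<^bsub>R\<^esub> ((s [^]\<^bsub>R\<^esub> p) \<otimes>\<^bsub>R\<^esub> (f [^]\<^bsub>R\<^esub> n))))"
          using s(1) by (simp add: R.nat_pow_mult[symmetric] AC)
        also have "\<dots> = (f [^]\<^bsub>R\<^esub> p) \<otimes>\<^bsub>R\<^esub> (s [^]\<^bsub>R\<^esub> (k + n + 1)) \<otimes>\<^bsub>R\<^esub>
            (f [^]\<^bsub>R\<^esub> k) \<otimes>\<^bsub>R\<^esub> (f [^]\<^bsub>R\<^esub> (m * p)) \<otimes>\<^bsub>R\<^esub> (f \<otimes>\<^bsub>R\<^esub> r)"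
          unfolding k using s(1) r(1) by (simp add: AC)
        also have "\<dots> \<in> I"
          by (rule Irad(4)) (use s(1) r(3) in simp_all)
        finally have "f \<otimes>\<^bsub>R\<^esub> s \<in> I"
          using s(1) Irad(5)[of "f \<otimes>\<^bsub>R\<^esub> s" ?N] by simp
        then show "g \<in> J"
          using g(1) s by (intro JI) simp_all
      qed
      have "g \<in> J" if d: "d \<in> \<D> c" and g: "is_localization ?S g (fst d) (snd d)" for d g
      proof -
        have ge: "g \<in> even_part ?S"
          using g by (simp add: is_localization_def)
        obtain r n where r: "r \<in> even_part R" "g \<otimes>\<^bsub>?S\<^esub> q n = ?\<phi> r"
          using even_fractionE[OF ge] unfolding q_def by blast
        have "is_localization R (f \<otimes>\<^bsub>R\<^esub> r) (fst d) (compose (carrier R) (snd d) ?\<phi>)"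
          using localization_compose[OF R f g r(1)] r(2) unfolding q_def by blast
        then have "f \<otimes>\<^bsub>R\<^esub> r \<in> I"
          using I c d by force
        then show ?thesis
          using JI r ge by blast
      qed
      then have "\<one>\<^bsub>?S\<^esub> \<in> J"
        using D(3)[OF c rad] by blast
      then obtain r n where r: "r \<in> even_part R" "q n = ?\<phi> r" "f \<otimes>\<^bsub>R\<^esub> r \<in> I"
        unfolding J_def using q(1) by auto
      then obtain k :: nat where "(f [^]\<^bsub>R\<^esub> k) \<otimes>\<^bsub>R\<^esub> (f [^]\<^bsub>R\<^esub> n) = (f [^]\<^bsub>R\<^esub> k) \<otimes>\<^bsub>R\<^esub> r"
        using kernelE[of "f [^]\<^bsub>R\<^esub> n" r] by (auto simp: q_def)
      then have "f [^]\<^bsub>R\<^esub> (1 + (k + n)) = f \<otimes>\<^bsub>R\<^esub> ((f [^]\<^bsub>R\<^esub> k) \<otimes>\<^bsub>R\<^esub> r)"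
        using r(1) R.even_comm[of "(f [^]\<^bsub>R\<^esub> k) \<otimes>\<^bsub>R\<^esub> r" f] by (simp add: R.nat_pow_mult[symmetric])
      also have "\<dots> = (f [^]\<^bsub>R\<^esub> k) \<otimes>\<^bsub>R\<^esub> (f \<otimes>\<^bsub>R\<^esub> r)"
        using r(1) by (intro R.even_lcomm) simp_all
      also have "\<dots> \<in> I"
        by (rule Irad(4)) (use r(3) in simp_all)
      finally show "f \<in> I"
        using Irad(5)[of f "1 + (k + n)"] by simp
    qed
    then show "\<one>\<^bsub>R\<^esub> \<in> I"
      by (intro unit[OF conjunct1[OF I]]) simp
  qed
qed

section \<open>Local properties\<close>

text \<open>Treating local existence as a modality hides the covers: \<open>locally_bind\<close>
  stands for transitivity of covers and \<open>locally_pullback\<close> for base change, so the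
  arguments on sheaves only refine predicates.\<close>

definition locally :: "'u superalg \<Rightarrow> ('u superalg \<Rightarrow> ('u \<Rightarrow> 'u) \<Rightarrow> bool) \<Rightarrow> bool" where
  "locally R Q \<longleftrightarrow> (\<exists>\<C>. zariski_cover R \<C> \<and> (\<forall>(S, \<phi>)\<in>\<C>. Q S \<phi>))"

definition base_change_stable :: "'u superalg \<Rightarrow> ('u superalg \<Rightarrow> ('u \<Rightarrow> 'u) \<Rightarrow> bool) \<Rightarrow> bool" where
  "base_change_stable R Q \<longleftrightarrow> (\<forall>S \<phi> T \<psi>. superalgebra S \<longrightarrow> \<phi> \<in> superhom R S \<longrightarrow> superalgebra T \<longrightarrow>
     \<psi> \<in> superhom S T \<longrightarrow> Q S \<phi> \<longrightarrow> Q T (compose (carrier R) \<psi> \<phi>))"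

lemma locally_trivial: "superalgebra R \<Longrightarrow> Q R (\<lambda>x\<in>carrier R. x) \<Longrightarrow> locally R Q"
  unfolding locally_def using zariski_cover_trivial by fastforce

lemma locally_bind:
  assumes R: "superalgebra R" and Q: "locally R Q"
    and step: "\<And>S \<phi>. \<lbrakk>superalgebra S; \<phi> \<in> superhom R S; Q S \<phi>\<rbrakk> \<Longrightarrow>
      locally S (\<lambda>T \<psi>. Q' T (compose (carrier R) \<psi> \<phi>))"
  shows "locally R Q'"
proof -
  obtain \<C> where \<C>: "zariski_cover R \<C>" "\<And>S \<phi>. (S, \<phi>) \<in> \<C> \<Longrightarrow> Q S \<phi>"
    using Q unfolding locally_def by blast
  have "\<exists>\<D>. zariski_cover (fst c) \<D> \<and> (\<forall>(T, \<psi>)\<in>\<D>. Q' T (compose (carrier R) \<psi> (snd c)))" if c: "c \<in> \<C>" for c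
  proof -
    have "(fst c, snd c) \<in> \<C>"
      using c by simp
    then show ?thesis
      using step zariski_cover_member[OF \<C>(1)] \<C>(2) unfolding locally_def by blast
  qed
  then obtain \<D> where \<D>: "\<And>c. c \<in> \<C> \<Longrightarrow> zariski_cover (fst c) (\<D> c)"
    "\<And>c. c \<in> \<C> \<Longrightarrow> \<forall>(T, \<psi>)\<in>\<D> c. Q' T (compose (carrier R) \<psi> (snd c))"
    by metis
  show ?thesis
    unfolding locally_def
    using zariski_cover_compose[OF R \<C>(1), of \<D>] \<D> by (intro exI conjI) (assumption | force)+
qed

lemma locally_mono:
  assumes R: "superalgebra R" and Q: "locally R Q"
    and "\<And>S \<phi>. \<lbrakk>superalgebra S; \<phi> \<in> superhom R S; Q S \<phi>\<rbrakk> \<Longrightarrow> Q' S \<phi>"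
  shows "locally R Q'"
proof -
  obtain \<C> where \<C>: "zariski_cover R \<C>" "\<And>S \<phi>. (S, \<phi>) \<in> \<C> \<Longrightarrow> Q S \<phi>"
    using Q unfolding locally_def by blast
  have "Q' S \<phi>" if "(S, \<phi>) \<in> \<C>" for S \<phi>
    using assms(3) zariski_cover_member[OF \<C>(1) that] \<C>(2)[OF that] by blast
  then show ?thesis
    unfolding locally_def using \<C>(1) by blast
qed

text \<open>Members of the pulled back cover merely factor through members of the original one,
  which is why Q has to be stable under base change.\<close>

lemma locally_pullback:
  assumes R: "superalgebra R" and S: "superalgebra S" and \<rho>: "\<rho> \<in> superhom R S"
    and st: "base_change_stable R Q" and Q: "locally R Q"
  shows "locally S (\<lambda>T \<psi>. Q T (compose (carrier R) \<psi> \<rho>))"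
proof -
  obtain \<C> where \<C>: "zariski_cover R \<C>" "\<And>S \<phi>. (S, \<phi>) \<in> \<C> \<Longrightarrow> Q S \<phi>"
    using Q unfolding locally_def by blast
  obtain \<D> where \<D>: "zariski_cover S \<D>" "\<And>T' \<psi>. (T', \<psi>) \<in> \<D> \<Longrightarrow> \<exists>(T, \<phi>)\<in>\<C>. \<exists>\<theta>\<in>superhom T T'.
    compose (carrier R) \<psi> \<rho> = compose (carrier R) \<theta> \<phi>"
    using zariski_cover_pullback[OF R S \<rho> \<C>(1)] by blast
  have "Q T' (compose (carrier R) \<psi> \<rho>)" if d: "(T', \<psi>) \<in> \<D>" for T' \<psi>
  proof -
    obtain T \<phi> \<theta> where c: "(T, \<phi>) \<in> \<C>" "\<theta> \<in> superhom T T'" "compose (carrier R) \<psi> \<rho> = compose (carrier R) \<theta> \<phi>"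
      using \<D>(2)[OF d] by blast
    show ?thesis
      using st zariski_cover_member[OF \<C>(1) c(1)] zariski_cover_member[OF \<D>(1) d] c(2) \<C>(2)[OF c(1)]
      unfolding c(3) base_change_stable_def by blast
  qed
  then show ?thesis
    unfolding locally_def using \<D>(1) by blast
qed

text \<open>A common refinement: over each member of the first cover the second one is pulled
  back.\<close>

lemma locally_conj:
  assumes R: "superalgebra R" and "locally R Q" "locally R Q'"
    and st: "base_change_stable R Q" "base_change_stable R Q'"
  shows "locally R (\<lambda>S \<phi>. Q S \<phi> \<and> Q' S \<phi>)"
proof (rule locally_bind[OF R assms(2)])
  fix S \<phi> assume S: "superalgebra S" and \<phi>: "\<phi> \<in> superhom R S" and Q: "Q S \<phi>"
  show "locally S (\<lambda>T \<psi>. Q T (compose (carrier R) \<psi> \<phi>) \<and> Q' T (compose (carrier R) \<psi> \<phi>))"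
    using locally_pullback[OF R S \<phi> st(2) assms(3)] st(1) Q S \<phi> unfolding base_change_stable_def
    by (elim locally_mono[OF S]) blast
qed

section \<open>Sheafification\<close>

text \<open>The functor laws, which the record \<open>superfunctor\<close> does not impose.\<close>

definition presheaf :: "('u, 'x) superfunctor \<Rightarrow> bool" where
  "presheaf F \<longleftrightarrow>
     (\<forall>R S \<phi> x. superalgebra R \<longrightarrow> superalgebra S \<longrightarrow> \<phi> \<in> superhom R S \<longrightarrow> x \<in> points F R \<longrightarrow>
        pmap F R S \<phi> x \<in> points F S) \<and>
     (\<forall>R x. superalgebra R \<longrightarrow> x \<in> points F R \<longrightarrow> pmap F R R (\<lambda>a\<in>carrier R. a) x = x) \<and>
     (\<forall>R S T \<phi> \<psi> x. superalgebra R \<longrightarrow> superalgebra S \<longrightarrow> superalgebra T \<longrightarrow> \<phi> \<in> superhom R S \<longrightarrow>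
        \<psi> \<in> superhom S T \<longrightarrow> x \<in> points F R \<longrightarrow>
        pmap F S T \<psi> (pmap F R S \<phi> x) = pmap F R T (compose (carrier R) \<psi> \<phi>) x)"

lemma presheafD:
  assumes "presheaf F" "superalgebra R"
  shows "\<lbrakk>superalgebra S; \<phi> \<in> superhom R S; x \<in> points F R\<rbrakk> \<Longrightarrow> pmap F R S \<phi> x \<in> points F S"
    and "x \<in> points F R \<Longrightarrow> pmap F R R (\<lambda>a\<in>carrier R. a) x = x"
    and "\<lbrakk>superalgebra S; superalgebra T; \<phi> \<in> superhom R S; \<psi> \<in> superhom S T; x \<in> points F R\<rbrakk> \<Longrightarrow>
      pmap F S T \<psi> (pmap F R S \<phi> x) = pmap F R T (compose (carrier R) \<psi> \<phi>) x"
  using assms unfolding presheaf_def by blast+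

lemma superfunctor_morphismD:
  assumes "superfunctor_morphism F F' \<alpha>" "superalgebra R" "x \<in> points F R"
  shows "\<alpha> R x \<in> points F' R"
    and "\<lbrakk>superalgebra S; \<phi> \<in> superhom R S\<rbrakk> \<Longrightarrow> \<alpha> S (pmap F R S \<phi> x) = pmap F' R S \<phi> (\<alpha> R x)"
  using assms unfolding superfunctor_morphism_def by (blast dest: funcset_mem)+

lemma locally_equal_iff:
  "locally_equal F R x y \<longleftrightarrow> locally R (\<lambda>S \<phi>. pmap F R S \<phi> x = pmap F R S \<phi> y)"
  by (simp add: locally_equal_def locally_def)

lemma locally_equal_refl: "superalgebra R \<Longrightarrow> locally_equal F R x x"
  unfolding locally_equal_iff by (rule locally_trivial) simp_all

lemma sheaf_section_iff:
  "sheaf_section F R s \<longleftrightarrow>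
     (\<forall>S \<phi> x. (S, \<phi>, x) \<in> s \<longrightarrow> superalgebra S \<and> \<phi> \<in> superhom R S \<and> x \<in> points F S) \<and>
     (\<forall>S \<phi> x T \<psi>. (S, \<phi>, x) \<in> s \<and> superalgebra T \<and> \<psi> \<in> superhom S T \<longrightarrow>
        (T, compose (carrier R) \<psi> \<phi>, pmap F S T \<psi> x) \<in> s) \<and>
     (\<forall>S \<phi> x y. (S, \<phi>, x) \<in> s \<and> (S, \<phi>, y) \<in> s \<longrightarrow> locally_equal F S x y) \<and>
     (\<forall>S \<phi> x. superalgebra S \<and> \<phi> \<in> superhom R S \<and> x \<in> points F S \<and>
        locally S (\<lambda>T \<psi>. (T, compose (carrier R) \<psi> \<phi>, pmap F S T \<psi> x) \<in> s) \<longrightarrow> (S, \<phi>, x) \<in> s) \<and>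
     locally R (\<lambda>S \<phi>. \<exists>x. (S, \<phi>, x) \<in> s)"
  unfolding sheaf_section_def locally_def by (intro conj_cong refl) blast

lemma sheaf_sectionD:
  assumes "sheaf_section F R s"
  shows "(S, \<phi>, x) \<in> s \<Longrightarrow> superalgebra S" "(S, \<phi>, x) \<in> s \<Longrightarrow> \<phi> \<in> superhom R S"
    "(S, \<phi>, x) \<in> s \<Longrightarrow> x \<in> points F S"
    "\<lbrakk>(S, \<phi>, x) \<in> s; superalgebra T; \<psi> \<in> superhom S T\<rbrakk> \<Longrightarrow>
      (T, compose (carrier R) \<psi> \<phi>, pmap F S T \<psi> x) \<in> s"
    "\<lbrakk>(S, \<phi>, x) \<in> s; (S, \<phi>, y) \<in> s\<rbrakk> \<Longrightarrow> locally_equal F S x y"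
    "\<lbrakk>superalgebra S; \<phi> \<in> superhom R S; x \<in> points F S;
      locally S (\<lambda>T \<psi>. (T, compose (carrier R) \<psi> \<phi>, pmap F S T \<psi> x) \<in> s)\<rbrakk> \<Longrightarrow> (S, \<phi>, x) \<in> s"
    "locally R (\<lambda>S \<phi>. \<exists>x. (S, \<phi>, x) \<in> s)"
  using assms unfolding sheaf_section_iff by blast+

lemma sheafify_simps:
  "s \<in> points (sheafify F) R \<longleftrightarrow> sheaf_section F R s"
  "(S, \<phi>, x) \<in> pmap (sheafify F) R R' \<rho> s \<longleftrightarrow> \<phi> \<in> superhom R' S \<and> (S, compose (carrier R) \<phi> \<rho>, x) \<in> s"
  by (simp_all add: sheafify_def)

lemma section_stable:
  assumes s: "sheaf_section F R s"
  shows "base_change_stable R (\<lambda>S \<phi>. \<exists>x. (S, \<phi>, x) \<in> s)"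
  using sheaf_sectionD(4)[OF s] unfolding base_change_stable_def by blast

lemma sheafify_pmap:
  fixes F :: "('u, 'x) superfunctor"
  assumes R: "superalgebra R" and R': "superalgebra R'" and \<rho>: "\<rho> \<in> superhom R R'"
    and s: "sheaf_section F R s"
  shows "sheaf_section F R' (pmap (sheafify F) R R' \<rho> s)"
  unfolding sheaf_section_iff sheafify_simps
proof (intro conjI allI impI)
  fix S :: "'u superalg" and \<phi> x and T :: "'u superalg" and \<psi>
  assume a: "(\<phi> \<in> superhom R' S \<and> (S, compose (carrier R) \<phi> \<rho>, x) \<in> s) \<and> superalgebra T \<and> \<psi> \<in> superhom S T"
  then have S: "superalgebra S"
    using sheaf_sectionD(1)[OF s] by blast
  show "compose (carrier R') \<psi> \<phi> \<in> superhom R' T"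
    using a by (intro superhom_compose[OF R' S]) auto
  show "(T, compose (carrier R) (compose (carrier R') \<psi> \<phi>) \<rho>, pmap F S T \<psi> x) \<in> s"
    using a sheaf_sectionD(4)[OF s, of S "compose (carrier R) \<phi> \<rho>" x T \<psi>]
    unfolding superhom_compose_assoc[OF \<rho>, symmetric] by blast
next
  fix S :: "'u superalg" and \<phi> x y
  assume "(\<phi> \<in> superhom R' S \<and> (S, compose (carrier R) \<phi> \<rho>, x) \<in> s) \<and>
    \<phi> \<in> superhom R' S \<and> (S, compose (carrier R) \<phi> \<rho>, y) \<in> s"
  then show "locally_equal F S x y"
    using sheaf_sectionD(5)[OF s] by blast
next
  fix S :: "'u superalg" and \<phi> x
  assume a: "superalgebra S \<and> \<phi> \<in> superhom R' S \<and> x \<in> points F S \<and>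
    locally S (\<lambda>T \<psi>. compose (carrier R') \<psi> \<phi> \<in> superhom R' T \<and>
      (T, compose (carrier R) (compose (carrier R') \<psi> \<phi>) \<rho>, pmap F S T \<psi> x) \<in> s)"
  then show "\<phi> \<in> superhom R' S" by blast
  have S: "superalgebra S" and \<phi>: "\<phi> \<in> superhom R' S"
    and l: "locally S (\<lambda>T \<psi>. compose (carrier R') \<psi> \<phi> \<in> superhom R' T \<and>
      (T, compose (carrier R) (compose (carrier R') \<psi> \<phi>) \<rho>, pmap F S T \<psi> x) \<in> s)"
    using a by blast+
  show "(S, compose (carrier R) \<phi> \<rho>, x) \<in> s"
  proof (rule sheaf_sectionD(6)[OF s S])
    show "compose (carrier R) \<phi> \<rho> \<in> superhom R S"
      by (rule superhom_compose[OF R R' S \<rho> \<phi>])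
    show "locally S (\<lambda>T \<psi>. (T, compose (carrier R) \<psi> (compose (carrier R) \<phi> \<rho>), pmap F S T \<psi> x) \<in> s)"
      unfolding superhom_compose_assoc[OF \<rho>] by (rule locally_mono[OF S l]) blast
  qed (use a in blast)
next
  have "locally R' (\<lambda>T \<psi>. \<exists>x. (T, compose (carrier R) \<psi> \<rho>, x) \<in> s)"
    by (rule locally_pullback[OF R R' \<rho> section_stable[OF s] sheaf_sectionD(7)[OF s]])
  then show "locally R' (\<lambda>S \<phi>. \<exists>x. \<phi> \<in> superhom R' S \<and> (S, compose (carrier R) \<phi> \<rho>, x) \<in> s)"
    by (rule locally_mono[OF R']) blast
qed (use sheaf_sectionD(1,3)[OF s] in blast)+

section \<open>Sheafification of a morphism of presheaves\<close>

locale presheaf_morphism =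
  fixes F :: "('u, 'x) superfunctor" and F' :: "('u, 'y) superfunctor" and \<alpha>
  assumes F: "presheaf F" and F': "presheaf F'" and \<alpha>: "superfunctor_morphism F F' \<alpha>"
begin

abbreviation (input) image where
  "image R s S \<phi> y \<equiv> \<lambda>T \<psi>. \<exists>x. (T, compose (carrier R) \<psi> \<phi>, x) \<in> s \<and> pmap F' S T \<psi> y = \<alpha> T x"

lemma sheafify_map_iff:
  "(S, \<phi>, y) \<in> sheafify_map F' \<alpha> R s \<longleftrightarrow>
    superalgebra S \<and> \<phi> \<in> superhom R S \<and> y \<in> points F' S \<and> locally S (image R s S \<phi> y)"
  by (simp add: sheafify_map_def locally_def)

lemma image_stable:
  assumes s: "sheaf_section F R s" and S: "superalgebra S" and \<phi>: "\<phi> \<in> superhom R S" and y: "y \<in> points F' S"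
  shows "base_change_stable S (image R s S \<phi> y)"
  unfolding base_change_stable_def
proof (intro allI impI)
  fix T :: "'u superalg" and \<psi> and T' :: "'u superalg" and \<theta>
  assume T: "superalgebra T" and \<psi>: "\<psi> \<in> superhom S T" and T': "superalgebra T'" and \<theta>: "\<theta> \<in> superhom T T'"
    and "image R s S \<phi> y T \<psi>"
  then obtain x where x: "(T, compose (carrier R) \<psi> \<phi>, x) \<in> s" "pmap F' S T \<psi> y = \<alpha> T x"
    by blast
  have "(T', compose (carrier R) (compose (carrier S) \<theta> \<psi>) \<phi>, pmap F T T' \<theta> x) \<in> s"
    using sheaf_sectionD(4)[OF s x(1) T' \<theta>] unfolding superhom_compose_assoc[OF \<phi>] .
  moreover have "pmap F' S T' (compose (carrier S) \<theta> \<psi>) y = \<alpha> T' (pmap F T T' \<theta> x)"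
    using presheafD(3)[OF F' S T T' \<psi> \<theta> y] superfunctor_morphismD(2)[OF \<alpha> T sheaf_sectionD(3)[OF s x(1)] T' \<theta>]
      x(2) by simp
  ultimately show "image R s S \<phi> y T' (compose (carrier S) \<theta> \<psi>)"
    by blast
qed

lemma image_germ:
  assumes R: "superalgebra R" and s: "sheaf_section F R s" and x: "(S, \<phi>, x) \<in> s"
  shows "(S, \<phi>, \<alpha> S x) \<in> sheafify_map F' \<alpha> R s"
proof -
  note S = sheaf_sectionD(1)[OF s x] and \<phi> = sheaf_sectionD(2)[OF s x] and xS = sheaf_sectionD(3)[OF s x]
  have "image R s S \<phi> (\<alpha> S x) S (\<lambda>a\<in>carrier S. a)"
    using x presheafD(2)[OF F' S superfunctor_morphismD(1)[OF \<alpha> S xS]] superhom_compose_id[OF \<phi>] by auto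
  then show ?thesis
    unfolding sheafify_map_iff using S \<phi> superfunctor_morphismD(1)[OF \<alpha> S xS]
    by (intro conjI locally_trivial) auto
qed

text \<open>Membership in the image is itself a local condition, so locality comes from composing
  covers. For uniqueness the two witnessing covers are refined to a common one, where the preimages
  are locally equal because they belong to one section s.\<close>

lemma sheafify_map_section:
  assumes R: "superalgebra R" and s: "sheaf_section F R s"
  shows "sheaf_section F' R (sheafify_map F' \<alpha> R s)"
  unfolding sheaf_section_iff
proof (intro conjI allI impI)
  fix S :: "'u superalg" and \<phi> y and T :: "'u superalg" and \<psi>
  assume "(S, \<phi>, y) \<in> sheafify_map F' \<alpha> R s \<and> superalgebra T \<and> \<psi> \<in> superhom S T"
  then have S: "superalgebra S" and \<phi>: "\<phi> \<in> superhom R S" and y: "y \<in> points F' S"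
    and loc: "locally S (image R s S \<phi> y)" and T: "superalgebra T" and \<psi>: "\<psi> \<in> superhom S T"
    unfolding sheafify_map_iff by blast+
  have "locally T (\<lambda>U \<chi>. image R s S \<phi> y U (compose (carrier S) \<chi> \<psi>))"
    by (rule locally_pullback[OF S T \<psi> image_stable[OF s S \<phi> y] loc])
  then have "locally T (image R s T (compose (carrier R) \<psi> \<phi>) (pmap F' S T \<psi> y))"
    using presheafD(3)[OF F' S T _ \<psi> _ y]
    by (elim locally_mono[OF T]) (simp add: superhom_compose_assoc[OF \<phi>])
  then show "(T, compose (carrier R) \<psi> \<phi>, pmap F' S T \<psi> y) \<in> sheafify_map F' \<alpha> R s"
    unfolding sheafify_map_iff
    using T superhom_compose[OF R S T \<phi> \<psi>] presheafD(1)[OF F' S T \<psi> y] by blast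
next
  fix S :: "'u superalg" and \<phi> y y'
  assume "(S, \<phi>, y) \<in> sheafify_map F' \<alpha> R s \<and> (S, \<phi>, y') \<in> sheafify_map F' \<alpha> R s"
  then have S: "superalgebra S" and \<phi>: "\<phi> \<in> superhom R S" and y: "y \<in> points F' S" "y' \<in> points F' S"
    and loc: "locally S (image R s S \<phi> y)" "locally S (image R s S \<phi> y')"
    unfolding sheafify_map_iff by blast+
  have "locally S (\<lambda>T \<psi>. image R s S \<phi> y T \<psi> \<and> image R s S \<phi> y' T \<psi>)"
    using loc image_stable[OF s S \<phi>] y by (intro locally_conj[OF S]) blast+
  then show "locally_equal F' S y y'"
    unfolding locally_equal_iff
  proof (rule locally_bind[OF S])
    fix T :: "'u superalg" and \<psi> assume T: "superalgebra T" and \<psi>: "\<psi> \<in> superhom S T"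
      and "image R s S \<phi> y T \<psi> \<and> image R s S \<phi> y' T \<psi>"
    then obtain x x' where x: "(T, compose (carrier R) \<psi> \<phi>, x) \<in> s" "pmap F' S T \<psi> y = \<alpha> T x"
      "(T, compose (carrier R) \<psi> \<phi>, x') \<in> s" "pmap F' S T \<psi> y' = \<alpha> T x'"
      by blast
    have "locally T (\<lambda>U \<chi>. pmap F T U \<chi> x = pmap F T U \<chi> x')"
      using sheaf_sectionD(5)[OF s x(1,3)] unfolding locally_equal_iff .
    then show "locally T (\<lambda>U \<chi>. pmap F' S U (compose (carrier S) \<chi> \<psi>) y = pmap F' S U (compose (carrier S) \<chi> \<psi>) y')"
    proof (rule locally_mono[OF T])
      fix U :: "'u superalg" and \<chi> assume U: "superalgebra U" "\<chi> \<in> superhom T U" and eq: "pmap F T U \<chi> x = pmap F T U \<chi> x'"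
      show "pmap F' S U (compose (carrier S) \<chi> \<psi>) y = pmap F' S U (compose (carrier S) \<chi> \<psi>) y'"
        using presheafD(3)[OF F' S T U(1) \<psi> U(2) y(1)] presheafD(3)[OF F' S T U(1) \<psi> U(2) y(2)]
          superfunctor_morphismD(2)[OF \<alpha> T sheaf_sectionD(3)[OF s x(1)] U]
          superfunctor_morphismD(2)[OF \<alpha> T sheaf_sectionD(3)[OF s x(3)] U] eq x(2,4) by simp
    qed
  qed
next
  fix S :: "'u superalg" and \<phi> y
  assume a: "superalgebra S \<and> \<phi> \<in> superhom R S \<and> y \<in> points F' S \<and>
    locally S (\<lambda>T \<psi>. (T, compose (carrier R) \<psi> \<phi>, pmap F' S T \<psi> y) \<in> sheafify_map F' \<alpha> R s)"
  then have S: "superalgebra S" and \<phi>: "\<phi> \<in> superhom R S" and y: "y \<in> points F' S"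
    by blast+
  have "locally S (image R s S \<phi> y)"
  proof (rule locally_bind[OF S])
    show "locally S (\<lambda>T \<psi>. (T, compose (carrier R) \<psi> \<phi>, pmap F' S T \<psi> y) \<in> sheafify_map F' \<alpha> R s)"
      using a by blast
    fix T :: "'u superalg" and \<psi> assume T: "superalgebra T" and \<psi>: "\<psi> \<in> superhom S T"
      and t: "(T, compose (carrier R) \<psi> \<phi>, pmap F' S T \<psi> y) \<in> sheafify_map F' \<alpha> R s"
    then have "locally T (image R s T (compose (carrier R) \<psi> \<phi>) (pmap F' S T \<psi> y))"
      unfolding sheafify_map_iff by blast
    then show "locally T (\<lambda>U \<chi>. image R s S \<phi> y U (compose (carrier S) \<chi> \<psi>))"
      using presheafD(3)[OF F' S T _ \<psi> _ y]
      by (elim locally_mono[OF T]) (simp add: superhom_compose_assoc[OF \<phi>])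
  qed
  then show "(S, \<phi>, y) \<in> sheafify_map F' \<alpha> R s"
    unfolding sheafify_map_iff using S \<phi> y by blast
next
  show "locally R (\<lambda>S \<phi>. \<exists>y. (S, \<phi>, y) \<in> sheafify_map F' \<alpha> R s)"
    using sheaf_sectionD(7)[OF s] image_germ[OF R s] by (elim locally_mono[OF R]) blast
qed (auto simp: sheafify_map_iff)

lemma sheafify_map_morphism:
  "superfunctor_morphism (sheafify F) (sheafify F') (sheafify_map F' \<alpha>)"
  unfolding superfunctor_morphism_def
proof (intro conjI allI impI)
  fix R :: "'u superalg" assume R: "superalgebra R"
  show "sheafify_map F' \<alpha> R \<in> points (sheafify F) R \<rightarrow> points (sheafify F') R"
    using sheafify_map_section[OF R] by (simp add: sheafify_simps)
next
  fix R R' :: "'u superalg" and \<rho> s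
  assume a: "superalgebra R \<and> superalgebra R' \<and> \<rho> \<in> superhom R R' \<and> s \<in> points (sheafify F) R"
  then have R: "superalgebra R" and R': "superalgebra R'" and \<rho>: "\<rho> \<in> superhom R R'" and s: "sheaf_section F R s"
    by (auto simp: sheafify_simps)
  have "(S, \<phi>, y) \<in> sheafify_map F' \<alpha> R' (pmap (sheafify F) R R' \<rho> s) \<longleftrightarrow>
    (S, \<phi>, y) \<in> pmap (sheafify F') R R' \<rho> (sheafify_map F' \<alpha> R s)" for S \<phi> y
  proof -
    have "locally S (image R' (pmap (sheafify F) R R' \<rho> s) S \<phi> y) \<longleftrightarrow>
        locally S (image R s S (compose (carrier R) \<phi> \<rho>) y)"
      if S: "superalgebra S" and \<phi>: "\<phi> \<in> superhom R' S"
      unfolding sheafify_simps superhom_compose_assoc[OF \<rho>]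
      using superhom_compose[OF R' S _ \<phi>] by (intro iffI; elim locally_mono[OF S]) blast+
    then show ?thesis
      unfolding sheafify_map_iff sheafify_simps
      using superhom_compose[OF R R' _ \<rho>] by blast
  qed
  then show "sheafify_map F' \<alpha> R' (pmap (sheafify F) R R' \<rho> s) = pmap (sheafify F') R R' \<rho> (sheafify_map F' \<alpha> R s)"
    by auto
qed

text \<open>Injectivity up to local equality makes germs in the source recoverable from their
  images. Since \<alpha> need not be locally surjective onto F', the target is cut out by the
  condition of lying locally in the image, which is the form in which the orbit is defined.\<close>

lemma sheafify_map_bij:
  assumes R: "superalgebra R"
    and inj: "\<And>S x y. \<lbrakk>superalgebra S; x \<in> points F S; y \<in> points F S; \<alpha> S x = \<alpha> S y\<rbrakk> \<Longrightarrow> locally_equal F S x y"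
  shows "bij_betw (sheafify_map F' \<alpha> R) (points (sheafify F) R)
    {s \<in> points (sheafify F') R. locally R (\<lambda>S \<phi>. \<exists>x\<in>points F S. (S, \<phi>, \<alpha> S x) \<in> s)}"
proof -
  \<comment> \<open>Equality of the images is symmetric in s and s', so one inclusion is enough for
    injectivity.\<close>
  have sub: "s \<subseteq> s'" if s: "sheaf_section F R s" and s': "sheaf_section F R s'"
    and eq: "sheafify_map F' \<alpha> R s = sheafify_map F' \<alpha> R s'" for s s'
  proof (intro subsetI, unfold split_paired_all)
    fix S :: "'u superalg" and \<phi> x assume x: "(S, \<phi>, x) \<in> s"
    note S = sheaf_sectionD(1)[OF s x] and \<phi> = sheaf_sectionD(2)[OF s x] and xS = sheaf_sectionD(3)[OF s x]
    have "(S, \<phi>, \<alpha> S x) \<in> sheafify_map F' \<alpha> R s'"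
      using image_germ[OF R s x] unfolding eq .
    then have "locally S (image R s' S \<phi> (\<alpha> S x))"
      unfolding sheafify_map_iff by blast
    then have "locally S (\<lambda>T \<psi>. (T, compose (carrier R) \<psi> \<phi>, pmap F S T \<psi> x) \<in> s')"
    proof (rule locally_bind[OF S])
      fix T :: "'u superalg" and \<psi> assume T: "superalgebra T" and \<psi>: "\<psi> \<in> superhom S T" and "image R s' S \<phi> (\<alpha> S x) T \<psi>"
      then obtain x' where x': "(T, compose (carrier R) \<psi> \<phi>, x') \<in> s'" "pmap F' S T \<psi> (\<alpha> S x) = \<alpha> T x'"
        by blast
      have "locally_equal F T (pmap F S T \<psi> x) x'"
        using x'(2) superfunctor_morphismD(2)[OF \<alpha> S xS T \<psi>]
        by (intro inj[OF T presheafD(1)[OF F S T \<psi> xS] sheaf_sectionD(3)[OF s' x'(1)]]) simp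
      then show "locally T (\<lambda>U \<chi>. (U, compose (carrier R) (compose (carrier S) \<chi> \<psi>) \<phi>,
          pmap F S U (compose (carrier S) \<chi> \<psi>) x) \<in> s')"
        unfolding locally_equal_iff
      proof (rule locally_mono[OF T])
        fix U :: "'u superalg" and \<chi> assume U: "superalgebra U" "\<chi> \<in> superhom T U" and e: "pmap F T U \<chi> (pmap F S T \<psi> x) = pmap F T U \<chi> x'"
        show "(U, compose (carrier R) (compose (carrier S) \<chi> \<psi>) \<phi>, pmap F S U (compose (carrier S) \<chi> \<psi>) x) \<in> s'"
          using sheaf_sectionD(4)[OF s' x'(1) U] presheafD(3)[OF F S T U(1) \<psi> U(2) xS] e
          unfolding superhom_compose_assoc[OF \<phi>] by simp
      qed
    qed
    then show "(S, \<phi>, x) \<in> s'"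
      by (rule sheaf_sectionD(6)[OF s' S \<phi> xS])
  qed
  have "inj_on (sheafify_map F' \<alpha> R) (points (sheafify F) R)"
    using sub by (intro inj_onI) (auto simp: sheafify_simps)
  moreover have "sheafify_map F' \<alpha> R s \<in>
      {s \<in> points (sheafify F') R. locally R (\<lambda>S \<phi>. \<exists>x\<in>points F S. (S, \<phi>, \<alpha> S x) \<in> s)}"
    if "s \<in> points (sheafify F) R" for s
  proof -
    have s: "sheaf_section F R s"
      using that by (simp add: sheafify_simps)
    have "locally R (\<lambda>S \<phi>. \<exists>x\<in>points F S. (S, \<phi>, \<alpha> S x) \<in> sheafify_map F' \<alpha> R s)"
      using sheaf_sectionD(7)[OF s] image_germ[OF R s] sheaf_sectionD(3)[OF s]
      by (elim locally_mono[OF R]) blast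
    then show ?thesis
      using sheafify_map_section[OF R s] by (simp add: sheafify_simps)
  qed
  moreover have "\<exists>t\<in>points (sheafify F) R. sheafify_map F' \<alpha> R t = s"
    if s': "s \<in> points (sheafify F') R" and loc: "locally R (\<lambda>S \<phi>. \<exists>x\<in>points F S. (S, \<phi>, \<alpha> S x) \<in> s)" for s
  proof -
    have s: "sheaf_section F' R s"
      using s' by (simp add: sheafify_simps)
    \<comment> \<open>The preimage consists of all germs whose image lies in s. It is the only
      candidate, and the hypothesis on s supplies the germs over a cover of R.\<close>
    define t where "t = {(S, \<phi>, x). x \<in> points F S \<and> (S, \<phi>, \<alpha> S x) \<in> s}"
    have t: "sheaf_section F R t"
      unfolding sheaf_section_iff
    proof (intro conjI allI impI)
      fix S :: "'u superalg" and \<phi> x assume "(S, \<phi>, x) \<in> t"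
      then show "superalgebra S" "\<phi> \<in> superhom R S" "x \<in> points F S"
        using sheaf_sectionD(1,2)[OF s] by (auto simp: t_def)
    next
      fix S :: "'u superalg" and \<phi> x and T :: "'u superalg" and \<psi> assume a: "(S, \<phi>, x) \<in> t \<and> superalgebra T \<and> \<psi> \<in> superhom S T"
      then have x: "x \<in> points F S" "(S, \<phi>, \<alpha> S x) \<in> s" and T: "superalgebra T" and \<psi>: "\<psi> \<in> superhom S T"
        by (auto simp: t_def)
      note S = sheaf_sectionD(1)[OF s x(2)]
      show "(T, compose (carrier R) \<psi> \<phi>, pmap F S T \<psi> x) \<in> t"
        using sheaf_sectionD(4)[OF s x(2) T \<psi>] presheafD(1)[OF F S T \<psi> x(1)]
          superfunctor_morphismD(2)[OF \<alpha> S x(1) T \<psi>] by (simp add: t_def)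
    next
      fix S :: "'u superalg" and \<phi> x y assume "(S, \<phi>, x) \<in> t \<and> (S, \<phi>, y) \<in> t"
      then have x: "x \<in> points F S" "(S, \<phi>, \<alpha> S x) \<in> s" and y: "y \<in> points F S" "(S, \<phi>, \<alpha> S y) \<in> s"
        by (auto simp: t_def)
      note S = sheaf_sectionD(1)[OF s x(2)]
      have "locally S (\<lambda>T \<psi>. pmap F' S T \<psi> (\<alpha> S x) = pmap F' S T \<psi> (\<alpha> S y))"
        using sheaf_sectionD(5)[OF s x(2) y(2)] unfolding locally_equal_iff .
      then show "locally_equal F S x y"
        unfolding locally_equal_iff
      proof (rule locally_bind[OF S])
        fix T :: "'u superalg" and \<psi> assume T: "superalgebra T" and \<psi>: "\<psi> \<in> superhom S T"
          and e: "pmap F' S T \<psi> (\<alpha> S x) = pmap F' S T \<psi> (\<alpha> S y)"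
        have "locally_equal F T (pmap F S T \<psi> x) (pmap F S T \<psi> y)"
          using e superfunctor_morphismD(2)[OF \<alpha> S x(1) T \<psi>] superfunctor_morphismD(2)[OF \<alpha> S y(1) T \<psi>]
          by (intro inj[OF T presheafD(1)[OF F S T \<psi> x(1)] presheafD(1)[OF F S T \<psi> y(1)]]) simp
        then show "locally T (\<lambda>U \<chi>. pmap F S U (compose (carrier S) \<chi> \<psi>) x = pmap F S U (compose (carrier S) \<chi> \<psi>) y)"
          unfolding locally_equal_iff
          using presheafD(3)[OF F S T _ \<psi> _ x(1)] presheafD(3)[OF F S T _ \<psi> _ y(1)]
          by (elim locally_mono[OF T]) simp
      qed
    next
      fix S :: "'u superalg" and \<phi> x
      assume a: "superalgebra S \<and> \<phi> \<in> superhom R S \<and> x \<in> points F S \<and>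
        locally S (\<lambda>T \<psi>. (T, compose (carrier R) \<psi> \<phi>, pmap F S T \<psi> x) \<in> t)"
      then have S: "superalgebra S" and \<phi>: "\<phi> \<in> superhom R S" and x: "x \<in> points F S"
        and l: "locally S (\<lambda>T \<psi>. (T, compose (carrier R) \<psi> \<phi>, pmap F S T \<psi> x) \<in> t)"
        by blast+
      have "locally S (\<lambda>T \<psi>. (T, compose (carrier R) \<psi> \<phi>, pmap F' S T \<psi> (\<alpha> S x)) \<in> s)"
        using l superfunctor_morphismD(2)[OF \<alpha> S x] by (elim locally_mono[OF S]) (simp add: t_def)
      then have "(S, \<phi>, \<alpha> S x) \<in> s"
        by (rule sheaf_sectionD(6)[OF s S \<phi> superfunctor_morphismD(1)[OF \<alpha> S x]])
      then show "(S, \<phi>, x) \<in> t"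
        using x by (simp add: t_def)
    next
      show "locally R (\<lambda>S \<phi>. \<exists>x. (S, \<phi>, x) \<in> t)"
        using loc by (elim locally_mono[OF R]) (auto simp: t_def)
    qed
    have "(S, \<phi>, y) \<in> sheafify_map F' \<alpha> R t \<longleftrightarrow> (S, \<phi>, y) \<in> s" for S \<phi> y
    proof
      assume "(S, \<phi>, y) \<in> sheafify_map F' \<alpha> R t"
      then have S: "superalgebra S" and \<phi>: "\<phi> \<in> superhom R S" and y: "y \<in> points F' S"
        and l: "locally S (image R t S \<phi> y)"
        unfolding sheafify_map_iff by blast+
      have "locally S (\<lambda>T \<psi>. (T, compose (carrier R) \<psi> \<phi>, pmap F' S T \<psi> y) \<in> s)"
        using l by (elim locally_mono[OF S]) (auto simp: t_def)
      then show "(S, \<phi>, y) \<in> s"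
        by (rule sheaf_sectionD(6)[OF s S \<phi> y])
    next
      assume y: "(S, \<phi>, y) \<in> s"
      note S = sheaf_sectionD(1)[OF s y] and \<phi> = sheaf_sectionD(2)[OF s y] and yS = sheaf_sectionD(3)[OF s y]
      have "locally S (\<lambda>T \<psi>. \<exists>x. (T, compose (carrier R) \<psi> \<phi>, x) \<in> t)"
        by (rule locally_pullback[OF R S \<phi> section_stable[OF t] sheaf_sectionD(7)[OF t]])
      then have "locally S (image R t S \<phi> y)"
      proof (rule locally_bind[OF S])
        fix T :: "'u superalg" and \<psi> assume T: "superalgebra T" and \<psi>: "\<psi> \<in> superhom S T"
          and "\<exists>x. (T, compose (carrier R) \<psi> \<phi>, x) \<in> t"
        then obtain x where x: "(T, compose (carrier R) \<psi> \<phi>, x) \<in> t" by blast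
        then have xs: "(T, compose (carrier R) \<psi> \<phi>, \<alpha> T x) \<in> s" and xT: "x \<in> points F T"
          by (auto simp: t_def)
        have "locally T (\<lambda>U \<chi>. pmap F' T U \<chi> (pmap F' S T \<psi> y) = pmap F' T U \<chi> (\<alpha> T x))"
          using sheaf_sectionD(5)[OF s sheaf_sectionD(4)[OF s y T \<psi>] xs] unfolding locally_equal_iff .
        then show "locally T (\<lambda>U \<chi>. image R t S \<phi> y U (compose (carrier S) \<chi> \<psi>))"
        proof (rule locally_mono[OF T])
          fix U :: "'u superalg" and \<chi> assume U: "superalgebra U" "\<chi> \<in> superhom T U"
            and e: "pmap F' T U \<chi> (pmap F' S T \<psi> y) = pmap F' T U \<chi> (\<alpha> T x)"
          have "(U, compose (carrier R) (compose (carrier S) \<chi> \<psi>) \<phi>, pmap F T U \<chi> x) \<in> t"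
            using sheaf_sectionD(4)[OF t x U] unfolding superhom_compose_assoc[OF \<phi>] .
          moreover have "pmap F' S U (compose (carrier S) \<chi> \<psi>) y = \<alpha> U (pmap F T U \<chi> x)"
            using e presheafD(3)[OF F' S T U(1) \<psi> U(2) yS] superfunctor_morphismD(2)[OF \<alpha> T xT U] by simp
          ultimately show "image R t S \<phi> y U (compose (carrier S) \<chi> \<psi>)"
            by blast
        qed
      qed
      then show "(S, \<phi>, y) \<in> sheafify_map F' \<alpha> R t"
        unfolding sheafify_map_iff using S \<phi> yS by blast
    qed
    then have "sheafify_map F' \<alpha> R t = s"
      by auto
    then show ?thesis
      using t by (auto simp: sheafify_simps)
  qed
  ultimately show ?thesis
    unfolding bij_betw_def by blast
qed

end

text \<open>The natural bijection goes from the glued charts to the orbit, opposite to the claim;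
  its pointwise inverse is again natural, provided that base change preserves the points of
  F.\<close>

lemma superfunctor_isomorphic_sym:
  assumes \<Phi>: "superfunctor_morphism F F' \<Phi>"
    and bij: "\<And>R. superalgebra R \<Longrightarrow> bij_betw (\<Phi> R) (points F R) (points F' R)"
    and closed: "\<And>R S \<phi> x. \<lbrakk>superalgebra R; superalgebra S; \<phi> \<in> superhom R S; x \<in> points F R\<rbrakk> \<Longrightarrow>
      pmap F R S \<phi> x \<in> points F S"
  shows "superfunctor_isomorphic F' F"
proof -
  define \<Psi> where "\<Psi> = (\<lambda>R. inv_into (points F R) (\<Phi> R))"
  have "superfunctor_morphism F' F \<Psi>"
    unfolding superfunctor_morphism_def
  proof (intro conjI allI impI)
    fix R :: "'a superalg" assume "superalgebra R"
    then show "\<Psi> R \<in> points F' R \<rightarrow> points F R"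
      using bij unfolding \<Psi>_def by (auto simp: bij_betw_def inv_into_into)
  next
    fix R S :: "'a superalg" and \<phi> y
    assume a: "superalgebra R \<and> superalgebra S \<and> \<phi> \<in> superhom R S \<and> y \<in> points F' R"
    then obtain x where x: "x \<in> points F R" "y = \<Phi> R x"
      using bij by (metis bij_betw_imp_surj_on imageE)
    have "pmap F' R S \<phi> y = \<Phi> S (pmap F R S \<phi> x)"
      using \<Phi> a x unfolding superfunctor_morphism_def by metis
    then show "\<Psi> S (pmap F' R S \<phi> y) = pmap F R S \<phi> (\<Psi> R y)"
      using x a bij closed[of R S \<phi> x] unfolding \<Psi>_def by (simp add: bij_betw_def)
  qed
  moreover have "bij_betw (\<Psi> R) (points F' R) (points F R)" if "superalgebra R" for R
    unfolding \<Psi>_def using bij[OF that] by (rule bij_betw_inv_into)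
  ultimately show ?thesis
    unfolding superfunctor_isomorphic_def by blast
qed

section \<open>The two charts\<close>

text \<open>The representative of low degree, read as a power series with integer exponents.\<close>

definition emb :: "'a superalg \<Rightarrow> (nat \<Rightarrow> 'a) \<Rightarrow> int \<Rightarrow> 'a" where
  "emb S p = (\<lambda>n. if n < 0 then \<zero>\<^bsub>S\<^esub> else p (nat n))"

definition chart0_matrix :: "'a superalg \<Rightarrow> 'a chart_point \<Rightarrow> 2 + 1 \<Rightarrow> 2 + 1 \<Rightarrow> int \<Rightarrow> 'a" where
  "chart0_matrix S = (\<lambda>(z, \<xi>, \<eta>). let i = \<one>\<^bsub>power_series S\<^esub>; n = \<zero>\<^bsub>power_series S\<^esub> in
     mat3 i (emb S z) (emb S \<xi>) n i (emb S \<eta>) n n i)"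

definition row_swap :: "'a superalg \<Rightarrow> 2 + 1 \<Rightarrow> 2 + 1 \<Rightarrow> int \<Rightarrow> 'a" where
  "row_swap S = (let i = \<one>\<^bsub>power_series S\<^esub>; n = \<zero>\<^bsub>power_series S\<^esub> in mat3 n i n i n n n n i)"

text \<open>The columns become (0, 1, 0), (1, z, 0) and (\<xi>, \<eta>, 1): the odd coordinates are
  exchanged beforehand so that the row swap puts \<xi> back into the first row. Since \<eta> is the
  longer odd coordinate here, (z, \<eta>, \<xi>) is a point of the first chart, and statements about
  the second chart follow from it.\<close>

definition chart1_matrix :: "'a superalg \<Rightarrow> 'a chart_point \<Rightarrow> 2 + 1 \<Rightarrow> 2 + 1 \<Rightarrow> int \<Rightarrow> 'a" where
  "chart1_matrix S = (\<lambda>(z, \<xi>, \<eta>). mat_mult (laurent S) (row_swap S) (chart0_matrix S (z, \<eta>, \<xi>)))"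

text \<open>The coset of \<open>g t^\<lambda>\<close> plays the role of a lattice; it is the point
  of the Grassmannian obtained by letting g act on [t^\<lambda>].\<close>

definition loop_lattice :: "'a superalg \<Rightarrow> int \<Rightarrow> int \<Rightarrow> (2 + 1 \<Rightarrow> 2 + 1 \<Rightarrow> int \<Rightarrow> 'a) \<Rightarrow>
    (2 + 1 \<Rightarrow> 2 + 1 \<Rightarrow> int \<Rightarrow> 'a) set" where
  "loop_lattice S k l g = mat_mult (laurent S) g (t_power S (weight k l))
     <#\<^bsub>GL_super (laurent S)\<^esub> carrier (GL_super (power_series S))"

lemma (in ring) diff_add_cancel:
  assumes "x \<in> carrier R" "y \<in> carrier R"
  shows "(x \<ominus> y) \<oplus> y = x"
  using assms by algebra

text \<open>The first identity is the (1,3) entry of a chart matrix times the transition matrix, the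
  second the even determinant of the transition between the charts. They are stated for
  noncommutative rings since they are used with odd x and y.\<close>

lemma (in ring) chart_matrix_identities:
  assumes "x \<in> carrier R" "x' \<in> carrier R" "y \<in> carrier R" "y' \<in> carrier R" "z \<in> carrier R" "z' \<in> carrier R"
  shows "((x' \<ominus> x) \<oplus> z \<otimes> (y \<ominus> y')) \<oplus> (z \<otimes> (y' \<ominus> y) \<oplus> x) = x'"
    and "\<ominus> z \<otimes> z' \<ominus> (\<one> \<ominus> z \<otimes> z') = \<ominus> \<one>"
  using assms by algebra+

lemma (in ring) diff_add_eq_zero_iff:
  assumes "x \<in> carrier R" "y \<in> carrier R" "z \<in> carrier R"
  shows "(y \<ominus> x) \<oplus> z = \<zero> \<longleftrightarrow> x = y \<oplus> z"
proof
  assume eq: "(y \<ominus> x) \<oplus> z = \<zero>"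
  have "x = x \<oplus> ((y \<ominus> x) \<oplus> z)"
    unfolding eq using assms by simp
  also have "\<dots> = y \<oplus> z"
    using assms by algebra
  finally show "x = y \<oplus> z" .
next
  assume eq: "x = y \<oplus> z"
  show "(y \<ominus> x) \<oplus> z = \<zero>"
    unfolding eq using assms by algebra
qed

section \<open>Comparison of normal forms within a chart and between the charts\<close>

context superring
begin

declare power_series_simps [simp del]

lemma emb_parity [simp]:
  "p \<in> trunc S (even_part S) r \<Longrightarrow> emb S p \<in> even_part P"
  "p \<in> trunc S (odd_part S) r \<Longrightarrow> emb S p \<in> odd_part P"
  by (auto simp: emb_def trunc_def even_power_series odd_power_series not_less) (metis even_zero odd_zero not_le)+

lemma emb_nat [simp]: "emb S p (int n) = p n"
  by (simp add: emb_def)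

lemma all_below_int_iff:
  assumes "\<And>n. n < 0 \<Longrightarrow> Q n"
  shows "(\<forall>n<int r. Q n) \<longleftrightarrow> (\<forall>n<r. Q (int n))"
proof (intro iffI allI impI)
  fix n assume "\<forall>n<r. Q (int n)" "n < int r"
  then show "Q n"
    using assms by (cases "n < 0") (auto dest: spec[of _ "nat n"])
qed simp

lemma trunc_eq_iff:
  assumes "p \<in> trunc S V r" "q \<in> trunc S V r"
  shows "p = q \<longleftrightarrow> (\<forall>n<r. p n = q n)"
proof
  assume "\<forall>n<r. p n = q n"
  then have "p n = q n" for n
    using assms by (cases "n < r") (auto simp: trunc_def)
  then show "p = q" by blast
qed simp

text \<open>Rewrites a coefficient of a product of series as a sum over natural indices, the form in
  which \<open>trunc_mult\<close> is defined.\<close>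

lemma emb_mult:
  assumes "emb S p \<in> carrier P" "f \<in> carrier P"
  shows "(emb S p \<otimes>\<^bsub>P\<^esub> f) (int n) = (\<Oplus>i\<in>{..n}. p i \<otimes> f (int (n - i)))"
proof -
  have c: "\<And>i. emb S p i \<in> carrier S" "\<And>i. f i \<in> carrier S"
    using assms by (simp_all add: carrier_power_series)
  then have c': "\<And>i. p i \<in> carrier S"
    by (metis emb_nat)
  have "(emb S p \<otimes>\<^bsub>P\<^esub> f) (int n) = (\<Oplus>i\<in>int ` {..n}. emb S p i \<otimes> f (int n - i))"
    using power_series_mult[OF assms] by (simp add: power_series_simps image_int_atLeastAtMost atMost_atLeast0)
  also have "\<dots> = (\<Oplus>i\<in>{..n}. emb S p (int i) \<otimes> f (int n - int i))"
    using c by (subst finsum_reindex) (auto simp del: emb_nat)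
  also have "\<dots> = (\<Oplus>i\<in>{..n}. p i \<otimes> f (int (n - i)))"
    using c c' by (intro finsum_cong') (auto simp: of_nat_diff)
  finally show ?thesis .
qed

lemma mat_mult_power_series:
  fixes A B :: "2 + 1 \<Rightarrow> 2 + 1 \<Rightarrow> int \<Rightarrow> 'a"
  assumes "A \<in> carrier (GL_super P)" "B \<in> carrier (GL_super P)"
  shows "mat_mult L A B = mat_mult P A B"
  using superring.GL_super_carrier[OF power_series_superring] assms
  by (intro power_series_mat_mult[symmetric]) auto

lemma row_swap_GL: "row_swap S \<in> carrier (GL_super P)"
  and row_swap_row_swap: "mat_mult L (row_swap S) (row_swap S) = mat_diag L (\<lambda>_. \<one>\<^bsub>L\<^esub>)"
proof -
  interpret P: superring P by (rule power_series_superring)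
  show GL: "row_swap S \<in> carrier (GL_super P)"
    unfolding row_swap_def Let_def P.GL_super_mat3 by (simp add: P.minus_eq P.even_unit_minus)
  show "mat_mult L (row_swap S) (row_swap S) = mat_diag L (\<lambda>_. \<one>\<^bsub>L\<^esub>)"
    unfolding mat_mult_power_series[OF GL GL]
    unfolding row_swap_def Let_def mat_diag_mat3 power_series_simps(3,4)[symmetric] by (simp add: P.mat_mult_mat3)
qed

lemma chart0_matrix_GL:
  assumes "z \<in> trunc S (even_part S) a" "\<xi> \<in> trunc S (odd_part S) b" "\<eta> \<in> trunc S (odd_part S) c"
  shows "chart0_matrix S (z, \<xi>, \<eta>) \<in> carrier (GL_super P)"
proof -
  interpret P: superring P by (rule power_series_superring)
  show ?thesis
    using assms unfolding chart0_matrix_def Let_def prod.case P.GL_super_mat3 by (simp add: P.minus_eq)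
qed

text \<open>Left multiplication by the row swap is an involution on cosets.\<close>

lemma lattice_row_swap:
  assumes "A \<in> carrier (GL_super P)" "B \<in> carrier (GL_super P)"
  shows "loop_lattice S k l (mat_mult L (row_swap S) A) = loop_lattice S k l (mat_mult L (row_swap S) B) \<longleftrightarrow>
    loop_lattice S k l A = loop_lattice S k l B"
proof -
  let ?K = "GL_super L :: (2 + 1 \<Rightarrow> 2 + 1 \<Rightarrow> int \<Rightarrow> 'a) monoid" and ?H = "carrier (GL_super P)"
  let ?T = "t_power S (weight k l)" and ?s = "row_swap S"
  interpret L: superring L by (rule laurent_superring)
  interpret K: group ?K by (rule L.GL_super_group)
  note H = GL_power_series_subgroup
  note HK = subgroup.mem_carrier[OF H] and s = subgroup.mem_carrier[OF H row_swap_GL] and T = t_power_GL[of k l]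
  have move: "loop_lattice S k l (mat_mult L ?s X) = ?s <#\<^bsub>?K\<^esub> (loop_lattice S k l X)" if "X \<in> ?H" for X
    unfolding loop_lattice_def
    using K.lcos_m_assoc[OF subgroup.subset[OF H] s K.m_closed[OF HK[OF that] T]] K.m_assoc[OF s HK[OF that] T]
    by simp
  have undo: "?s <#\<^bsub>?K\<^esub> (?s <#\<^bsub>?K\<^esub> loop_lattice S k l X) = loop_lattice S k l X" if "X \<in> ?H" for X
  proof -
    have sub: "loop_lattice S k l X \<subseteq> carrier ?K"
      unfolding loop_lattice_def using K.l_coset_subset_G[OF subgroup.subset[OF H] K.m_closed[OF HK[OF that] T]] by simp
    then show ?thesis
      using K.lcos_m_assoc[OF sub s s] row_swap_row_swap K.lcos_mult_one[OF sub] by (simp add: L.GL_super_one[symmetric] del: L.GL_super_one)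
  qed
  show ?thesis
    using move undo assms by metis
qed

lemma lattice_stabilizer:
  assumes "0 \<le> l" "l \<le> k" "A \<in> carrier (GL_super P)" "mat3 a b c d e f g h i \<in> carrier (GL_super P)"
    "mat_mult L A (mat3 a b c d e f g h i) = B"
  shows "loop_lattice S k l A = loop_lattice S k l B \<longleftrightarrow>
    (\<forall>n<k - l. b n = \<zero>) \<and> (\<forall>n<k. c n = \<zero>) \<and> (\<forall>n<l. f n = \<zero>)"
  using lcoset_stabilizer[OF assms(1-4)] unfolding loop_lattice_def assms(5) .

lemma power_series_diff:
  assumes "f \<in> carrier P" "g \<in> carrier P"
  shows "(f \<ominus>\<^bsub>P\<^esub> g) n = f n \<ominus> g n"
  using assms by (simp add: a_minus_def power_series_minus add_laurent power_series_simps)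

lemma diff_eq_zero_iff_sym:
  assumes "x \<in> carrier S" "y \<in> carrier S"
  shows "y \<ominus> x = \<zero> \<longleftrightarrow> x = y"
  using diff_eq_zero_iff[OF assms(2,1)] by blast

lemma power_series_diff_vanish_iff:
  assumes "f \<in> carrier P" "g \<in> carrier P"
  shows "(\<forall>n<m. (g \<ominus>\<^bsub>P\<^esub> f) n = \<zero>) \<longleftrightarrow> (\<forall>n<m. f n = g n)"
  using assms by (simp add: power_series_diff diff_eq_zero_iff_sym carrier_power_series)

lemma emb_agree_iff:
  assumes "p \<in> trunc S V r" "q \<in> trunc S V r"
  shows "(\<forall>n<int r. emb S p n = emb S q n) \<longleftrightarrow> p = q"
  unfolding trunc_eq_iff[OF assms] by (subst all_below_int_iff) (simp_all add: emb_def)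

text \<open>The transition matrix M^(-1) M' lies in the stabiliser iff its entries above the
  diagonal vanish to orders k - l, k and l. These are differences of coordinates of just these
  lengths, so vanishing means equality.\<close>

lemma chart0_chart0:
  fixes k l :: nat
  assumes "l \<le> k" and x: "x \<in> points (chart0 k l) S" and x': "x' \<in> points (chart0 k l) S"
  shows "loop_lattice S k l (chart0_matrix S x) = loop_lattice S k l (chart0_matrix S x') \<longleftrightarrow> x = x'"
proof -
  interpret P: superring P by (rule power_series_superring)
  obtain z \<xi> \<eta> where X: "x = (z, \<xi>, \<eta>)" by (cases x)
  obtain z' \<xi>' \<eta>' where X': "x' = (z', \<xi>', \<eta>')" by (cases x')
  have t: "z \<in> trunc S (even_part S) (k - l)" "\<xi> \<in> trunc S (odd_part S) k" "\<eta> \<in> trunc S (odd_part S) l"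
    "z' \<in> trunc S (even_part S) (k - l)" "\<xi>' \<in> trunc S (odd_part S) k" "\<eta>' \<in> trunc S (odd_part S) l"
    using x x' by (auto simp: X X' chart0_def chart_def)
  let ?Z = "emb S z" and ?X = "emb S \<xi>" and ?Y = "emb S \<eta>"
  let ?Z' = "emb S z'" and ?X' = "emb S \<xi>'" and ?Y' = "emb S \<eta>'"
  have e: "?Z \<in> even_part P" "?Z' \<in> even_part P" "?X \<in> odd_part P" "?X' \<in> odd_part P"
    "?Y \<in> odd_part P" "?Y' \<in> odd_part P"
    using t by simp_all
  \<comment> \<open>The entries above the diagonal of the inverse of the first chart matrix times
    the second one.\<close>
  let ?b = "?Z' \<ominus>\<^bsub>P\<^esub> ?Z" and ?c = "(?X' \<ominus>\<^bsub>P\<^esub> ?X) \<oplus>\<^bsub>P\<^esub> ?Z \<otimes>\<^bsub>P\<^esub> (?Y \<ominus>\<^bsub>P\<^esub> ?Y')" and ?f = "?Y' \<ominus>\<^bsub>P\<^esub> ?Y"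
  let ?w = "mat3 \<one>\<^bsub>P\<^esub> ?b ?c \<zero>\<^bsub>P\<^esub> \<one>\<^bsub>P\<^esub> ?f \<zero>\<^bsub>P\<^esub> \<zero>\<^bsub>P\<^esub> \<one>\<^bsub>P\<^esub>"
  have w: "?w \<in> carrier (GL_super P)"
    using e unfolding P.GL_super_mat3 by (simp add: P.minus_eq)
  have A: "chart0_matrix S x \<in> carrier (GL_super P)"
    unfolding X using t by (intro chart0_matrix_GL)
  have "mat_mult L (chart0_matrix S x) ?w = chart0_matrix S x'"
    unfolding mat_mult_power_series[OF A w]
    unfolding X X' chart0_matrix_def Let_def prod.case
    using e P.chart_matrix_identities(1)[of ?X ?X' ?Y ?Y' ?Z ?Z']
    by (simp add: P.mat_mult_mat3 P.diff_add_cancel)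
  then have "loop_lattice S k l (chart0_matrix S x) = loop_lattice S k l (chart0_matrix S x') \<longleftrightarrow>
    (\<forall>n<int (k - l). ?b n = \<zero>) \<and> (\<forall>n<int k. ?c n = \<zero>) \<and> (\<forall>n<int l. ?f n = \<zero>)"
    using lattice_stabilizer[OF _ _ A w, of "int l" "int k"] assms(1) by (simp add: of_nat_diff)
  also have "\<dots> \<longleftrightarrow> z = z' \<and> (\<forall>n<int k. ?c n = \<zero>) \<and> \<eta> = \<eta>'"
    using power_series_diff_vanish_iff[of ?Z ?Z'] power_series_diff_vanish_iff[of ?Y ?Y'] e
      emb_agree_iff[OF t(1,4)] emb_agree_iff[OF t(3,6)] by simp
  also have "\<dots> \<longleftrightarrow> z = z' \<and> \<xi> = \<xi>' \<and> \<eta> = \<eta>'"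
  proof -
    \<comment> \<open>The mixed term z (\<eta> - \<eta>') disappears once the last coordinates are
      known to agree.\<close>
    have "?c = ?X' \<ominus>\<^bsub>P\<^esub> ?X" if "\<eta> = \<eta>'"
      using that e by (simp add: P.minus_eq P.r_neg)
    then show ?thesis
      using power_series_diff_vanish_iff[of ?X ?X'] e emb_agree_iff[OF t(2,5)] by auto
  qed
  finally show ?thesis
    by (auto simp: X X')
qed

text \<open>For matrices of different charts the same transition test gives 1 - z z' modulo t^(k-l),
  \<eta>' - \<eta> modulo t^l and \<xi>' - \<xi> + z (\<eta> - \<eta>') modulo t^k. With \<eta>
  equal to the reduction of \<eta>' these are the gluing relations.\<close>

lemma chart0_chart1:
  fixes k l :: nat
  assumes "l < k" and x: "x \<in> points (chart0 k l) S" and x': "x' \<in> points (chart1 k l) S"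
  shows "loop_lattice S k l (chart0_matrix S x) = loop_lattice S k l (chart1_matrix S x') \<longleftrightarrow> (x, x') \<in> P_overlap k l S"
proof -
  interpret P: superring P by (rule power_series_superring)
  obtain z \<xi> \<eta> where X: "x = (z, \<xi>, \<eta>)" by (cases x)
  obtain z' \<xi>' \<eta>' where X': "x' = (z', \<xi>', \<eta>')" by (cases x')
  have t: "z \<in> trunc S (even_part S) (k - l)" "\<xi> \<in> trunc S (odd_part S) k" "\<eta> \<in> trunc S (odd_part S) l"
    "z' \<in> trunc S (even_part S) (k - l)" "\<xi>' \<in> trunc S (odd_part S) l" "\<eta>' \<in> trunc S (odd_part S) k"
    using x x' by (auto simp: X X' chart0_def chart1_def chart_def)
  let ?Z = "emb S z" and ?X = "emb S \<xi>" and ?Y = "emb S \<eta>"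
  let ?Z' = "emb S z'" and ?X' = "emb S \<xi>'" and ?Y' = "emb S \<eta>'"
  have e: "?Z \<in> even_part P" "?Z' \<in> even_part P" "?X \<in> odd_part P" "?X' \<in> odd_part P"
    "?Y \<in> odd_part P" "?Y' \<in> odd_part P"
    using t by simp_all
  \<comment> \<open>The transition matrix is again the inverse of the first matrix times the second
    one. Its even determinant is -1, so it is invertible whether or not z is.\<close>
  let ?b = "\<one>\<^bsub>P\<^esub> \<ominus>\<^bsub>P\<^esub> ?Z \<otimes>\<^bsub>P\<^esub> ?Z'" and ?c = "(?X' \<ominus>\<^bsub>P\<^esub> ?X) \<oplus>\<^bsub>P\<^esub> ?Z \<otimes>\<^bsub>P\<^esub> (?Y \<ominus>\<^bsub>P\<^esub> ?Y')" and ?f = "?Y' \<ominus>\<^bsub>P\<^esub> ?Y"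
  let ?w = "mat3 (\<ominus>\<^bsub>P\<^esub> ?Z) ?b ?c \<one>\<^bsub>P\<^esub> ?Z' ?f \<zero>\<^bsub>P\<^esub> \<zero>\<^bsub>P\<^esub> \<one>\<^bsub>P\<^esub>"
  note ids = P.chart_matrix_identities[of ?X ?X' ?Y ?Y' ?Z ?Z']
  have w: "?w \<in> carrier (GL_super P)"
    using e ids(2) P.even_unit_minus[OF P.even_unit_one] unfolding P.GL_super_mat3 by simp
  have A: "chart0_matrix S x \<in> carrier (GL_super P)"
    unfolding X using t by (intro chart0_matrix_GL)
  have B: "chart1_matrix S x' = mat3 \<zero>\<^bsub>P\<^esub> \<one>\<^bsub>P\<^esub> ?X' \<one>\<^bsub>P\<^esub> ?Z' ?Y' \<zero>\<^bsub>P\<^esub> \<zero>\<^bsub>P\<^esub> \<one>\<^bsub>P\<^esub>"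
    unfolding X' chart1_matrix_def prod.case
      mat_mult_power_series[OF row_swap_GL chart0_matrix_GL, OF t(4,6,5)]
    unfolding row_swap_def chart0_matrix_def Let_def prod.case
    using e by (simp add: P.mat_mult_mat3)
  have "mat_mult L (chart0_matrix S x) ?w = chart1_matrix S x'"
    unfolding mat_mult_power_series[OF A w] B
    unfolding X chart0_matrix_def Let_def prod.case
    using e ids(1) by (simp add: P.mat_mult_mat3 P.diff_add_cancel P.l_neg)
  then have "loop_lattice S k l (chart0_matrix S x) = loop_lattice S k l (chart1_matrix S x') \<longleftrightarrow>
    (\<forall>n<int (k - l). ?b n = \<zero>) \<and> (\<forall>n<int k. ?c n = \<zero>) \<and> (\<forall>n<int l. ?f n = \<zero>)"
    using lattice_stabilizer[OF _ _ A w, of "int l" "int k"] assms(1) by (simp add: of_nat_diff)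
  also have "(\<forall>n<int (k - l). ?b n = \<zero>) \<longleftrightarrow> trunc_mult S (k - l) z z' = trunc_one S (k - l)"
  proof -
    have c: "\<one>\<^bsub>P\<^esub> \<in> carrier P" "?Z \<otimes>\<^bsub>P\<^esub> ?Z' \<in> carrier P"
      using e by simp_all
    have "(\<forall>n<int (k - l). ?b n = \<zero>) \<longleftrightarrow> (\<forall>n<int (k - l). (?Z \<otimes>\<^bsub>P\<^esub> ?Z') n = \<one>\<^bsub>P\<^esub> n)"
      by (rule power_series_diff_vanish_iff[OF c(2,1)])
    also have "\<dots> \<longleftrightarrow> (\<forall>n<k - l. (?Z \<otimes>\<^bsub>P\<^esub> ?Z') (int n) = \<one>\<^bsub>P\<^esub> (int n))"
      using c by (intro all_below_int_iff) (simp add: carrier_power_series)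
    also have "\<dots> \<longleftrightarrow> (\<forall>n<k - l. trunc_mult S (k - l) z z' n = trunc_one S (k - l) n)"
      using e by (simp add: emb_mult trunc_mult_def trunc_one_def power_series_simps(3) one_laurent)
    also have "\<dots> \<longleftrightarrow> (\<forall>n. trunc_mult S (k - l) z z' n = trunc_one S (k - l) n)"
    proof -
      have "trunc_mult S (k - l) z z' n = trunc_one S (k - l) n" if "\<not> n < k - l" for n
        using that by (simp add: trunc_mult_def trunc_one_def)
      then show ?thesis by blast
    qed
    also have "\<dots> \<longleftrightarrow> trunc_mult S (k - l) z z' = trunc_one S (k - l)"
      by (auto simp: fun_eq_iff)
    finally show ?thesis .
  qed
  also have "(\<forall>n<int l. ?f n = \<zero>) \<longleftrightarrow> \<eta> = trunc_reduce S l \<eta>'"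
  proof -
    have r: "trunc_reduce S l \<eta>' \<in> trunc S (odd_part S) l"
      using t(6) assms(1) by (simp add: trunc_def trunc_reduce_def)
    have "(\<forall>n<int l. ?f n = \<zero>) \<longleftrightarrow> (\<forall>n<int l. ?Y n = ?Y' n)"
      using e by (intro power_series_diff_vanish_iff) simp_all
    also have "\<dots> \<longleftrightarrow> (\<forall>n<l. \<eta> n = \<eta>' n)"
      by (subst all_below_int_iff) (simp_all add: emb_def)
    also have "\<dots> \<longleftrightarrow> \<eta> = trunc_reduce S l \<eta>'"
      unfolding trunc_eq_iff[OF t(3) r] by (simp add: trunc_reduce_def)
    finally show ?thesis .
  qed
  also have "(\<forall>n<int k. ?c n = \<zero>) \<longleftrightarrow> \<xi> = trunc_add S \<xi>' (trunc_mult S k z (trunc_diff S \<eta> \<eta>'))"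
  proof -
    have c: "?Z \<in> carrier P" "?Y \<ominus>\<^bsub>P\<^esub> ?Y' \<in> carrier P"
      using e by simp_all
    define u where "u = ?Z \<otimes>\<^bsub>P\<^esub> (?Y \<ominus>\<^bsub>P\<^esub> ?Y')"
    have u: "u \<in> carrier P"
      using c by (simp add: u_def)
    have cn: "\<xi> n \<in> carrier S" "\<xi>' n \<in> carrier S" "u m \<in> carrier S" for n m
      using t(2,5) u by (cases "n < k"; cases "n < l"; auto simp: trunc_def carrier_power_series)+
    have un: "u (int n) = trunc_mult S k z (trunc_diff S \<eta> \<eta>') n" if "n < k" for n
    proof -
      have "(?Y \<ominus>\<^bsub>P\<^esub> ?Y') (int i) = \<eta> i \<ominus> \<eta>' i" for i
        using e by (subst power_series_diff) simp_all
      then show ?thesis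
        using that unfolding u_def emb_mult[OF c] trunc_mult_def trunc_diff_def by simp
    qed
    have "(\<forall>n<int k. ?c n = \<zero>) \<longleftrightarrow> (\<forall>n<k. ?c (int n) = \<zero>)"
    proof (rule all_below_int_iff)
      have "?c \<in> odd_part P"
        using e by simp
      then show "?c n = \<zero>" if "n < 0" for n
        unfolding odd_power_series using that by blast
    qed
    also have "\<dots> \<longleftrightarrow> (\<forall>n<k. \<xi> n = \<xi>' n \<oplus> u (int n))"
    proof -
      have "?c (int n) = (\<xi>' n \<ominus> \<xi> n) \<oplus> u (int n)" for n
        using e power_series_diff[of ?X' ?X "int n"]
        by (simp add: u_def power_series_simps(2) add_laurent)
      then show ?thesis
        using diff_add_eq_zero_iff cn by simp
    qed
    also have "\<dots> \<longleftrightarrow> (\<forall>n<k. \<xi> n = trunc_add S \<xi>' (trunc_mult S k z (trunc_diff S \<eta> \<eta>')) n)"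
      using un by (simp add: trunc_add_def)
    also have "\<dots> \<longleftrightarrow> (\<forall>n. \<xi> n = trunc_add S \<xi>' (trunc_mult S k z (trunc_diff S \<eta> \<eta>')) n)"
    proof -
      have "\<xi> n = trunc_add S \<xi>' (trunc_mult S k z (trunc_diff S \<eta> \<eta>')) n" if "\<not> n < k" for n
        using that t(2,5) assms(1) by (simp add: trunc_def trunc_add_def trunc_mult_def)
      then show ?thesis by blast
    qed
    also have "\<dots> \<longleftrightarrow> \<xi> = trunc_add S \<xi>' (trunc_mult S k z (trunc_diff S \<eta> \<eta>'))"
      by (auto simp: fun_eq_iff)
    finally show ?thesis .
  qed
  finally have main: "loop_lattice S k l (chart0_matrix S x) = loop_lattice S k l (chart1_matrix S x') \<longleftrightarrow>
    trunc_mult S (k - l) z z' = trunc_one S (k - l) \<and>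
    \<xi> = trunc_add S \<xi>' (trunc_mult S k z (trunc_diff S \<eta> \<eta>')) \<and> \<eta> = trunc_reduce S l \<eta>'" .
  \<comment> \<open>The relation between base points is the constant coefficient of z z' = 1, which
    is present because k - l > 0.\<close>
  have base: "z 0 \<otimes> z' 0 = \<one>" if "trunc_mult S (k - l) z z' = trunc_one S (k - l)"
    using fun_cong[OF that, of 0] assms(1) t(1,4)
    by (simp add: trunc_mult_def trunc_one_def trunc_def)
  have "z 0 \<in> even_part S" "z' 0 \<in> even_part S"
    using t(1,4) assms(1) by (auto simp: trunc_def)
  then show ?thesis
    unfolding main using x x' base
    by (auto simp: P_overlap_def X X' base_point_def P1_overlap_def trunc_incl_def)
qed

text \<open>The row swap reduces this to the first chart.\<close>

lemma chart1_chart1: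
  fixes k l :: nat
  assumes "l \<le> k" and x: "x \<in> points (chart1 k l) S" and x': "x' \<in> points (chart1 k l) S"
  shows "loop_lattice S k l (chart1_matrix S x) = loop_lattice S k l (chart1_matrix S x') \<longleftrightarrow> x = x'"
proof -
  obtain z \<xi> \<eta> where X: "x = (z, \<xi>, \<eta>)" by (cases x)
  obtain z' \<xi>' \<eta>' where X': "x' = (z', \<xi>', \<eta>')" by (cases x')
  have t: "z \<in> trunc S (even_part S) (k - l)" "\<xi> \<in> trunc S (odd_part S) l" "\<eta> \<in> trunc S (odd_part S) k"
    "z' \<in> trunc S (even_part S) (k - l)" "\<xi>' \<in> trunc S (odd_part S) l" "\<eta>' \<in> trunc S (odd_part S) k"
    using x x' by (auto simp: X X' chart1_def chart_def)
  then have "(z, \<eta>, \<xi>) \<in> points (chart0 k l) S" "(z', \<eta>', \<xi>') \<in> points (chart0 k l) S"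
    by (simp_all add: chart0_def chart_def)
  then have "loop_lattice S k l (chart0_matrix S (z, \<eta>, \<xi>)) = loop_lattice S k l (chart0_matrix S (z', \<eta>', \<xi>')) \<longleftrightarrow>
      (z, \<eta>, \<xi>) = (z', \<eta>', \<xi>')"
    by (rule chart0_chart0[OF assms(1)])
  then show ?thesis
    using lattice_row_swap[OF chart0_matrix_GL chart0_matrix_GL, OF t(1,3,2) t(4,6,5)]
    by (auto simp: X X' chart1_matrix_def)
qed


section \<open>Existence of normal forms\<close>

lemma mult_vanish:
  assumes "f \<in> carrier P" "g \<in> carrier P" "\<forall>n<m. f n = \<zero>"
  shows "\<forall>n<m. (f \<otimes>\<^bsub>P\<^esub> g) n = \<zero>"
  using mult_laurent_zero[of f g m 0] assms
  by (simp add: power_series_simps carrier_power_series power_series_laurent)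

lemma truncation_exists:
  assumes "f \<in> carrier P" "\<And>n. f n \<in> V"
  obtains p where "p \<in> trunc S V r" "\<forall>n<int r. f n = emb S p n"
proof
  let ?p = "\<lambda>n. if n < r then f (int n) else \<zero>"
  show "?p \<in> trunc S V r"
    using assms(2) by (simp add: trunc_def)
  show "\<forall>n<int r. f n = emb S ?p n"
    using assms(1) by (subst all_below_int_iff) (simp_all add: emb_def carrier_power_series)
qed

end

text \<open>With f = p i and c = q i these rewrite the entries (2,3), (1,3) and (1,2) of the inverse
  chart matrix times g so that every summand contains a difference between a series and its
  truncation. Odd elements occur, hence no commutativity is assumed.\<close>

lemma (in ring) chart_normal_form:
  assumes "p \<in> carrier R" "q \<in> carrier R" "b \<in> carrier R" "e \<in> carrier R" "h \<in> carrier R"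
    "i \<in> carrier R" "x \<in> carrier R" "y \<in> carrier R" "z \<in> carrier R"
  shows "(p \<ominus> y) \<otimes> i = p \<otimes> i \<oplus> \<ominus> y \<otimes> i"
    and "(q \<ominus> z \<otimes> (p \<ominus> y) \<ominus> x) \<otimes> i = q \<otimes> i \<oplus> (\<ominus> z \<otimes> (p \<otimes> i) \<oplus> (z \<otimes> y \<ominus> x) \<otimes> i)"
    and "((b \<ominus> q \<otimes> h) \<ominus> z \<otimes> (e \<ominus> p \<otimes> h)) \<oplus> (q \<ominus> z \<otimes> (p \<ominus> y) \<ominus> x) \<otimes> h =
      b \<oplus> (\<ominus> z \<otimes> e \<oplus> (z \<otimes> y \<ominus> x) \<otimes> h)"
  using assms by algebra+

lemma (in ring) chart_inverse_identity:
  assumes "x \<in> carrier R" "y \<in> carrier R" "z \<in> carrier R"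
  shows "(z \<otimes> y \<ominus> x) \<oplus> (z \<otimes> \<ominus> y \<oplus> x) = \<zero>"
  using assms by algebra

context superring
begin

text \<open>
  With column operations of the stabiliser, the third column is normalised first, then the second
  one; this is possible when the entry in position \<open>(2, 2)\<close> is invertible.
\<close>

lemma chart0_surj:
  fixes k l :: nat
  assumes "l \<le> k" and g: "g \<in> carrier (GL_super P)" and unit: "even_unit (g (Inl 0) (Inl 0) 0)"
  shows "\<exists>x\<in>points (chart0 k l) S. loop_lattice S k l (chart0_matrix S x) = loop_lattice S k l g"
proof -
  interpret P: superring P by (rule power_series_superring)
  obtain a b c d e f g' h i where eq: "g = mat3 a b c d e f g' h i"
    by (rule mat3_cases)
  note mem = g[unfolded eq P.GL_super_mat3]
  have ev: "f n \<in> even_part S" if "f \<in> even_part P" for f n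
    using that by (simp add: even_power_series)
  have od: "f n \<in> odd_part S" if "f \<in> odd_part P" for f n
    using that by (simp add: odd_power_series)
  obtain D where D: "D \<in> even_part P" "i \<otimes>\<^bsub>P\<^esub> D = \<one>\<^bsub>P\<^esub>" "D \<otimes>\<^bsub>P\<^esub> i = \<one>\<^bsub>P\<^esub>"
    using mem P.even_unit_inverseE by metis
  \<comment> \<open>p and q are the odd entries of the third column after division by its last entry
    i.\<close>
  define p where "p = f \<otimes>\<^bsub>P\<^esub> D"
  define q where "q = c \<otimes>\<^bsub>P\<^esub> D"
  have pq: "p \<in> odd_part P" "q \<in> odd_part P" "p \<otimes>\<^bsub>P\<^esub> i = f" "q \<otimes>\<^bsub>P\<^esub> i = c"
    using mem D by (simp_all add: p_def q_def P.m_assoc)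
  \<comment> \<open>The (2,2) entry once the third column has been used to clear the last entry h of
    the second one. It differs from e by a product of two odd elements and so remains a
    unit.\<close>
  define u where "u = e \<ominus>\<^bsub>P\<^esub> p \<otimes>\<^bsub>P\<^esub> h"
  have "P.even_unit e"
    using unit mem by (intro power_series_even_unit) (simp_all add: eq)
  then have "P.even_unit u"
    unfolding u_def a_minus_def using mem pq
    by (intro P.perturb_unit P.perturb_minus P.odd_odd_perturb) simp_all
  then obtain v where v: "v \<in> even_part P" "v \<otimes>\<^bsub>P\<^esub> u = \<one>\<^bsub>P\<^esub>"
    by (rule P.even_unit_inverseE)
  have ue: "u \<in> even_part P"
    using \<open>P.even_unit u\<close> by simp
  \<comment> \<open>The (1,2) entry after the same clearing, divided by u; its truncation is the
    even coordinate.\<close>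
  define \<zeta> where "\<zeta> = (b \<ominus>\<^bsub>P\<^esub> q \<otimes>\<^bsub>P\<^esub> h) \<otimes>\<^bsub>P\<^esub> v"
  have \<zeta>: "\<zeta> \<in> even_part P" "\<zeta> \<otimes>\<^bsub>P\<^esub> u = b \<ominus>\<^bsub>P\<^esub> q \<otimes>\<^bsub>P\<^esub> h"
    using mem pq v ue by (simp_all add: \<zeta>_def P.m_assoc)
  obtain z where z: "z \<in> trunc S (even_part S) (k - l)" "\<forall>n<int (k - l). \<zeta> n = emb S z n"
    using truncation_exists[OF P.even_carrier[OF \<zeta>(1)], of "even_part S"] ev[OF \<zeta>(1)] by metis
  obtain \<eta> where \<eta>: "\<eta> \<in> trunc S (odd_part S) l" "\<forall>n<int l. p n = emb S \<eta> n"
    using truncation_exists[OF P.odd_carrier[OF pq(1)], of "odd_part S"] od[OF pq(1)] by metis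
  let ?Z = "emb S z" and ?Y = "emb S \<eta>"
  \<comment> \<open>p agrees with the truncation Y only up to order l < = k, so Z (p - Y) can have
    coefficients below k. This error is moved into the first odd coordinate before that one is
    truncated at order k.\<close>
  define r where "r = q \<ominus>\<^bsub>P\<^esub> ?Z \<otimes>\<^bsub>P\<^esub> (p \<ominus>\<^bsub>P\<^esub> ?Y)"
  have r: "r \<in> odd_part P"
    using pq z(1) \<eta>(1) by (simp add: r_def)
  obtain \<xi> where \<xi>: "\<xi> \<in> trunc S (odd_part S) k" "\<forall>n<int k. r n = emb S \<xi> n"
    using truncation_exists[OF P.odd_carrier[OF r], of "odd_part S"] od[OF r] by metis
  let ?X = "emb S \<xi>"
  have E: "?Z \<in> even_part P" "?X \<in> odd_part P" "?Y \<in> odd_part P"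
    using z(1) \<xi>(1) \<eta>(1) by simp_all
  have \<delta>: "\<forall>n<int (k - l). (\<zeta> \<ominus>\<^bsub>P\<^esub> ?Z) n = \<zero>" "\<forall>n<int l. (p \<ominus>\<^bsub>P\<^esub> ?Y) n = \<zero>" "\<forall>n<int k. (r \<ominus>\<^bsub>P\<^esub> ?X) n = \<zero>"
    using z(2) \<eta>(2) \<xi>(2) E \<zeta>(1) pq(1) r power_series_diff_vanish_iff[of ?Z \<zeta>]
      power_series_diff_vanish_iff[of ?Y p] power_series_diff_vanish_iff[of ?X r] by auto
  let ?M = "chart0_matrix S (z, \<xi>, \<eta>)"
  \<comment> \<open>The inverse of the chart matrix. The matrix w = N g then has to satisfy the
    three divisibility conditions of the stabiliser.\<close>
  let ?N = "mat3 \<one>\<^bsub>P\<^esub> (\<ominus>\<^bsub>P\<^esub> ?Z) (?Z \<otimes>\<^bsub>P\<^esub> ?Y \<ominus>\<^bsub>P\<^esub> ?X) \<zero>\<^bsub>P\<^esub> \<one>\<^bsub>P\<^esub> (\<ominus>\<^bsub>P\<^esub> ?Y) \<zero>\<^bsub>P\<^esub> \<zero>\<^bsub>P\<^esub> \<one>\<^bsub>P\<^esub>"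
  have M: "?M \<in> carrier (GL_super P)"
    using z(1) \<xi>(1) \<eta>(1) by (rule chart0_matrix_GL)
  have N: "?N \<in> carrier (GL_super P)"
    using E unfolding P.GL_super_mat3 by (simp add: P.minus_eq)
  have MN: "mat_mult P ?M ?N = mat_diag P (\<lambda>_. \<one>\<^bsub>P\<^esub>)"
    unfolding chart0_matrix_def Let_def prod.case mat_diag_mat3
    using E P.chart_inverse_identity[of ?X ?Y ?Z] by (simp add: P.mat_mult_mat3 P.l_neg)
  define w where "w = mat_mult P ?N g"
  have w: "w \<in> carrier (GL_super P)"
    unfolding w_def using N g by (rule P.GL_super_mult_closed)
  have "mat_mult P ?M w = mat_mult P (mat_mult P ?M ?N) g"
    unfolding w_def using P.GL_super_carrier M N g by (intro P.mat_mult_assoc[symmetric]) auto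
  also have "\<dots> = g"
    unfolding MN eq mat_diag_mat3 using mem by (simp add: P.mat_mult_mat3)
  finally have Mw: "mat_mult L ?M w = g"
    unfolding mat_mult_power_series[OF M w] .
  \<comment> \<open>Only the three entries above the diagonal enter the stabiliser test; the other
    six are kept anonymous.\<close>
  have "\<exists>a' d' e' g' h' i'. w = mat3 a' (b \<oplus>\<^bsub>P\<^esub> (\<ominus>\<^bsub>P\<^esub> ?Z \<otimes>\<^bsub>P\<^esub> e \<oplus>\<^bsub>P\<^esub> (?Z \<otimes>\<^bsub>P\<^esub> ?Y \<ominus>\<^bsub>P\<^esub> ?X) \<otimes>\<^bsub>P\<^esub> h))
      (c \<oplus>\<^bsub>P\<^esub> (\<ominus>\<^bsub>P\<^esub> ?Z \<otimes>\<^bsub>P\<^esub> f \<oplus>\<^bsub>P\<^esub> (?Z \<otimes>\<^bsub>P\<^esub> ?Y \<ominus>\<^bsub>P\<^esub> ?X) \<otimes>\<^bsub>P\<^esub> i))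
      d' e' (f \<oplus>\<^bsub>P\<^esub> \<ominus>\<^bsub>P\<^esub> ?Y \<otimes>\<^bsub>P\<^esub> i) g' h' i'"
    unfolding w_def eq using E mem by (simp add: P.mat_mult_mat3)
  then obtain a1 d1 e1 g1 h1 i1 where w_eq: "w = mat3 a1 (b \<oplus>\<^bsub>P\<^esub> (\<ominus>\<^bsub>P\<^esub> ?Z \<otimes>\<^bsub>P\<^esub> e \<oplus>\<^bsub>P\<^esub> (?Z \<otimes>\<^bsub>P\<^esub> ?Y \<ominus>\<^bsub>P\<^esub> ?X) \<otimes>\<^bsub>P\<^esub> h))
      (c \<oplus>\<^bsub>P\<^esub> (\<ominus>\<^bsub>P\<^esub> ?Z \<otimes>\<^bsub>P\<^esub> f \<oplus>\<^bsub>P\<^esub> (?Z \<otimes>\<^bsub>P\<^esub> ?Y \<ominus>\<^bsub>P\<^esub> ?X) \<otimes>\<^bsub>P\<^esub> i))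
      d1 e1 (f \<oplus>\<^bsub>P\<^esub> \<ominus>\<^bsub>P\<^esub> ?Y \<otimes>\<^bsub>P\<^esub> i) g1 h1 i1"
    by blast
  have "b \<oplus>\<^bsub>P\<^esub> (\<ominus>\<^bsub>P\<^esub> ?Z \<otimes>\<^bsub>P\<^esub> e \<oplus>\<^bsub>P\<^esub> (?Z \<otimes>\<^bsub>P\<^esub> ?Y \<ominus>\<^bsub>P\<^esub> ?X) \<otimes>\<^bsub>P\<^esub> h) =
      (\<zeta> \<ominus>\<^bsub>P\<^esub> ?Z) \<otimes>\<^bsub>P\<^esub> u \<oplus>\<^bsub>P\<^esub> (r \<ominus>\<^bsub>P\<^esub> ?X) \<otimes>\<^bsub>P\<^esub> h"
  proof -
    have "(\<zeta> \<ominus>\<^bsub>P\<^esub> ?Z) \<otimes>\<^bsub>P\<^esub> u = (b \<ominus>\<^bsub>P\<^esub> q \<otimes>\<^bsub>P\<^esub> h) \<ominus>\<^bsub>P\<^esub> ?Z \<otimes>\<^bsub>P\<^esub> (e \<ominus>\<^bsub>P\<^esub> p \<otimes>\<^bsub>P\<^esub> h)"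
      using \<zeta> E ue by (simp add: P.minus_eq P.l_distr P.l_minus flip: u_def[unfolded P.minus_eq])
    then show ?thesis
      unfolding r_def using P.chart_normal_form(3)[of p q b e h i ?X ?Y ?Z] E mem pq by simp
  qed
  moreover have "\<forall>n<int (k - l). ((\<zeta> \<ominus>\<^bsub>P\<^esub> ?Z) \<otimes>\<^bsub>P\<^esub> u \<oplus>\<^bsub>P\<^esub> (r \<ominus>\<^bsub>P\<^esub> ?X) \<otimes>\<^bsub>P\<^esub> h) n = \<zero>"
  proof -
    have "\<forall>n<int (k - l). ((\<zeta> \<ominus>\<^bsub>P\<^esub> ?Z) \<otimes>\<^bsub>P\<^esub> u) n = \<zero>"
      using \<delta>(1) \<zeta>(1) E ue by (intro mult_vanish) simp_all
    moreover have "\<forall>n<int k. ((r \<ominus>\<^bsub>P\<^esub> ?X) \<otimes>\<^bsub>P\<^esub> h) n = \<zero>"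
      using \<delta>(3) r E mem by (intro mult_vanish) simp_all
    ultimately show ?thesis
      by (simp add: power_series_simps(2) add_laurent)
  qed
  moreover have "c \<oplus>\<^bsub>P\<^esub> (\<ominus>\<^bsub>P\<^esub> ?Z \<otimes>\<^bsub>P\<^esub> f \<oplus>\<^bsub>P\<^esub> (?Z \<otimes>\<^bsub>P\<^esub> ?Y \<ominus>\<^bsub>P\<^esub> ?X) \<otimes>\<^bsub>P\<^esub> i) = (r \<ominus>\<^bsub>P\<^esub> ?X) \<otimes>\<^bsub>P\<^esub> i"
    unfolding r_def using P.chart_normal_form(2)[of p q b e h i ?X ?Y ?Z] E mem pq by simp
  moreover have "\<forall>n<int k. ((r \<ominus>\<^bsub>P\<^esub> ?X) \<otimes>\<^bsub>P\<^esub> i) n = \<zero>"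
    using \<delta>(3) r E mem by (intro mult_vanish) simp_all
  moreover have "f \<oplus>\<^bsub>P\<^esub> \<ominus>\<^bsub>P\<^esub> ?Y \<otimes>\<^bsub>P\<^esub> i = (p \<ominus>\<^bsub>P\<^esub> ?Y) \<otimes>\<^bsub>P\<^esub> i"
    using P.chart_normal_form(1)[of p q b e h i ?X ?Y ?Z] E mem pq by simp
  moreover have "\<forall>n<int l. ((p \<ominus>\<^bsub>P\<^esub> ?Y) \<otimes>\<^bsub>P\<^esub> i) n = \<zero>"
    using \<delta>(2) pq E mem by (intro mult_vanish) simp_all
  ultimately have "loop_lattice S k l ?M = loop_lattice S k l g"
    using lattice_stabilizer[OF _ _ M w[unfolded w_eq] Mw[unfolded w_eq], of "int l" "int k"] assms(1)
    by (simp add: of_nat_diff)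
  moreover have "(z, \<xi>, \<eta>) \<in> points (chart0 k l) S"
    using z(1) \<xi>(1) \<eta>(1) by (simp add: chart0_def chart_def)
  ultimately show ?thesis by blast
qed

text \<open>Swapping the rows of g moves the unit into position (2,2), where the first chart
  applies; swapping back gives the matrix of the second chart.\<close>

lemma chart1_surj:
  fixes k l :: nat
  assumes "l \<le> k" and g: "g \<in> carrier (GL_super P)" and unit: "even_unit (g (Inl 1) (Inl 0) 0)"
  shows "\<exists>x\<in>points (chart1 k l) S. loop_lattice S k l (chart1_matrix S x) = loop_lattice S k l g"
proof -
  interpret P: superring P by (rule power_series_superring)
  let ?\<sigma> = "row_swap S"
  note \<sigma> = row_swap_GL
  have \<sigma>g: "mat_mult P ?\<sigma> g \<in> carrier (GL_super P)"
    using \<sigma> g by (rule P.GL_super_mult_closed)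
  have swap: "mat_mult P ?\<sigma> g (Inl 0) (Inl 0) = g (Inl 1) (Inl 0)"
    using P.GL_super_carrier[OF g] P.GL_super_carrier[OF \<sigma>]
    by (simp add: P.mat_mult_entry) (simp add: row_swap_def Let_def)
  obtain x where x: "x \<in> points (chart0 k l) S"
    "loop_lattice S k l (chart0_matrix S x) = loop_lattice S k l (mat_mult P ?\<sigma> g)"
    using chart0_surj[OF assms(1) \<sigma>g] unit unfolding swap by blast
  obtain z \<xi> \<eta> where X: "x = (z, \<xi>, \<eta>)" by (cases x)
  have t: "z \<in> trunc S (even_part S) (k - l)" "\<xi> \<in> trunc S (odd_part S) k" "\<eta> \<in> trunc S (odd_part S) l"
    using x by (auto simp: X chart0_def chart_def)
  have "mat_mult L ?\<sigma> (mat_mult P ?\<sigma> g) = mat_mult P (mat_mult P ?\<sigma> ?\<sigma>) g"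
    unfolding mat_mult_power_series[OF \<sigma> \<sigma>g]
    using P.GL_super_carrier[OF g] P.GL_super_carrier[OF \<sigma>] by (intro P.mat_mult_assoc[symmetric]) auto
  also have "\<dots> = g"
  proof -
    have "mat_mult P ?\<sigma> ?\<sigma> = mat_diag P (\<lambda>_. \<one>\<^bsub>P\<^esub>)"
      using row_swap_row_swap unfolding mat_mult_power_series[OF \<sigma> \<sigma>]
      by (simp add: mat_diag_mat3 power_series_simps)
    then show ?thesis
      using monoid.l_one[OF P.GL_super_monoid g] by simp
  qed
  finally have "loop_lattice S k l (mat_mult L ?\<sigma> (chart0_matrix S x)) = loop_lattice S k l g"
    using lattice_row_swap[OF chart0_matrix_GL[OF t] \<sigma>g, of "int k" "int l"] x(2) unfolding X by simp
  moreover have "(z, \<eta>, \<xi>) \<in> points (chart1 k l) S"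
    using t by (simp add: chart1_def chart_def)
  ultimately show ?thesis
    by (intro bexI[of _ "(z, \<eta>, \<xi>)"]) (simp_all add: chart1_matrix_def X)
qed

end

section \<open>Gluing\<close>

locale gluing =
  fixes F\<^sub>0 :: "('u, 'x) superfunctor" and F\<^sub>1 :: "('u, 'y) superfunctor" and E
  assumes F\<^sub>0: "presheaf F\<^sub>0" and F\<^sub>1: "presheaf F\<^sub>1"
    and E_points: "superalgebra R \<Longrightarrow> (x, y) \<in> E R \<Longrightarrow> x \<in> points F\<^sub>0 R \<and> y \<in> points F\<^sub>1 R"
    and E_pmap: "\<lbrakk>superalgebra R; superalgebra S; \<phi> \<in> superhom R S; (x, y) \<in> E R\<rbrakk> \<Longrightarrow>
      (pmap F\<^sub>0 R S \<phi> x, pmap F\<^sub>1 R S \<phi> y) \<in> E S"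
begin

abbreviation (input) A where "A R \<equiv> points F\<^sub>0 R <+> points F\<^sub>1 R"
abbreviation (input) rel where "rel R \<equiv> glue_rel F\<^sub>0 F\<^sub>1 E R"
abbreviation (input) base_change where
  "base_change R S \<phi> \<equiv> map_sum (pmap F\<^sub>0 R S \<phi>) (pmap F\<^sub>1 R S \<phi>)"

lemma rel_equiv: "equiv (A R) (rel R)"
proof (rule equivI)
  let ?e = "{(Inl x, Inr y) | x y. (x, y) \<in> E R}"
  have eq: "rel R = (?e \<union> ?e\<inverse>)\<^sup>* \<inter> A R \<times> A R"
    by (simp add: glue_rel_def Let_def)
  show "refl_on (A R) (rel R)"
    unfolding eq by (intro refl_onI) auto
  have "sym ((?e \<union> ?e\<inverse>)\<^sup>*)"
    by (intro sym_rtrancl sym_Un_converse)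
  then show "sym (rel R)"
    unfolding eq by (auto simp: sym_def)
  show "trans (rel R)"
    unfolding eq by (rule transI) (auto intro: rtrancl_trans)
  show "rel R \<subseteq> A R \<times> A R"
    unfolding eq by blast
qed

text \<open>Compatibility with the generating pairs propagates along chains of identifications. It
  is used with the identity as Q for lattices, and with a gluing relation as Q for base change and
  for the projection.\<close>

lemma rel_induct:
  assumes R: "superalgebra R" and ab: "(a, b) \<in> rel R"
    and Q: "equiv B Q" and h: "\<And>c. c \<in> A R \<Longrightarrow> h c \<in> B"
    and step: "\<And>x y. (x, y) \<in> E R \<Longrightarrow> (h (Inl x), h (Inr y)) \<in> Q"
  shows "(h a, h b) \<in> Q"
proof -
  let ?e = "{(Inl x, Inr y) | x y. (x, y) \<in> E R}"
  have a: "a \<in> A R" and path: "(a, b) \<in> (?e \<union> ?e\<inverse>)\<^sup>*"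
    using ab by (auto simp: glue_rel_def Let_def)
  from path show ?thesis
  proof (induction rule: rtrancl_induct)
    case base
    show ?case
      using equivE[OF Q] h[OF a] by (auto dest: refl_onD)
  next
    case (step c d)
    then have "(h c, h d) \<in> Q"
      using assms(5) equivE[OF Q] by (auto dest: symD)
    then show ?case
      using step.IH equivE[OF Q] by (auto dest: transD)
  qed
qed

lemma glue_points: "C \<in> points (glue_presheaf F\<^sub>0 F\<^sub>1 E) R \<longleftrightarrow> (\<exists>a\<in>A R. C = rel R `` {a})"
  by (auto simp: glue_presheaf_def quotient_def)

text \<open>All representatives have Q-equivalent images, so the union of their Q-classes is one
  class. Base change and the projection are defined through images of whole classes and can thus be
  computed on a single representative.\<close>

lemma rel_class_image:
  assumes R: "superalgebra R" and a: "a \<in> A R"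
    and Q: "equiv B Q" and h: "\<And>c. c \<in> A R \<Longrightarrow> h c \<in> B"
    and step: "\<And>x y. (x, y) \<in> E R \<Longrightarrow> (h (Inl x), h (Inr y)) \<in> Q"
  shows "Q `` (h ` (rel R `` {a})) = Q `` {h a}"
proof -
  let ?X = "rel R `` {a}"
  have a: "a \<in> ?X"
    using rel_equiv a by (rule equiv_class_self)
  have same: "Q `` {h b} = Q `` {h a}" if "b \<in> ?X" for b
  proof -
    have "(h a, h b) \<in> Q"
      by (rule rel_induct[OF R _ Q h step]) (use that in auto)
    then show ?thesis
      using equiv_class_eq[OF Q] by blast
  qed
  have "Q `` (h ` ?X) = (\<Union>b\<in>?X. Q `` {h b})"
    by blast
  also have "\<dots> = (\<Union>b\<in>?X. Q `` {h a})"
    by (intro SUP_cong refl same)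
  also have "\<dots> = Q `` {h a}"
    using a by (intro SUP_const) blast
  finally show ?thesis .
qed

lemma base_change_mem:
  assumes "superalgebra R" "superalgebra S" "\<phi> \<in> superhom R S" "a \<in> A R"
  shows "base_change R S \<phi> a \<in> A S"
  using assms(4) presheafD(1)[OF F\<^sub>0 assms(1-3)] presheafD(1)[OF F\<^sub>1 assms(1-3)] by auto

lemma E_rel: "superalgebra R \<Longrightarrow> (x, y) \<in> E R \<Longrightarrow> (Inl x, Inr y) \<in> rel R"
  using E_points by (auto simp: glue_rel_def Let_def intro!: r_into_rtrancl)

lemma glue_pmap:
  assumes R: "superalgebra R" and S: "superalgebra S" and \<phi>: "\<phi> \<in> superhom R S" and a: "a \<in> A R"
  shows "pmap (glue_presheaf F\<^sub>0 F\<^sub>1 E) R S \<phi> (rel R `` {a}) = rel S `` {base_change R S \<phi> a}"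
  using rel_class_image[OF R a rel_equiv[of S], of "base_change R S \<phi>"] base_change_mem[OF R S \<phi>]
    E_rel[OF S E_pmap[OF R S \<phi>]]
  by (simp add: glue_presheaf_def)

lemma glue_presheaf: "presheaf (glue_presheaf F\<^sub>0 F\<^sub>1 E)"
  unfolding presheaf_def
proof (intro conjI allI impI)
  fix R S :: "'u superalg" and \<phi> C
  assume R: "superalgebra R" and S: "superalgebra S" and \<phi>: "\<phi> \<in> superhom R S"
    and "C \<in> points (glue_presheaf F\<^sub>0 F\<^sub>1 E) R"
  then obtain a where a: "a \<in> A R" "C = rel R `` {a}"
    unfolding glue_points by blast
  show "pmap (glue_presheaf F\<^sub>0 F\<^sub>1 E) R S \<phi> C \<in> points (glue_presheaf F\<^sub>0 F\<^sub>1 E) S"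
    unfolding a(2) glue_pmap[OF R S \<phi> a(1)] glue_points
    by (rule bexI[OF refl base_change_mem[OF R S \<phi> a(1)]])
next
  fix R :: "'u superalg" and C
  assume R: "superalgebra R" and "C \<in> points (glue_presheaf F\<^sub>0 F\<^sub>1 E) R"
  then obtain a where a: "a \<in> A R" "C = rel R `` {a}"
    unfolding glue_points by blast
  have "base_change R R (\<lambda>x\<in>carrier R. x) a = a"
    using a(1) presheafD(2)[OF F\<^sub>0 R] presheafD(2)[OF F\<^sub>1 R] by auto
  then show "pmap (glue_presheaf F\<^sub>0 F\<^sub>1 E) R R (\<lambda>x\<in>carrier R. x) C = C"
    using glue_pmap[OF R R superhom_id[OF R] a(1)] a(2) by simp
next
  fix R S T :: "'u superalg" and \<phi> \<psi> C
  assume R: "superalgebra R" and S: "superalgebra S" and T: "superalgebra T"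
    and \<phi>: "\<phi> \<in> superhom R S" and \<psi>: "\<psi> \<in> superhom S T"
    and "C \<in> points (glue_presheaf F\<^sub>0 F\<^sub>1 E) R"
  then obtain a where a: "a \<in> A R" "C = rel R `` {a}"
    unfolding glue_points by blast
  have "base_change S T \<psi> (base_change R S \<phi> a) = base_change R T (compose (carrier R) \<psi> \<phi>) a"
    using a(1) presheafD(3)[OF F\<^sub>0 R S T \<phi> \<psi>] presheafD(3)[OF F\<^sub>1 R S T \<phi> \<psi>] by auto
  then show "pmap (glue_presheaf F\<^sub>0 F\<^sub>1 E) S T \<psi> (pmap (glue_presheaf F\<^sub>0 F\<^sub>1 E) R S \<phi> C) =
      pmap (glue_presheaf F\<^sub>0 F\<^sub>1 E) R T (compose (carrier R) \<psi> \<phi>) C"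
    using glue_pmap[OF R S \<phi> a(1)] glue_pmap[OF S T \<psi> base_change_mem[OF R S \<phi> a(1)]]
      glue_pmap[OF R T superhom_compose[OF R S T \<phi> \<psi>] a(1)] a(2) by simp
qed

end

section \<open>The affine line, the projective line and the charts as presheaves\<close>

lemma affine_line_presheaf: "presheaf affine_line"
  unfolding presheaf_def
proof (intro conjI allI impI)
  fix R S :: "'a superalg" and \<phi> x
  assume "\<phi> \<in> superhom R S" "x \<in> points affine_line R"
  then show "pmap affine_line R S \<phi> x \<in> points affine_line S"
    by (auto simp: superhom_def affine_line_def)
next
  fix R :: "'a superalg" and x
  assume R: "superalgebra R" and x: "x \<in> points affine_line R"
  interpret superring R by (rule superalgebra_superring[OF R])
  show "pmap affine_line R R (\<lambda>a\<in>carrier R. a) x = x"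
    using x by (simp add: affine_line_def)
next
  fix R S T :: "'a superalg" and \<phi> \<psi> x
  assume R: "superalgebra R" and x: "x \<in> points affine_line R"
  interpret superring R by (rule superalgebra_superring[OF R])
  show "pmap affine_line S T \<psi> (pmap affine_line R S \<phi> x) = pmap affine_line R T (compose (carrier R) \<psi> \<phi>) x"
    using x by (simp add: affine_line_def compose_def)
qed

lemma P1_gluing: "gluing affine_line affine_line P1_overlap"
proof (intro gluing.intro affine_line_presheaf)
  fix R :: "'a superalg" and x y
  assume "(x, y) \<in> P1_overlap R"
  then show "x \<in> points affine_line R \<and> y \<in> points affine_line R"
    by (auto simp: P1_overlap_def affine_line_def)
next
  fix R S :: "'a superalg" and \<phi> x y
  assume R: "superalgebra R" "superalgebra S" "\<phi> \<in> superhom R S" and xy: "(x, y) \<in> P1_overlap R"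
  interpret superring_hom R S \<phi> by (rule superhom_superring_hom[OF R])
  have e: "x \<in> even_part R" "y \<in> even_part R" "x \<otimes>\<^bsub>R\<^esub> y = \<one>\<^bsub>R\<^esub>"
    using xy by (auto simp: P1_overlap_def)
  have "\<phi> x \<otimes>\<^bsub>S\<^esub> \<phi> y = \<phi> (x \<otimes>\<^bsub>R\<^esub> y)"
    using e(1,2) by simp
  also have "\<dots> = \<one>\<^bsub>S\<^esub>"
    unfolding e(3) by simp
  finally show "(pmap affine_line R S \<phi> x, pmap affine_line R S \<phi> y) \<in> P1_overlap S"
    using e(1,2) by (simp add: P1_overlap_def affine_line_def)
qed

lemma chart_carrier:
  fixes R :: "'u superalg"
  assumes R: "superalgebra R" and x: "(z, \<xi>, \<eta>) \<in> points (chart a b c) R"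
  shows "z n \<in> carrier R" "\<xi> n \<in> carrier R" "\<eta> n \<in> carrier R"
proof -
  interpret superring R by (rule superalgebra_superring[OF R])
  show "z n \<in> carrier R" "\<xi> n \<in> carrier R" "\<eta> n \<in> carrier R"
    using x by (cases "n < a"; cases "n < b"; cases "n < c"; simp add: chart_def trunc_def)+
qed

lemma chart_presheaf: "presheaf (chart a b c)"
  unfolding presheaf_def
proof (intro conjI allI impI)
  fix R S :: "'a superalg" and \<phi> x
  assume R: "superalgebra R" and S: "superalgebra S" and \<phi>: "\<phi> \<in> superhom R S" and x: "x \<in> points (chart a b c) R"
  interpret superring_hom R S \<phi> by (rule superhom_superring_hom[OF R S \<phi>])
  show "pmap (chart a b c) R S \<phi> x \<in> points (chart a b c) S"
    using x by (auto simp: chart_def trunc_def)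
next
  fix R :: "'a superalg" and x
  assume R: "superalgebra R" and x: "x \<in> points (chart a b c) R"
  then show "pmap (chart a b c) R R (\<lambda>a\<in>carrier R. a) x = x"
    using chart_carrier[OF R] by (cases x) (simp add: chart_def fun_eq_iff)
next
  fix R S T :: "'a superalg" and \<phi> \<psi> x
  assume R: "superalgebra R" and x: "x \<in> points (chart a b c) R"
  then show "pmap (chart a b c) S T \<psi> (pmap (chart a b c) R S \<phi> x) = pmap (chart a b c) R T (compose (carrier R) \<psi> \<phi>) x"
    using chart_carrier[OF R] by (cases x) (simp add: chart_def fun_eq_iff compose_def)
qed

section \<open>The presheaf of lattices\<close>

text \<open>The image of a coset under \<phi> is only part of a coset; multiplying on the right by
  the subgroup over S completes it, because \<phi> maps the subgroup over R into it.\<close>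

lemma Gr_pmap_lcoset:
  fixes g :: "2 + 1 \<Rightarrow> 2 + 1 \<Rightarrow> int \<Rightarrow> 'u"
  assumes R: "superalgebra R" and S: "superalgebra S" and \<phi>: "\<phi> \<in> superhom R S"
    and g: "g \<in> carrier (GL_super (laurent R))"
  shows "pmap Gr_presheaf R S \<phi> (g <#\<^bsub>GL_super (laurent R)\<^esub> carrier (GL_super (power_series R))) =
    mat_map \<phi> g <#\<^bsub>GL_super (laurent S)\<^esub> carrier (GL_super (power_series S))"
proof -
  interpret superring_hom R S \<phi> by (rule superhom_superring_hom[OF R S \<phi>])
  interpret LR: superring "laurent R" by (rule R.laurent_superring)
  interpret LS: superring "laurent S" by (rule S.laurent_superring)
  interpret KS: group "GL_super (laurent S) :: (2 + 1 \<Rightarrow> 2 + 1 \<Rightarrow> int \<Rightarrow> 'u) monoid" by (rule LS.GL_super_group)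
  interpret KR: group "GL_super (laurent R) :: (2 + 1 \<Rightarrow> 2 + 1 \<Rightarrow> int \<Rightarrow> 'u) monoid" by (rule LR.GL_super_group)
  note HR = R.GL_power_series_subgroup and HS = S.GL_power_series_subgroup
  have mult: "mat_map \<phi> (mat_mult (laurent R) g h) = mat_mult (laurent S) (mat_map \<phi> g) (mat_map \<phi> h)"
    if "h \<in> carrier (GL_super (power_series R))" for h
    using LR.GL_super_carrier g subgroup.mem_carrier[OF HR that] by (intro mat_map_mult) auto
  have g': "mat_map \<phi> g \<in> carrier (GL_super (laurent S))"
    using g by (rule mat_map_GL_laurent)
  show ?thesis (is "?l = ?r")
  proof
    show "?l \<subseteq> ?r"
    proof
      fix x assume "x \<in> ?l"
      then obtain h h' where h: "h \<in> carrier (GL_super (power_series R))" "h' \<in> carrier (GL_super (power_series S))"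
        and x: "x = mat_mult (laurent S) (mat_map \<phi> (mat_mult (laurent R) g h)) h'"
        by (auto simp: Gr_presheaf_def l_coset_def set_mult_def)
      note m = mat_map_GL_power_series[OF h(1)]
      have "x = mat_mult (laurent S) (mat_map \<phi> g) (mat_mult (laurent S) (mat_map \<phi> h) h')"
        unfolding x mult[OF h(1)]
        using KS.m_assoc[OF g' subgroup.mem_carrier[OF HS m] subgroup.mem_carrier[OF HS h(2)]] by simp
      moreover have "mat_mult (laurent S) (mat_map \<phi> h) h' \<in> carrier (GL_super (power_series S))"
        using subgroup.m_closed[OF HS m h(2)] by simp
      ultimately show "x \<in> ?r"
        by (auto simp: l_coset_def)
    qed
    show "?r \<subseteq> ?l"
    proof
      fix x assume "x \<in> ?r"
      then obtain h where h: "h \<in> carrier (GL_super (power_series S))" "x = mat_mult (laurent S) (mat_map \<phi> g) h"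
        by (auto simp: l_coset_def)
      have "mat_mult (laurent R) g (mat_diag (laurent R) (\<lambda>_. \<one>\<^bsub>laurent R\<^esub>)) = g"
        using KR.r_one[OF g] by simp
      moreover have "(mat_diag (laurent R) (\<lambda>_. \<one>\<^bsub>laurent R\<^esub>) :: 2 + 1 \<Rightarrow> 2 + 1 \<Rightarrow> int \<Rightarrow> 'u) \<in> carrier (GL_super (power_series R))"
        using subgroup.one_closed[OF HR] by simp
      ultimately have "g \<in> g <#\<^bsub>GL_super (laurent R)\<^esub> carrier (GL_super (power_series R))"
        unfolding l_coset_def by force
      then show "x \<in> ?l"
        using h by (auto simp: Gr_presheaf_def set_mult_def)
    qed
  qed
qed

lemma Gr_points:
  "C \<in> points Gr_presheaf R \<longleftrightarrow> (\<exists>g\<in>carrier (GL_super (laurent R)).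
    C = g <#\<^bsub>GL_super (laurent R)\<^esub> carrier (GL_super (power_series R)))"
  by (auto simp: Gr_presheaf_def LCOSETS_def)

lemma Gr_presheaf_presheaf: "presheaf (Gr_presheaf :: ('u, ('u, 2, 1) loop_coset) superfunctor)"
  unfolding presheaf_def
proof (intro conjI allI impI)
  fix R S :: "'u superalg" and \<phi> and C :: "('u, 2, 1) loop_coset"
  assume R: "superalgebra R" and S: "superalgebra S" and \<phi>: "\<phi> \<in> superhom R S"
    and "C \<in> points Gr_presheaf R"
  then obtain g where "g \<in> carrier (GL_super (laurent R))"
    "C = g <#\<^bsub>GL_super (laurent R)\<^esub> carrier (GL_super (power_series R))"
    unfolding Gr_points by blast
  then show "pmap Gr_presheaf R S \<phi> C \<in> points Gr_presheaf S"
    using Gr_pmap_lcoset[OF R S \<phi>] superring_hom.mat_map_GL_laurent[OF superhom_superring_hom[OF R S \<phi>]]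
    unfolding Gr_points by blast
next
  fix R :: "'u superalg" and C :: "('u, 2, 1) loop_coset"
  assume R: "superalgebra R" and "C \<in> points Gr_presheaf R"
  then obtain g where g: "g \<in> carrier (GL_super (laurent R))"
    "C = g <#\<^bsub>GL_super (laurent R)\<^esub> carrier (GL_super (power_series R))"
    unfolding Gr_points by blast
  interpret R: superring R by (rule superalgebra_superring[OF R])
  have "g i j n \<in> carrier R" for i j n
    using superring.GL_super_carrier[OF R.laurent_superring g(1), of i j] by (simp add: R.carrier_laurent)
  then have "mat_map (\<lambda>a\<in>carrier R. a) g = g"
    by (simp add: mat_map_def)
  then show "pmap Gr_presheaf R R (\<lambda>a\<in>carrier R. a) C = C"
    using Gr_pmap_lcoset[OF R R superhom_id[OF R] g(1)] g(2) by simp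
next
  fix R S T :: "'u superalg" and \<phi> \<psi> and C :: "('u, 2, 1) loop_coset"
  assume R: "superalgebra R" and S: "superalgebra S" and T: "superalgebra T"
    and \<phi>: "\<phi> \<in> superhom R S" and \<psi>: "\<psi> \<in> superhom S T" and "C \<in> points Gr_presheaf R"
  then obtain g where g: "g \<in> carrier (GL_super (laurent R))"
    "C = g <#\<^bsub>GL_super (laurent R)\<^esub> carrier (GL_super (power_series R))"
    unfolding Gr_points by blast
  interpret R: superring R by (rule superalgebra_superring[OF R])
  have "g i j n \<in> carrier R" for i j n
    using superring.GL_super_carrier[OF R.laurent_superring g(1), of i j] by (simp add: R.carrier_laurent)
  then have "mat_map \<psi> (mat_map \<phi> g) = mat_map (compose (carrier R) \<psi> \<phi>) g"
    by (simp add: mat_map_def compose_def)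
  then show "pmap Gr_presheaf S T \<psi> (pmap Gr_presheaf R S \<phi> C) = pmap Gr_presheaf R T (compose (carrier R) \<psi> \<phi>) C"
    using Gr_pmap_lcoset[OF R S \<phi> g(1)] Gr_pmap_lcoset[OF R T superhom_compose[OF R S T \<phi> \<psi>] g(1)]
      Gr_pmap_lcoset[OF S T \<psi> superring_hom.mat_map_GL_laurent[OF superhom_superring_hom[OF R S \<phi>] g(1)]] g(2)
    by simp
qed

section \<open>The orbit and the superscheme\<close>

text \<open>The coefficients of \<open>t^\<lambda>\<close> are 0 and 1, so every homomorphism fixes
  it.\<close>

lemma lattice_pmap:
  assumes R: "superalgebra R" and S: "superalgebra S" and \<phi>: "\<phi> \<in> superhom R S"
    and g: "g \<in> carrier (GL_super (power_series R))"
  shows "pmap Gr_presheaf R S \<phi> (loop_lattice R k l g) = loop_lattice S k l (mat_map \<phi> g)"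
proof -
  interpret superring_hom R S \<phi> by (rule superhom_superring_hom[OF R S \<phi>])
  interpret L: superring "laurent R" by (rule R.laurent_superring)
  interpret K: group "GL_super (laurent R) :: (2 + 1 \<Rightarrow> 2 + 1 \<Rightarrow> int \<Rightarrow> 'a) monoid" by (rule L.GL_super_group)
  note gK = subgroup.mem_carrier[OF R.GL_power_series_subgroup g] and T = R.t_power_GL[of k l]
  have "mat_map \<phi> (mat_mult (laurent R) g (t_power R (weight k l))) =
      mat_mult (laurent S) (mat_map \<phi> g) (t_power S (weight k l))"
    using mat_map_mult[of g "t_power R (weight k l)"] L.GL_super_carrier[OF gK] L.GL_super_carrier[OF T]
    by (simp add: mat_map_t_power)
  then show ?thesis
    unfolding loop_lattice_def using Gr_pmap_lcoset[OF R S \<phi> K.m_closed[OF gK T]] by simp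
qed

lemma chart_point_cases:
  assumes "x \<in> points (chart a b c) R"
  obtains z \<xi> \<eta> where "x = (z, \<xi>, \<eta>)" "z \<in> trunc R (even_part R) a"
    "\<xi> \<in> trunc R (odd_part R) b" "\<eta> \<in> trunc R (odd_part R) c"
  using assms by (cases x) (auto simp: chart_def)

definition gluing_matrix :: "'u superalg \<Rightarrow> 'u chart_point + 'u chart_point \<Rightarrow> 2 + 1 \<Rightarrow> 2 + 1 \<Rightarrow> int \<Rightarrow> 'u" where
  "gluing_matrix R = case_sum (chart0_matrix R) (chart1_matrix R)"

lemma gluing_matrix_GL:
  assumes "superring R" and "a \<in> points (chart0 k l) R <+> points (chart1 k l) R"
  shows "gluing_matrix R a \<in> carrier (GL_super (power_series R))"
proof -
  interpret superring R by fact
  interpret P: superring "power_series R" by (rule power_series_superring)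
  from assms(2) show ?thesis
  proof
    fix x assume "a = Inl x" "x \<in> points (chart0 k l) R"
    then show ?thesis
      unfolding chart0_def
      by (elim chart_point_cases) (auto simp: gluing_matrix_def intro: chart0_matrix_GL)
  next
    fix x assume "a = Inr x" "x \<in> points (chart1 k l) R"
    then show ?thesis
      unfolding chart1_def
    proof (elim chart_point_cases)
      fix z \<xi> \<eta> assume a: "a = Inr x" "x = (z, \<xi>, \<eta>)"
        and t: "z \<in> trunc R (even_part R) (k - l)" "\<xi> \<in> trunc R (odd_part R) l" "\<eta> \<in> trunc R (odd_part R) k"
      show ?thesis
        using P.GL_super_mult_closed[OF row_swap_GL chart0_matrix_GL, OF t(1,3,2)]
        unfolding a mat_mult_power_series[OF row_swap_GL chart0_matrix_GL, OF t(1,3,2), symmetric]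
        by (simp add: gluing_matrix_def chart1_matrix_def)
    qed
  qed
qed

lemma gluing_matrix_pmap:
  assumes R: "superalgebra R" and S: "superalgebra S" and \<phi>: "\<phi> \<in> superhom R S"
    and a: "a \<in> points (chart0 k l) R <+> points (chart1 k l) R"
  shows "mat_map \<phi> (gluing_matrix R a) =
    gluing_matrix S (map_sum (pmap (chart0 k l) R S \<phi>) (pmap (chart1 k l) R S \<phi>) a)"
proof -
  interpret superring_hom R S \<phi> by (rule superhom_superring_hom[OF R S \<phi>])
  interpret P: superring "power_series R" by (rule R.power_series_superring)
  interpret L: superring "laurent R" by (rule R.laurent_superring)
  have emb: "\<phi> \<circ> emb R p = emb S (\<phi> \<circ> p)" for p
    by (auto simp: emb_def)
  have const: "\<phi> \<circ> \<one>\<^bsub>power_series R\<^esub> = \<one>\<^bsub>power_series S\<^esub>" "\<phi> \<circ> \<zero>\<^bsub>power_series R\<^esub> = \<zero>\<^bsub>power_series S\<^esub>"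
    by (auto simp: R.power_series_simps S.power_series_simps R.one_laurent S.one_laurent R.zero_laurent S.zero_laurent)
  have chart0: "mat_map \<phi> (chart0_matrix R (z, \<xi>, \<eta>)) = chart0_matrix S (\<phi> \<circ> z, \<phi> \<circ> \<xi>, \<phi> \<circ> \<eta>)" for z \<xi> \<eta>
    unfolding chart0_matrix_def Let_def prod.case mat_map_mat3 emb const ..
  have swap: "mat_map \<phi> (row_swap R) = row_swap S"
    unfolding row_swap_def Let_def mat_map_mat3 const ..
  have c: "A i j \<in> carrier (laurent R)" if "A \<in> carrier (GL_super (power_series R))" for A :: "2 + 1 \<Rightarrow> 2 + 1 \<Rightarrow> int \<Rightarrow> 'a" and i j
    using L.GL_super_carrier[OF subgroup.mem_carrier[OF R.GL_power_series_subgroup that]] .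
  from a show ?thesis
  proof
    fix x assume a: "a = Inl x" "x \<in> points (chart0 k l) R"
    then show ?thesis
      by (cases x) (simp add: gluing_matrix_def chart0 chart0_def chart_def)
  next
    fix x assume a: "a = Inr x" and x: "x \<in> points (chart1 k l) R"
    obtain z \<xi> \<eta> where X: "x = (z, \<xi>, \<eta>)" and t: "z \<in> trunc R (even_part R) (k - l)"
      "\<xi> \<in> trunc R (odd_part R) l" "\<eta> \<in> trunc R (odd_part R) k"
      using x unfolding chart1_def by (elim chart_point_cases)
    have "mat_map \<phi> (chart1_matrix R (z, \<xi>, \<eta>)) = chart1_matrix S (\<phi> \<circ> z, \<phi> \<circ> \<xi>, \<phi> \<circ> \<eta>)"
      unfolding chart1_matrix_def prod.case swap[symmetric] chart0[symmetric]
      using c[OF R.row_swap_GL] c[OF R.chart0_matrix_GL[OF t(1,3,2)]] by (rule mat_map_mult)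
    then show ?thesis
      by (simp add: a X gluing_matrix_def chart1_def chart_def)
  qed
qed

section \<open>The map from the glued charts to lattices, and its image\<close>

context
  fixes k l :: nat
  assumes kl: "0 < l" "l < k"
begin

definition code :: "'u superalg \<Rightarrow> 'u chart_point + 'u chart_point \<Rightarrow> ('u, 2, 1) loop_coset" where
  "code R a = loop_lattice R k l (gluing_matrix R a)"

lemma code_overlap:
  assumes "superalgebra R" "x \<in> points (chart0 k l) R" "y \<in> points (chart1 k l) R"
  shows "code R (Inl x) = code R (Inr y) \<longleftrightarrow> (x, y) \<in> P_overlap k l R"
  using superring.chart0_chart1[OF superalgebra_superring[OF assms(1)] kl(2) assms(2,3)]
  by (simp add: code_def gluing_matrix_def)

lemma code_pmap:
  assumes R: "superalgebra R" and S: "superalgebra S" and \<phi>: "\<phi> \<in> superhom R S"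
    and a: "a \<in> points (chart0 k l) R <+> points (chart1 k l) R"
  shows "code S (map_sum (pmap (chart0 k l) R S \<phi>) (pmap (chart1 k l) R S \<phi>) a) =
    pmap Gr_presheaf R S \<phi> (code R a)"
  unfolding code_def gluing_matrix_pmap[OF assms, symmetric]
  by (rule lattice_pmap[OF R S \<phi> gluing_matrix_GL[OF superalgebra_superring[OF R] a], symmetric])

text \<open>Stability of the gluing relations under base change is obtained without computing with
  truncated products: on chart points the relations express equality of lattices, and lattices are
  mapped functorially.\<close>

lemma P_gluing: "gluing (chart0 k l) (chart1 k l) (P_overlap k l)"
proof
  show "presheaf (chart0 k l)" "presheaf (chart1 k l)"
    by (simp_all add: chart0_def chart1_def chart_presheaf)
  show points: "x \<in> points (chart0 k l) R \<and> y \<in> points (chart1 k l) R"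
    if "superalgebra R" "(x, y) \<in> P_overlap k l R" for R :: "'a superalg" and x y
    using that by (auto simp: P_overlap_def)
  fix R S :: "'a superalg" and \<phi> x y
  assume R: "superalgebra R" and S: "superalgebra S" and \<phi>: "\<phi> \<in> superhom R S" and xy: "(x, y) \<in> P_overlap k l R"
  have x: "x \<in> points (chart0 k l) R" and y: "y \<in> points (chart1 k l) R"
    using points[OF R xy] by auto
  have pm: "pmap (chart0 k l) R S \<phi> x \<in> points (chart0 k l) S" "pmap (chart1 k l) R S \<phi> y \<in> points (chart1 k l) S"
    using x y presheafD(1)[OF chart_presheaf R S \<phi>] by (auto simp: chart0_def chart1_def)
  have "code R (Inl x) = code R (Inr y)"
    using code_overlap[OF R x y] xy by blast
  then have "code S (Inl (pmap (chart0 k l) R S \<phi> x)) = code S (Inr (pmap (chart1 k l) R S \<phi> y))"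
    using code_pmap[OF R S \<phi> InlI[OF x]] code_pmap[OF R S \<phi> InrI[OF y]] by simp
  then show "(pmap (chart0 k l) R S \<phi> x, pmap (chart1 k l) R S \<phi> y) \<in> P_overlap k l S"
    using code_overlap[OF S pm] by blast
qed

interpretation P: gluing "chart0 k l" "chart1 k l" "P_overlap k l"
  by (rule P_gluing)

interpretation P1: gluing affine_line affine_line P1_overlap
  by (rule P1_gluing)

abbreviation (input) overlap_rel where "overlap_rel R \<equiv> glue_rel (chart0 k l) (chart1 k l) (P_overlap k l) R"

text \<open>Each chart embeds into lattices, and the pairs from different charts with equal lattice
  are exactly the overlap. So the generated relation is the kernel of \<open>code\<close>; in
  particular no chain of identifications merges two points of one chart.\<close>

lemma overlap_rel_iff:
  assumes R: "superalgebra R" and a: "a \<in> points (chart0 k l) R <+> points (chart1 k l) R"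
    and b: "b \<in> points (chart0 k l) R <+> points (chart1 k l) R"
  shows "(a, b) \<in> overlap_rel R \<longleftrightarrow> code R a = code R b"
proof
  assume "(a, b) \<in> overlap_rel R"
  then have "(code R a, code R b) \<in> Id"
    by (rule P.rel_induct[OF R, where B = UNIV])
      (use code_overlap[OF R] P.E_points[OF R] in \<open>auto simp: equiv_def refl_on_def sym_def trans_def\<close>)
  then show "code R a = code R b" by simp
next
  note ring = superalgebra_superring[OF R]
  assume eq: "code R a = code R b"
  have cross: "(Inl x, Inr y) \<in> overlap_rel R"
    if "code R (Inl x) = code R (Inr y)" "x \<in> points (chart0 k l) R" "y \<in> points (chart1 k l) R" for x y
    using code_overlap[OF R that(2,3)] that(1) P.E_rel[OF R] by blast
  have refl: "(a, a) \<in> overlap_rel R" and sym: "sym (overlap_rel R)"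
    using P.rel_equiv[of R] a by (auto simp: equiv_def refl_on_def)
  show "(a, b) \<in> overlap_rel R"
  proof (cases a; cases b)
    fix x y assume ab: "a = Inl x" "b = Inl y"
    then have "x = y"
      using eq a b superring.chart0_chart0[OF ring less_imp_le[OF kl(2)], of x y]
      by (auto simp: code_def gluing_matrix_def)
    then show ?thesis
      using refl ab by simp
  next
    fix x y assume ab: "a = Inr x" "b = Inr y"
    then have "x = y"
      using eq a b superring.chart1_chart1[OF ring less_imp_le[OF kl(2)], of x y]
      by (auto simp: code_def gluing_matrix_def)
    then show ?thesis
      using refl ab by simp
  next
    fix x y assume ab: "a = Inl x" "b = Inr y"
    then show ?thesis
      using cross[of x y] eq a b by auto
  next
    fix x y assume ab: "a = Inr x" "b = Inl y"
    then show ?thesis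
      using cross[of y x] eq a b symD[OF sym] by auto
  qed
qed

text \<open>\<open>code\<close> is constant on classes, so the image of a class is a singleton and
  \<open>the_elem\<close> extracts its element.\<close>

definition class_code :: "'u superalg \<Rightarrow> ('u chart_point + 'u chart_point) set \<Rightarrow> ('u, 2, 1) loop_coset" where
  "class_code R C = the_elem (code R ` C)"

lemma class_code_class:
  assumes R: "superalgebra R" and a: "a \<in> points (chart0 k l) R <+> points (chart1 k l) R"
  shows "class_code R (overlap_rel R `` {a}) = code R a"
proof -
  have "code R b = code R a" if "b \<in> overlap_rel R `` {a}" for b
  proof -
    have "(a, b) \<in> overlap_rel R"
      using that by blast
    moreover from this have "b \<in> points (chart0 k l) R <+> points (chart1 k l) R"
      by (simp add: glue_rel_def Let_def)
    ultimately show ?thesis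
      using overlap_rel_iff[OF R a] by simp
  qed
  moreover have "a \<in> overlap_rel R `` {a}"
    using P.rel_equiv a by (rule equiv_class_self)
  ultimately have "code R ` (overlap_rel R `` {a}) = {code R a}"
    by blast
  then show ?thesis
    by (simp add: class_code_def)
qed

lemma class_code_morphism:
  "presheaf_morphism (glue_presheaf (chart0 k l) (chart1 k l) (P_overlap k l))
    (Gr_presheaf :: ('u, ('u, 2, 1) loop_coset) superfunctor) class_code"
proof (intro presheaf_morphism.intro P.glue_presheaf Gr_presheaf_presheaf)
  show "superfunctor_morphism (glue_presheaf (chart0 k l) (chart1 k l) (P_overlap k l))
      (Gr_presheaf :: ('u, ('u, 2, 1) loop_coset) superfunctor) class_code"
    unfolding superfunctor_morphism_def
  proof (intro conjI allI impI funcsetI)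
    fix R :: "'u superalg" and C
    assume R: "superalgebra R" and "C \<in> points (glue_presheaf (chart0 k l) (chart1 k l) (P_overlap k l)) R"
    then obtain a where a: "a \<in> points (chart0 k l) R <+> points (chart1 k l) R" "C = overlap_rel R `` {a}"
      unfolding P.glue_points by blast
    interpret superring R by (rule superalgebra_superring[OF R])
    interpret L: superring "laurent R" by (rule laurent_superring)
    interpret K: group "GL_super (laurent R) :: (2 + 1 \<Rightarrow> 2 + 1 \<Rightarrow> int \<Rightarrow> 'u) monoid" by (rule L.GL_super_group)
    have "gluing_matrix R a \<in> carrier (GL_super (laurent R))"
      using subgroup.mem_carrier[OF GL_power_series_subgroup gluing_matrix_GL[OF superring_axioms a(1)]] .
    then have "mat_mult (laurent R) (gluing_matrix R a) (t_power R (weight k l)) \<in> carrier (GL_super (laurent R))"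
      using K.m_closed[OF _ t_power_GL] by simp
    then show "class_code R C \<in> points Gr_presheaf R"
      unfolding a(2) class_code_class[OF R a(1)] code_def loop_lattice_def Gr_points by blast
  next
    fix R S :: "'u superalg" and \<phi> C
    assume "superalgebra R \<and> superalgebra S \<and> \<phi> \<in> superhom R S \<and>
      C \<in> points (glue_presheaf (chart0 k l) (chart1 k l) (P_overlap k l)) R"
    then obtain a where R: "superalgebra R" and S: "superalgebra S" and \<phi>: "\<phi> \<in> superhom R S"
      and a: "a \<in> points (chart0 k l) R <+> points (chart1 k l) R" "C = overlap_rel R `` {a}"
      unfolding P.glue_points by blast
    show "class_code S (pmap (glue_presheaf (chart0 k l) (chart1 k l) (P_overlap k l)) R S \<phi> C) =
        pmap Gr_presheaf R S \<phi> (class_code R C)"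
      unfolding a(2) P.glue_pmap[OF R S \<phi> a(1)] class_code_class[OF R a(1)]
        class_code_class[OF S P.base_change_mem[OF R S \<phi> a(1)]]
      by (rule code_pmap[OF R S \<phi> a(1)])
  qed
qed

lemma class_code_inj:
  assumes S: "superalgebra S"
    and x: "x \<in> points (glue_presheaf (chart0 k l) (chart1 k l) (P_overlap k l)) S"
    and y: "y \<in> points (glue_presheaf (chart0 k l) (chart1 k l) (P_overlap k l)) S"
    and eq: "class_code S x = class_code S y"
  shows "x = y"
proof -
  obtain a where a: "a \<in> points (chart0 k l) S <+> points (chart1 k l) S" "x = overlap_rel S `` {a}"
    using x unfolding P.glue_points by blast
  obtain b where b: "b \<in> points (chart0 k l) S <+> points (chart1 k l) S" "y = overlap_rel S `` {b}"
    using y unfolding P.glue_points by blast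
  have "(a, b) \<in> overlap_rel S"
    using eq unfolding overlap_rel_iff[OF S a(1) b(1)] a(2) b(2) class_code_class[OF S a(1)] class_code_class[OF S b(1)] .
  then show ?thesis
    unfolding a(2) b(2) by (rule equiv_class_eq[OF P.rel_equiv])
qed

text \<open>
  The determinant of the even block of a matrix over power series is a unit, so the constant terms
  of the two entries of its second column generate the unit ideal: one of the two charts applies
  locally.
\<close>

lemma lattice_locally_chart:
  assumes S: "superalgebra S" and g: "g \<in> carrier (GL_super (power_series S))"
  shows "locally S (\<lambda>T \<psi>. \<exists>x\<in>points (glue_presheaf (chart0 k l) (chart1 k l) (P_overlap k l)) T.
    class_code T x = loop_lattice T k l (mat_map \<psi> g))"
proof -
  interpret superring S by (rule superalgebra_superring[OF S])
  interpret P: superring "power_series S" by (rule power_series_superring)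
  obtain a b c d e f g' h i where eq: "g = mat3 a b c d e f g' h i"
    by (rule mat3_cases)
  note mem = g[unfolded eq P.GL_super_mat3]
  have ev: "a 0 \<in> even_part S" "b 0 \<in> even_part S" "d 0 \<in> even_part S" "e 0 \<in> even_part S"
    using mem by (simp_all add: even_power_series)
  have "even_unit ((a \<otimes>\<^bsub>power_series S\<^esub> e \<ominus>\<^bsub>power_series S\<^esub> b \<otimes>\<^bsub>power_series S\<^esub> d) 0)"
    using mem by (intro power_series_even_unit_const) simp
  also have "(a \<otimes>\<^bsub>power_series S\<^esub> e \<ominus>\<^bsub>power_series S\<^esub> b \<otimes>\<^bsub>power_series S\<^esub> d) 0 =
      a 0 \<otimes>\<^bsub>S\<^esub> e 0 \<ominus>\<^bsub>S\<^esub> b 0 \<otimes>\<^bsub>S\<^esub> d 0"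
    using mem power_series_diff[of "a \<otimes>\<^bsub>power_series S\<^esub> e" "b \<otimes>\<^bsub>power_series S\<^esub> d" 0]
      power_series_mult_const[of a e] power_series_mult_const[of b d]
    by (simp add: power_series_simps(1)[symmetric])
  finally obtain v where v: "v \<in> even_part S" "v \<otimes>\<^bsub>S\<^esub> (a 0 \<otimes>\<^bsub>S\<^esub> e 0 \<ominus>\<^bsub>S\<^esub> b 0 \<otimes>\<^bsub>S\<^esub> d 0) = \<one>\<^bsub>S\<^esub>"
    by (rule even_unit_inverseE)
  \<comment> \<open>The determinant divided by itself, read as a linear combination of the two
    entries e 0 and b 0 of the second column.\<close>
  have "v \<otimes>\<^bsub>S\<^esub> a 0 \<otimes>\<^bsub>S\<^esub> e 0 \<oplus>\<^bsub>S\<^esub> (\<ominus>\<^bsub>S\<^esub> (v \<otimes>\<^bsub>S\<^esub> d 0)) \<otimes>\<^bsub>S\<^esub> b 0 = \<one>\<^bsub>S\<^esub>"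
  proof -
    have "v \<otimes>\<^bsub>S\<^esub> d 0 \<otimes>\<^bsub>S\<^esub> b 0 = v \<otimes>\<^bsub>S\<^esub> (b 0 \<otimes>\<^bsub>S\<^esub> d 0)"
      using v(1) ev even_comm[of "d 0" "b 0"] by (simp add: m_assoc)
    then show ?thesis
      using v ev by (simp add: minus_eq r_distr r_minus l_minus m_assoc)
  qed
  then obtain \<C> where \<C>: "zariski_cover S \<C>" "\<And>T \<psi>. (T, \<psi>) \<in> \<C> \<Longrightarrow> \<psi> (e 0) \<in> Units T \<or> \<psi> (b 0) \<in> Units T"
    using zariski_cover_pair[OF S ev(4,2), of "v \<otimes>\<^bsub>S\<^esub> a 0" "\<ominus>\<^bsub>S\<^esub> (v \<otimes>\<^bsub>S\<^esub> d 0)"] v(1) ev by auto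
  have "\<exists>x\<in>points (glue_presheaf (chart0 k l) (chart1 k l) (P_overlap k l)) T.
    class_code T x = loop_lattice T k l (mat_map \<psi> g)" if T\<psi>: "(T, \<psi>) \<in> \<C>" for T \<psi>
  proof -
    note T = zariski_cover_member[OF \<C>(1) T\<psi>]
    interpret \<psi>: superring_hom S T \<psi> by (rule superhom_superring_hom[OF S T])
    have g: "mat_map \<psi> g \<in> carrier (GL_super (power_series T))"
      using g by (rule \<psi>.mat_map_GL_power_series)
    have "\<exists>y\<in>points (chart0 k l) T <+> points (chart1 k l) T. code T y = loop_lattice T k l (mat_map \<psi> g)"
    proof -
      \<comment> \<open>A unit in position (2,2) leads to the first chart, a unit in position (1,2)
        to the second.\<close>
      consider "\<psi>.S.even_unit (\<psi> (e 0))" | "\<psi>.S.even_unit (\<psi> (b 0))"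
        using \<C>(2)[OF T\<psi>] ev by (auto simp: \<psi>.S.even_unit_iff_Units)
      then show ?thesis
      proof cases
        case 1
        then obtain x where "x \<in> points (chart0 k l) T"
          "loop_lattice T k l (chart0_matrix T x) = loop_lattice T k l (mat_map \<psi> g)"
          using \<psi>.S.chart0_surj[OF less_imp_le[OF kl(2)] g] by (auto simp: eq mat_map_def)
        then show ?thesis
          by (intro bexI[of _ "Inl x"]) (auto simp: code_def gluing_matrix_def)
      next
        case 2
        then obtain x where "x \<in> points (chart1 k l) T"
          "loop_lattice T k l (chart1_matrix T x) = loop_lattice T k l (mat_map \<psi> g)"
          using \<psi>.S.chart1_surj[OF less_imp_le[OF kl(2)] g] by (auto simp: eq mat_map_def)
        then show ?thesis
          by (intro bexI[of _ "Inr x"]) (auto simp: code_def gluing_matrix_def)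
      qed
    qed
    then obtain y where y: "y \<in> points (chart0 k l) T <+> points (chart1 k l) T"
      "code T y = loop_lattice T k l (mat_map \<psi> g)"
      by blast
    have "overlap_rel T `` {y} \<in> points (glue_presheaf (chart0 k l) (chart1 k l) (P_overlap k l)) T"
      unfolding P.glue_points using y(1) by blast
    then show ?thesis
      using y class_code_class[OF T(1) y(1)] by (intro bexI[of _ "overlap_rel T `` {y}"]) simp_all
  qed
  then show ?thesis
    unfolding locally_def using \<C>(1) by blast
qed

text \<open>In one direction the lattice of g comes from a chart after a further refinement of the
  cover; in the other, chart matrices are themselves matrices over power series. This puts the orbit
  into the form of the target in \<open>sheafify_map_bij\<close>.\<close>

lemma Gr_orbit_points:
  fixes R :: "'u superalg"
  assumes R: "superalgebra R"
  shows "points (Gr_orbit (weight k l)) R =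
    {s \<in> points (sheafify Gr_presheaf) R. locally R (\<lambda>S \<phi>.
      \<exists>x\<in>points (glue_presheaf (chart0 k l) (chart1 k l) (P_overlap k l)) S. (S, \<phi>, class_code S x) \<in> s)}"
proof -
  let ?orb = "\<lambda>s S \<phi>. \<exists>g\<in>carrier (GL_super (power_series S)). (S, \<phi>, loop_lattice S k l g) \<in> s"
  let ?img = "\<lambda>s S \<phi>. \<exists>x\<in>points (glue_presheaf (chart0 k l) (chart1 k l) (P_overlap k l)) S. (S, \<phi>, class_code S x) \<in> s"
  have "points (Gr_orbit (weight k l)) R = {s \<in> points (sheafify Gr_presheaf) R. locally R (?orb s)}"
    by (simp add: Gr_orbit_def Gr_def locally_def loop_lattice_def GL_super_def)
  moreover have "locally R (?orb s) \<longleftrightarrow> locally R (?img s)" if "s \<in> points (sheafify Gr_presheaf) R" for s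
  proof -
    have s: "sheaf_section Gr_presheaf R s"
      using that by (simp add: sheafify_simps)
    show ?thesis
    proof
      assume "locally R (?orb s)"
      then show "locally R (?img s)"
      proof (rule locally_bind[OF R])
        fix S :: "'u superalg" and \<phi> assume S: "superalgebra S" and \<phi>: "\<phi> \<in> superhom R S" and "?orb s S \<phi>"
        then obtain g where g: "g \<in> carrier (GL_super (power_series S))" "(S, \<phi>, loop_lattice S k l g) \<in> s"
          by blast
        show "locally S (\<lambda>T \<psi>. ?img s T (compose (carrier R) \<psi> \<phi>))"
        proof (rule locally_mono[OF S lattice_locally_chart[OF S g(1)]])
          fix T :: "'u superalg" and \<psi> assume T: "superalgebra T" "\<psi> \<in> superhom S T"
            and "\<exists>x\<in>points (glue_presheaf (chart0 k l) (chart1 k l) (P_overlap k l)) T.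
              class_code T x = loop_lattice T k l (mat_map \<psi> g)"
          then show "?img s T (compose (carrier R) \<psi> \<phi>)"
            using sheaf_sectionD(4)[OF s g(2) T] unfolding lattice_pmap[OF S T g(1)] by metis
        qed
      qed
    next
      assume "locally R (?img s)"
      then show "locally R (?orb s)"
      proof (rule locally_mono[OF R])
        fix S :: "'u superalg" and \<phi> assume S: "superalgebra S" and "?img s S \<phi>"
        then obtain a where a: "a \<in> points (chart0 k l) S <+> points (chart1 k l) S"
          "(S, \<phi>, class_code S (overlap_rel S `` {a})) \<in> s"
          unfolding Bex_def P.glue_points by blast
        then show "?orb s S \<phi>"
          using gluing_matrix_GL[OF superalgebra_superring[OF S] a(1)]
          unfolding class_code_class[OF S a(1)] code_def by blast
      qed
    qed
  qed
  ultimately show ?thesis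
    by blast
qed

text \<open>\<open>P_overlap\<close> includes the relation between base points that glues the
  projective line, so \<open>base_point\<close> descends to glued classes; the rest is functoriality
  of sheafification.\<close>

lemma P_proj_morphism: "superfunctor_morphism (P_scheme k l) (P1 :: ('u, ('u, ('u + 'u) set) germs) superfunctor) P_proj"
proof -
  let ?b = "map_sum base_point base_point"
  have mem: "?b a \<in> points affine_line R <+> points affine_line R"
    if "a \<in> points (chart0 k l) R <+> points (chart1 k l) R" for R :: "'u superalg" and a
    using that kl by (auto simp: chart0_def chart1_def chart_def affine_line_def base_point_def trunc_def)
  have step: "(?b (Inl x), ?b (Inr y)) \<in> glue_rel affine_line affine_line P1_overlap R"
    if "superalgebra R" "(x, y) \<in> P_overlap k l R" for R :: "'u superalg" and x y
    using that P1.E_rel[OF that(1)] by (auto simp: P_overlap_def)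
  have cls: "glue_rel affine_line affine_line P1_overlap R `` (?b ` (overlap_rel R `` {a})) =
      glue_rel affine_line affine_line P1_overlap R `` {?b a}"
    if R: "superalgebra R" and a: "a \<in> points (chart0 k l) R <+> points (chart1 k l) R" for R :: "'u superalg" and a
    by (rule P.rel_class_image[OF R a P1.rel_equiv mem step[OF R]])
  have "presheaf_morphism (glue_presheaf (chart0 k l) (chart1 k l) (P_overlap k l))
      (glue_presheaf affine_line affine_line P1_overlap :: ('u, ('u + 'u) set) superfunctor)
      (\<lambda>R C. glue_rel affine_line affine_line P1_overlap R `` (?b ` C))"
  proof (intro presheaf_morphism.intro P.glue_presheaf P1.glue_presheaf)
    show "superfunctor_morphism (glue_presheaf (chart0 k l) (chart1 k l) (P_overlap k l))
      (glue_presheaf affine_line affine_line P1_overlap :: ('u, ('u + 'u) set) superfunctor)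
      (\<lambda>R C. glue_rel affine_line affine_line P1_overlap R `` (?b ` C))"
      unfolding superfunctor_morphism_def
    proof (intro conjI allI impI funcsetI)
      fix R :: "'u superalg" and C
      assume R: "superalgebra R" and "C \<in> points (glue_presheaf (chart0 k l) (chart1 k l) (P_overlap k l)) R"
      then obtain a where a: "a \<in> points (chart0 k l) R <+> points (chart1 k l) R" "C = overlap_rel R `` {a}"
        unfolding P.glue_points by blast
      show "glue_rel affine_line affine_line P1_overlap R `` (?b ` C) \<in> points (glue_presheaf affine_line affine_line P1_overlap) R"
        unfolding a(2) cls[OF R a(1)] P1.glue_points by (rule bexI[OF refl mem[OF a(1)]])
    next
      fix R S :: "'u superalg" and \<phi> C
      assume "superalgebra R \<and> superalgebra S \<and> \<phi> \<in> superhom R S \<and>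
        C \<in> points (glue_presheaf (chart0 k l) (chart1 k l) (P_overlap k l)) R"
      then obtain a where R: "superalgebra R" and S: "superalgebra S" and \<phi>: "\<phi> \<in> superhom R S"
        and a: "a \<in> points (chart0 k l) R <+> points (chart1 k l) R" "C = overlap_rel R `` {a}"
        unfolding P.glue_points by blast
      have "?b (map_sum (pmap (chart0 k l) R S \<phi>) (pmap (chart1 k l) R S \<phi>) a) =
          map_sum (pmap affine_line R S \<phi>) (pmap affine_line R S \<phi>) (?b a)"
        by (cases a) (auto simp: chart0_def chart1_def chart_def affine_line_def base_point_def split: prod.splits)
      then show "glue_rel affine_line affine_line P1_overlap S ``
          (?b ` pmap (glue_presheaf (chart0 k l) (chart1 k l) (P_overlap k l)) R S \<phi> C) =
        pmap (glue_presheaf affine_line affine_line P1_overlap) R S \<phi>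
          (glue_rel affine_line affine_line P1_overlap R `` (?b ` C))"
        unfolding a(2) P.glue_pmap[OF R S \<phi> a(1)] cls[OF R a(1)] P1.glue_pmap[OF R S \<phi> mem[OF a(1)]]
          cls[OF S P.base_change_mem[OF R S \<phi> a(1)]] by simp
    qed
  qed
  then show ?thesis
    unfolding P_scheme_def P1_def glue_def P_proj_def by (rule presheaf_morphism.sheafify_map_morphism)
qed

text \<open>\<open>class_code\<close> is injective on the presheaf itself, so the hypothesis of
  \<open>sheafify_map_bij\<close> about local equality is immediate. The resulting bijection starts
  at the scheme and is inverted at the end.\<close>

lemma Gr_orbit_isomorphic:
  "superfunctor_isomorphic (Gr_orbit (weight k l) :: ('u, ('u, ('u, 2, 1) loop_coset) germs) superfunctor)
    (P_scheme k l)"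
proof -
  interpret M: presheaf_morphism "glue_presheaf (chart0 k l) (chart1 k l) (P_overlap k l)"
    "Gr_presheaf :: ('u, ('u, 2, 1) loop_coset) superfunctor" class_code
    by (rule class_code_morphism)
  let ?F = "glue_presheaf (chart0 k l) (chart1 k l) (P_overlap k l) :: ('u, ('u chart_point + 'u chart_point) set) superfunctor"
  let ?\<Phi> = "sheafify_map Gr_presheaf class_code :: 'u superalg \<Rightarrow> _"
  have bij: "bij_betw (?\<Phi> R) (points (sheafify ?F) R) (points (Gr_orbit (weight k l)) R)"
    if R: "superalgebra R" for R :: "'u superalg"
    unfolding Gr_orbit_points[OF R]
    by (rule M.sheafify_map_bij[OF R]) (metis class_code_inj locally_equal_refl)
  have "superfunctor_morphism (sheafify ?F) (Gr_orbit (weight k l)) ?\<Phi>"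
    unfolding superfunctor_morphism_def
  proof (intro conjI allI impI funcsetI)
    fix R :: "'u superalg" and s
    assume "superalgebra R" "s \<in> points (sheafify ?F) R"
    then show "?\<Phi> R s \<in> points (Gr_orbit (weight k l)) R"
      using bij bij_betwE by blast
  next
    fix R S :: "'u superalg" and \<phi> s
    assume "superalgebra R \<and> superalgebra S \<and> \<phi> \<in> superhom R S \<and> s \<in> points (sheafify ?F) R"
    then show "?\<Phi> S (pmap (sheafify ?F) R S \<phi> s) = pmap (Gr_orbit (weight k l)) R S \<phi> (?\<Phi> R s)"
      using superfunctor_morphismD(2)[OF M.sheafify_map_morphism] by (simp add: Gr_orbit_def Gr_def)
  qed
  then have "superfunctor_isomorphic (Gr_orbit (weight k l)) (sheafify ?F)"
  proof (rule superfunctor_isomorphic_sym[OF _ bij])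
    fix R S :: "'u superalg" and \<phi> s
    assume "superalgebra R" "superalgebra S" "\<phi> \<in> superhom R S" "s \<in> points (sheafify ?F) R"
    then show "pmap (sheafify ?F) R S \<phi> s \<in> points (sheafify ?F) S"
      using sheafify_pmap by (simp add: sheafify_simps(1))
  qed
  then show ?thesis
    by (simp add: P_scheme_def glue_def)
qed

end

theorem theorem4:
  fixes k l :: nat
  assumes "0 < l" and "l < k"
  shows
    "superfunctor_morphism
        (P_scheme k l) (P1 :: ('u, ('u, ('u + 'u) set) germs) superfunctor) P_proj \<and>
     superfunctor_isomorphic
        (Gr_orbit (weight (int k) (int l)) :: ('u, ('u, ('u, 2, 1) loop_coset) germs) superfunctor)
        (P_scheme k l)"
  using P_proj_morphism[OF assms] Gr_orbit_isomorphic[OF assms] by blast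

end
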